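(* Let $F$, $H$, $m_0$ satisfy the standing assumptions stated in the context, with constants $C_o\ge 1$, $L>0$. There exist a constant $\lambda_0\ge 1$ depending only on $n,C_o,L$ and a constant $\eta'$ depending only on $L,C_o$ such that, if $\lambda\ge \Lambda:=\max\{\lambda_0,\eta'\}$, then the system $({\rm MFG}_\lambda)$ has a unique solution in the following sense: given two couples $(u_1,m_1)$, $(u_2,m_2)$ which are classical solutions of $({\rm MFG}_\lambda)$ (with the same initial datum $m_0$) and which both satisfy the bounds $$\inf_{\mathbb{R}^n\times[0,\infty)} u_i>-\infty,\quad \sup_{(x,t)\in\mathbb{R}^n\times[0,\infty)}\frac{u_i(x,t)}{1+|x|}<\infty,\quad \|Du_i\|_\infty<\infty,\quad \|D^2u_i\|_\infty\le 1\qquad (i=1,2),$$ one has $u_1\equiv u_2$ and $m_1\equiv m_2$.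
   Context: Fix $n\ge1$ and $\alpha\in(0,1)$. $\mathcal{P}_1(\mathbb{R}^n)$ is the set of Borel probability measures on $\mathbb{R}^n$ with finite first moment and $d_1$ is the $1$-Wasserstein distance. For functions on $\mathbb{R}^n\times[0,\infty)$, $\|u\|_\infty=\sup_{(x,t)}|u(x,t)|$. $D=D_x$ is the gradient in $x$. Standing assumptions: $m_0\in\mathcal{P}_1(\mathbb{R}^n)$, $F:\mathbb{R}^n\times\mathcal{P}_1(\mathbb{R}^n)\to\mathbb{R}$, $H=H(p,x):\mathbb{R}^n\times\mathbb{R}^n\to\mathbb{R}$, and there are constants $C_o\ge1$, $L>0$ such that: - $F(\cdot,m)$ is of class $C^{2,\alpha}$ for all $m$, and $|F(x,m)|\le C_o(1+|x|)$ for all $(x,m)$. - For all $x,y\in\mathbb{R}^n$, $m,\tilde m\in\mathcal{P}_1(\mathbb{R}^n)$: $|F(x,m)-F(y,\tilde m)|\le L(|x-y|+d_1(m,\tilde m))$ and $|D_xF(x,m)-D_xF(y,\tilde m)|\le L(|x-y|+d_1(m,\tilde m))$. - $H$ is of class $C^{2,\alpha}$ and convex in its first variable $p$. - For all $p,x$: $-C_o\le H(p,x)\le C_o(1+|p|^2)$; $C_o^{-1}I_d\le D^2_{pp}H(p,x)\le C_oI_d$; $|D_xH(p,x)|+|D^2_{px}H(p,x)|\le C_o(1+|p|)$; $|D^2_{xx}H(p,x)|\le C_o$. For $\lambda>0$, the system $({\rm MFG}_\lambda)$ for $(u_\lambda,m_\lambda)$ is $$\begin{cases}-\partial_tu_\lambda-\Delta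 u_\lambda+\frac1\lambda H(\lambda Du_\lambda,x)+\lambda u_\lambda=F(x,m_\lambda(t)), & x\in\mathbb{R}^n,\ t\in(0,\infty),\\ \partial_tm_\lambda-\Delta m_\lambda-\mathrm{div}(m_\lambda D_pH(\lambda Du_\lambda,x))=0,& x\in\mathbb{R}^n,\ t\in(0,\infty),\\ m_\lambda(x,0)=m_0(x),& x\in\mathbb{R}^n.\end{cases}$$ Here classical solution means: $u_\lambda$ is $C^{2}$ in $x$ and $C^1$ in $t$ on $\mathbb{R}^n\times[0,\infty)$ and satisfies its equation pointwise; $t\mapsto m_\lambda(t)\in\mathcal{P}_1(\mathbb{R}^n)$ is $d_1$-continuous on $[0,\infty)$ with $m_\lambda(0)=m_0$, and for $t>0$ it is identified with a density solving the second equation. *)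

theory Defs
  imports "HOL-Probability.Probability"
begin

section \<open>Differential operators in the space variable\<close>

text \<open>These operators are only used for functions whose differentiability is required
  separately.\<close>

definition grad :: "('a::euclidean_space \<Rightarrow> real) \<Rightarrow> 'a \<Rightarrow> 'a" where
  "grad f x = (THE D. GDERIV f x :> D)"

text \<open>The Hessian is the linear map $h \mapsto D^2 f(x) h$; its size $|D^2 f(x)|$ is the
  operator norm \<^const>\<open>onorm\<close>.\<close>

definition hess :: "('a::euclidean_space \<Rightarrow> real) \<Rightarrow> 'a \<Rightarrow> 'a \<Rightarrow> 'a" where
  "hess f x = frechet_derivative (grad f) (at x)"

definition divergence :: "('a::euclidean_space \<Rightarrow> 'a) \<Rightarrow> 'a \<Rightarrow> real" where
  "divergence V x = (\<Sum>b\<in>Basis. frechet_derivative V (at x) b \<bullet> b)"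

definition laplacian :: "('a::euclidean_space \<Rightarrow> real) \<Rightarrow> 'a \<Rightarrow> real" where
  "laplacian f x = divergence (grad f) x"

section \<open>Regularity classes\<close>

text \<open>A Hoelder condition on the second derivatives implies their continuity. It is imposed
  locally: the functions at hand are unbounded, so a global $C^{2,\alpha}$ norm would be
  infinite.\<close>

definition class_C2_holder :: "real \<Rightarrow> ('a::euclidean_space \<Rightarrow> real) \<Rightarrow> bool" where
  "class_C2_holder \<alpha> f \<longleftrightarrow>
     (\<forall>x. f differentiable (at x)) \<and>
     (\<forall>x. grad f differentiable (at x)) \<and>
     (\<forall>R. \<exists>K. \<forall>x\<in>cball 0 R. \<forall>y\<in>cball 0 R.
        onorm (\<lambda>h. hess f x h - hess f y h) \<le> K * dist x y powr \<alpha>)"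

text \<open>Time derivative on $[0,\infty)$: one-sided at $t = 0$, the ordinary derivative for
  $t > 0$.\<close>

definition time_deriv :: "('a \<Rightarrow> real \<Rightarrow> real) \<Rightarrow> 'a \<Rightarrow> real \<Rightarrow> real" where
  "time_deriv u x t = vector_derivative (\<lambda>s. u x s) (at t within {0..})"

text \<open>$C^2$ in $x$ and $C^1$ in $t$ on $\mathbb{R}^n \times T$ (with $T \subseteq [0,\infty)$),
  all derivatives being jointly continuous in $(x,t)$.\<close>

definition class_C21_on :: "real set \<Rightarrow> ('a::euclidean_space \<Rightarrow> real \<Rightarrow> real) \<Rightarrow> bool" where
  "class_C21_on T u \<longleftrightarrow>
     (\<forall>x. \<forall>t\<in>T. (\<lambda>y. u y t) differentiable (at x)) \<and>
     (\<forall>x. \<forall>t\<in>T. grad (\<lambda>y. u y t) differentiable (at x)) \<and>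
     (\<forall>x. \<forall>t\<in>T. (\<lambda>s. u x s) differentiable (at t within {0..})) \<and>
     continuous_on (UNIV \<times> T) (\<lambda>(x, t). u x t) \<and>
     continuous_on (UNIV \<times> T) (\<lambda>(x, t). grad (\<lambda>y. u y t) x) \<and>
     (\<forall>h. continuous_on (UNIV \<times> T) (\<lambda>(x, t). hess (\<lambda>y. u y t) x h)) \<and>
     continuous_on (UNIV \<times> T) (\<lambda>(x, t). time_deriv u x t)"

section \<open>Probability measures with finite first moment\<close>

definition P1 :: "'a::euclidean_space measure set" where
  "P1 = {\<mu>. prob_space \<mu> \<and> sets \<mu> = sets borel \<and> integrable \<mu> norm}"

definition couplings ::
  "'a::euclidean_space measure \<Rightarrow> 'a measure \<Rightarrow> ('a \<times> 'a) measure set" where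
  "couplings \<mu> \<nu> =
     {\<pi>. prob_space \<pi> \<and> sets \<pi> = sets borel \<and> distr \<pi> borel fst = \<mu> \<and> distr \<pi> borel snd = \<nu>}"

text \<open>The 1-Wasserstein distance, for measures in \<^const>\<open>P1\<close>: there every coupling has finite
  cost, so the real-valued integral and infimum are the intended ones.\<close>

definition d1 :: "'a::euclidean_space measure \<Rightarrow> 'a measure \<Rightarrow> real" where
  "d1 \<mu> \<nu> = (INF \<pi>\<in>couplings \<mu> \<nu>. LINT z|\<pi>. dist (fst z) (snd z))"

section \<open>Standing assumptions on the data\<close>

definition coupling_cost_assms ::
  "real \<Rightarrow> real \<Rightarrow> real \<Rightarrow> (real^'n \<Rightarrow> (real^'n) measure \<Rightarrow> real) \<Rightarrow> bool" where
  "coupling_cost_assms \<alpha> C L F \<longleftrightarrow>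
     (\<forall>m\<in>P1. class_C2_holder \<alpha> (\<lambda>x. F x m)) \<and>
     (\<forall>m\<in>P1. \<forall>x. \<bar>F x m\<bar> \<le> C * (1 + norm x)) \<and>
     (\<forall>m\<in>P1. \<forall>m'\<in>P1. \<forall>x y. \<bar>F x m - F y m'\<bar> \<le> L * (norm (x - y) + d1 m m')) \<and>
     (\<forall>m\<in>P1. \<forall>m'\<in>P1. \<forall>x y.
        norm (grad (\<lambda>z. F z m) x - grad (\<lambda>z. F z m') y) \<le> L * (norm (x - y) + d1 m m'))"

text \<open>The first argument of $H$ is the momentum $p$, the second the position $x$.\<close>

definition grad_p :: "(real^'n \<Rightarrow> real^'n \<Rightarrow> real) \<Rightarrow> real^'n \<Rightarrow> real^'n \<Rightarrow> real^'n" where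
  "grad_p H p x = grad (\<lambda>q. H q x) p"

definition hamiltonian_assms ::
  "real \<Rightarrow> real \<Rightarrow> (real^'n \<Rightarrow> real^'n \<Rightarrow> real) \<Rightarrow> bool" where
  "hamiltonian_assms \<alpha> C H \<longleftrightarrow>
     class_C2_holder \<alpha> (\<lambda>(p, x). H p x) \<and>
     (\<forall>x. convex_on UNIV (\<lambda>p. H p x)) \<and>
     (\<forall>p x. - C \<le> H p x \<and> H p x \<le> C * (1 + (norm p)\<^sup>2)) \<and>
     (\<forall>p x v. inverse C * (v \<bullet> v) \<le> hess (\<lambda>q. H q x) p v \<bullet> v \<and>
              hess (\<lambda>q. H q x) p v \<bullet> v \<le> C * (v \<bullet> v)) \<and>
     (\<forall>p x. norm (grad (\<lambda>y. H p y) x)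
              + onorm (frechet_derivative (\<lambda>y. grad_p H p y) (at x)) \<le> C * (1 + norm p)) \<and>
     (\<forall>p x. onorm (hess (\<lambda>y. H p y) x) \<le> C)"

section \<open>The mean field game system\<close>

definition hjb_solution ::
  "(real^'n \<Rightarrow> (real^'n) measure \<Rightarrow> real) \<Rightarrow> (real^'n \<Rightarrow> real^'n \<Rightarrow> real) \<Rightarrow> real \<Rightarrow>
   (real^'n \<Rightarrow> real \<Rightarrow> real) \<Rightarrow> (real \<Rightarrow> (real^'n) measure) \<Rightarrow> bool" where
  "hjb_solution F H lam u m \<longleftrightarrow>
     class_C21_on {0..} u \<and>
     (\<forall>x. \<forall>t>0.
        - time_deriv u x t - laplacian (\<lambda>y. u y t) x
          + 1 / lam * H (lam *\<^sub>R grad (\<lambda>y. u y t) x) x + lam * u x t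
        = F x (m t))"

text \<open>\<open>\<rho> x t\<close> is the density of \<open>m t\<close> with respect to Lebesgue measure for $t > 0$ (values of
  \<open>\<rho>\<close> at $t \le 0$ play no role). The initial condition is attained through the continuity of
  the curve \<open>m\<close> at $0$.\<close>

definition fp_solution ::
  "(real^'n \<Rightarrow> real^'n \<Rightarrow> real) \<Rightarrow> (real^'n) measure \<Rightarrow> real \<Rightarrow>
   (real^'n \<Rightarrow> real \<Rightarrow> real) \<Rightarrow> (real \<Rightarrow> (real^'n) measure) \<Rightarrow> bool" where
  "fp_solution H m0 lam u m \<longleftrightarrow>
     (\<forall>t\<ge>0. m t \<in> P1) \<and>
     (\<forall>t\<ge>0. ((\<lambda>s. d1 (m s) (m t)) \<longlongrightarrow> 0) (at t within {0..})) \<and>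
     m 0 = m0 \<and>
     (\<exists>\<rho>. class_C21_on {0<..} \<rho> \<and>
        (\<forall>t>0. (\<forall>x. 0 \<le> \<rho> x t) \<and> m t = density lborel (\<lambda>x. ennreal (\<rho> x t))) \<and>
        (\<forall>x. \<forall>t>0.
           time_deriv \<rho> x t - laplacian (\<lambda>y. \<rho> y t) x
             - divergence (\<lambda>y. \<rho> y t *\<^sub>R grad_p H (lam *\<^sub>R grad (\<lambda>z. u z t) y) y) x = 0))"

definition mfg_classical_solution ::
  "(real^'n \<Rightarrow> (real^'n) measure \<Rightarrow> real) \<Rightarrow> (real^'n \<Rightarrow> real^'n \<Rightarrow> real) \<Rightarrow>
   (real^'n) measure \<Rightarrow> real \<Rightarrow>
   (real^'n \<Rightarrow> real \<Rightarrow> real) \<Rightarrow> (real \<Rightarrow> (real^'n) measure) \<Rightarrow> bool" where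
  "mfg_classical_solution F H m0 lam u m \<longleftrightarrow> hjb_solution F H lam u m \<and> fp_solution H m0 lam u m"

definition uniqueness_bounds :: "(real^'n \<Rightarrow> real \<Rightarrow> real) \<Rightarrow> bool" where
  "uniqueness_bounds u \<longleftrightarrow>
     bdd_below ((\<lambda>(x, t). u x t) ` (UNIV \<times> {0..})) \<and>
     bdd_above ((\<lambda>(x, t). u x t / (1 + norm x)) ` (UNIV \<times> {0..})) \<and>
     bdd_above ((\<lambda>(x, t). norm (grad (\<lambda>y. u y t) x)) ` (UNIV \<times> {0..})) \<and>
     (\<forall>x. \<forall>t\<ge>0. onorm (hess (\<lambda>y. u y t) x) \<le> 1)"

end

theory Submission
  imports Defs
begin

text \<open>Let \<open>v = u1 - u2\<close>, let \<open>\<mu>\<close> be the difference of the two densities and \<open>b\<^sub>i = D\<^sub>pH (lam Du\<^sub>i)\<close> the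
  drifts. All quantities are measured with the weight \<open>exp (- k\<^sup>2 t)\<close>, where \<open>lam = 2 k\<^sup>2\<close>.

  The maximum principle with doubled variables gives \<open>lam |Du\<^sub>i| \<le> 2 (L + C)\<close>, so the drifts are bounded
  independently of \<open>lam\<close>; a second doubling argument with a bounded concave modulus gives
  \<open>|Dv| \<le> (2 L / k) sup d1 (m1, m2)\<close> without any regularity of the drift.
  Conversely, \<open>\<mu>\<close> solves a heat equation with source \<open>div q\<close>, \<open>|q| \<le> B |\<mu>| + C lam |Dv| \<rho>2\<close>, and zero
  initial value. Duhamel's formula bounds the total variation of \<open>\<mu>\<close> by \<open>O(1/k) |q|\<close>, and
  since the gradient of the heat kernel is odd it also exhibits \<open>\<mu>\<close> as the net marginal of a transport plan of
  cost \<open>O(1/k\<^sup>2) |q|\<close>. As \<open>lam = 2 k\<^sup>2\<close>, together these give \<open>sup d1 \<le> O(1/k) sup d1\<close>, a contraction for large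
  \<open>lam\<close>. Nothing here depends on the initial datum or on the size of its moments.\<close>

section \<open>Transport plans with prescribed net marginal\<close>

text \<open>As \<open>d1\<close> is an infimum over couplings, bounding it from above means building
  a coupling. Duhamel's formula only yields a plan whose net effect is the difference of the two
  measures, which is why the proof opens by converting such plans into couplings. Two errors are
  carried through the forward equation: the drift acts on the signed density itself, and
  \<open>d1\<close> does not control total variation. They scale differently. The gradient of the
  heat kernel has L1 norm of order 1/sqrt \<tau>, but weighted with the distance travelled its norm
  does not depend on \<tau>; integrated against the exponential weight, these give 1/k and 1/k^2.
  The factor \<open>lam\<close> |Dv| costs one power of k, since |Dv| is only of order 1/k, and the
  second gain is the one that beats this loss. The rate k^2 is half of the discount
  \<open>lam\<close>, so the backward equation keeps a positive zero order term after multiplication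
  by the weight. A contraction argument also needs finite suprema in advance; these come from the
  unit masses and from the a priori bound on \<open>lam\<close> |Du|.\<close>

lemma reroute_through_point:
  fixes c :: "'a::metric_space \<Rightarrow> 'a \<Rightarrow> real"
  assumes S: "finite S" "j \<in> S" and nn: "\<And>i k. 0 \<le> c i k"
  shows "\<exists>c' \<delta>. (\<forall>i k. 0 \<le> c' i k) \<and> 0 \<le> \<delta> \<and>
     (\<forall>i\<in>S. (\<Sum>k\<in>S. c' i k) = (\<Sum>k\<in>S. c i k) - (if i = j then \<delta> else 0)) \<and>
     (\<forall>k\<in>S. (\<Sum>i\<in>S. c' i k) = (\<Sum>i\<in>S. c i k) - (if k = j then \<delta> else 0)) \<and>
     (\<Sum>i\<in>S. \<Sum>k\<in>S. c' i k * dist i k) \<le> (\<Sum>i\<in>S. \<Sum>k\<in>S. c i k * dist i k) \<and>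
     ((\<Sum>k\<in>S. c' j k) = 0 \<or> (\<Sum>i\<in>S. c' i j) = 0)"
proof -
  \<comment> \<open>Mass resting at \<open>j\<close> costs nothing and counts equally in row and
    column \<open>j\<close>, so it is dropped first. With \<open>a j j = 0\<close> no path through
    \<open>j\<close> starts or ends there.\<close>
  define a where "a i k = (if i = j \<and> k = j then 0 else c i k)" for i k
  have ann: "0 \<le> a i k" for i k using nn by (simp add: a_def)
  have ajj: "a j j = 0" by (simp add: a_def)
  define d where "d i k = (if i = j \<and> k = j then c j j else 0)" for i k
  have ad: "a i k = c i k - d i k" for i k by (auto simp: a_def d_def)
  have d1: "(\<Sum>k\<in>S. d i k) = (if i = j then c j j else 0)" for i
    using S by (cases "i = j") (simp_all add: d_def)
  have d2: "(\<Sum>i\<in>S. d i k) = (if k = j then c j j else 0)" for k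
    using S by (cases "k = j") (simp_all add: d_def)
  have arow: "(\<Sum>k\<in>S. a i k) = (\<Sum>k\<in>S. c i k) - (if i = j then c j j else 0)" for i
    by (simp only: ad sum_subtractf d1)
  have acol: "(\<Sum>i\<in>S. a i k) = (\<Sum>i\<in>S. c i k) - (if k = j then c j j else 0)" for k
    by (simp only: ad sum_subtractf d2)
  have acost: "a i k * dist i k = c i k * dist i k" for i k by (auto simp: a_def)
  define out where "out = (\<Sum>k\<in>S. a j k)"
  define inn where "inn = (\<Sum>i\<in>S. a i j)"
  have out0: "0 \<le> out" and inn0: "0 \<le> inn" by (auto simp: out_def inn_def ann sum_nonneg)
  \<comment> \<open>The total amount \<open>min out inn\<close> is rerouted. Incoming mass is
    distributed over the outgoing edges in proportion, so the path from \<open>i\<close> over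
    \<open>j\<close> to \<open>k\<close> receives \<open>th * a i j * a j k\<close>. Every edge into
    \<open>j\<close> then loses the fraction \<open>th * out\<close> and every edge out of
    \<open>j\<close> the fraction \<open>th * inn\<close>; both are at most 1, which keeps the new
    plan nonnegative.\<close>
  define th where "th = (if out = 0 \<or> inn = 0 then 0 else min out inn / (out * inn))"
  have th0: "0 \<le> th" using out0 inn0 by (simp add: th_def)
  have tho: "th * out \<le> 1" using out0 inn0
    by (cases "out = 0 \<or> inn = 0") (auto simp: th_def min_def field_simps)
  have thi: "th * inn \<le> 1" using out0 inn0
    by (cases "out = 0 \<or> inn = 0") (auto simp: th_def min_def field_simps)
  have thoi: "th * out * inn = min out inn" using out0 inn0
    by (cases "out = 0 \<or> inn = 0") (auto simp: th_def)
  define c' where "c' i k = a i k + th * (a i j * a j k) - (if k = j then th * out * a i j else 0)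
      - (if i = j then th * inn * a j k else 0)" for i k
  have r1: "(\<Sum>k\<in>S. th * (a i j * a j k)) = th * out * a i j" for i
    by (simp add: out_def sum_distrib_left sum_distrib_right mult_ac)
  have r2: "(\<Sum>k\<in>S. (if k = j then th * out * a i j else 0)) = th * out * a i j" for i
    using S by simp
  have r3: "(\<Sum>k\<in>S. (if i = j then th * inn * a j k else 0)) = (if i = j then th * out * inn else 0)" for i
    by (simp add: out_def sum_distrib_left sum_distrib_right mult_ac)
  have row: "(\<Sum>k\<in>S. c' i k) = (\<Sum>k\<in>S. a i k) - (if i = j then th * out * inn else 0)" for i
    by (simp only: c'_def sum_subtractf sum.distrib r1 r2 r3)
  have q1: "(\<Sum>i\<in>S. th * (a i j * a j k)) = th * inn * a j k" for k
    by (simp add: inn_def sum_distrib_left sum_distrib_right mult_ac)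
  have q2: "(\<Sum>i\<in>S. (if i = j then th * inn * a j k else 0)) = th * inn * a j k" for k
    using S by simp
  have q3: "(\<Sum>i\<in>S. (if k = j then th * out * a i j else 0)) = (if k = j then th * out * inn else 0)" for k
    by (simp add: inn_def sum_distrib_left sum_distrib_right mult_ac)
  have col: "(\<Sum>i\<in>S. c' i k) = (\<Sum>i\<in>S. a i k) - (if k = j then th * out * inn else 0)" for k
    by (simp only: c'_def sum_subtractf sum.distrib q1 q2 q3)
  have c'nn: "0 \<le> c' i k" for i k
  proof -
    have p: "0 \<le> a i j * (1 - th * out)" "0 \<le> a j k * (1 - th * inn)"
      using ann tho thi by auto
    have "0 \<le> th * (a i j * a j k)" using th0 ann by simp
    then show ?thesis using p ajj ann[of i k]
      by (auto simp: c'_def algebra_simps)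
  qed
  have cost: "(\<Sum>i\<in>S. \<Sum>k\<in>S. c' i k * dist i k) \<le> (\<Sum>i\<in>S. \<Sum>k\<in>S. a i k * dist i k)"
  proof -
    have s1: "(\<Sum>i\<in>S. \<Sum>k\<in>S. (if k = j then th * out * a i j else 0) * dist i k)
        = (\<Sum>i\<in>S. \<Sum>k\<in>S. th * (a i j * a j k) * dist i j)"
    proof (rule sum.cong[OF refl])
      fix i
      have "(\<Sum>k\<in>S. (if k = j then th * out * a i j else 0) * dist i k)
          = (\<Sum>k\<in>S. if k = j then th * out * a i j * dist i j else 0)"
        by (rule sum.cong) auto
      also have "\<dots> = th * out * a i j * dist i j" using S by simp
      finally show "(\<Sum>k\<in>S. (if k = j then th * out * a i j else 0) * dist i k)
          = (\<Sum>k\<in>S. th * (a i j * a j k) * dist i j)"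
        by (simp add: r1[symmetric] sum_distrib_right)
    qed
    have s2: "(\<Sum>i\<in>S. \<Sum>k\<in>S. (if i = j then th * inn * a j k else 0) * dist i k)
        = (\<Sum>i\<in>S. \<Sum>k\<in>S. th * (a i j * a j k) * dist j k)"
    proof -
      have "(\<Sum>i\<in>S. (if i = j then th * inn * a j k else 0) * dist i k)
          = (\<Sum>i\<in>S. th * (a i j * a j k) * dist j k)" for k
      proof -
        have "(\<Sum>i\<in>S. (if i = j then th * inn * a j k else 0) * dist i k)
          = (\<Sum>i\<in>S. if i = j then th * inn * a j k * dist j k else 0)"
          by (rule sum.cong) auto
        also have "\<dots> = th * inn * a j k * dist j k" using S by simp
        finally show ?thesis by (simp add: q1[symmetric] sum_distrib_right)
      qed
      then show ?thesis by (subst (1 2) sum.swap) simp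
    qed
    \<comment> \<open>Grouping the three correction terms path by path leaves
      \<open>dist i k - dist i j - dist j k\<close> as the cost change per unit, so the triangle
      inequality decides the sign.\<close>
    have "(\<Sum>i\<in>S. \<Sum>k\<in>S. c' i k * dist i k) = (\<Sum>i\<in>S. \<Sum>k\<in>S. a i k * dist i k)
       + (\<Sum>i\<in>S. \<Sum>k\<in>S. th * (a i j * a j k) * (dist i k - dist i j - dist j k))"
      unfolding c'_def left_diff_distrib right_diff_distrib distrib_right sum_subtractf sum.distrib s1 s2
      by simp
    also have "(\<Sum>i\<in>S. \<Sum>k\<in>S. th * (a i j * a j k) * (dist i k - dist i j - dist j k)) \<le> 0"
    proof (intro sum_nonpos mult_nonneg_nonpos)
      fix i k show "dist i k - dist i j - dist j k \<le> 0" using dist_triangle[of i k j] by simp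
    qed (use th0 ann in auto)
    finally show ?thesis by simp
  qed
  have z: "(\<Sum>k\<in>S. c' j k) = 0 \<or> (\<Sum>i\<in>S. c' i j) = 0"
    using row[of j] col[of j] thoi by (auto simp: out_def[symmetric] inn_def[symmetric] min_def)
  show ?thesis
    apply (rule exI[of _ c'], rule exI[of _ "c j j + th * out * inn"])
    using c'nn nn[of j j] th0 out0 inn0 row col arow acol cost z
    by (auto simp: acost)
qed

text \<open>Points are treated one at a time by \<open>reroute_through_point\<close>. That step
  leaves the row and column sums at all other points unchanged, so a point that has become a pure
  source or a pure sink stays one; at \<open>j\<close> itself both sums drop by the same amount,
  which preserves the net flow.\<close>

lemma plan_elimination:
  fixes c :: "'a::metric_space \<Rightarrow> 'a \<Rightarrow> real"
  assumes S: "finite S" and T: "T \<subseteq> S" and nn: "\<And>i j. 0 \<le> c i j"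
  shows "\<exists>c'. (\<forall>i j. 0 \<le> c' i j) \<and>
     (\<forall>i\<in>S. (\<Sum>k\<in>S. c' i k) - (\<Sum>k\<in>S. c' k i) = (\<Sum>k\<in>S. c i k) - (\<Sum>k\<in>S. c k i)) \<and>
     (\<Sum>i\<in>S. \<Sum>k\<in>S. c' i k * dist i k) \<le> (\<Sum>i\<in>S. \<Sum>k\<in>S. c i k * dist i k) \<and>
     (\<forall>i\<in>T. (\<Sum>k\<in>S. c' i k) = 0 \<or> (\<Sum>k\<in>S. c' k i) = 0)"
  using finite_subset[OF T S] T
proof (induction T rule: finite_induct)
  case empty
  then show ?case using nn by (intro exI[of _ c]) auto
next
  case (insert j T)
  then obtain a where a: "\<forall>i j. 0 \<le> a i j"
     "\<forall>i\<in>S. (\<Sum>k\<in>S. a i k) - (\<Sum>k\<in>S. a k i) = (\<Sum>k\<in>S. c i k) - (\<Sum>k\<in>S. c k i)"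
     "(\<Sum>i\<in>S. \<Sum>k\<in>S. a i k * dist i k) \<le> (\<Sum>i\<in>S. \<Sum>k\<in>S. c i k * dist i k)"
     "\<forall>i\<in>T. (\<Sum>k\<in>S. a i k) = 0 \<or> (\<Sum>k\<in>S. a k i) = 0"
    by auto
  have "j \<in> S" using insert by auto
  from reroute_through_point[OF S this, of a] a(1) obtain c' \<delta> where c': "\<forall>i k. 0 \<le> c' i k" "0 \<le> \<delta>"
     "\<forall>i\<in>S. (\<Sum>k\<in>S. c' i k) = (\<Sum>k\<in>S. a i k) - (if i = j then \<delta> else 0)"
     "\<forall>k\<in>S. (\<Sum>i\<in>S. c' i k) = (\<Sum>i\<in>S. a i k) - (if k = j then \<delta> else 0)"
     "(\<Sum>i\<in>S. \<Sum>k\<in>S. c' i k * dist i k) \<le> (\<Sum>i\<in>S. \<Sum>k\<in>S. a i k * dist i k)"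
     "(\<Sum>k\<in>S. c' j k) = 0 \<or> (\<Sum>i\<in>S. c' i j) = 0"
    by blast
  have "(\<Sum>k\<in>S. c' i k) = 0 \<or> (\<Sum>k\<in>S. c' k i) = 0" if "i \<in> insert j T" for i
  proof (cases "i = j")
    case False
    then have "i \<in> T" "i \<in> S" using that insert.prems by auto
    then show ?thesis using a(4) c'(3,4) False by auto
  qed (use c' in auto)
  then show ?case
    using a c' by (intro exI[of _ c']) auto
qed

text \<open>Once every point is a pure source or a pure sink, the row sum at \<open>i\<close> has to
  be the positive part of \<open>a i - b i\<close> and the column sum its negative part. The common
  mass \<open>min (a i) (b i)\<close> stays on the diagonal, free of cost, and completes the
  marginals.\<close>

lemma finite_coupling_of_plan:
  fixes c :: "'a::metric_space \<Rightarrow> 'a \<Rightarrow> real" and a b :: "'a \<Rightarrow> real"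
  assumes S: "finite S" and nn: "\<And>i j. 0 \<le> c i j" and a: "\<And>i. 0 \<le> a i" and b: "\<And>i. 0 \<le> b i"
    and net: "\<And>i. i \<in> S \<Longrightarrow> a i - b i = (\<Sum>k\<in>S. c i k) - (\<Sum>k\<in>S. c k i)"
  shows "\<exists>P. (\<forall>i j. 0 \<le> P i j) \<and> (\<forall>i\<in>S. (\<Sum>k\<in>S. P i k) = a i) \<and> (\<forall>i\<in>S. (\<Sum>k\<in>S. P k i) = b i) \<and>
     (\<Sum>i\<in>S. \<Sum>k\<in>S. P i k * dist i k) \<le> (\<Sum>i\<in>S. \<Sum>k\<in>S. c i k * dist i k)"
proof -
  from plan_elimination[where c = c, OF S order_refl nn] obtain c' where c': "\<forall>i j. 0 \<le> c' i j"
     "\<forall>i\<in>S. (\<Sum>k\<in>S. c' i k) - (\<Sum>k\<in>S. c' k i) = (\<Sum>k\<in>S. c i k) - (\<Sum>k\<in>S. c k i)"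
     "(\<Sum>i\<in>S. \<Sum>k\<in>S. c' i k * dist i k) \<le> (\<Sum>i\<in>S. \<Sum>k\<in>S. c i k * dist i k)"
     "\<forall>i\<in>S. (\<Sum>k\<in>S. c' i k) = 0 \<or> (\<Sum>k\<in>S. c' k i) = 0"
    by blast
  define P where "P i k = c' i k + (if i = k then min (a i) (b i) else 0)" for i k
  have nonneg: "0 \<le> (\<Sum>k\<in>S. c' i k)" "0 \<le> (\<Sum>k\<in>S. c' k i)" for i
    using c'(1) by (auto intro: sum_nonneg)
  have d: "(\<Sum>k\<in>S. if i = k then min (a i) (b i) else 0) = min (a i) (b i)"
     "(\<Sum>k\<in>S. if k = i then min (a k) (b k) else 0) = min (a i) (b i)" if "i \<in> S" for i
    using S that by simp_all
  have ab: "(\<Sum>k\<in>S. P i k) = a i \<and> (\<Sum>k\<in>S. P k i) = b i" if i: "i \<in> S" for i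
  proof -
    have "(\<Sum>k\<in>S. c' i k) - (\<Sum>k\<in>S. c' k i) = a i - b i" "(\<Sum>k\<in>S. c' i k) = 0 \<or> (\<Sum>k\<in>S. c' k i) = 0"
      using net[OF i] c'(2,4) i by auto
    then show ?thesis unfolding P_def sum.distrib d[OF i] using nonneg[of i]
      by (auto simp: min_def)
  qed
  have e: "P i k * dist i k = c' i k * dist i k" for i k by (auto simp: P_def)
  have "(\<Sum>i\<in>S. \<Sum>k\<in>S. P i k * dist i k) \<le> (\<Sum>i\<in>S. \<Sum>k\<in>S. c i k * dist i k)"
    using c'(3) by (simp only: e)
  moreover have "0 \<le> P i k" for i k using c'(1) a b by (simp add: P_def)
  ultimately show ?thesis using ab by blast
qed

section \<open>Couplings of measures on Euclidean space by discretisation\<close>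

lemma d1_le_coupling:
  assumes "\<pi> \<in> couplings \<mu> \<nu>"
  shows "d1 \<mu> \<nu> \<le> (LINT z|\<pi>. dist (fst z) (snd z))"
  unfolding d1_def
proof (rule cINF_lower[OF _ assms])
  show "bdd_below ((\<lambda>\<pi>. LINT z|\<pi>. dist (fst z) (snd z)) ` couplings \<mu> \<nu>)"
    by (rule bdd_belowI[of _ 0]) auto
qed

lemma P1_D:
  assumes "\<mu> \<in> P1"
  shows "prob_space \<mu>" "sets \<mu> = sets borel" "space \<mu> = UNIV" "integrable \<mu> norm"
  using assms sets_eq_imp_space_eq[of \<mu> borel] by (auto simp: P1_def)

text \<open>The cells of \<open>g\<close> turn both measures and the plan into finite data, to which
  \<open>finite_coupling_of_plan\<close> applies. The resulting finite coupling is lifted back by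
  using, on each product of two cells, a multiple of the product measure. Points are then compared
  through their images under \<open>g\<close>, which accounts for the first two terms of the
  bound.\<close>

lemma d1_le_discretized_plan:
  fixes \<mu> \<nu> :: "'a::euclidean_space measure" and \<gamma> :: "('a \<times> 'a) measure" and g :: "'a \<Rightarrow> 'a"
  assumes \<mu>: "\<mu> \<in> P1" and \<nu>: "\<nu> \<in> P1" and fin: "finite_measure \<gamma>" and sets\<gamma>: "sets \<gamma> = sets borel"
    and net: "\<And>A. A \<in> sets borel \<Longrightarrow>
       measure \<mu> A - measure \<nu> A = measure \<gamma> (fst -` A) - measure \<gamma> (snd -` A)"
    and g[measurable]: "g \<in> borel_measurable borel" and finr: "finite (range g)"
  shows "d1 \<mu> \<nu> \<le> (LINT x|\<mu>. dist x (g x)) + (LINT x|\<nu>. dist x (g x))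
           + (LINT z|\<gamma>. dist (g (fst z)) (g (snd z)))"
proof -
  interpret \<mu>: prob_space \<mu> using P1_D[OF \<mu>] by auto
  interpret \<nu>: prob_space \<nu> using P1_D[OF \<nu>] by auto
  interpret \<gamma>: finite_measure \<gamma> by fact
  note s\<mu>[measurable_cong] = P1_D(2)[OF \<mu>] and s\<nu>[measurable_cong] = P1_D(2)[OF \<nu>]
  note s\<gamma>[measurable_cong] = sets\<gamma>[folded borel_prod]
  note sp = P1_D(3)[OF \<mu>] P1_D(3)[OF \<nu>]
  have sp\<gamma>: "space \<gamma> = UNIV" using sets_eq_imp_space_eq[OF sets\<gamma>] by simp
  interpret pair_prob_space \<mu> \<nu> ..
  define S where "S = range g"
  have S: "finite S" "\<And>x. g x \<in> S" using finr by (auto simp: S_def)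
  define A where "A i = g -` {i}" for i
  have A[measurable]: "A i \<in> sets borel" for i
    unfolding A_def using measurable_sets_borel[OF g, of "{i}"] by simp
  have Ax: "x \<in> A i \<longleftrightarrow> g x = i" for x i by (auto simp: A_def)
  define a where "a i = measure \<mu> (A i)" for i
  define b where "b i = measure \<nu> (A i)" for i
  define c where "c i j = measure \<gamma> (A i \<times> A j)" for i j
  have cm: "A i \<times> A j \<in> sets \<gamma>" for i j by (simp add: s\<gamma>)
  have row: "(\<Sum>j\<in>S. c i j) = measure \<gamma> (fst -` A i)" for i
  proof -
    have "measure \<gamma> (\<Union>j\<in>S. A i \<times> A j) = (\<Sum>j\<in>S. c i j)"
      unfolding c_def using S(1) cm
      by (intro \<gamma>.finite_measure_finite_Union) (auto simp: disjoint_family_on_def A_def)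
    also have "(\<Union>j\<in>S. A i \<times> A j) = fst -` A i" using S(2) by (auto simp: Ax)
    finally show ?thesis by simp
  qed
  have col: "(\<Sum>j\<in>S. c j i) = measure \<gamma> (snd -` A i)" for i
  proof -
    have "measure \<gamma> (\<Union>j\<in>S. A j \<times> A i) = (\<Sum>j\<in>S. c j i)"
      unfolding c_def using S(1) cm
      by (intro \<gamma>.finite_measure_finite_Union) (auto simp: disjoint_family_on_def A_def)
    also have "(\<Union>j\<in>S. A j \<times> A i) = snd -` A i" using S(2) by (auto simp: Ax)
    finally show ?thesis by simp
  qed
  have expand: "h (g x) (g y) = (\<Sum>i\<in>S. \<Sum>j\<in>S. h i j * indicator (A i \<times> A j) (x, y))"
    for h :: "'a \<Rightarrow> 'a \<Rightarrow> real" and x y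
  proof -
    have "(\<Sum>j\<in>S. h i j * indicator (A i \<times> A j) (x, y)) = (if i = g x then h i (g y) else 0)" for i
    proof -
      have "(\<Sum>j\<in>S. h i j * indicator (A i \<times> A j) (x, y)) = (\<Sum>j\<in>S. if j = g y then (if i = g x then h i j else 0) else 0)"
        by (rule sum.cong) (auto simp: indicator_def Ax)
      then show ?thesis using S by simp
    qed
    then show ?thesis using S by simp
  qed
  have "\<exists>P. (\<forall>i j. 0 \<le> P i j) \<and> (\<forall>i\<in>S. (\<Sum>k\<in>S. P i k) = a i) \<and> (\<forall>i\<in>S. (\<Sum>k\<in>S. P k i) = b i) \<and>
     (\<Sum>i\<in>S. \<Sum>k\<in>S. P i k * dist i k) \<le> (\<Sum>i\<in>S. \<Sum>k\<in>S. c i k * dist i k)"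
    by (rule finite_coupling_of_plan)
       (auto simp: S a_def b_def c_def[symmetric] row col net, auto simp: c_def)
  then obtain P where P0: "\<And>i j. 0 \<le> P i j" and Pa: "\<And>i. i \<in> S \<Longrightarrow> (\<Sum>k\<in>S. P i k) = a i"
     and Pb: "\<And>i. i \<in> S \<Longrightarrow> (\<Sum>k\<in>S. P k i) = b i"
     and Pc: "(\<Sum>i\<in>S. \<Sum>k\<in>S. P i k * dist i k) \<le> (\<Sum>i\<in>S. \<Sum>k\<in>S. c i k * dist i k)"
    by blast
  have Pa0: "P i k = 0" if "i \<in> S" "k \<in> S" "a i = 0" for i k
    using Pa[of i] that S(1) P0 by (simp add: sum_nonneg_eq_0_iff)
  have Pb0: "P i k = 0" if "i \<in> S" "k \<in> S" "b k = 0" for i k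
    using Pb[of k] that S(1) P0 by (simp add: sum_nonneg_eq_0_iff)
  \<comment> \<open>Density of the lifted coupling on the product of cells \<open>i\<close> and
    \<open>j\<close>. If a cell has mass zero the division yields 0; this is the right value,
    because \<open>P i j\<close> vanishes as well.\<close>
  define W where "W i j = P i j / (a i * b j)" for i j
  have ab0: "0 \<le> a i" "0 \<le> b i" for i by (auto simp: a_def b_def)
  have W0: "0 \<le> W i j" for i j using P0 ab0 by (simp add: W_def)
  have WP: "W i j * a i * b j = P i j" if "i \<in> S" "j \<in> S" for i j
    using Pa0[OF that] Pb0[OF that] by (auto simp: W_def)
  define w where "w z = W (g (fst z)) (g (snd z))" for z
  have w0: "0 \<le> w z" for z by (simp add: w_def W0)
  have w_eq: "w = (\<lambda>z. \<Sum>i\<in>S. \<Sum>j\<in>S. W i j * indicator (A i \<times> A j) z)"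
    unfolding w_def expand by simp
  have [measurable]: "w \<in> borel_measurable (borel \<Otimes>\<^sub>M borel)"
    unfolding w_eq by measurable
  define \<pi> where "\<pi> = density (\<mu> \<Otimes>\<^sub>M \<nu>) (\<lambda>z. ennreal (w z))"
  \<comment> \<open>The conditional mass computed in \<open>inner\<close> is 1 only over cells of
    positive mass. There are finitely many cells, so the remaining ones form a null set
    together.\<close>
  have AEa: "AE x in \<mu>. a (g x) \<noteq> 0"
  proof -
    have "emeasure \<mu> (A i) = 0" if "a i = 0" for i
      using that by (simp add: a_def \<mu>.emeasure_eq_measure)
    then have "\<forall>i\<in>{i\<in>S. a i = 0}. AE x in \<mu>. x \<notin> A i"
      by (auto intro!: AE_not_in simp: null_sets_def s\<mu>)
    then have "AE x in \<mu>. \<forall>i\<in>{i\<in>S. a i = 0}. x \<notin> A i"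
      using S by (intro AE_ball_countable[THEN iffD2]) (auto intro: countable_finite)
    then show ?thesis by eventually_elim (use S in \<open>auto simp: Ax\<close>)
  qed
  have AEb: "AE x in \<nu>. b (g x) \<noteq> 0"
  proof -
    have "emeasure \<nu> (A i) = 0" if "b i = 0" for i
      using that by (simp add: b_def \<nu>.emeasure_eq_measure)
    then have "\<forall>i\<in>{i\<in>S. b i = 0}. AE x in \<nu>. x \<notin> A i"
      by (auto intro!: AE_not_in simp: null_sets_def s\<nu>)
    then have "AE x in \<nu>. \<forall>i\<in>{i\<in>S. b i = 0}. x \<notin> A i"
      using S by (intro AE_ball_countable[THEN iffD2]) (auto intro: countable_finite)
    then show ?thesis by eventually_elim (use S in \<open>auto simp: Ax\<close>)
  qed
  have inner: "(\<integral>\<^sup>+y. ennreal (w (x, y)) \<partial>\<nu>) = 1" if "a (g x) \<noteq> 0" for x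
  proof -
    have ww: "w (x, y) = (\<Sum>j\<in>S. W (g x) j * indicator (A j) y)" for y
    proof -
      have "(\<Sum>j\<in>S. W (g x) j * indicator (A j) y) = (\<Sum>j\<in>S. if j = g y then W (g x) j else 0)"
        by (rule sum.cong) (auto simp: Ax)
      then show ?thesis using S by (simp add: w_def)
    qed
    have "(\<integral>\<^sup>+y. ennreal (w (x, y)) \<partial>\<nu>) = ennreal (LINT y|\<nu>. w (x, y))"
      unfolding ww by (intro nn_integral_eq_integral) (auto intro!: sum_nonneg W0 mult_nonneg_nonneg simp: \<nu>.emeasure_eq_measure)
    also have "(LINT y|\<nu>. w (x, y)) = (\<Sum>j\<in>S. W (g x) j * b j)"
      unfolding ww by (subst Bochner_Integration.integral_sum) (auto simp: b_def sp \<nu>.emeasure_eq_measure)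
    also have "\<dots> = (\<Sum>j\<in>S. P (g x) j) / a (g x)"
      unfolding sum_divide_distrib using that WP[OF S(2)] by (intro sum.cong) (auto simp: field_simps)
    also have "\<dots> = 1" using that by (simp add: Pa S)
    finally show ?thesis by simp
  qed
  have inner': "(\<integral>\<^sup>+x. ennreal (w (x, y)) \<partial>\<mu>) = 1" if "b (g y) \<noteq> 0" for y
  proof -
    have ww: "w (x, y) = (\<Sum>j\<in>S. W j (g y) * indicator (A j) x)" for x
    proof -
      have "(\<Sum>j\<in>S. W j (g y) * indicator (A j) x) = (\<Sum>j\<in>S. if j = g x then W j (g y) else 0)"
        by (rule sum.cong) (auto simp: Ax)
      then show ?thesis using S by (simp add: w_def)
    qed
    have "(\<integral>\<^sup>+x. ennreal (w (x, y)) \<partial>\<mu>) = ennreal (LINT x|\<mu>. w (x, y))"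
      unfolding ww by (intro nn_integral_eq_integral) (auto intro!: sum_nonneg W0 mult_nonneg_nonneg simp: \<mu>.emeasure_eq_measure)
    also have "(LINT x|\<mu>. w (x, y)) = (\<Sum>j\<in>S. W j (g y) * a j)"
      unfolding ww by (subst Bochner_Integration.integral_sum) (auto simp: a_def sp \<mu>.emeasure_eq_measure)
    also have "\<dots> = (\<Sum>j\<in>S. P j (g y)) / b (g y)"
      unfolding sum_divide_distrib using that WP[OF _ S(2)] by (intro sum.cong) (auto simp: field_simps)
    also have "\<dots> = 1" using that by (simp add: Pb S)
    finally show ?thesis by simp
  qed
  have s\<pi>: "sets \<pi> = sets borel" unfolding \<pi>_def
    by (simp add: borel_prod[symmetric] cong: sets_pair_measure_cong[OF s\<mu> s\<nu>])
  have m1: "distr \<pi> borel fst = \<mu>"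
  proof (rule measure_eqI)
    fix B assume "B \<in> sets (distr \<pi> borel fst)"
    then have B[measurable]: "B \<in> sets borel" by simp
    have "emeasure (distr \<pi> borel fst) B = emeasure \<pi> (fst -` B)"
      using s\<pi> by (subst emeasure_distr) (auto simp: \<pi>_def space_pair_measure sp)
    also have "\<dots> = (\<integral>\<^sup>+z. ennreal (w z) * indicator (fst -` B) z \<partial>(\<mu> \<Otimes>\<^sub>M \<nu>))"
      unfolding \<pi>_def using measurable_sets[OF measurable_fst, of B borel borel]
      by (subst emeasure_density) (auto simp: space_pair_measure cong: sets_pair_measure_cong[OF s\<mu> s\<nu>])
    also have "\<dots> = (\<integral>\<^sup>+x. (\<integral>\<^sup>+y. ennreal (w (x, y)) * indicator B x \<partial>\<nu>) \<partial>\<mu>)"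
      by (subst \<nu>.nn_integral_fst[symmetric]) (auto simp: indicator_def)
    also have "\<dots> = (\<integral>\<^sup>+x. (\<integral>\<^sup>+y. ennreal (w (x, y)) \<partial>\<nu>) * indicator B x \<partial>\<mu>)"
      by (intro nn_integral_cong nn_integral_multc) measurable
    also have "\<dots> = (\<integral>\<^sup>+x. indicator B x \<partial>\<mu>)"
      using AEa by (intro nn_integral_cong_AE, eventually_elim) (simp add: inner)
    finally show "emeasure (distr \<pi> borel fst) B = emeasure \<mu> B" by (simp add: s\<mu>)
  qed (simp add: s\<mu>)
  have m2: "distr \<pi> borel snd = \<nu>"
  proof (rule measure_eqI)
    fix B assume "B \<in> sets (distr \<pi> borel snd)"
    then have B[measurable]: "B \<in> sets borel" by simp
    have "emeasure (distr \<pi> borel snd) B = emeasure \<pi> (snd -` B)"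
      using s\<pi> by (subst emeasure_distr) (auto simp: \<pi>_def space_pair_measure sp)
    also have "\<dots> = (\<integral>\<^sup>+z. ennreal (w z) * indicator (snd -` B) z \<partial>(\<mu> \<Otimes>\<^sub>M \<nu>))"
      unfolding \<pi>_def using measurable_sets[OF measurable_snd, of B borel borel]
      by (subst emeasure_density) (auto simp: space_pair_measure cong: sets_pair_measure_cong[OF s\<mu> s\<nu>])
    also have "\<dots> = (\<integral>\<^sup>+y. (\<integral>\<^sup>+x. ennreal (w (x, y)) * indicator B y \<partial>\<mu>) \<partial>\<nu>)"
      by (subst nn_integral_snd[symmetric]) (auto simp: indicator_def)
    also have "\<dots> = (\<integral>\<^sup>+y. (\<integral>\<^sup>+x. ennreal (w (x, y)) \<partial>\<mu>) * indicator B y \<partial>\<nu>)"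
      by (intro nn_integral_cong nn_integral_multc) measurable
    also have "\<dots> = (\<integral>\<^sup>+y. indicator B y \<partial>\<nu>)"
      using AEb by (intro nn_integral_cong_AE, eventually_elim) (simp add: inner')
    finally show "emeasure (distr \<pi> borel snd) B = emeasure \<nu> B" by (simp add: s\<nu>)
  qed (simp add: s\<nu>)
  have "emeasure \<pi> (space \<pi>) = 1"
  proof -
    have "emeasure (distr \<pi> borel fst) UNIV = emeasure \<mu> UNIV" by (simp add: m1)
    moreover have "fst \<in> measurable \<pi> borel"
      by (simp add: s\<pi> borel_prod[symmetric] cong: measurable_cong_sets)
    ultimately show ?thesis using s\<pi> \<mu>.emeasure_space_1 by (subst (asm) emeasure_distr) (auto simp: sp)
  qed
  then have p\<pi>: "prob_space \<pi>" by (rule prob_spaceI)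
  interpret \<pi>: prob_space \<pi> by fact
  note s\<pi>'[measurable_cong] = s\<pi>[folded borel_prod]
  have sp\<pi>: "space \<pi> = UNIV" using sets_eq_imp_space_eq[OF s\<pi>] by simp
  have coup: "\<pi> \<in> couplings \<mu> \<nu>" by (simp add: couplings_def p\<pi> s\<pi> m1 m2)
  have \<pi>ij: "measure \<pi> (A i \<times> A j) = P i j" if ij: "i \<in> S" "j \<in> S" for i j
  proof -
    have "emeasure \<pi> (A i \<times> A j) = (\<integral>\<^sup>+z. ennreal (w z) * indicator (A i \<times> A j) z \<partial>(\<mu> \<Otimes>\<^sub>M \<nu>))"
      unfolding \<pi>_def by (subst emeasure_density) auto
    also have "\<dots> = (\<integral>\<^sup>+z. ennreal (W i j) * indicator (A i \<times> A j) z \<partial>(\<mu> \<Otimes>\<^sub>M \<nu>))"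
      by (intro nn_integral_cong) (auto simp: indicator_def w_def Ax)
    also have "\<dots> = ennreal (W i j) * (emeasure \<mu> (A i) * emeasure \<nu> (A j))"
      by (subst nn_integral_cmult_indicator) (auto simp: \<nu>.emeasure_pair_measure_Times)
    also have "\<dots> = ennreal (W i j * a i * b j)"
      by (simp add: a_def b_def \<mu>.emeasure_eq_measure \<nu>.emeasure_eq_measure ennreal_mult[symmetric] W0 mult_ac)
    also have "\<dots> = ennreal (P i j)" using WP[OF ij] by simp
    finally show ?thesis by (simp add: measure_def P0)
  qed
  have gint: "(LINT z|\<pi>. dist (g (fst z)) (g (snd z))) = (\<Sum>i\<in>S. \<Sum>j\<in>S. P i j * dist i j)"
       "integrable \<pi> (\<lambda>z. dist (g (fst z)) (g (snd z)))"
  proof -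
    have I: "integrable \<pi> (\<lambda>z. dist i j * indicator (A i \<times> A j) z)" for i j
      by (intro integrable_mult_right integrable_real_indicator) (auto simp: s\<pi>' \<pi>.emeasure_eq_measure)
    have e: "dist (g (fst z)) (g (snd z)) = (\<Sum>i\<in>S. \<Sum>j\<in>S. dist i j * indicator (A i \<times> A j) z)" for z
      using expand[of dist "fst z" "snd z"] by simp
    show "integrable \<pi> (\<lambda>z. dist (g (fst z)) (g (snd z)))"
      unfolding e using I by auto
    show "(LINT z|\<pi>. dist (g (fst z)) (g (snd z))) = (\<Sum>i\<in>S. \<Sum>j\<in>S. P i j * dist i j)"
      unfolding e using I by (simp add: Bochner_Integration.integral_sum sp\<pi> \<pi>ij mult.commute)
  qed
  have gint\<gamma>: "(LINT z|\<gamma>. dist (g (fst z)) (g (snd z))) = (\<Sum>i\<in>S. \<Sum>j\<in>S. c i j * dist i j)"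
  proof -
    have I: "integrable \<gamma> (\<lambda>z. dist i j * indicator (A i \<times> A j) z)" for i j
      by (intro integrable_mult_right integrable_real_indicator) (auto simp: cm \<gamma>.emeasure_eq_measure)
    have e: "dist (g (fst z)) (g (snd z)) = (\<Sum>i\<in>S. \<Sum>j\<in>S. dist i j * indicator (A i \<times> A j) z)" for z
      using expand[of dist "fst z" "snd z"] by simp
    show ?thesis
      unfolding e using I by (simp add: Bochner_Integration.integral_sum sp\<gamma> c_def mult.commute)
  qed
  have bg: "\<exists>K. \<forall>x. norm (g x) \<le> K"
    using finite_imp_bounded[OF finr] by (auto simp: bounded_iff)
  then obtain K where K: "\<And>x. norm (g x) \<le> K" by blast
  have I1: "integrable \<mu> (\<lambda>x. dist x (g x))"
  proof (rule Bochner_Integration.integrable_bound)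
    show "integrable \<mu> (\<lambda>x. norm x + K)" using P1_D(4)[OF \<mu>] by auto
    show "AE x in \<mu>. norm (dist x (g x)) \<le> norm (norm x + K)"
      using K by (intro AE_I2) (smt (verit, best) dist_norm norm_triangle_ineq4 real_norm_def norm_ge_zero)
  qed measurable
  have I2: "integrable \<nu> (\<lambda>x. dist x (g x))"
  proof (rule Bochner_Integration.integrable_bound)
    show "integrable \<nu> (\<lambda>x. norm x + K)" using P1_D(4)[OF \<nu>] by auto
    show "AE x in \<nu>. norm (dist x (g x)) \<le> norm (norm x + K)"
      using K by (intro AE_I2) (smt (verit, best) dist_norm norm_triangle_ineq4 real_norm_def norm_ge_zero)
  qed measurable
  have J1: "integrable \<pi> (\<lambda>z. dist (fst z) (g (fst z)))"
    using I1 by (subst (asm) m1[symmetric], subst (asm) integrable_distr_eq) auto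
  have J2: "integrable \<pi> (\<lambda>z. dist (snd z) (g (snd z)))"
    using I2 by (subst (asm) m2[symmetric], subst (asm) integrable_distr_eq) auto
  have E1: "(LINT z|\<pi>. dist (fst z) (g (fst z))) = (LINT x|\<mu>. dist x (g x))"
    by (subst m1[symmetric], subst integral_distr) auto
  have E2: "(LINT z|\<pi>. dist (snd z) (g (snd z))) = (LINT x|\<nu>. dist x (g x))"
    by (subst m2[symmetric], subst integral_distr) auto
  have "d1 \<mu> \<nu> \<le> (LINT z|\<pi>. dist (fst z) (snd z))" by (rule d1_le_coupling[OF coup])
  also have "\<dots> \<le> (LINT z|\<pi>. dist (fst z) (g (fst z)) + dist (snd z) (g (snd z)) + dist (g (fst z)) (g (snd z)))"
  proof (rule integral_mono')
    show "integrable \<pi> (\<lambda>z. dist (fst z) (g (fst z)) + dist (snd z) (g (snd z)) + dist (g (fst z)) (g (snd z)))"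
      using J1 J2 gint(2) by auto
    fix z :: "'a \<times> 'a"
    have "dist (fst z) (snd z) \<le> dist (fst z) (g (fst z)) + (dist (g (fst z)) (g (snd z)) + dist (g (snd z)) (snd z))"
      by (meson add_left_mono dist_triangle order_trans)
    then show "dist (fst z) (snd z) \<le> dist (fst z) (g (fst z)) + dist (snd z) (g (snd z)) + dist (g (fst z)) (g (snd z))"
      by (simp add: dist_commute)
  qed auto
  also have "\<dots> = (LINT x|\<mu>. dist x (g x)) + (LINT x|\<nu>. dist x (g x)) + (LINT z|\<pi>. dist (g (fst z)) (g (snd z)))"
    using J1 J2 gint(2) by (simp add: E1 E2)
  also have "\<dots> \<le> (LINT x|\<mu>. dist x (g x)) + (LINT x|\<nu>. dist x (g x)) + (LINT z|\<gamma>. dist (g (fst z)) (g (snd z)))"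
    using gint(1) gint\<gamma> Pc by simp
  finally show ?thesis .
qed

text \<open>Only the difference of the marginals of \<open>\<gamma>\<close> has to match: mass that \<open>\<gamma>\<close> moves into a point
  and out again can be rerouted past that point without increasing the cost.\<close>

lemma d1_le_plan:
  fixes \<mu> \<nu> :: "'a::euclidean_space measure" and \<gamma> :: "('a \<times> 'a) measure"
  assumes \<mu>: "\<mu> \<in> P1" and \<nu>: "\<nu> \<in> P1" and fin: "finite_measure \<gamma>" and sets\<gamma>: "sets \<gamma> = sets borel"
    and net: "\<And>A. A \<in> sets borel \<Longrightarrow>
       measure \<mu> A - measure \<nu> A = measure \<gamma> (fst -` A) - measure \<gamma> (snd -` A)"
    and i1: "integrable \<gamma> (\<lambda>z. norm (fst z))" and i2: "integrable \<gamma> (\<lambda>z. norm (snd z))"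
  shows "d1 \<mu> \<nu> \<le> (LINT z|\<gamma>. dist (fst z) (snd z))"
proof -
  have "(\<lambda>x. x) \<in> borel_measurable (borel :: 'a measure)" by simp
  \<comment> \<open>Simple functions converging to the identity with norm at most twice that of the
    point. The base point 0 is what makes the first moments available as dominating functions in all
    three limits below.\<close>
  from borel_measurable_implies_sequence_metric[OF this, of 0]
  obtain g :: "nat \<Rightarrow> 'a \<Rightarrow> 'a" where g: "\<And>i. simple_function borel (g i)" "\<And>x. (\<lambda>i. g i x) \<longlonglongrightarrow> x"
     "\<And>i x. dist (g i x) 0 \<le> 2 * dist x 0"
    by auto
  have gm[measurable]: "g i \<in> borel_measurable borel" for i
    using g(1) by (rule borel_measurable_simple_function)
  have gf: "finite (range (g i))" for i using g(1)[of i] by (simp add: simple_function_def)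
  note s[measurable_cong] = P1_D(2)[OF \<mu>] P1_D(2)[OF \<nu>] sets\<gamma>[folded borel_prod]
  have bd: "dist x (g i x) \<le> 3 * norm x" for x i
    using g(3)[of i x] norm_triangle_ineq4[of x "g i x"] by (simp add: dist_norm)
  have d0: "(\<lambda>i. dist x (g i x)) \<longlonglongrightarrow> 0" for x
    using tendsto_dist[OF tendsto_const[of x] g(2)[of x]] by simp
  have l1: "(\<lambda>i. LINT x|\<mu>. dist x (g i x)) \<longlonglongrightarrow> (LINT x|\<mu>. 0)"
    by (rule integral_dominated_convergence[where w = "\<lambda>x. 3 * norm x"])
       (use P1_D(4)[OF \<mu>] bd d0 in auto)
  have l2: "(\<lambda>i. LINT x|\<nu>. dist x (g i x)) \<longlonglongrightarrow> (LINT x|\<nu>. 0)"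
    by (rule integral_dominated_convergence[where w = "\<lambda>x. 3 * norm x"])
       (use P1_D(4)[OF \<nu>] bd d0 in auto)
  have l3: "(\<lambda>i. LINT z|\<gamma>. dist (g i (fst z)) (g i (snd z))) \<longlonglongrightarrow> (LINT z|\<gamma>. dist (fst z) (snd z))"
  proof (rule integral_dominated_convergence[where w = "\<lambda>z. 2 * norm (fst z) + 2 * norm (snd z)"])
    show "AE z in \<gamma>. (\<lambda>i. dist (g i (fst z)) (g i (snd z))) \<longlonglongrightarrow> dist (fst z) (snd z)"
      by (intro AE_I2 tendsto_dist g)
    show "AE z in \<gamma>. norm (dist (g i (fst z)) (g i (snd z))) \<le> 2 * norm (fst z) + 2 * norm (snd z)" for i
    proof (intro AE_I2)
      fix z :: "'a \<times> 'a"
      show "norm (dist (g i (fst z)) (g i (snd z))) \<le> 2 * norm (fst z) + 2 * norm (snd z)"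
        using g(3)[of i "fst z"] g(3)[of i "snd z"] norm_triangle_ineq4[of "g i (fst z)" "g i (snd z)"]
        by (simp add: dist_norm)
    qed
  qed (use i1 i2 in auto)
  have "(\<lambda>i. (LINT x|\<mu>. dist x (g i x)) + (LINT x|\<nu>. dist x (g i x)) + (LINT z|\<gamma>. dist (g i (fst z)) (g i (snd z))))
     \<longlonglongrightarrow> 0 + 0 + (LINT z|\<gamma>. dist (fst z) (snd z))"
    using l1 l2 l3 by (intro tendsto_add) auto
  then have "(\<lambda>i. (LINT x|\<mu>. dist x (g i x)) + (LINT x|\<nu>. dist x (g i x)) + (LINT z|\<gamma>. dist (g i (fst z)) (g i (snd z))))
     \<longlonglongrightarrow> (LINT z|\<gamma>. dist (fst z) (snd z))" by simp
  then show ?thesis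
    by (rule LIMSEQ_le_const)
       (use d1_le_discretized_plan[OF \<mu> \<nu> fin sets\<gamma> net gm gf] in auto)
qed

text \<open>The plan that moves nothing has net marginal zero and cost zero.\<close>

lemma d1_refl_le: "\<mu> \<in> P1 \<Longrightarrow> d1 \<mu> \<mu> \<le> 0"
  using d1_le_plan[of \<mu> \<mu> "null_measure borel"] by (simp add: finite_measureI borel_prod[symmetric])

section \<open>A comparison principle by doubling of variables\<close>

text \<open>The second derivative is only known at the single point 0, so there is no Taylor formula
  to rely on. If \<open>c\<close> were positive, \<open>f'\<close> would be positive just to the
  right of its zero at 0, and the mean value theorem would make \<open>f\<close> exceed its
  maximum.\<close>

lemma second_derivative_nonpos_at_max:
  fixes f f' :: "real \<Rightarrow> real"
  assumes d: "d > 0" and f: "\<And>s. \<bar>s\<bar> < d \<Longrightarrow> (f has_real_derivative f' s) (at s)"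
    and f': "(f' has_real_derivative c) (at 0)" and mx: "\<And>s. \<bar>s\<bar> < d \<Longrightarrow> f s \<le> f 0"
  shows "c \<le> 0"
proof (rule ccontr)
  assume "\<not> c \<le> 0"
  then have c: "c > 0" by simp
  have f0: "f' 0 = 0"
    using DERIV_local_max[of f "f' 0" 0 d] f[of 0] d mx by (auto simp: abs_minus_commute)
  from DERIV_pos_inc_right[OF f' c] f0 obtain e where e: "e > 0" "\<And>h. h > 0 \<Longrightarrow> h < e \<Longrightarrow> f' h > 0"
    by auto
  define s where "s = min d e / 2"
  have s: "0 < s" "s < d" "s < e" using d e by (auto simp: s_def)
  have "\<exists>z. 0 < z \<and> z < s \<and> f s - f 0 = (s - 0) * f' z"
    using s by (intro MVT2) (auto intro!: f)
  then obtain z where z: "0 < z" "z < s" "f s - f 0 = (s - 0) * f' z" by auto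
  have "f' z > 0" using e(2)[of z] z s by auto
  then have "0 < s * f' z" using s by simp
  then have "f s > f 0" using z(3) by simp
  then show False using mx[of s] s by auto
qed

text \<open>The map sending \<open>b\<close> to \<open>b - (2 * (b \<bullet> e)) *\<^sub>R e\<close>
  is the orthogonal reflection in the hyperplane normal to \<open>e\<close>, and the trace is
  invariant under conjugation with it. This allows the second point in the doubling argument to move
  along mirrored directions.\<close>

lemma trace_reflection:
  fixes h :: "'a::euclidean_space \<Rightarrow> 'a"
  assumes h: "linear h" and e: "norm e = 1"
  shows "(\<Sum>b\<in>Basis. h (b - (2 * (b \<bullet> e)) *\<^sub>R e) \<bullet> (b - (2 * (b \<bullet> e)) *\<^sub>R e)) = (\<Sum>b\<in>Basis. h b \<bullet> b)"
proof -
  have ee: "e \<bullet> e = 1" using e by (simp add: dot_square_norm)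
  have 1: "h (b - (2 * (b \<bullet> e)) *\<^sub>R e) \<bullet> (b - (2 * (b \<bullet> e)) *\<^sub>R e)
     = h b \<bullet> b - 2 * ((b \<bullet> e) * (h e \<bullet> b)) - 2 * ((b \<bullet> e) * (h b \<bullet> e)) + 4 * ((b \<bullet> e) * ((b \<bullet> e) * (h e \<bullet> e)))" for b
    by (simp add: linear_diff[OF h] linear_scale[OF h] inner_diff_left inner_diff_right algebra_simps)
  have 2: "(\<Sum>b\<in>Basis. (b \<bullet> e) * (h e \<bullet> b)) = h e \<bullet> e"
    by (subst euclidean_inner[of "h e" e]) (simp add: inner_commute mult.commute)
  have 3: "(\<Sum>b\<in>Basis. (b \<bullet> e) * (h b \<bullet> e)) = h e \<bullet> e"
  proof -
    have "h e = h (\<Sum>b\<in>Basis. (e \<bullet> b) *\<^sub>R b)" by (simp add: euclidean_representation)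
    also have "\<dots> = (\<Sum>b\<in>Basis. (e \<bullet> b) *\<^sub>R h b)" by (simp add: linear_sum[OF h] linear_scale[OF h])
    finally have "h e \<bullet> e = (\<Sum>b\<in>Basis. (e \<bullet> b) *\<^sub>R h b) \<bullet> e" by simp
    then have "h e \<bullet> e = (\<Sum>b\<in>Basis. (e \<bullet> b) * (h b \<bullet> e))" by (simp only: inner_sum_left inner_scaleR_left)
    then show ?thesis by (simp only: inner_commute[of e])
  qed
  have 4: "(\<Sum>b\<in>Basis. (b \<bullet> e) * ((b \<bullet> e) * (h e \<bullet> e))) = h e \<bullet> e"
  proof -
    have "(\<Sum>b\<in>Basis. (b \<bullet> e) * ((b \<bullet> e) * (h e \<bullet> e))) = (\<Sum>b\<in>Basis. (e \<bullet> b) * (e \<bullet> b)) * (h e \<bullet> e)"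
      by (simp add: sum_distrib_right inner_commute mult.assoc)
    then show ?thesis using ee by (simp add: euclidean_inner[of e e])
  qed
  show ?thesis
    unfolding 1 sum.distrib sum_subtractf sum_distrib_left[symmetric] 2 3 4 by simp
qed

text \<open>A reflection coupling in the language of the maximum principle: at a maximum of the
  doubled function the two points are displaced in mirrored directions, which brings in 4 \<psi>''
  from the one direction joining them. The coefficient \<open>Q\<close> multiplies quantities that
  vanish at the maximum up to the penalisation, so its size does not affect the conclusion; a first
  order term that does not vanish there has to be put into \<Xi>. The condition \<open>gap\<close>
  is imposed away from r = 0 only, since \<psi> may vanish at 0.\<close>

lemma doubling_comparison:
  fixes w wt :: "'a::euclidean_space \<Rightarrow> real \<Rightarrow> real" and g :: "'a \<Rightarrow> real \<Rightarrow> 'a"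
    and h :: "'a \<Rightarrow> real \<Rightarrow> 'a \<Rightarrow> 'a" and \<psi> \<psi>' \<psi>'' \<Xi> :: "real \<Rightarrow> real"
  assumes cont: "continuous_on (UNIV \<times> {0<..}) (\<lambda>(x, t). w x t)"
    and g: "\<And>x t. t > 0 \<Longrightarrow> ((\<lambda>y. w y t) has_derivative (\<lambda>v. g x t \<bullet> v)) (at x)"
    and h: "\<And>x t. t > 0 \<Longrightarrow> ((\<lambda>y. g y t) has_derivative h x t) (at x)"
    and wt: "\<And>x t. t > 0 \<Longrightarrow> ((\<lambda>s. w x s) has_real_derivative wt x t) (at t)"
    and lip: "\<And>x y t. t > 0 \<Longrightarrow> w x t - w y t \<le> G * norm (x - y)" and G: "G > 0"
    and \<psi>: "\<And>r. r > 0 \<Longrightarrow> (\<psi> has_real_derivative \<psi>' r) (at r)"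
    and \<psi>': "\<And>r. r > 0 \<Longrightarrow> (\<psi>' has_real_derivative \<psi>'' r) (at r)"
    and c\<psi>: "continuous_on {0..} \<psi>" and \<psi>0: "\<And>r. r \<ge> 0 \<Longrightarrow> \<psi> r \<ge> 0"
    and lam: "lam > 0" and Q: "Q \<ge> 0"
    and ineq: "\<And>x y t. t > 0 \<Longrightarrow> x \<noteq> y \<Longrightarrow>
      - (wt x t - wt y t) - ((\<Sum>b\<in>Basis. h x t b \<bullet> b) - (\<Sum>b\<in>Basis. h y t b \<bullet> b)) + lam * (w x t - w y t)
        \<le> \<Xi> (norm (x - y)) + Q * (norm (g x t - \<psi>' (norm (x - y)) *\<^sub>R sgn (x - y))
             + norm (g y t - \<psi>' (norm (x - y)) *\<^sub>R sgn (x - y)))"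
    and gap: "\<And>r0. r0 > 0 \<Longrightarrow> \<exists>c>0. \<forall>r\<ge>r0. \<Xi> r + c \<le> lam * \<psi> r - 4 * \<psi>'' r"
    and t: "t > 0"
  shows "w x t - w y t \<le> \<psi> (norm (x - y))"
proof (rule ccontr)
  assume "\<not> ?thesis"
  then have viol: "w x t - w y t - \<psi> (norm (x - y)) > 0" by simp
  \<comment> \<open>Half of the excess may be spent on the penalty, whose value at the given point
    is \<epsilon> times \<open>S\<close>; the other half keeps the maximum of \<Phi> at or above
    \<eta>.\<close>
  define \<eta> where "\<eta> = (w x t - w y t - \<psi> (norm (x - y))) / 2"
  have \<eta>: "\<eta> > 0" using viol by (simp add: \<eta>_def)
  define S where "S = (norm x)\<^sup>2 + (norm y)\<^sup>2 + (t + 1 / t)"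
  have S: "S > 0" using t by (simp add: S_def add_nonneg_pos)
  obtain c where c: "c > 0" "\<And>r. r \<ge> \<eta> / G \<Longrightarrow> \<Xi> r + c \<le> lam * \<psi> r - 4 * \<psi>'' r"
    using gap[of "\<eta> / G"] \<eta> G by auto
  \<comment> \<open>All errors caused by the penalty, per unit of \<epsilon>: 1 from the time
    derivative, 4 per dimension from the Laplacians, and at each of the two points
    \<open>Q\<^sup>2 / lam\<close> from completing the square, where the zero order term absorbs the
    linear one.\<close>
  define D where "D = 1 + 4 * real DIM('a) + 2 * Q\<^sup>2 / lam"
  have D: "D > 0" using lam by (simp add: D_def add_pos_nonneg)
  define \<epsilon> where "\<epsilon> = min (\<eta> / S) (c / (2 * D))"
  have \<epsilon>: "\<epsilon> > 0" "\<epsilon> * S \<le> \<eta>" "\<epsilon> * D < c"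
  proof -
    show "\<epsilon> > 0" using \<eta> S c D by (simp add: \<epsilon>_def)
    have "\<epsilon> * S \<le> \<eta> / S * S" using S by (intro mult_right_mono) (auto simp: \<epsilon>_def)
    then show "\<epsilon> * S \<le> \<eta>" using S by simp
    have "\<epsilon> * D \<le> c / (2 * D) * D" using D by (intro mult_right_mono) (auto simp: \<epsilon>_def)
    then show "\<epsilon> * D < c" using D c by simp
  qed
  \<comment> \<open>The quadratic part makes the maximum attained in space. The part t + 1/t does so
    in time and keeps the maximum away from t = 0, so that neither an initial nor a terminal
    condition is required.\<close>
  define \<Phi> where "\<Phi> x y t = w x t - w y t - \<psi> (norm (x - y)) - \<epsilon> * ((norm x)\<^sup>2 + (norm y)\<^sup>2 + (t + 1 / t))" for x y t
  have \<Phi>hat: "\<Phi> x y t \<ge> \<eta>" using \<epsilon>(2) by (simp add: \<Phi>_def \<eta>_def S_def)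
  have quad: "G * a - \<epsilon> * a\<^sup>2 \<le> G\<^sup>2 / (4 * \<epsilon>)" for a
  proof -
    have "0 \<le> (2 * \<epsilon> * a - G)\<^sup>2 / (4 * \<epsilon>)" using \<epsilon> by simp
    also have "\<dots> = \<epsilon> * a\<^sup>2 - G * a + G\<^sup>2 / (4 * \<epsilon>)" using \<epsilon> by (simp add: power2_eq_square field_simps)
    finally show ?thesis by simp
  qed
  define M where "M = 2 * G / \<epsilon>"
  define T where "T = G\<^sup>2 / (2 * \<epsilon>\<^sup>2)"
  \<comment> \<open>Differences of \<open>w\<close> grow at most linearly with slope
    \<open>G\<close>, uniformly in time, and so lose against the quadratic penalty; the set where
    \<Phi> is at least \<eta> lies in an explicit compact set.\<close>
  have bnd: "norm x \<le> M \<and> norm y \<le> M \<and> t \<le> T \<and> 1 / T \<le> t" if "\<Phi> x y t \<ge> \<eta>" "t > 0" for x y t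
  proof -
    have "G * norm (x - y) \<le> G * (norm x + norm y)" using G by (intro mult_left_mono norm_triangle_ineq4) auto
    then have a: "\<epsilon> * (t + 1 / t) < (G * norm x - \<epsilon> * (norm x)\<^sup>2) + (G * norm y - \<epsilon> * (norm y)\<^sup>2)"
      using that lip[of t x y] \<psi>0[of "norm (x - y)"] \<eta> by (simp add: \<Phi>_def algebra_simps)
    have t0: "0 < \<epsilon> * (t + 1 / t)" using \<epsilon> that by (simp add: add_pos_pos)
    have "\<epsilon> * (t + 1 / t) \<le> G\<^sup>2 / (2 * \<epsilon>)"
      using a quad[of "norm x"] quad[of "norm y"] by simp
    then have "t + 1 / t \<le> T" using \<epsilon> by (simp add: T_def field_simps power2_eq_square)
    then have tT: "t \<le> T" "1 / t \<le> T" using that(2) by (auto intro: order_trans[rotated])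
    then have "1 / T \<le> t" using that(2) by (simp add: field_simps)
    moreover have "u \<le> M" if "0 \<le> u" "G * u - \<epsilon> * u\<^sup>2 > - (G\<^sup>2 / (4 * \<epsilon>))" for u
    proof (rule ccontr)
      assume u: "\<not> u \<le> M"
      then have "\<epsilon> * u > 2 * G" using \<epsilon> by (simp add: M_def field_simps)
      then have "u * (\<epsilon> * u - G) \<ge> u * G" using that(1) by (intro mult_left_mono) auto
      moreover have "u * G \<ge> M * G" using u G by (intro mult_right_mono) auto
      moreover have "M * G \<ge> G\<^sup>2 / (4 * \<epsilon>)" using \<epsilon> G by (simp add: M_def field_simps power2_eq_square)
      ultimately show False using that(2) by (simp add: algebra_simps power2_eq_square)
    qed
    ultimately show ?thesis
      using a t0 quad[of "norm x"] quad[of "norm y"] tT by auto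
  qed
  define K where "K = cball (0::'a) M \<times> cball (0::'a) M \<times> {1 / T .. T}"
  have KT: "T > 0" using G \<epsilon> by (simp add: T_def)
  have Kc: "compact K" unfolding K_def by (intro compact_Times compact_cball compact_Icc)
  have "(x, y, t) \<in> K" using bnd[OF \<Phi>hat t] by (simp add: K_def)
  then have Kn: "K \<noteq> {}" by auto
  have Kpos: "snd (snd p) > 0" if "p \<in> K" for p
  proof -
    have "0 < 1 / T" using KT by simp
    also have "1 / T \<le> snd (snd p)" using that by (auto simp: K_def)
    finally show ?thesis .
  qed
  have "continuous_on K (\<lambda>p. \<Phi> (fst p) (fst (snd p)) (snd (snd p)))"
  proof -
    have c1: "continuous_on K (\<lambda>p. w (fst p) (snd (snd p)))"
      using continuous_on_compose2[OF cont, of K "\<lambda>p. (fst p, snd (snd p))"] Kpos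
      by (force intro!: continuous_intros)
    have c2: "continuous_on K (\<lambda>p. w (fst (snd p)) (snd (snd p)))"
      using continuous_on_compose2[OF cont, of K "\<lambda>p. (fst (snd p), snd (snd p))"] Kpos
      by (force intro!: continuous_intros)
    have c3: "continuous_on K (\<lambda>p. \<psi> (norm (fst p - fst (snd p))))"
      by (rule continuous_on_compose2[OF c\<psi>]) (auto intro!: continuous_intros)
    show ?thesis unfolding \<Phi>_def
      by (intro continuous_intros c1 c2 c3) (use Kpos in force)
  qed
  from continuous_attains_sup[OF Kc Kn this] obtain p where p: "p \<in> K"
    "\<And>q. q \<in> K \<Longrightarrow> \<Phi> (fst q) (fst (snd q)) (snd (snd q)) \<le> \<Phi> (fst p) (fst (snd p)) (snd (snd p))" by blast
  obtain x' y' t' where pe: "p = (x', y', t')" by (cases p)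
  have m: "(x', y', t') \<in> K" "\<And>q. q \<in> K \<Longrightarrow> \<Phi> (fst q) (fst (snd q)) (snd (snd q)) \<le> \<Phi> x' y' t'"
    using p by (auto simp: pe)
  have t': "t' > 0" using Kpos[OF m(1)] by simp
  have max\<eta>: "\<Phi> x' y' t' \<ge> \<eta>" using m(2)[OF \<open>(x, y, t) \<in> K\<close>] \<Phi>hat by simp
  have mx: "\<Phi> a b s \<le> \<Phi> x' y' t'" if "s > 0" for a b s
  proof (cases "\<Phi> a b s \<ge> \<eta>")
    case True
    then have "(a, b, s) \<in> K" using bnd[OF True that] by (simp add: K_def)
    then show ?thesis using m(2)[of "(a, b, s)"] by simp
  qed (use max\<eta> in auto)
  define r where "r = norm (x' - y')"
  define e where "e = sgn (x' - y')"
  have wge: "w x' t' - w y' t' \<ge> \<psi> r + \<epsilon> * ((norm x')\<^sup>2 + (norm y')\<^sup>2 + (t' + 1 / t')) + \<eta>"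
    using max\<eta> by (simp add: \<Phi>_def r_def)
  have pen0: "\<epsilon> * ((norm x')\<^sup>2 + (norm y')\<^sup>2 + (t' + 1 / t')) \<ge> \<epsilon> * ((norm x')\<^sup>2 + (norm y')\<^sup>2)"
    using \<epsilon> t' by (intro mult_left_mono) auto
  have pen1: "\<epsilon> * ((norm x')\<^sup>2 + (norm y')\<^sup>2) \<ge> 0" using \<epsilon> by simp
  \<comment> \<open>The Lipschitz bound keeps the maximum off the diagonal, where the norm is not
    differentiable, and supplies the lower bound on \<open>r\<close> that \<open>gap\<close> asks
    for.\<close>
  have "\<eta> \<le> G * r"
    using wge pen0 pen1 lip[OF t', of x' y'] \<psi>0[of r] by (simp add: r_def)
  then have r: "r \<ge> \<eta> / G" using G by (simp add: field_simps)
  then have r0: "r > 0" using \<eta> G by (smt (verit) divide_pos_pos)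
  then have xy: "x' \<noteq> y'" by (auto simp: r_def)
  have e1: "norm e = 1" using xy by (simp add: e_def norm_sgn)
  have re: "x' - y' = r *\<^sub>R e" using xy by (simp add: r_def e_def sgn_div_norm)
  \<comment> \<open>The equation runs backward in time, so an upper bound on the difference of the
    time derivatives is what is needed. The derivative of 1/t is negative and hence
    harmless.\<close>
  have time: "wt x' t' - wt y' t' \<le> \<epsilon>"
  proof -
    have "((\<lambda>s. \<Phi> x' y' s) has_real_derivative
        wt x' t' - wt y' t' - 0 - \<epsilon> * (0 + 0 + (1 + - (1 / t'\<^sup>2)))) (at t')"
      unfolding \<Phi>_def using t' by (auto intro!: derivative_eq_intros wt simp: power2_eq_square field_simps)
    from DERIV_local_max[OF this t'] have "wt x' t' - wt y' t' = \<epsilon> * (1 - 1 / t'\<^sup>2)"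
      using mx by (simp add: abs_if split: if_splits)
    also have "\<dots> \<le> \<epsilon> * 1" using \<epsilon> by (intro mult_left_mono) auto
    finally show ?thesis by simp
  qed
  have nd: "((\<lambda>z. norm (z - y')) has_derivative (\<lambda>v. e \<bullet> v)) (at x')"
    using has_derivative_norm[of "x' - y'"] xy
    by (intro has_derivative_compose[of "\<lambda>z. z - y'" "\<lambda>v. v" x' UNIV norm "\<lambda>v. e \<bullet> v", simplified])
       (auto intro!: derivative_eq_intros simp: e_def inner_commute)
  have nd2: "((\<lambda>z. norm (x' - z)) has_derivative (\<lambda>v. - (e \<bullet> v))) (at y')"
    using has_derivative_norm[of "x' - y'"] xy
    by (intro has_derivative_compose[of "\<lambda>z. x' - z" "\<lambda>v. - v" y' UNIV norm "\<lambda>v. e \<bullet> v", simplified])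
       (auto intro!: derivative_eq_intros simp: e_def inner_commute)
  have \<psi>d: "(\<psi> has_derivative (\<lambda>v. \<psi>' r * v)) (at (norm (x' - y')))"
    using \<psi>[OF r0] by (simp add: has_field_derivative_def r_def)
  have gx: "g x' t' = \<psi>' r *\<^sub>R e + (2 * \<epsilon>) *\<^sub>R x'"
  proof -
    have "((\<lambda>z. \<Phi> z y' t') has_derivative
        (\<lambda>v. g x' t' \<bullet> v - 0 - \<psi>' r * (e \<bullet> v) - \<epsilon> * (2 * (x' \<bullet> v)))) (at x')"
      unfolding \<Phi>_def power2_norm_eq_inner
      by (auto intro!: derivative_eq_intros g[OF t'] has_derivative_compose[OF nd \<psi>d] simp: inner_commute)
    from differential_zero_maxmin[OF _ open_UNIV this] mx t'
    have "(\<lambda>v. g x' t' \<bullet> v - 0 - \<psi>' r * (e \<bullet> v) - \<epsilon> * (2 * (x' \<bullet> v))) = (\<lambda>v. 0)"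
      by auto
    then have "(g x' t' - (\<psi>' r *\<^sub>R e + (2 * \<epsilon>) *\<^sub>R x')) \<bullet> v = 0" for v
      by (simp add: fun_eq_iff inner_diff_left inner_add_left algebra_simps)
    then show ?thesis by (metis inner_eq_zero_iff right_minus_eq)
  qed
  have gy: "g y' t' = \<psi>' r *\<^sub>R e - (2 * \<epsilon>) *\<^sub>R y'"
  proof -
    have "((\<lambda>z. \<Phi> x' z t') has_derivative
        (\<lambda>v. 0 - g y' t' \<bullet> v - \<psi>' r * - (e \<bullet> v) - \<epsilon> * (2 * (y' \<bullet> v)))) (at y')"
      unfolding \<Phi>_def power2_norm_eq_inner
      by (auto intro!: derivative_eq_intros g[OF t'] has_derivative_compose[OF nd2 \<psi>d] simp: inner_commute)
    from differential_zero_maxmin[OF _ open_UNIV this] mx t'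
    have "(\<lambda>v. 0 - g y' t' \<bullet> v - \<psi>' r * - (e \<bullet> v) - \<epsilon> * (2 * (y' \<bullet> v))) = (\<lambda>v. 0)"
      by auto
    then have "(g y' t' - (\<psi>' r *\<^sub>R e - (2 * \<epsilon>) *\<^sub>R y')) \<bullet> v = 0" for v
      by (simp add: fun_eq_iff inner_diff_left algebra_simps)
    then show ?thesis by (metis inner_eq_zero_iff right_minus_eq)
  qed
  \<comment> \<open>Displacing \<open>x'\<close> by \<open>s *\<^sub>R b\<close> and
    \<open>y'\<close> by \<open>s *\<^sub>R R b\<close> leaves the direction of
    \<open>x' - y'\<close> unchanged and alters its length at rate
    \<open>2 * (b \<bullet> e)\<close>. Equal displacements would keep the difference fixed, and
    \<psi>'' would not appear at all.\<close>
  define R where "R b = b - (2 * (b \<bullet> e)) *\<^sub>R e" for b :: 'a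
  have second: "h x' t' b \<bullet> b - h y' t' (R b) \<bullet> R b - 4 * \<psi>'' r * (b \<bullet> e)\<^sup>2 - 4 * \<epsilon> \<le> 0" if b: "b \<in> Basis" for b
  proof -
    define \<beta> where "\<beta> = b \<bullet> e"
    have ee: "e \<bullet> e = 1" using e1 by (simp add: dot_square_norm)
    have bb: "b \<bullet> b = 1" using b by (simp add: inner_Basis)
    have RR: "R b \<bullet> R b = 1"
      using ee bb by (simp add: R_def inner_diff_left inner_diff_right inner_commute algebra_simps)
    have \<beta>: "\<bar>\<beta>\<bar> \<le> 1" unfolding \<beta>_def using Cauchy_Schwarz_ineq2[of b e] e1 b by simp
    have pos: "r + 2 * s * \<beta> > 0" if "\<bar>s\<bar> < r / 2" for s
    proof -
      have "\<bar>s * \<beta>\<bar> \<le> \<bar>s\<bar> * 1" unfolding abs_mult using \<beta> by (intro mult_left_mono) auto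
      then show ?thesis using that by linarith
    qed
    \<comment> \<open>\<Phi> along the mirrored displacement, with the norm replaced by the length
      it equals. For |s| < r/2 that length is positive, so the two agree and \<psi> is
      differentiable at the values that occur.\<close>
    define f where "f s = w (x' + s *\<^sub>R b) t' - w (y' + s *\<^sub>R R b) t' - \<psi> (r + 2 * s * \<beta>)
       - \<epsilon> * ((norm (x' + s *\<^sub>R b))\<^sup>2 + (norm (y' + s *\<^sub>R R b))\<^sup>2 + (t' + 1 / t'))" for s
    define f' where "f' s = g (x' + s *\<^sub>R b) t' \<bullet> b - g (y' + s *\<^sub>R R b) t' \<bullet> R b - 2 * \<beta> * \<psi>' (r + 2 * s * \<beta>)
       - \<epsilon> * (2 * (x' \<bullet> b) + 2 * s + (2 * (y' \<bullet> R b) + 2 * s))" for s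
    have fe: "f s = \<Phi> (x' + s *\<^sub>R b) (y' + s *\<^sub>R R b) t'" if "\<bar>s\<bar> < r / 2" for s
    proof -
      have "x' + s *\<^sub>R b - (y' + s *\<^sub>R R b) = (r + 2 * s * \<beta>) *\<^sub>R e"
        using re by (simp add: R_def \<beta>_def algebra_simps)
      then have "norm (x' + s *\<^sub>R b - (y' + s *\<^sub>R R b)) = r + 2 * s * \<beta>"
        using pos[OF that] e1 by simp
      then show ?thesis by (simp add: f_def \<Phi>_def)
    qed
    have line: "((\<lambda>s. w (p + s *\<^sub>R d) t') has_real_derivative g (p + s *\<^sub>R d) t' \<bullet> d) (at s)" for p d s
    proof -
      have "((\<lambda>s. p + s *\<^sub>R d) has_derivative (\<lambda>s. s *\<^sub>R d)) (at s)" by (auto intro!: derivative_eq_intros)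
      from has_derivative_compose[OF this g[OF t']]
      have "((\<lambda>s. w (p + s *\<^sub>R d) t') has_derivative (\<lambda>r. g (p + s *\<^sub>R d) t' \<bullet> (r *\<^sub>R d))) (at s)" .
      moreover have "(\<lambda>r. g (p + s *\<^sub>R d) t' \<bullet> (r *\<^sub>R d)) = (*) (g (p + s *\<^sub>R d) t' \<bullet> d)"
        by (simp add: fun_eq_iff)
      ultimately show ?thesis by (simp add: has_field_derivative_def)
    qed
    have lineg: "((\<lambda>s. g (p + s *\<^sub>R d) t' \<bullet> d) has_real_derivative h p t' d \<bullet> d) (at 0)" for p d
    proof -
      have lin: "linear (h p t')" using h[OF t', of p] by (rule has_derivative_linear)
      have "((\<lambda>s. p + s *\<^sub>R d) has_derivative (\<lambda>s. s *\<^sub>R d)) (at 0)" by (auto intro!: derivative_eq_intros)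
      moreover have "((\<lambda>y. g y t') has_derivative h p t') (at (p + 0 *\<^sub>R d))" using h[OF t', of p] by simp
      ultimately have "((\<lambda>s. g (p + s *\<^sub>R d) t') has_derivative (\<lambda>s. h p t' (s *\<^sub>R d))) (at 0)"
        by (rule has_derivative_compose)
      from has_derivative_inner_left[OF this, of d]
      have "((\<lambda>s. g (p + s *\<^sub>R d) t' \<bullet> d) has_derivative (\<lambda>s. h p t' (s *\<^sub>R d) \<bullet> d)) (at 0)" .
      moreover have "(\<lambda>s. h p t' (s *\<^sub>R d) \<bullet> d) = (*) (h p t' d \<bullet> d)"
        by (simp add: fun_eq_iff linear_scale[OF lin])
      ultimately show ?thesis by (simp add: has_field_derivative_def)
    qed
    have f1: "(f has_real_derivative f' s) (at s)" if s: "\<bar>s\<bar> < r / 2" for s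
    proof -
      have p: "((\<lambda>s. \<psi> (r + 2 * s * \<beta>)) has_real_derivative \<psi>' (r + 2 * s * \<beta>) * (2 * \<beta>)) (at s)"
        by (rule DERIV_chain2[where f = \<psi> and g = "\<lambda>s. r + 2 * s * \<beta>", OF \<psi>[OF pos[OF s]]]) (auto intro!: derivative_eq_intros)
      have q: "((\<lambda>s. (norm (p + s *\<^sub>R d))\<^sup>2) has_real_derivative 2 * (p \<bullet> d) + 2 * s) (at s)" if "d \<bullet> d = 1" for p d :: 'a
      proof -
        have "(norm (p + s *\<^sub>R d))\<^sup>2 = p \<bullet> p + 2 * (p \<bullet> d) * s + s * s" for s
          using that by (simp add: power2_norm_eq_inner inner_add_left inner_add_right inner_commute algebra_simps)
        then show ?thesis by (auto intro!: derivative_eq_intros)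
      qed
      show ?thesis unfolding f_def f'_def
        by (rule derivative_eq_intros line p q bb RR | simp)+
    qed
    have f2: "(f' has_real_derivative h x' t' b \<bullet> b - h y' t' (R b) \<bullet> R b - 4 * \<psi>'' r * \<beta>\<^sup>2 - 4 * \<epsilon>) (at 0)"
    proof -
      have p: "((\<lambda>s. \<psi>' (r + 2 * s * \<beta>)) has_real_derivative \<psi>'' r * (2 * \<beta>)) (at 0)"
        by (rule DERIV_chain2[where f = \<psi>' and g = "\<lambda>s. r + 2 * s * \<beta>"]) (use \<psi>'[OF r0] in \<open>auto intro!: derivative_eq_intros\<close>)
      show ?thesis unfolding f'_def
        by (rule derivative_eq_intros lineg p | simp add: power2_eq_square)+
    qed
    show ?thesis unfolding \<beta>_def[symmetric]
    proof (rule second_derivative_nonpos_at_max[OF _ f1 f2])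
      fix s assume s: "\<bar>s\<bar> < r / 2"
      show "f s \<le> f 0" using fe[OF s] fe[of 0] r0 mx[OF t'] by simp
    qed (use r0 in auto)
  qed
  have lap: "(\<Sum>b\<in>Basis. h x' t' b \<bullet> b) - (\<Sum>b\<in>Basis. h y' t' b \<bullet> b) \<le> 4 * \<psi>'' r + 4 * real DIM('a) * \<epsilon>"
  proof -
    have "(\<Sum>b\<in>Basis. h x' t' b \<bullet> b - h y' t' (R b) \<bullet> R b - 4 * \<psi>'' r * (b \<bullet> e)\<^sup>2 - 4 * \<epsilon>) \<le> 0"
      by (intro sum_nonpos second)
    moreover have "(\<Sum>b\<in>Basis. h y' t' (R b) \<bullet> R b) = (\<Sum>b\<in>Basis. h y' t' b \<bullet> b)"
      unfolding R_def by (rule trace_reflection[OF has_derivative_linear[OF h[OF t']] e1])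
    moreover have "(\<Sum>b\<in>Basis. (b \<bullet> e)\<^sup>2) = 1"
      using e1 euclidean_inner[of e e] by (simp add: dot_square_norm power2_eq_square inner_commute)
    ultimately show ?thesis
      by (simp add: sum_subtractf sum_distrib_left[symmetric])
  qed
  have "- \<epsilon> - (4 * \<psi>'' r + 4 * real DIM('a) * \<epsilon>) + lam * (\<psi> r + \<epsilon> * ((norm x')\<^sup>2 + (norm y')\<^sup>2))
     \<le> - (wt x' t' - wt y' t') - ((\<Sum>b\<in>Basis. h x' t' b \<bullet> b) - (\<Sum>b\<in>Basis. h y' t' b \<bullet> b)) + lam * (w x' t' - w y' t')"
    using time lap mult_left_mono[of "\<psi> r + \<epsilon> * ((norm x')\<^sup>2 + (norm y')\<^sup>2)" "w x' t' - w y' t'" lam]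
      wge pen0 \<eta> lam by linarith
  also have "\<dots> \<le> \<Xi> r + Q * (2 * \<epsilon> * norm x' + 2 * \<epsilon> * norm y')"
    using ineq[OF t' xy] \<epsilon> by (simp add: gx gy r_def[symmetric] e_def[symmetric])
  finally have f: "lam * \<psi> r - 4 * \<psi>'' r - \<Xi> r \<le> \<epsilon> * (1 + 4 * real DIM('a)
     + ((2 * Q * norm x' - lam * (norm x')\<^sup>2) + (2 * Q * norm y' - lam * (norm y')\<^sup>2)))"
    by (simp add: algebra_simps)
  have q: "2 * Q * a - lam * a\<^sup>2 \<le> Q\<^sup>2 / lam" for a
  proof -
    have "0 \<le> (lam * a - Q)\<^sup>2 / lam" using lam by simp
    also have "\<dots> = lam * a\<^sup>2 - 2 * Q * a + Q\<^sup>2 / lam" using lam by (simp add: power2_eq_square field_simps)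
    finally show ?thesis by simp
  qed
  have "lam * \<psi> r - 4 * \<psi>'' r - \<Xi> r \<le> \<epsilon> * D"
    unfolding D_def using q[of "norm x'"] q[of "norm y'"] \<epsilon>
    by (intro order_trans[OF f] mult_left_mono) auto
  then show False using c(2)[OF r] \<epsilon>(3) by simp
qed

section \<open>Gradients and the Hamiltonian\<close>

lemma linear_functional_representation:
  fixes f :: "'a::euclidean_space \<Rightarrow> real"
  assumes "linear f"
  shows "f v = (\<Sum>b\<in>Basis. f b *\<^sub>R b) \<bullet> v"
proof -
  have "f v = f (\<Sum>b\<in>Basis. (v \<bullet> b) *\<^sub>R b)" by (simp add: euclidean_representation)
  also have "\<dots> = (\<Sum>b\<in>Basis. (v \<bullet> b) *\<^sub>R f b)" by (simp add: linear_sum[OF assms] linear_scale[OF assms])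
  also have "\<dots> = (\<Sum>b\<in>Basis. f b *\<^sub>R b) \<bullet> v"
    unfolding inner_sum_left by (intro sum.cong refl) (simp add: inner_commute mult.commute)
  finally show ?thesis .
qed

lemma grad_eqI:
  fixes f :: "'a::euclidean_space \<Rightarrow> real"
  assumes "(f has_derivative (\<lambda>v. D \<bullet> v)) (at x)"
  shows "grad f x = D"
proof -
  have "GDERIV f x :> D" using assms by (simp add: gderiv_def inner_commute)
  moreover have "D' = D" if "GDERIV f x :> D'" for D'
  proof -
    have eq: "(\<lambda>h. h \<bullet> D') = (\<lambda>v. D \<bullet> v)"
      using that assms unfolding gderiv_def by (rule has_derivative_unique)
    have "D' \<bullet> v = D \<bullet> v" for v
      using fun_cong[OF eq, of v] inner_commute[of v D'] by linarith
    then have "(D' - D) \<bullet> v = 0" for v by (simp add: inner_diff_left)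
    then show ?thesis by (metis inner_eq_zero_iff right_minus_eq)
  qed
  ultimately show ?thesis unfolding grad_def by (rule the_equality)
qed

text \<open>The coordinates of the Frechet derivative provide a vector representing it, so the
  definite description in \<open>grad\<close> is legitimate.\<close>

lemma has_derivative_grad:
  fixes f :: "'a::euclidean_space \<Rightarrow> real"
  assumes "f differentiable (at x)"
  shows "(f has_derivative (\<lambda>v. grad f x \<bullet> v)) (at x)"
proof -
  have d: "(f has_derivative frechet_derivative f (at x)) (at x)"
    using assms by (simp add: frechet_derivative_works)
  have l: "linear (frechet_derivative f (at x))" using d by (rule has_derivative_linear)
  have e: "frechet_derivative f (at x) = (\<lambda>v. (\<Sum>b\<in>Basis. frechet_derivative f (at x) b *\<^sub>R b) \<bullet> v)"
    by (rule ext) (rule linear_functional_representation[OF l])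
  have d': "(f has_derivative (\<lambda>v. (\<Sum>b\<in>Basis. frechet_derivative f (at x) b *\<^sub>R b) \<bullet> v)) (at x)"
    using d by (subst (asm) e)
  show ?thesis unfolding grad_eqI[OF d'] by (rule d')
qed

lemma has_derivative_hess:
  fixes f :: "'a::euclidean_space \<Rightarrow> real"
  assumes "grad f differentiable (at x)"
  shows "(grad f has_derivative hess f x) (at x)"
  using assms by (simp add: frechet_derivative_works hess_def)

lemma laplacian_eq: "laplacian f x = (\<Sum>b\<in>Basis. hess f x b \<bullet> b)"
  by (simp add: laplacian_def divergence_def hess_def)

lemma has_real_derivative_along_line:
  fixes f :: "'a::real_inner \<Rightarrow> real"
  assumes "(f has_derivative (\<lambda>v. g \<bullet> v)) (at (p + s *\<^sub>R d))"
  shows "((\<lambda>s. f (p + s *\<^sub>R d)) has_real_derivative g \<bullet> d) (at s)"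
proof -
  have "((\<lambda>s. p + s *\<^sub>R d) has_derivative (\<lambda>s. s *\<^sub>R d)) (at s)" by (auto intro!: derivative_eq_intros)
  from has_derivative_compose[OF this assms]
  have "((\<lambda>s. f (p + s *\<^sub>R d)) has_derivative (\<lambda>r. g \<bullet> (r *\<^sub>R d))) (at s)" .
  moreover have "(\<lambda>r. g \<bullet> (r *\<^sub>R d)) = (*) (g \<bullet> d)"
    by (simp add: fun_eq_iff)
  ultimately show ?thesis by (simp add: has_field_derivative_def)
qed

text \<open>A one-sided growth bound is enough, because the function can be tested in the direction
  of its own gradient.\<close>

lemma norm_gradient_le:
  fixes f :: "'a::real_inner \<Rightarrow> real"
  assumes g: "(f has_derivative (\<lambda>v. g \<bullet> v)) (at x)" and A: "\<And>y. f y - f x \<le> A * norm (y - x)" and A0: "A \<ge> 0"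
  shows "norm g \<le> A"
proof (cases "g = 0")
  case False
  have "((\<lambda>s. f (x + s *\<^sub>R g)) has_real_derivative g \<bullet> g) (at 0)"
    by (rule has_real_derivative_along_line) (simp add: g)
  then have "((\<lambda>s. (f (x + s *\<^sub>R g) - f x) / s) \<longlongrightarrow> g \<bullet> g) (at 0)"
    by (simp add: DERIV_def)
  then have "((\<lambda>s. (f (x + s *\<^sub>R g) - f x) / s) \<longlongrightarrow> g \<bullet> g) (at_right 0)"
    by (rule filterlim_mono) (auto simp: at_within_le_at)
  moreover have "eventually (\<lambda>s. (f (x + s *\<^sub>R g) - f x) / s \<le> A * norm g) (at_right 0)"
    using eventually_at_right_less[of 0]
  proof eventually_elim
    case (elim s)
    then show ?case using A[of "x + s *\<^sub>R g"] by (simp add: field_simps)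
  qed
  ultimately have "g \<bullet> g \<le> A * norm g" by (rule tendsto_upperbound) simp
  then have "norm g * norm g \<le> A * norm g" by (simp add: dot_square_norm power2_eq_square)
  then show ?thesis using False by simp
qed (use A0 in simp)

lemma lipschitz_of_gradient_bound:
  fixes f :: "'a::real_inner \<Rightarrow> real"
  assumes g: "\<And>x. (f has_derivative (\<lambda>v. g x \<bullet> v)) (at x)" and G: "\<And>x. norm (g x) \<le> G"
  shows "\<bar>f x - f y\<bar> \<le> G * norm (x - y)"
proof -
  have "0 \<le> G" using G[of x] norm_ge_zero[of "g x"] by linarith
  then have "onorm (\<lambda>v. g x \<bullet> v) \<le> G" for x
    by (rule onorm_bound) (use G[of x] in \<open>auto intro!: order_trans[OF Cauchy_Schwarz_ineq2] mult_right_mono\<close>)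
  then have "norm (f x - f y) \<le> G * norm (x - y)"
    using differentiable_bound[of UNIV f "\<lambda>x v. g x \<bullet> v" G x y] g by auto
  then show ?thesis by simp
qed

text \<open>Taylor's formula with Lagrange remainder on the segment from \<open>p\<close> to
  \<open>q\<close>. That form asks for the existence of the second derivative along the segment, not
  for its continuity.\<close>

lemma second_order_remainder:
  fixes f :: "'a::real_inner \<Rightarrow> real"
  assumes g: "\<And>x. (f has_derivative (\<lambda>v. g x \<bullet> v)) (at x)"
    and h: "\<And>x. (g has_derivative h x) (at x)"
    and lo: "\<And>x v. 0 \<le> h x v \<bullet> v" and hi: "\<And>x v. h x v \<bullet> v \<le> C * (v \<bullet> v)"
  shows "0 \<le> f q - f p - g p \<bullet> (q - p)" and "f q - f p - g p \<bullet> (q - p) \<le> C / 2 * (norm (q - p))\<^sup>2"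
proof -
  define d where "d = q - p"
  define D where "D n s = (if n = 0 then f (p + s *\<^sub>R d) else if n = 1 then g (p + s *\<^sub>R d) \<bullet> d
      else h (p + s *\<^sub>R d) d \<bullet> d)" for n :: nat and s :: real
  have 1: "((\<lambda>s. f (p + s *\<^sub>R d)) has_real_derivative g (p + s *\<^sub>R d) \<bullet> d) (at s)" for s
    by (rule has_real_derivative_along_line[OF g])
  have 2: "((\<lambda>s. g (p + s *\<^sub>R d) \<bullet> d) has_real_derivative h (p + s *\<^sub>R d) d \<bullet> d) (at s)" for s
  proof -
    have lin: "linear (h (p + s *\<^sub>R d))" using h by (rule has_derivative_linear)
    have "((\<lambda>s. p + s *\<^sub>R d) has_derivative (\<lambda>s. s *\<^sub>R d)) (at s)" by (auto intro!: derivative_eq_intros)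
    from has_derivative_inner_left[OF has_derivative_compose[OF this h], of d]
    have "((\<lambda>s. g (p + s *\<^sub>R d) \<bullet> d) has_derivative (\<lambda>r. h (p + s *\<^sub>R d) (r *\<^sub>R d) \<bullet> d)) (at s)" .
    moreover have "(\<lambda>r. h (p + s *\<^sub>R d) (r *\<^sub>R d) \<bullet> d) = (*) (h (p + s *\<^sub>R d) d \<bullet> d)"
      by (simp add: fun_eq_iff linear_scale[OF lin])
    ultimately show ?thesis by (simp add: has_field_derivative_def)
  qed
  have "\<exists>t. 0 < t \<and> t < 1 \<and> D 0 1 = (\<Sum>m<2. (D m 0 / fact m) * 1 ^ m) + (D 2 t / fact 2) * 1 ^ 2"
  proof (rule Maclaurin)
    show "\<forall>m t. m < 2 \<and> 0 \<le> t \<and> t \<le> 1 \<longrightarrow> (D m has_real_derivative D (Suc m) t) (at t)"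
      using 1 2 by (auto simp: D_def[abs_def] less_2_cases_iff)
  qed auto
  then obtain t where "D 0 1 = (\<Sum>m<2. (D m 0 / fact m) * 1 ^ m) + (D 2 t / fact 2) * 1 ^ 2" by blast
  then have e: "f q - f p - g p \<bullet> (q - p) = (h (p + t *\<^sub>R d) d \<bullet> d) / 2"
    by (simp add: D_def lessThan_Suc numeral_2_eq_2 d_def)
  show "0 \<le> f q - f p - g p \<bullet> (q - p)" unfolding e using lo[of "p + t *\<^sub>R d" d] by simp
  show "f q - f p - g p \<bullet> (q - p) \<le> C / 2 * (norm (q - p))\<^sup>2"
    unfolding e using hi[of "p + t *\<^sub>R d" d] by (simp add: power2_norm_eq_inner d_def)
qed

text \<open>Convexity replaces the symmetry of the Hessian: one gradient step of length \<open>1/C\<close> from \<open>q\<close>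
  cannot go below the supporting hyperplane at \<open>p\<close>.\<close>

lemma gradient_lipschitz_of_convex:
  fixes f :: "'a::real_inner \<Rightarrow> real"
  assumes g: "\<And>x. (f has_derivative (\<lambda>v. g x \<bullet> v)) (at x)"
    and h: "\<And>x. (g has_derivative h x) (at x)"
    and lo: "\<And>x v. 0 \<le> h x v \<bullet> v" and hi: "\<And>x v. h x v \<bullet> v \<le> C * (v \<bullet> v)" and C: "C > 0"
  shows "norm (g q - g p) \<le> C * norm (q - p)"
proof -
  define d where "d = g q - g p"
  define z where "z = q - (1 / C) *\<^sub>R d"
  note r = second_order_remainder[OF g h lo hi]
  have "0 \<le> f z - f p - g p \<bullet> (z - p)" by (rule r(1))
  moreover have "f z - f q - g q \<bullet> (z - q) \<le> C / 2 * (norm (z - q))\<^sup>2" by (rule r(2))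
  moreover have "f q - f p - g p \<bullet> (q - p) \<le> C / 2 * (norm (q - p))\<^sup>2" by (rule r(2))
  ultimately have "0 \<le> (g q - g p) \<bullet> (z - q) + C / 2 * (norm (z - q))\<^sup>2 + C / 2 * (norm (q - p))\<^sup>2"
    by (simp add: inner_diff_left inner_diff_right)
  moreover have "(g q - g p) \<bullet> (z - q) = - (norm d)\<^sup>2 / C"
    using C by (simp add: z_def d_def[symmetric] power2_norm_eq_inner)
  moreover have "(norm (z - q))\<^sup>2 = (norm d)\<^sup>2 / C\<^sup>2"
    using C by (simp add: z_def power_divide)
  ultimately have "(norm d)\<^sup>2 / (2 * C) \<le> C / 2 * (norm (q - p))\<^sup>2"
    using C by (simp add: power2_eq_square field_simps)
  then have "(norm d)\<^sup>2 / (2 * C) * (2 * C) \<le> C / 2 * (norm (q - p))\<^sup>2 * (2 * C)"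
    using C by (intro mult_right_mono) auto
  then have "(norm d)\<^sup>2 \<le> (C * norm (q - p))\<^sup>2"
    using C by (simp add: power_mult_distrib power2_eq_square mult_ac)
  from power2_le_imp_le[OF this] show ?thesis using C by (simp add: d_def)
qed

section \<open>Consequences of the structural assumptions on the Hamiltonian\<close>

context
  fixes \<alpha> C :: real and H :: "real^'n \<Rightarrow> real^'n \<Rightarrow> real"
  assumes ham: "hamiltonian_assms \<alpha> C H" and C: "C \<ge> 1"
begin

lemma H_class: "class_C2_holder \<alpha> (\<lambda>(p, x). H p x)"
  using ham unfolding hamiltonian_assms_def by (rule conjunct1)

lemmas H_growth = ham[unfolded hamiltonian_assms_def, THEN conjunct2, THEN conjunct2, THEN conjunct1, rule_format]
lemmas H_pp = ham[unfolded hamiltonian_assms_def, THEN conjunct2, THEN conjunct2, THEN conjunct2,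
    THEN conjunct1, rule_format]
lemmas H_x = ham[unfolded hamiltonian_assms_def, THEN conjunct2, THEN conjunct2, THEN conjunct2,
    THEN conjunct2, THEN conjunct1, rule_format]

lemma H_joint_derivative: "((\<lambda>(p, x). H p x) has_derivative (\<lambda>v. grad (\<lambda>(p, x). H p x) z \<bullet> v)) (at z)"
  using H_class[unfolded class_C2_holder_def, THEN conjunct1] by (intro has_derivative_grad) (rule spec)

text \<open>Regularity is assumed for H as a function of the pair (p, x); the partial gradient is
  recovered as a component of the joint one.\<close>

lemma H_derivative_p: "((\<lambda>q. H q x) has_derivative (\<lambda>v. grad_p H p x \<bullet> v)) (at p)"
  and grad_p_eq: "grad_p H p x = fst (grad (\<lambda>(p, x). H p x) (p, x))"
proof -
  have "((\<lambda>q. (q, x)) has_derivative (\<lambda>v. (v, 0))) (at p)"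
    by (auto intro!: derivative_eq_intros)
  from has_derivative_compose[OF this H_joint_derivative]
  have d: "((\<lambda>q. H q x) has_derivative (\<lambda>v. fst (grad (\<lambda>(p, x). H p x) (p, x)) \<bullet> v)) (at p)"
    by (simp add: inner_prod_def)
  show e: "grad_p H p x = fst (grad (\<lambda>(p, x). H p x) (p, x))"
    unfolding grad_p_def by (rule grad_eqI[OF d])
  show "((\<lambda>q. H q x) has_derivative (\<lambda>v. grad_p H p x \<bullet> v)) (at p)"
    unfolding e by (rule d)
qed

lemma H_derivative_x: "((\<lambda>y. H p y) has_derivative (\<lambda>v. grad (\<lambda>y. H p y) x \<bullet> v)) (at x)"
proof (rule has_derivative_grad)
  have "((\<lambda>y. (p, y)) has_derivative (\<lambda>v. (0, v))) (at x)"
    by (auto intro!: derivative_eq_intros)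
  from has_derivative_compose[OF this H_joint_derivative]
  show "(\<lambda>y. H p y) differentiable (at x)"
    by (auto simp: differentiable_def)
qed

lemma grad_p_differentiable: "(\<lambda>z. grad_p H (fst z) (snd z)) differentiable (at z)"
proof -
  have "grad (\<lambda>(p, x). H p x) differentiable (at z)"
    using H_class[unfolded class_C2_holder_def, THEN conjunct2, THEN conjunct1] by (rule spec)
  then obtain D where "(grad (\<lambda>(p, x). H p x) has_derivative D) (at z)"
    by (auto simp: differentiable_def)
  then have "(\<lambda>z. fst (grad (\<lambda>(p, x). H p x) z)) differentiable (at z)"
    using has_derivative_fst[of _ D] by (auto simp only: differentiable_def)
  then show ?thesis by (simp add: grad_p_eq)
qed

lemma grad_p_derivative_p: "((\<lambda>q. grad_p H q x) has_derivative hess (\<lambda>q. H q x) p) (at p)"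
proof -
  have "((\<lambda>q. (q, x)) has_derivative (\<lambda>v. (v, 0))) (at p)"
    by (auto intro!: derivative_eq_intros)
  moreover obtain D where "((\<lambda>z. grad_p H (fst z) (snd z)) has_derivative D) (at (p, x))"
    using grad_p_differentiable[of "(p, x)"] unfolding differentiable_def by blast
  ultimately have "((\<lambda>q. grad_p H (fst (q, x)) (snd (q, x))) has_derivative (\<lambda>v. D (v, 0))) (at p)"
    by (rule has_derivative_compose)
  then have "(\<lambda>q. grad_p H q x) differentiable (at p)"
    by (auto simp: differentiable_def)
  moreover have e: "grad (\<lambda>q. H q x) = (\<lambda>q. grad_p H q x)" by (auto simp: grad_p_def)
  ultimately have "grad (\<lambda>q. H q x) differentiable (at p)" by (simp only: e)
  from has_derivative_hess[OF this] show ?thesis by (simp only: e)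
qed

lemma hess_p_bounds: "0 \<le> hess (\<lambda>q. H q x) p v \<bullet> v" "hess (\<lambda>q. H q x) p v \<bullet> v \<le> C * (v \<bullet> v)"
proof -
  have "0 \<le> inverse C * (v \<bullet> v)" using C by simp
  also have "\<dots> \<le> hess (\<lambda>q. H q x) p v \<bullet> v" using H_pp by (rule conjunct1)
  finally show "0 \<le> hess (\<lambda>q. H q x) p v \<bullet> v" .
  show "hess (\<lambda>q. H q x) p v \<bullet> v \<le> C * (v \<bullet> v)" using H_pp by (rule conjunct2)
qed

lemma grad_p_lipschitz_p: "norm (grad_p H q x - grad_p H p x) \<le> C * norm (q - p)"
  by (rule gradient_lipschitz_of_convex[OF H_derivative_p grad_p_derivative_p hess_p_bounds]) (use C in simp)

lemma H_subgradient: "H q x \<ge> H p x + grad_p H p x \<bullet> (q - p)"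
  using second_order_remainder(1)[OF H_derivative_p grad_p_derivative_p hess_p_bounds, of q x p] by simp

text \<open>The assumptions bound H and its second derivatives but not D_pH. By convexity the slope
  at \<open>p\<close> in the unit direction of the gradient is at most the increment
  \<open>H (p + s) x - H p x\<close>, and this is controlled by the quadratic growth from above and
  the constant bound from below.\<close>

lemma norm_grad_p_le: "norm (grad_p H p x) \<le> C * (2 + (1 + norm p)\<^sup>2)"
proof -
  define s where "s = sgn (grad_p H p x)"
  have "norm (grad_p H p x) = grad_p H p x \<bullet> s"
    by (cases "grad_p H p x = 0") (auto simp: s_def sgn_div_norm dot_square_norm power2_eq_square)
  also have "\<dots> \<le> H (p + s) x - H p x" using H_subgradient[of p x "p + s"] by simp
  also have "\<dots> \<le> C * (1 + (norm (p + s))\<^sup>2) + C"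
    using H_growth[of "p + s" x] H_growth[of p x] by linarith
  also have "\<dots> \<le> C * (1 + (1 + norm p)\<^sup>2) + C"
  proof -
    have "norm (p + s) \<le> 1 + norm p"
      using norm_triangle_ineq[of p s] norm_sgn[of "grad_p H p x"] by (simp add: s_def split: if_splits)
    then show ?thesis using C by (intro add_right_mono mult_left_mono add_left_mono power_mono) auto
  qed
  finally show ?thesis by (simp add: algebra_simps)
qed

text \<open>The supporting hyperplane at \<open>p\<close> bounds \<open>H p x - H q x\<close> by the
  gradient at \<open>p\<close>, and exchanging the points bounds the opposite difference. The
  constant is the one that later becomes \<open>drift_bound\<close>.\<close>

lemma H_lipschitz_p:
  assumes "norm p \<le> R" "norm q \<le> R"
  shows "\<bar>H p x - H q x\<bar> \<le> C * (2 + (1 + R)\<^sup>2) * norm (p - q)"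
proof -
  have b: "norm (grad_p H p x) \<le> C * (2 + (1 + R)\<^sup>2)" if "norm p \<le> R" for p
  proof -
    have "C * (2 + (1 + norm p)\<^sup>2) \<le> C * (2 + (1 + R)\<^sup>2)"
      using C that by (intro mult_left_mono add_left_mono power_mono) auto
    then show ?thesis using norm_grad_p_le[of p x] by linarith
  qed
  have "H p x - H q x \<le> C * (2 + (1 + R)\<^sup>2) * norm (p - q)" if "norm p \<le> R" for p q
  proof -
    have "H p x - H q x \<le> grad_p H p x \<bullet> (p - q)"
      using H_subgradient[of p x q] by (simp add: inner_diff_right)
    also have "\<dots> \<le> norm (grad_p H p x) * norm (p - q)" by (rule norm_cauchy_schwarz)
    also have "\<dots> \<le> C * (2 + (1 + R)\<^sup>2) * norm (p - q)" using b[OF that] by (rule mult_right_mono) simp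
    finally show ?thesis .
  qed
  from this[OF assms(1), of q] this[OF assms(2), of p] show ?thesis
    by (simp add: abs_le_iff norm_minus_commute)
qed

lemma H_x_bounds:
  "norm (grad (\<lambda>y. H p y) x) \<le> C * (1 + norm p)"
  "onorm (frechet_derivative (\<lambda>y. grad_p H p y) (at x)) \<le> C * (1 + norm p)"
  "((\<lambda>y. grad_p H p y) has_derivative frechet_derivative (\<lambda>y. grad_p H p y) (at x)) (at x)"
proof -
  have "((\<lambda>y. (p, y)) has_derivative (\<lambda>v. (0, v))) (at x)"
    by (auto intro!: derivative_eq_intros)
  moreover obtain D where "((\<lambda>z. grad_p H (fst z) (snd z)) has_derivative D) (at (p, x))"
    using grad_p_differentiable[of "(p, x)"] unfolding differentiable_def by blast
  ultimately have "((\<lambda>y. grad_p H (fst (p, y)) (snd (p, y))) has_derivative (\<lambda>v. D (0, v))) (at x)"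
    by (rule has_derivative_compose)
  then have "(\<lambda>y. grad_p H p y) differentiable (at x)"
    by (auto simp: differentiable_def)
  then show d: "((\<lambda>y. grad_p H p y) has_derivative frechet_derivative (\<lambda>y. grad_p H p y) (at x)) (at x)"
    by (simp add: frechet_derivative_works)
  then have "0 \<le> onorm (frechet_derivative (\<lambda>y. grad_p H p y) (at x))"
    using has_derivative_bounded_linear onorm_pos_le by blast
  moreover have "norm (grad (\<lambda>y. H p y) x) + onorm (frechet_derivative (\<lambda>y. grad_p H p y) (at x)) \<le> C * (1 + norm p)"
    by (rule H_x)
  ultimately show "norm (grad (\<lambda>y. H p y) x) \<le> C * (1 + norm p)"
    "onorm (frechet_derivative (\<lambda>y. grad_p H p y) (at x)) \<le> C * (1 + norm p)"
    using norm_ge_zero[of "grad (\<lambda>y. H p y) x"] by linarith+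
qed

lemma H_lipschitz_x: "\<bar>H p x - H p y\<bar> \<le> C * (1 + norm p) * norm (x - y)"
  by (rule lipschitz_of_gradient_bound[OF H_derivative_x H_x_bounds(1)])

lemma grad_p_lipschitz_x: "norm (grad_p H p x - grad_p H p y) \<le> C * (1 + norm p) * norm (x - y)"
  by (rule differentiable_bound[of UNIV "\<lambda>y. grad_p H p y" "\<lambda>x. frechet_derivative (\<lambda>y. grad_p H p y) (at x)"])
     (auto intro: H_x_bounds(2,3))

end

lemma class_C21_onD:
  fixes u :: "'a::euclidean_space \<Rightarrow> real \<Rightarrow> real"
  assumes u: "class_C21_on T u" and t: "t \<in> T"
  shows "((\<lambda>y. u y t) has_derivative (\<lambda>v. grad (\<lambda>y. u y t) x \<bullet> v)) (at x)"
    and "((\<lambda>y. grad (\<lambda>z. u z t) y) has_derivative hess (\<lambda>y. u y t) x) (at x)"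
    and "t > 0 \<Longrightarrow> ((\<lambda>s. u x s) has_real_derivative time_deriv u x t) (at t)"
proof -
  show "((\<lambda>y. u y t) has_derivative (\<lambda>v. grad (\<lambda>y. u y t) x \<bullet> v)) (at x)"
    using u t by (intro has_derivative_grad) (auto simp: class_C21_on_def)
  show "((\<lambda>y. grad (\<lambda>z. u z t) y) has_derivative hess (\<lambda>y. u y t) x) (at x)"
    using u t by (intro has_derivative_hess) (auto simp: class_C21_on_def)
  assume "t > 0"
  then have "at t within {0..} = at t" by (intro at_within_interior) (auto simp: interior_Ici[of "0 - 1"])
  moreover have "(\<lambda>s. u x s) differentiable (at t within {0..})"
    using u t by (auto simp: class_C21_on_def)
  then have "((\<lambda>s. u x s) has_vector_derivative time_deriv u x t) (at t within {0..})"
    unfolding time_deriv_def by (simp add: vector_derivative_works)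
  ultimately show "((\<lambda>s. u x s) has_real_derivative time_deriv u x t) (at t)"
    by (simp add: has_real_derivative_iff_has_vector_derivative)
qed

section \<open>Gradient estimates for the Hamilton-Jacobi-Bellman equation\<close>

text \<open>With equal measures the Lipschitz assumption still contains the term
  \<open>d1 m m\<close>, which \<open>d1_refl_le\<close> removes.\<close>

lemma coupling_cost_lipschitz:
  assumes F: "coupling_cost_assms \<alpha> C L F" and L: "L > 0" and m: "m \<in> P1"
  shows "F x m - F y m \<le> L * norm (x - y)"
proof -
  have "\<bar>F x m - F y m\<bar> \<le> L * (norm (x - y) + d1 m m)"
    using F m unfolding coupling_cost_assms_def by auto
  also have "\<dots> \<le> L * norm (x - y)" using L d1_refl_le[OF m] by (intro mult_left_mono) auto
  finally show ?thesis by simp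
qed

lemma hjb_equation:
  assumes "hjb_solution F H lam u m" "t > 0"
  shows "- time_deriv u x t - (\<Sum>b\<in>Basis. hess (\<lambda>y. u y t) x b \<bullet> b) + lam * u x t
    = F x (m t) - 1 / lam * H (lam *\<^sub>R grad (\<lambda>y. u y t) x) x"
  using assms by (simp add: hjb_solution_def laplacian_eq algebra_simps)

text \<open>A Lipschitz bound for \<open>u\<close> reproduces itself with the factor \<open>C / lam\<close>, so the best constant is of
  order \<open>1 / lam\<close>, whatever the a priori bound was.\<close>

lemma hjb_gradient_bound:
  fixes H :: "real^'n \<Rightarrow> real^'n \<Rightarrow> real"
  assumes ham: "hamiltonian_assms \<alpha> C H" and C: "C \<ge> 1"
    and F: "coupling_cost_assms \<alpha> C L F" and L: "L > 0"
    and hjb: "hjb_solution F H lam u m" and bounds: "uniqueness_bounds u"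
    and m: "\<And>t. t > 0 \<Longrightarrow> m t \<in> P1" and lam: "lam \<ge> 2 * C" and t: "t > 0"
  shows "lam * norm (grad (\<lambda>y. u y t) x) \<le> 2 * (L + C)"
proof -
  have lam0: "lam \<ge> 2" "lam > 0" using lam C by auto
  have reg: "class_C21_on {0..} u" using hjb by (simp add: hjb_solution_def)
  define g where "g x t = grad (\<lambda>y. u y t) x" for x t
  define h where "h x t = hess (\<lambda>y. u y t) x" for x t
  define V where "V = (\<lambda>(x, t). norm (g x t)) ` (UNIV \<times> {0<..})"
  have bd: "bdd_above V"
    unfolding V_def g_def
    by (rule bdd_above_mono[OF bounds[unfolded uniqueness_bounds_def, THEN conjunct2, THEN conjunct2, THEN conjunct1]])
       (intro image_mono, auto)
  define M where "M = Sup V"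
  have gM: "norm (g x t) \<le> M" if "t > 0" for x t
    unfolding M_def using that by (intro cSup_upper[OF _ bd]) (auto simp: V_def)
  have M0: "M \<ge> 0" using gM[OF t, of 0] norm_ge_zero order_trans by blast
  have Vn: "V \<noteq> {}" by (auto simp: V_def intro: exI[of _ 1])
  have gd: "((\<lambda>y. u y t) has_derivative (\<lambda>v. g x t \<bullet> v)) (at x)" if "t > 0" for x t
    unfolding g_def using class_C21_onD(1)[OF reg] that by auto
  have hd: "((\<lambda>y. g y t) has_derivative h x t) (at x)" if "t > 0" for x t
    unfolding g_def h_def using class_C21_onD(2)[OF reg] that by auto
  have key: "norm (g x t) \<le> A" if A: "lam * A > L + C / lam + C * M" and t: "t > 0" for A x t
  proof -
    have "0 < lam * A" using A L C M0 lam0 by (smt (verit) divide_pos_pos mult_nonneg_nonneg)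
    then have A0: "A > 0" using lam0 by (simp add: zero_less_mult_iff)
    \<comment> \<open>This Lipschitz constant of H depends on \<open>lam\<close> and on the a priori
      bound \<open>M\<close>. That is harmless: it is passed on as the coefficient \<open>Q\<close>
      of \<open>doubling_comparison\<close>, which leaves no trace in the conclusion.\<close>
    define B where "B = C * (2 + (1 + lam * M)\<^sup>2)"
    have B: "B \<ge> 0" using C by (simp add: B_def)
    have "u x t - u y t \<le> A * norm (x - y)" for x y
    proof (rule doubling_comparison[where w = u and g = g and h = h and wt = "time_deriv u" and G = "M + 1"
          and \<psi> = "\<lambda>r. A * r" and \<psi>' = "\<lambda>_. A" and \<psi>'' = "\<lambda>_. 0" and \<Xi> = "\<lambda>r. (L + C / lam + C * M) * r"
          and lam = lam and Q = B])
      show "continuous_on (UNIV \<times> {0<..}) (\<lambda>(x, t). u x t)"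
        using reg unfolding class_C21_on_def by (elim conjE continuous_on_subset) auto
      fix x y :: "real^'n" and t :: real assume t: "t > 0"
      show "((\<lambda>y. u y t) has_derivative (\<lambda>v. g x t \<bullet> v)) (at x)" by (rule gd[OF t])
      show "((\<lambda>y. g y t) has_derivative h x t) (at x)" by (rule hd[OF t])
      show "((\<lambda>s. u x s) has_real_derivative time_deriv u x t) (at t)"
        using class_C21_onD(3)[OF reg] t by auto
      have "u x t - u y t \<le> M * norm (x - y)"
        using lipschitz_of_gradient_bound[of "\<lambda>y. u y t", OF gd[OF t] gM[OF t], of x y] by linarith
      also have "\<dots> \<le> (M + 1) * norm (x - y)" by (intro mult_right_mono) auto
      finally show "u x t - u y t \<le> (M + 1) * norm (x - y)" .
      show "- (time_deriv u x t - time_deriv u y t)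
          - ((\<Sum>b\<in>Basis. h x t b \<bullet> b) - (\<Sum>b\<in>Basis. h y t b \<bullet> b)) + lam * (u x t - u y t)
        \<le> (L + C / lam + C * M) * norm (x - y) + B * (norm (g x t - A *\<^sub>R sgn (x - y))
             + norm (g y t - A *\<^sub>R sgn (x - y)))"
      proof -
        define p q where "p = lam *\<^sub>R g x t" and "q = lam *\<^sub>R g y t"
        have pq: "norm p \<le> lam * M" "norm q \<le> lam * M" using gM[OF t] lam0 by (auto simp: p_def q_def)
        \<comment> \<open>The change in x is estimated at the fixed momentum \<open>q\<close> and
          enters the modulus. The change in p is measured by the difference of the two gradients;
          the linear modulus prescribes the same gradient at both points, so this part belongs to
          the vanishing terms.\<close>
        have "H q y - H p x = (H q y - H q x) + (H q x - H p x)" by simp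
        also have "\<dots> \<le> C * (1 + norm q) * norm (y - x) + B * norm (q - p)"
          using H_lipschitz_x[OF ham C, of q y x] H_lipschitz_p[OF ham C pq(2,1), of x]
          unfolding B_def by linarith
        also have "\<dots> \<le> C * (1 + lam * M) * norm (x - y) + B * (lam * norm (g x t - g y t))"
        proof (rule add_mono)
          show "C * (1 + norm q) * norm (y - x) \<le> C * (1 + lam * M) * norm (x - y)"
            unfolding norm_minus_commute[of y x] using pq C
            by (intro mult_right_mono mult_left_mono) auto
          show "B * norm (q - p) \<le> B * (lam * norm (g x t - g y t))"
            using lam0 by (simp add: norm_minus_commute p_def q_def scaleR_diff_right[symmetric])
        qed
        finally have "1 / lam * (H q y - H p x)
            \<le> 1 / lam * (C * (1 + lam * M) * norm (x - y) + B * (lam * norm (g x t - g y t)))"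
          using lam0 by (intro mult_left_mono) auto
        also have "\<dots> = (C / lam + C * M) * norm (x - y) + B * norm (g x t - g y t)"
          using lam0 by (simp add: field_simps)
        also have "\<dots> \<le> (C / lam + C * M) * norm (x - y)
            + B * (norm (g x t - A *\<^sub>R sgn (x - y)) + norm (g y t - A *\<^sub>R sgn (x - y)))"
          using B norm_triangle_ineq4[of "g x t - A *\<^sub>R sgn (x - y)" "g y t - A *\<^sub>R sgn (x - y)"]
          by (intro add_left_mono mult_left_mono) auto
        finally have 1: "1 / lam * H q y - 1 / lam * H p x \<le> (C / lam + C * M) * norm (x - y)
            + B * (norm (g x t - A *\<^sub>R sgn (x - y)) + norm (g y t - A *\<^sub>R sgn (x - y)))"
          by (simp add: right_diff_distrib)
        have 2: "F x (m t) - F y (m t) \<le> L * norm (x - y)"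
          by (rule coupling_cost_lipschitz[OF F L m[OF t]])
        show ?thesis
          using hjb_equation[OF hjb t, of x] hjb_equation[OF hjb t, of y] 1 2
          unfolding p_def q_def g_def[symmetric] h_def[symmetric] by (simp add: algebra_simps)
      qed
    next
      fix r0 :: real assume r0: "r0 > 0"
      show "\<exists>c>0. \<forall>r\<ge>r0. (L + C / lam + C * M) * r + c \<le> lam * (A * r) - 4 * 0"
      proof (intro exI[of _ "(lam * A - (L + C / lam + C * M)) * r0"] conjI allI impI)
        fix r assume "r0 \<le> r"
        then have "(lam * A - (L + C / lam + C * M)) * r0 \<le> (lam * A - (L + C / lam + C * M)) * r"
          using A by (intro mult_left_mono) auto
        then show "(L + C / lam + C * M) * r + (lam * A - (L + C / lam + C * M)) * r0 \<le> lam * (A * r) - 4 * 0"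
          by (simp add: algebra_simps)
      qed (use A r0 in simp)
    qed (use M0 A0 B lam0 t in \<open>auto intro!: derivative_eq_intros continuous_intros\<close>)
    then show ?thesis using A0
      by (intro norm_gradient_le[OF gd[OF t]]) auto
  qed
  \<comment> \<open>Every admissible \<open>A\<close> bounds \<open>M\<close>, so \<open>M\<close>
    satisfies the limiting inequality. Since \<open>lam\<close> is at least 2C, the term C M is at
    most half of \<open>lam * M\<close> and moves to the left; this is where the factor 2 in the
    bound arises.\<close>
  have "M \<le> (L + C / lam + C * M) / lam"
  proof (rule dense_ge)
    fix A assume "(L + C / lam + C * M) / lam < A"
    then have A: "lam * A > L + C / lam + C * M" using lam0 by (simp add: field_simps)
    show "M \<le> A" unfolding M_def using key[OF A] by (intro cSup_least Vn) (auto simp: V_def)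
  qed
  then have "lam * M \<le> L + C / lam + C * M" using lam0 by (simp add: field_simps)
  moreover have "C / lam \<le> C" using lam0 C by (simp add: field_simps)
  moreover have "2 * (C * M) \<le> lam * M" using mult_right_mono[OF lam M0] by (simp add: mult.assoc)
  moreover have "X \<le> L + Z + Y \<Longrightarrow> Z \<le> C \<Longrightarrow> 2 * Y \<le> X \<Longrightarrow> X \<le> 2 * (L + C)" for X Y Z :: real
    by auto
  ultimately have "lam * M \<le> 2 * (L + C)" by blast
  moreover have "lam * norm (g x t) \<le> lam * M" using gM[OF t] lam0 by (intro mult_left_mono) auto
  ultimately show ?thesis unfolding g_def by linarith
qed

text \<open>The bounded, concave modulus \<open>c (1 - exp (- k r))\<close> absorbs the first order term: its second
  derivative dominates the drift as soon as \<open>k\<close> does.\<close>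

lemma hjb_difference_gradient_bound:
  fixes H :: "real^'n \<Rightarrow> real^'n \<Rightarrow> real"
  assumes ham: "hamiltonian_assms \<alpha> C H" and C: "C \<ge> 1"
    and F: "coupling_cost_assms \<alpha> C L F" and L: "L > 0"
    and hjb1: "hjb_solution F H lam u1 m1" and hjb2: "hjb_solution F H lam u2 m2"
    and m1: "\<And>t. t > 0 \<Longrightarrow> m1 t \<in> P1" and m2: "\<And>t. t > 0 \<Longrightarrow> m2 t \<in> P1"
    and g1: "\<And>x t. t > 0 \<Longrightarrow> lam * norm (grad (\<lambda>y. u1 y t) x) \<le> R"
    and g2: "\<And>x t. t > 0 \<Longrightarrow> lam * norm (grad (\<lambda>y. u2 y t) x) \<le> R"
    and lam: "lam = 2 * k\<^sup>2" and k: "k \<ge> C * (2 + (1 + R)\<^sup>2)"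
    and N: "\<And>t. t > 0 \<Longrightarrow> d1 (m1 t) (m2 t) \<le> N * exp (k\<^sup>2 * t)" and N0: "N \<ge> 0" and R: "R > 0"
    and t: "t > 0"
  shows "norm (grad (\<lambda>y. u1 y t) x - grad (\<lambda>y. u2 y t) x) \<le> 2 * L * N / k * exp (k\<^sup>2 * t)"
proof -
  define B where "B = C * (2 + (1 + R)\<^sup>2)"
  have B: "B \<ge> 0" using C by (simp add: B_def)
  have "C * 2 \<le> B" unfolding B_def using C by (intro mult_left_mono) auto
  then have k0: "k > 0" using k C unfolding B_def by linarith
  have kB: "k \<ge> B" using k by (simp add: B_def)
  have lam0: "lam > 0" using lam k0 by simp
  have reg1: "class_C21_on {0..} u1" and reg2: "class_C21_on {0..} u2"
    using hjb1 hjb2 by (simp_all add: hjb_solution_def)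
  define E where "E t = exp (- (k\<^sup>2 * t))" for t
  have E0: "E t > 0" for t by (simp add: E_def)
  have E1: "E t \<le> 1" if "t > 0" for t using that by (simp add: E_def)
  define p1 where "p1 x t = grad (\<lambda>y. u1 y t) x" for x t
  define p2 where "p2 x t = grad (\<lambda>y. u2 y t) x" for x t
  define w where "w x t = E t * (u1 x t - u2 x t)" for x t
  define g where "g x t = E t *\<^sub>R (p1 x t - p2 x t)" for x t
  define h where "h x t v = E t *\<^sub>R (hess (\<lambda>y. u1 y t) x v - hess (\<lambda>y. u2 y t) x v)" for x t v
  \<comment> \<open>Differentiating the weight produces -k^2 w. Of the zero order coefficient 2 k^2
    = \<open>lam\<close> one half is thus used up and the equation for \<open>w\<close> retains the
    coefficient k^2.\<close>
  define wt where "wt x t = E t * (time_deriv u1 x t - time_deriv u2 x t) - k\<^sup>2 * w x t" for x t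
  have gd: "((\<lambda>y. w y t) has_derivative (\<lambda>v. g x t \<bullet> v)) (at x)" if "t > 0" for x t
    unfolding w_def g_def p1_def p2_def
    using class_C21_onD(1)[OF reg1, of t] class_C21_onD(1)[OF reg2, of t] that
    by (auto intro!: derivative_eq_intros simp: inner_diff_left)
  have hd: "((\<lambda>y. g y t) has_derivative h x t) (at x)" if "t > 0" for x t
    unfolding g_def p1_def p2_def h_def
    using class_C21_onD(2)[OF reg1, of t] class_C21_onD(2)[OF reg2, of t] that
    by (auto intro!: derivative_eq_intros)
  have wd: "((\<lambda>s. w x s) has_real_derivative wt x t) (at t)" if "t > 0" for x t
    unfolding w_def wt_def E_def
    using class_C21_onD(3)[OF reg1, of t] class_C21_onD(3)[OF reg2, of t] that
    by (auto intro!: derivative_eq_intros simp: algebra_simps)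
  define G where "G = 2 * R / lam"
  have G: "G > 0" using R lam0 by (simp add: G_def)
  have pR: "norm (p1 x t) \<le> R / lam" "norm (p2 x t) \<le> R / lam" if "t > 0" for x t
    using g1[OF that, of x] g2[OF that, of x] lam0 by (auto simp: p1_def p2_def field_simps)
  have gG: "norm (g x t) \<le> G" if "t > 0" for x t
  proof -
    have "norm (p1 x t - p2 x t) \<le> G"
      using norm_triangle_ineq4[of "p1 x t" "p2 x t"] pR[OF that, of x] by (simp add: G_def)
    then have "E t * norm (p1 x t - p2 x t) \<le> 1 * G"
      using E0[of t] E1[OF that] by (intro mult_mono) (auto simp: less_imp_le)
    then show ?thesis using E0[of t] by (simp add: g_def)
  qed
  have res: "\<bar>- wt x t - (\<Sum>b\<in>Basis. h x t b \<bullet> b) + k\<^sup>2 * w x t\<bar> \<le> L * N + B * norm (g x t)" if t: "t > 0" for x t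
  proof -
    have "- wt x t - (\<Sum>b\<in>Basis. h x t b \<bullet> b) + k\<^sup>2 * w x t
      = E t * ((- time_deriv u1 x t - (\<Sum>b\<in>Basis. hess (\<lambda>y. u1 y t) x b \<bullet> b) + lam * u1 x t)
           - (- time_deriv u2 x t - (\<Sum>b\<in>Basis. hess (\<lambda>y. u2 y t) x b \<bullet> b) + lam * u2 x t))"
      by (simp add: wt_def h_def w_def lam inner_diff_left sum_subtractf sum_distrib_left[symmetric] algebra_simps)
    also have "\<dots> = E t * (F x (m1 t) - F x (m2 t)) - E t * (1 / lam * (H (lam *\<^sub>R p1 x t) x - H (lam *\<^sub>R p2 x t) x))"
      unfolding hjb_equation[OF hjb1 t] hjb_equation[OF hjb2 t] by (simp add: p1_def p2_def algebra_simps)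
    finally have e: "- wt x t - (\<Sum>b\<in>Basis. h x t b \<bullet> b) + k\<^sup>2 * w x t
      = E t * (F x (m1 t) - F x (m2 t)) - E t * (1 / lam * (H (lam *\<^sub>R p1 x t) x - H (lam *\<^sub>R p2 x t) x))" .
    have "\<bar>F x (m1 t) - F x (m2 t)\<bar> \<le> L * (norm (x - x) + d1 (m1 t) (m2 t))"
      using F m1[OF t] m2[OF t] unfolding coupling_cost_assms_def by blast
    also have "\<dots> \<le> L * (N * exp (k\<^sup>2 * t))" using N[OF t] L by simp
    finally have "E t * \<bar>F x (m1 t) - F x (m2 t)\<bar> \<le> E t * (L * (N * exp (k\<^sup>2 * t)))"
      using E0[of t] by (intro mult_left_mono) auto
    then have 1: "\<bar>E t * (F x (m1 t) - F x (m2 t))\<bar> \<le> L * N"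
      using E0[of t] by (simp add: abs_mult E_def exp_minus field_simps)
    have "\<bar>H (lam *\<^sub>R p1 x t) x - H (lam *\<^sub>R p2 x t) x\<bar> \<le> B * norm (lam *\<^sub>R p1 x t - lam *\<^sub>R p2 x t)"
      unfolding B_def by (rule H_lipschitz_p[OF ham C]) (use g1[OF t] g2[OF t] lam0 in \<open>auto simp: p1_def p2_def\<close>)
    also have "\<dots> = lam * (B * norm (p1 x t - p2 x t))"
      using lam0 by (simp add: scaleR_diff_right[symmetric])
    finally have "E t * (1 / lam * \<bar>H (lam *\<^sub>R p1 x t) x - H (lam *\<^sub>R p2 x t) x\<bar>)
       \<le> E t * (1 / lam * (lam * (B * norm (p1 x t - p2 x t))))"
      using lam0 E0[of t] by (intro mult_left_mono) auto
    then have 2: "\<bar>E t * (1 / lam * (H (lam *\<^sub>R p1 x t) x - H (lam *\<^sub>R p2 x t) x))\<bar> \<le> B * norm (g x t)"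
      using lam0 E0[of t] by (simp add: abs_mult g_def mult_ac)
    show ?thesis unfolding e using 1 2 by linarith
  qed
  have key: "norm (g x t) \<le> c * k" if c: "c > 2 * L * N / k\<^sup>2" for c
  proof -
    have "0 \<le> 2 * L * N / k\<^sup>2" using L N0 by simp
    then have c0: "c > 0" using c by linarith
    have ck: "k\<^sup>2 * c > 2 * L * N" using c k0 by (simp add: field_simps)
    have "w x t - w y t \<le> c * k * norm (x - y)" for x y
    proof -
      \<comment> \<open>The differenced equation bounds the first order term by \<open>B\<close>
        times the sum of |g| at the two points. Each is at most \<psi>' plus its deviation from
        \<psi>' e, so 2 B \<psi>' enters \<Xi> and the deviations go with the coefficient
        \<open>Q\<close>.\<close>
      have "w x t - w y t \<le> c * (1 - exp (- (k * norm (x - y))))"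
      proof (rule doubling_comparison[where w = w and g = g and h = h and wt = wt and G = G
          and \<psi> = "\<lambda>r. c * (1 - exp (- (k * r)))" and \<psi>' = "\<lambda>r. c * k * exp (- (k * r))"
          and \<psi>'' = "\<lambda>r. - (c * k\<^sup>2 * exp (- (k * r)))"
          and \<Xi> = "\<lambda>r. 2 * L * N + 2 * B * (c * k * exp (- (k * r)))"
          and lam = "k\<^sup>2" and Q = B])
        have c1: "continuous_on (UNIV \<times> {0<..}) (\<lambda>(x, t). u1 x t)"
          using reg1 unfolding class_C21_on_def by (elim conjE continuous_on_subset) auto
        have c2: "continuous_on (UNIV \<times> {0<..}) (\<lambda>(x, t). u2 x t)"
          using reg2 unfolding class_C21_on_def by (elim conjE continuous_on_subset) auto
        show "continuous_on (UNIV \<times> {0<..}) (\<lambda>(x, t). w x t)"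
          using c1 c2 unfolding w_def E_def case_prod_unfold by (intro continuous_intros)
        fix x y :: "real^'n" and t :: real assume t: "t > 0"
        show "((\<lambda>y. w y t) has_derivative (\<lambda>v. g x t \<bullet> v)) (at x)" by (rule gd[OF t])
        show "((\<lambda>y. g y t) has_derivative h x t) (at x)" by (rule hd[OF t])
        show "((\<lambda>s. w x s) has_real_derivative wt x t) (at t)" by (rule wd[OF t])
        show "w x t - w y t \<le> G * norm (x - y)"
          using lipschitz_of_gradient_bound[of "\<lambda>y. w y t", OF gd[OF t] gG[OF t], of x y] by linarith
        show "- (wt x t - wt y t) - ((\<Sum>b\<in>Basis. h x t b \<bullet> b) - (\<Sum>b\<in>Basis. h y t b \<bullet> b)) + k\<^sup>2 * (w x t - w y t)
          \<le> 2 * L * N + 2 * B * (c * k * exp (- (k * norm (x - y))))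
            + B * (norm (g x t - (c * k * exp (- (k * norm (x - y)))) *\<^sub>R sgn (x - y))
             + norm (g y t - (c * k * exp (- (k * norm (x - y)))) *\<^sub>R sgn (x - y)))"
        proof -
          define a where "a = c * k * exp (- (k * norm (x - y)))"
          have a0: "a \<ge> 0" using c0 k0 by (simp add: a_def)
          have n: "norm z \<le> norm (z - a *\<^sub>R sgn (x - y)) + a" for z
          proof -
            have "norm (a *\<^sub>R sgn (x - y)) \<le> a" using a0 norm_sgn[of "x - y"] by (simp split: if_splits)
            then show ?thesis using norm_triangle_ineq[of "z - a *\<^sub>R sgn (x - y)" "a *\<^sub>R sgn (x - y)"] by simp
          qed
          have "B * norm (g x t) + B * norm (g y t)
            \<le> B * (norm (g x t - a *\<^sub>R sgn (x - y)) + a) + B * (norm (g y t - a *\<^sub>R sgn (x - y)) + a)"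
            using B by (intro add_mono mult_left_mono n)
          then show ?thesis unfolding a_def[symmetric]
            using res[OF t, of x] res[OF t, of y] by (simp add: algebra_simps)
        qed
      next
        fix r0 :: real assume r0: "r0 > 0"
        show "\<exists>d>0. \<forall>r\<ge>r0. 2 * L * N + 2 * B * (c * k * exp (- (k * r))) + d
            \<le> k\<^sup>2 * (c * (1 - exp (- (k * r)))) - 4 * - (c * k\<^sup>2 * exp (- (k * r)))"
        proof (intro exI[of _ "k\<^sup>2 * c - 2 * L * N"] conjI allI impI)
          fix r assume "r0 \<le> r"
          \<comment> \<open>The zero order term contributes -1 and the term -4 \<psi>'' contributes
            +4 to the coefficient of \<open>c * k\<^sup>2 * exp (- (k * r))\<close>. The remaining 3
            k has to dominate 2 B, as it does for k at least B.\<close>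
          have "0 \<le> c * k * exp (- (k * r)) * (3 * k - 2 * B)"
            using c0 k0 kB B by (intro mult_nonneg_nonneg) auto
          then show "2 * L * N + 2 * B * (c * k * exp (- (k * r))) + (k\<^sup>2 * c - 2 * L * N)
            \<le> k\<^sup>2 * (c * (1 - exp (- (k * r)))) - 4 * - (c * k\<^sup>2 * exp (- (k * r)))"
            by (simp add: algebra_simps power2_eq_square)
        qed (use ck in simp)
      qed (use G B k0 c0 t in \<open>auto intro!: derivative_eq_intros continuous_intros simp: power2_eq_square\<close>)
      also have "\<dots> \<le> c * (k * norm (x - y))"
        using c0 exp_ge_add_one_self[of "- (k * norm (x - y))"] by (intro mult_left_mono) auto
      finally show ?thesis by simp
    qed
    then show ?thesis using c0 k0
      by (intro norm_gradient_le[OF gd[OF t]]) auto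
  qed
  have "norm (g x t) / k \<le> 2 * L * N / k\<^sup>2"
  proof (rule dense_ge)
    fix c assume "2 * L * N / k\<^sup>2 < c"
    from key[OF this] show "norm (g x t) / k \<le> c" using k0 by (simp add: field_simps)
  qed
  then have "norm (g x t) \<le> 2 * L * N / k"
    using k0 by (simp add: field_simps power2_eq_square)
  then have "E t * norm (p1 x t - p2 x t) \<le> 2 * L * N / k" using E0[of t] by (simp add: g_def)
  then have "norm (p1 x t - p2 x t) \<le> 2 * L * N / k / E t"
    by (subst pos_le_divide_eq[OF E0]) (simp add: mult.commute)
  then show ?thesis by (simp add: p1_def p2_def E_def exp_minus field_simps)
qed

section \<open>The heat kernel\<close>

text \<open>The normalisation is that of the equation with the full Laplacian: each coordinate has
  variance 2 \<tau>.\<close>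

definition heat :: "real \<Rightarrow> 'a::euclidean_space \<Rightarrow> real" where
  "heat \<tau> z = exp (- (z \<bullet> z) / (4 * \<tau>)) / sqrt (4 * pi * \<tau>) ^ DIM('a)"

definition heat_grad :: "real \<Rightarrow> 'a::euclidean_space \<Rightarrow> 'a" where
  "heat_grad \<tau> z = (- (heat \<tau> z / (2 * \<tau>))) *\<^sub>R z"

lemma heat_pos: "\<tau> > 0 \<Longrightarrow> heat \<tau> z > 0"
  by (simp add: heat_def)

lemma heat_nonneg [simp]: "\<tau> > 0 \<Longrightarrow> heat \<tau> z \<ge> 0"
  by (simp add: heat_def)

lemma heat_minus [simp]: "heat \<tau> (- z) = heat \<tau> z"
  by (simp add: heat_def)

lemma heat_le: "\<tau> > 0 \<Longrightarrow> heat \<tau> (z::'a::euclidean_space) \<le> 1 / sqrt (4 * pi * \<tau>) ^ DIM('a)"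
  unfolding heat_def by (intro divide_right_mono) (auto simp: divide_nonpos_pos)

lemma heat_measurable [measurable]: "(\<lambda>z. heat \<tau> z) \<in> borel_measurable borel"
  unfolding heat_def by measurable

lemma heat_eq_prod:
  fixes z :: "'a::euclidean_space" and \<tau> :: real
  assumes "\<tau> > 0"
  shows "heat \<tau> z = (\<Prod>b\<in>Basis. normal_density 0 (sqrt (2 * \<tau>)) (z \<bullet> b))"
proof -
  have n: "normal_density 0 (sqrt (2 * \<tau>)) x = exp (- (x * x) / (4 * \<tau>)) / sqrt (4 * pi * \<tau>)" for x
    using assms by (simp add: normal_density_def power2_eq_square mult_ac)
  have "- (z \<bullet> z) / (4 * \<tau>) = (\<Sum>b\<in>Basis. - ((z \<bullet> b) * (z \<bullet> b)) / (4 * \<tau>))"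
    by (subst euclidean_inner) (simp add: sum_negf sum_divide_distrib)
  then show ?thesis by (simp add: heat_def n prod_dividef exp_sum)
qed

lemma nn_integral_heat:
  assumes "\<tau> > 0"
  shows "(\<integral>\<^sup>+z. ennreal (heat \<tau> z) \<partial>(lborel :: 'a::euclidean_space measure)) = 1"
proof -
  have s: "sqrt (2 * \<tau>) > 0" using assms by simp
  have "(\<integral>\<^sup>+z. ennreal (heat \<tau> z) \<partial>(lborel :: 'a measure))
    = (\<integral>\<^sup>+z. (\<Prod>b\<in>Basis. ennreal (normal_density 0 (sqrt (2 * \<tau>)) (z \<bullet> b))) \<partial>(lborel :: 'a measure))"
    by (simp add: heat_eq_prod[OF assms] prod_ennreal)
  also have "\<dots> = (\<Prod>b\<in>(Basis::'a set). (\<integral>\<^sup>+x. ennreal (normal_density 0 (sqrt (2 * \<tau>)) x) \<partial>lborel))"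
    by (rule nn_integral_lborel_prod) auto
  also have "(\<integral>\<^sup>+x. ennreal (normal_density 0 (sqrt (2 * \<tau>)) x) \<partial>lborel) = 1"
    using s by (subst nn_integral_eq_integral) auto
  finally show ?thesis by simp
qed

text \<open>The squared norm is split over coordinates. In each summand a single factor of the
  Gaussian product carries the square and gives the variance 2 \<tau>, while all others integrate to
  1.\<close>

lemma nn_integral_heat_second_moment:
  fixes \<tau> :: real
  assumes "\<tau> > 0"
  shows "(\<integral>\<^sup>+z. ennreal ((z \<bullet> z) * heat \<tau> z) \<partial>(lborel :: 'a::euclidean_space measure)) = ennreal (2 * DIM('a) * \<tau>)"
proof -
  have s: "sqrt (2 * \<tau>) > 0" using assms by simp
  have one: "(\<integral>\<^sup>+z. ennreal ((z \<bullet> c)\<^sup>2 * heat \<tau> z) \<partial>(lborel :: 'a measure)) = ennreal (2 * \<tau>)"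
    if c: "c \<in> Basis" for c :: 'a
  proof -
    have e: "(z \<bullet> c)\<^sup>2 * heat \<tau> z = (\<Prod>b\<in>Basis. (if b = c then (z \<bullet> b)\<^sup>2 else 1) * normal_density 0 (sqrt (2 * \<tau>)) (z \<bullet> b))" for z
      using c by (simp add: heat_eq_prod[OF assms] prod.distrib)
    have "(\<integral>\<^sup>+z. ennreal ((z \<bullet> c)\<^sup>2 * heat \<tau> z) \<partial>(lborel :: 'a measure))
      = (\<integral>\<^sup>+z. (\<Prod>b\<in>Basis. ennreal ((if b = c then (z \<bullet> b)\<^sup>2 else 1) * normal_density 0 (sqrt (2 * \<tau>)) (z \<bullet> b))) \<partial>(lborel :: 'a measure))"
      unfolding e by (subst prod_ennreal) auto
    also have "\<dots> = (\<Prod>b\<in>(Basis::'a set). (\<integral>\<^sup>+x. ennreal ((if b = c then x\<^sup>2 else 1) * normal_density 0 (sqrt (2 * \<tau>)) x) \<partial>lborel))"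
      by (rule nn_integral_lborel_prod) auto
    also have "\<dots> = (\<Prod>b\<in>(Basis::'a set). if b = c then ennreal (2 * \<tau>) else 1)"
    proof (rule prod.cong[OF refl])
      fix b :: 'a
      have 1: "(\<integral>\<^sup>+x. ennreal (normal_density 0 (sqrt (2 * \<tau>)) x) \<partial>lborel) = 1"
        using s by (subst nn_integral_eq_integral) auto
      have m: "has_bochner_integral lborel (\<lambda>x. x\<^sup>2 * normal_density 0 (sqrt (2 * \<tau>)) x) (2 * \<tau>)"
        using normal_moment_even[OF s, of 0 1] assms by (simp add: mult.commute fact_numeral)
      have 2: "(\<integral>\<^sup>+x. ennreal (x\<^sup>2 * normal_density 0 (sqrt (2 * \<tau>)) x) \<partial>lborel) = ennreal (2 * \<tau>)"
        using m by (subst nn_integral_eq_integral) (auto simp: has_bochner_integral_iff)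
      show "(\<integral>\<^sup>+x. ennreal ((if b = c then x\<^sup>2 else 1) * normal_density 0 (sqrt (2 * \<tau>)) x) \<partial>lborel)
        = (if b = c then ennreal (2 * \<tau>) else 1)"
        using 1 2 by simp
    qed
    also have "\<dots> = ennreal (2 * \<tau>)" using c by simp
    finally show ?thesis .
  qed
  have "(\<integral>\<^sup>+z. ennreal ((z \<bullet> z) * heat \<tau> z) \<partial>(lborel :: 'a measure))
     = (\<integral>\<^sup>+z. (\<Sum>c\<in>Basis. ennreal ((z \<bullet> c)\<^sup>2 * heat \<tau> z)) \<partial>(lborel :: 'a measure))"
  proof (rule nn_integral_cong)
    fix z :: 'a
    have "(z \<bullet> z) * heat \<tau> z = (\<Sum>c\<in>Basis. (z \<bullet> c)\<^sup>2 * heat \<tau> z)"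
      by (subst euclidean_inner) (simp add: sum_distrib_right power2_eq_square)
    then show "ennreal ((z \<bullet> z) * heat \<tau> z) = (\<Sum>c\<in>Basis. ennreal ((z \<bullet> c)\<^sup>2 * heat \<tau> z))"
      using heat_pos[OF assms, of z] by (simp add: sum_ennreal)
  qed
  also have "\<dots> = (\<Sum>c\<in>(Basis::'a set). ennreal (2 * \<tau>))"
    by (subst nn_integral_sum) (auto simp: one)
  also have "\<dots> = ennreal (2 * DIM('a) * \<tau>)"
    using assms by (simp add: ennreal_of_nat_eq_real_of_nat ennreal_mult[symmetric] mult_ac)
  finally show ?thesis .
qed

lemma integrable_heat: "\<tau> > 0 \<Longrightarrow> integrable lborel (\<lambda>z::'a::euclidean_space. heat \<tau> z)"
  and integral_heat: "\<tau> > 0 \<Longrightarrow> (LINT z|(lborel :: 'a::euclidean_space measure). heat \<tau> z) = 1"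
proof -
  assume t: "\<tau> > 0"
  show i: "integrable lborel (\<lambda>z::'a. heat \<tau> z)"
    using t by (intro integrableI_nonneg AE_I2) (auto simp: nn_integral_heat[OF t])
  have "ennreal (LINT z|(lborel :: 'a measure). heat \<tau> z) = 1"
    using t by (subst nn_integral_eq_integral[OF i, symmetric]) (auto simp: nn_integral_heat[OF t])
  then show "(LINT z|(lborel :: 'a measure). heat \<tau> z) = 1"
    by (metis ennreal_eq_1)
qed

lemma heat_grad_minus [simp]: "heat_grad \<tau> (- z) = - heat_grad \<tau> z"
  by (simp add: heat_grad_def)

lemma heat_grad_measurable [measurable]: "(\<lambda>z. heat_grad \<tau> z) \<in> borel_measurable borel"
  unfolding heat_grad_def by measurable

lemma norm_heat_grad: "\<tau> > 0 \<Longrightarrow> norm (heat_grad \<tau> z) = norm z * heat \<tau> z / (2 * \<tau>)"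
  using heat_pos[of \<tau> z] by (simp add: heat_grad_def abs_mult)

text \<open>To avoid computing a first absolute moment, 2 s |z| is bounded by s^2 + |z|^2 with the
  natural scale s = sqrt \<tau>. Mass and second moment then give the constant.\<close>

lemma nn_integral_norm_heat_grad:
  fixes \<tau> :: real
  assumes "\<tau> > 0"
  shows "(\<integral>\<^sup>+z. ennreal (norm (heat_grad \<tau> z)) \<partial>(lborel :: 'a::euclidean_space measure))
    \<le> ennreal ((1 + 2 * DIM('a)) / 4 / sqrt \<tau>)"
proof -
  define s where "s = sqrt \<tau>"
  have s: "s > 0" "\<tau> = s * s" using assms by (simp_all add: s_def)
  have "norm (heat_grad \<tau> z) \<le> 1 / (4 * s) * heat \<tau> z + 1 / (4 * s * \<tau>) * ((z \<bullet> z) * heat \<tau> z)" for z :: 'a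
  proof -
    have "2 * s * norm z \<le> s * s + z \<bullet> z"
      using sum_squares_bound[of s "norm z"] by (simp add: dot_square_norm power2_eq_square)
    then have "norm z \<le> (s * s + z \<bullet> z) / (2 * s)" using s by (simp add: field_simps)
    then have "norm z * heat \<tau> z / (2 * \<tau>) \<le> (s * s + z \<bullet> z) / (2 * s) * heat \<tau> z / (2 * \<tau>)"
      using heat_pos[OF assms, of z] assms by (intro divide_right_mono mult_right_mono) auto
    also have "\<dots> = 1 / (4 * s) * heat \<tau> z + 1 / (4 * s * \<tau>) * ((z \<bullet> z) * heat \<tau> z)"
      using s by (simp add: field_simps)
    finally show ?thesis by (simp add: norm_heat_grad[OF assms])
  qed
  then have "(\<integral>\<^sup>+z. ennreal (norm (heat_grad \<tau> z)) \<partial>(lborel :: 'a measure))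
    \<le> (\<integral>\<^sup>+z. ennreal (1 / (4 * s)) * ennreal (heat \<tau> z) + ennreal (1 / (4 * s * \<tau>)) * ennreal ((z \<bullet> z) * heat \<tau> z) \<partial>(lborel :: 'a measure))"
    using s assms heat_pos[OF assms]
    by (intro nn_integral_mono) (simp add: ennreal_mult[symmetric] ennreal_plus[symmetric] less_imp_le ennreal_leI del: ennreal_plus)
  also have "\<dots> = ennreal (1 / (4 * s)) * 1 + ennreal (1 / (4 * s * \<tau>)) * ennreal (2 * DIM('a) * \<tau>)"
    by (subst nn_integral_add) (auto simp: nn_integral_cmult nn_integral_heat[OF assms] nn_integral_heat_second_moment[OF assms])
  also have "\<dots> = ennreal (1 / (4 * s) + 1 / (4 * s * \<tau>) * (2 * DIM('a) * \<tau>))"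
    using s assms by (simp add: ennreal_mult[symmetric] ennreal_plus[symmetric] del: ennreal_plus)
  also have "1 / (4 * s) + 1 / (4 * s * \<tau>) * (2 * DIM('a) * \<tau>) = (1 + 2 * DIM('a)) / 4 / s"
    using s by (simp add: field_simps)
  finally show ?thesis by (simp add: s_def)
qed

text \<open>The integrand is the second moment density divided by 2 \<tau>, so \<tau> cancels. This
  freedom from singularity is what later yields 1/k^2 instead of 1/k for the transport cost.\<close>

lemma nn_integral_norm_times_heat_grad:
  fixes \<tau> :: real
  assumes "\<tau> > 0"
  shows "(\<integral>\<^sup>+z. ennreal (norm z * norm (heat_grad \<tau> z)) \<partial>(lborel :: 'a::euclidean_space measure)) = ennreal DIM('a)"
proof -
  have "norm z * norm (heat_grad \<tau> z) = 1 / (2 * \<tau>) * ((z \<bullet> z) * heat \<tau> z)" for z :: 'a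
    by (simp add: norm_heat_grad[OF assms] dot_square_norm power2_eq_square)
  then have "(\<integral>\<^sup>+z. ennreal (norm z * norm (heat_grad \<tau> z)) \<partial>(lborel :: 'a measure))
    = (\<integral>\<^sup>+z. ennreal (1 / (2 * \<tau>)) * ennreal ((z \<bullet> z) * heat \<tau> z) \<partial>(lborel :: 'a measure))"
    using assms heat_pos[OF assms] by (intro nn_integral_cong) (simp add: ennreal_mult[symmetric] less_imp_le)
  also have "\<dots> = ennreal (1 / (2 * \<tau>)) * ennreal (2 * DIM('a) * \<tau>)"
    by (simp add: nn_integral_cmult nn_integral_heat_second_moment[OF assms])
  also have "\<dots> = ennreal DIM('a)" using assms by (simp add: ennreal_mult[symmetric])
  finally show ?thesis .
qed

lemma heat_has_derivative:
  fixes z :: "'a::euclidean_space" and \<tau> :: real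
  assumes "\<tau> > 0"
  shows "((\<lambda>z. heat \<tau> z) has_derivative (\<lambda>v. heat_grad \<tau> z \<bullet> v)) (at z)"
proof -
  define S where "S = sqrt (4 * pi * \<tau>) ^ DIM('a)"
  have S: "S > 0" using assms by (simp add: S_def)
  have "((\<lambda>z. exp (- (z \<bullet> z) / (4 * \<tau>)) / S) has_derivative
     (\<lambda>v. exp (- (z \<bullet> z) / (4 * \<tau>)) * (- (z \<bullet> v + v \<bullet> z) / (4 * \<tau>)) / S)) (at z)"
    using assms S by (auto intro!: derivative_eq_intros simp: field_simps)
  then show ?thesis
    unfolding heat_def[abs_def] heat_grad_def S_def[symmetric] heat_def
    by (rule has_derivative_eq_rhs) (use assms S in \<open>auto simp: fun_eq_iff inner_commute field_simps\<close>)
qed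

lemma heat_grad_has_derivative:
  fixes z :: "'a::euclidean_space" and \<tau> :: real
  assumes "\<tau> > 0"
  shows "((\<lambda>z. heat_grad \<tau> z) has_derivative
     (\<lambda>v. (- (heat \<tau> z / (2 * \<tau>))) *\<^sub>R v - ((heat_grad \<tau> z \<bullet> v) / (2 * \<tau>)) *\<^sub>R z)) (at z)"
proof -
  have "((\<lambda>z. - (heat \<tau> z / (2 * \<tau>))) has_derivative (\<lambda>v. - ((heat_grad \<tau> z \<bullet> v) / (2 * \<tau>)))) (at z)"
    by (intro has_derivative_minus bounded_linear.has_derivative[OF bounded_linear_divide] heat_has_derivative assms)
  from has_derivative_scaleR[OF this has_derivative_ident]
  show ?thesis unfolding heat_grad_def[abs_def] by (simp add: algebra_simps)
qed

lemma heat_has_time_derivative: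
  fixes z :: "'a::euclidean_space" and \<tau> :: real
  assumes "\<tau> > 0"
  shows "((\<lambda>\<tau>. heat \<tau> z) has_real_derivative heat \<tau> z * ((z \<bullet> z) / (4 * \<tau>\<^sup>2) - DIM('a) / (2 * \<tau>))) (at \<tau>)"
proof -
  define n where "n = DIM('a)"
  have n: "n > 0" by (simp add: n_def)
  define S where "S t = sqrt (4 * pi * t) ^ n" for t
  have S0: "S \<tau> > 0" using assms by (simp add: S_def)
  have s2: "sqrt (4 * pi * \<tau>) * sqrt (4 * pi * \<tau>) = 4 * pi * \<tau>" using assms by simp
  have r: "((\<lambda>t. sqrt (4 * pi * t)) has_real_derivative sqrt (4 * pi * \<tau>) / (2 * \<tau>)) (at \<tau>)"
  proof -
    have "((\<lambda>t. sqrt (4 * pi * t)) has_real_derivative (inverse (sqrt (4 * pi * \<tau>)) / 2) * (4 * pi)) (at \<tau>)"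
      by (rule DERIV_chain2[where f = sqrt and g = "\<lambda>t. 4 * pi * t", OF DERIV_real_sqrt])
         (use assms in \<open>auto intro!: derivative_eq_intros\<close>)
    moreover have "(inverse (sqrt (4 * pi * \<tau>)) / 2) * (4 * pi) = sqrt (4 * pi * \<tau>) / (2 * \<tau>)"
    proof -
      have "sqrt (4 * pi * \<tau>) > 0" using assms by simp
      then show ?thesis using s2 assms by (simp add: field_simps)
    qed
    ultimately show ?thesis by simp
  qed
  have dS: "(S has_real_derivative n * S \<tau> / (2 * \<tau>)) (at \<tau>)"
  proof -
    have "(S has_real_derivative real n * (sqrt (4 * pi * \<tau>) / (2 * \<tau>) * sqrt (4 * pi * \<tau>) ^ (n - Suc 0))) (at \<tau>)"
      unfolding S_def[abs_def] by (rule DERIV_power[OF r])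
    moreover have "sqrt (4 * pi * \<tau>) * sqrt (4 * pi * \<tau>) ^ (n - Suc 0) = S \<tau>"
      using n by (cases n) (auto simp: S_def)
    ultimately show ?thesis by (metis (no_types, lifting) mult.assoc times_divide_eq_left times_divide_eq_right)
  qed
  have dE: "((\<lambda>t. exp (- (z \<bullet> z) / (4 * t))) has_real_derivative exp (- (z \<bullet> z) / (4 * \<tau>)) * ((z \<bullet> z) / (4 * \<tau>\<^sup>2))) (at \<tau>)"
    using assms by (auto intro!: derivative_eq_intros simp: power2_eq_square field_simps)
  have "((\<lambda>t. exp (- (z \<bullet> z) / (4 * t)) / S t) has_real_derivative
     (exp (- (z \<bullet> z) / (4 * \<tau>)) * ((z \<bullet> z) / (4 * \<tau>\<^sup>2)) * S \<tau> - exp (- (z \<bullet> z) / (4 * \<tau>)) * (n * S \<tau> / (2 * \<tau>))) / (S \<tau> * S \<tau>)) (at \<tau>)"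
    by (rule DERIV_divide[OF dE dS]) (use S0 in simp)
  moreover have "(exp (- (z \<bullet> z) / (4 * \<tau>)) * ((z \<bullet> z) / (4 * \<tau>\<^sup>2)) * S \<tau> - exp (- (z \<bullet> z) / (4 * \<tau>)) * (n * S \<tau> / (2 * \<tau>))) / (S \<tau> * S \<tau>)
     = exp (- (z \<bullet> z) / (4 * \<tau>)) / S \<tau> * ((z \<bullet> z) / (4 * \<tau>\<^sup>2) - n / (2 * \<tau>))"
    using S0 by (simp add: divide_simps) (simp add: algebra_simps)
  ultimately show ?thesis unfolding heat_def n_def S_def by simp
qed

text \<open>The right-hand side is the time derivative found in
  \<open>heat_has_time_derivative\<close>; together the two lemmas are the heat equation.\<close>

lemma heat_laplacian:
  fixes z :: "'a::euclidean_space" and \<tau> :: real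
  assumes "\<tau> > 0"
  shows "(\<Sum>b\<in>Basis. ((- (heat \<tau> z / (2 * \<tau>))) *\<^sub>R b - ((heat_grad \<tau> z \<bullet> b) / (2 * \<tau>)) *\<^sub>R z) \<bullet> b)
     = heat \<tau> z * ((z \<bullet> z) / (4 * \<tau>\<^sup>2) - DIM('a) / (2 * \<tau>))"
proof -
  have "(\<Sum>b\<in>Basis. ((- (heat \<tau> z / (2 * \<tau>))) *\<^sub>R b - ((heat_grad \<tau> z \<bullet> b) / (2 * \<tau>)) *\<^sub>R z) \<bullet> b)
    = (\<Sum>b\<in>(Basis::'a set). - (heat \<tau> z / (2 * \<tau>)) + heat \<tau> z / (4 * \<tau>\<^sup>2) * ((z \<bullet> b) * (z \<bullet> b)))"
    using assms by (intro sum.cong) (auto simp: inner_diff_left inner_Basis heat_grad_def power2_eq_square)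
  also have "\<dots> = - (DIM('a) * (heat \<tau> z / (2 * \<tau>))) + heat \<tau> z / (4 * \<tau>\<^sup>2) * (z \<bullet> z)"
    by (simp only: sum.distrib sum_distrib_left[symmetric] sum_constant euclidean_inner[of z z, symmetric])
  finally show ?thesis by (simp add: algebra_simps)
qed

section \<open>Integration by parts with a cut-off\<close>

lemma has_real_derivative_max_power:
  "((\<lambda>t::real. (max 0 t) ^ Suc (Suc k)) has_real_derivative real (k + 2) * (max 0 t) ^ Suc k) (at t)"
proof (cases t "0 :: real" rule: linorder_cases)
  case less
  have "((\<lambda>t::real. 0) has_real_derivative real (k + 2) * (max 0 t) ^ Suc k) (at t)" using less by simp
  then show ?thesis
    by (rule has_field_derivative_transform_within_open[where S = "{..<0}"]) (use less in auto)
next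
  case greater
  have "((\<lambda>t::real. t ^ Suc (Suc k)) has_real_derivative real (k + 2) * t ^ Suc k) (at t)"
    using DERIV_pow[of "Suc (Suc k)" t] by simp
  then have "((\<lambda>t::real. t ^ Suc (Suc k)) has_real_derivative real (k + 2) * (max 0 t) ^ Suc k) (at t)"
    using greater by simp
  then show ?thesis
    by (rule has_field_derivative_transform_within_open[where S = "{0<..}"]) (use greater in auto)
next
  case equal
  have "((\<lambda>h::real. (max 0 h) ^ Suc k) \<longlongrightarrow> (max 0 0) ^ Suc k) (at 0)"
    by (intro tendsto_intros)
  then have "((\<lambda>h::real. (max 0 h) ^ Suc k) \<longlongrightarrow> 0) (at 0)" by simp
  moreover have "eventually (\<lambda>h::real. (max 0 h) ^ Suc k = (max 0 (0 + h) ^ Suc (Suc k) - max 0 0 ^ Suc (Suc k)) / h) (at 0)"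
    by (rule eventually_at_filter[THEN iffD2], rule always_eventually) (auto simp: max_def)
  ultimately have "((\<lambda>h::real. (max 0 (0 + h) ^ Suc (Suc k) - max 0 0 ^ Suc (Suc k)) / h) \<longlongrightarrow> 0) (at 0)"
    by (rule Lim_transform_eventually)
  then show ?thesis using equal by (simp add: DERIV_def)
qed

definition bump_base :: "real \<Rightarrow> 'a::real_inner \<Rightarrow> real" where
  "bump_base R y = max 0 (1 - (y \<bullet> y) / R\<^sup>2)"

text \<open>An explicit polynomial cut-off makes all bounds elementary. The cube is the lowest
  integer power whose gradient is still differentiable across the sphere of radius R.\<close>

definition bump :: "real \<Rightarrow> 'a::real_inner \<Rightarrow> real" where
  "bump R y = bump_base R y ^ 3"

definition bump_grad :: "real \<Rightarrow> 'a::real_inner \<Rightarrow> 'a" where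
  "bump_grad R y = (- (6 / R\<^sup>2 * bump_base R y ^ 2)) *\<^sub>R y"

definition bump_hess :: "real \<Rightarrow> 'a::real_inner \<Rightarrow> 'a \<Rightarrow> 'a" where
  "bump_hess R y v = (- (6 / R\<^sup>2 * bump_base R y ^ 2)) *\<^sub>R v + (24 / R ^ 4 * bump_base R y * (y \<bullet> v)) *\<^sub>R y"

lemma bump_base_bounds: "0 \<le> bump_base R y" "bump_base R y \<le> 1"
  by (auto simp: bump_base_def)

lemma bump_base_eq_0: "R > 0 \<Longrightarrow> norm y \<ge> R \<Longrightarrow> bump_base R y = 0"
  using power_mono[of R "norm y" 2] by (auto simp: bump_base_def dot_square_norm max_def field_simps)

lemma bump_base_power_derivative:
  assumes R: "R > 0"
  shows "((\<lambda>y. bump_base R y ^ Suc (Suc k)) has_derivative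
    (\<lambda>v. - (real (k + 2) * (2 / R\<^sup>2) * bump_base R y ^ Suc k * (y \<bullet> v)))) (at y)"
proof -
  have "((\<lambda>y. 1 - (y \<bullet> y) / R\<^sup>2) has_derivative (\<lambda>v. 0 - (y \<bullet> v + v \<bullet> y) / R\<^sup>2)) (at y)"
    by (intro has_derivative_diff has_derivative_const bounded_linear.has_derivative[OF bounded_linear_divide]
        has_derivative_inner has_derivative_ident)
  from has_derivative_compose[OF this has_real_derivative_max_power[of k, unfolded has_field_derivative_def]]
  show ?thesis
    unfolding bump_base_def
    by (rule has_derivative_eq_rhs) (auto simp: fun_eq_iff inner_commute algebra_simps add_divide_distrib)
qed

lemma bump_derivative:
  assumes "R > 0"
  shows "((\<lambda>y. bump R y) has_derivative (\<lambda>v. bump_grad R y \<bullet> v)) (at y)"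
  using bump_base_power_derivative[OF assms, of 1 y]
  by (simp add: bump_def[abs_def] bump_grad_def numeral_3_eq_3 power2_eq_square mult_ac)

lemma bump_grad_derivative:
  assumes R: "R > 0"
  shows "((\<lambda>y. bump_grad R y) has_derivative bump_hess R y) (at y)"
proof -
  have "((\<lambda>y. - (6 / R\<^sup>2 * bump_base R y ^ 2)) has_derivative (\<lambda>v. - (6 / R\<^sup>2 * - (2 * (2 / R\<^sup>2) * bump_base R y * (y \<bullet> v))))) (at y)"
    using bump_base_power_derivative[OF R, of 0 y]
    by (intro has_derivative_minus has_derivative_mult_right) (simp add: numeral_2_eq_2)
  from has_derivative_scaleR[OF this has_derivative_ident]
  have "((\<lambda>y. bump_grad R y) has_derivative
     (\<lambda>v. (- (6 / R\<^sup>2 * bump_base R y ^ 2)) *\<^sub>R v + (- (6 / R\<^sup>2 * - (2 * (2 / R\<^sup>2) * bump_base R y * (y \<bullet> v)))) *\<^sub>R y)) (at y)"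
    by (simp add: bump_grad_def[abs_def])
  then show ?thesis
  proof (rule has_derivative_eq_rhs)
    have "- (6 / R\<^sup>2 * - (2 * (2 / R\<^sup>2) * bump_base R y * (y \<bullet> v))) = 24 / R ^ 4 * bump_base R y * (y \<bullet> v)" for v
      using R by (simp add: field_simps power4_eq_xxxx power2_eq_square)
    then show "(\<lambda>v. (- (6 / R\<^sup>2 * bump_base R y ^ 2)) *\<^sub>R v + (- (6 / R\<^sup>2 * - (2 * (2 / R\<^sup>2) * bump_base R y * (y \<bullet> v)))) *\<^sub>R y) = bump_hess R y"
      unfolding bump_hess_def by auto
  qed
qed

lemma bump_bounds: "0 \<le> bump R y" "bump R y \<le> 1"
  using bump_base_bounds[of R y] by (auto simp: bump_def power_le_one)

lemma norm_bump_grad_le: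
  assumes R: "R > 0"
  shows "norm (bump_grad R y) \<le> 6 / R"
proof (cases "norm y \<ge> R")
  case True
  then show ?thesis using R by (simp add: bump_grad_def bump_base_eq_0)
next
  case False
  have "bump_base R y ^ 2 \<le> 1" using bump_base_bounds[of R y] by (simp add: power_le_one)
  then have "6 / R\<^sup>2 * bump_base R y ^ 2 * norm y \<le> 6 / R\<^sup>2 * 1 * R"
    using False R by (intro mult_mono) auto
  then show ?thesis using R by (simp add: bump_grad_def abs_mult power2_eq_square)
qed

lemma norm_bump_hess_le:
  assumes R: "R > 0" and v: "norm v \<le> 1"
  shows "norm (bump_hess R y v) \<le> 30 / R\<^sup>2"
proof (cases "norm y \<ge> R")
  case True
  then show ?thesis using R by (simp add: bump_hess_def bump_base_eq_0)
next
  case False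
  have b: "bump_base R y ^ 2 \<le> 1" using bump_base_bounds[of R y] by (simp add: power_le_one)
  have "\<bar>y \<bullet> v\<bar> \<le> norm y * norm v" by (rule Cauchy_Schwarz_ineq2)
  also have "\<dots> \<le> R * 1" using False R v by (intro mult_mono) auto
  finally have yv: "\<bar>y \<bullet> v\<bar> \<le> R" by simp
  have "norm ((- (6 / R\<^sup>2 * bump_base R y ^ 2)) *\<^sub>R v) \<le> 6 / R\<^sup>2 * 1 * 1"
    using b v R unfolding norm_scaleR by (intro mult_mono) (auto simp: abs_mult intro: divide_right_mono)
  moreover have "norm ((24 / R ^ 4 * bump_base R y * (y \<bullet> v)) *\<^sub>R y) \<le> 24 / R ^ 4 * 1 * R * R"
    using yv False R bump_base_bounds[of R y] unfolding norm_scaleR abs_mult by (intro mult_mono) auto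
  moreover have "24 / R ^ 4 * 1 * R * R = 24 / R\<^sup>2" using R by (simp add: power4_eq_xxxx power2_eq_square)
  moreover have "6 / R\<^sup>2 * 1 * 1 + 24 / R\<^sup>2 = 30 / R\<^sup>2" by simp
  ultimately show ?thesis unfolding bump_hess_def
    using norm_triangle_ineq[of "(- (6 / R\<^sup>2 * bump_base R y ^ 2)) *\<^sub>R v" "(24 / R ^ 4 * bump_base R y * (y \<bullet> v)) *\<^sub>R y"]
    by linarith
qed

lemma bump_tendsto: "((\<lambda>R. bump R y) \<longlongrightarrow> 1) at_top"
proof -
  have "((\<lambda>R. (max 0 (1 - (y \<bullet> y) / R\<^sup>2)) ^ 3) \<longlongrightarrow> (max 0 (1 - 0)) ^ 3) at_top"
    by (intro tendsto_intros tendsto_divide_0[OF tendsto_const] filterlim_at_top_imp_at_infinity filterlim_pow_at_top filterlim_ident) auto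
  then show ?thesis by (simp add: bump_def bump_base_def)
qed

lemma bump_continuous: "continuous_on A (\<lambda>y. bump R y)" "continuous_on A (\<lambda>y. bump_grad R y)"
    "continuous_on A (\<lambda>y. bump_hess R y v)"
  unfolding bump_def bump_grad_def bump_hess_def bump_base_def divide_inverse by (intro continuous_intros)+

text \<open>Translation invariance of Lebesgue measure makes the integrals of difference quotients vanish.\<close>

lemma integral_partial_derivative_zero:
  fixes f :: "'a::euclidean_space \<Rightarrow> real"
  assumes f: "\<And>x. (f has_derivative f' x) (at x)" and b: "norm b \<le> 1" and M: "\<And>x. \<bar>f' x b\<bar> \<le> M"
    and supp: "\<And>x. norm x > R \<Longrightarrow> f x = 0"
  shows "integrable lborel (\<lambda>x. f' x b)" and "(LINT x|lborel. f' x b) = 0"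
proof -
  have fc: "continuous_on UNIV f" using f by (intro has_derivative_continuous_on) auto
  then have [measurable]: "f \<in> borel_measurable borel" by (rule borel_measurable_continuous_onI)
  have "integrable lborel (\<lambda>x. indicator (cball 0 R) x *\<^sub>R f x)"
    by (intro borel_integrable_compact continuous_on_subset[OF fc]) auto
  moreover have "(\<lambda>x. indicator (cball 0 R) x *\<^sub>R f x) = f"
    using supp by (auto simp: fun_eq_iff indicator_def)
  ultimately have fi: "integrable lborel f" by simp
  define s where "s i x = (f (x + (1 / real (Suc i)) *\<^sub>R b) - f x) / (1 / real (Suc i))" for i x
  have sm[measurable]: "s i \<in> borel_measurable borel" for i unfolding s_def by measurable
  have fi': "integrable lborel (\<lambda>x. f (c + x))" "(LINT x|lborel. f (c + x)) = (LINT x|lborel. f x)" for c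
  proof -
    have "integrable (distr lborel borel ((+) c)) f" using fi by (simp only: lborel_distr_plus)
    then show "integrable lborel (\<lambda>x. f (c + x))" by (subst (asm) integrable_distr_eq) auto
    have "(LINT x|distr lborel borel ((+) c). f x) = (LINT x|lborel. f (c + x))"
      by (rule integral_distr) auto
    then show "(LINT x|lborel. f (c + x)) = (LINT x|lborel. f x)" by (simp only: lborel_distr_plus)
  qed
  have s0: "(LINT x|lborel. s i x) = 0" for i
    unfolding s_def using fi fi'[of "(1 / real (Suc i)) *\<^sub>R b"] by (simp add: add.commute)
  have d: "((\<lambda>r. f (x + r *\<^sub>R b)) has_real_derivative f' (x + r *\<^sub>R b) b) (at r)" for x r
  proof -
    have "((\<lambda>r. x + r *\<^sub>R b) has_derivative (\<lambda>r. r *\<^sub>R b)) (at r)" by (auto intro!: derivative_eq_intros)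
    from has_derivative_compose[OF this f]
    have "((\<lambda>r. f (x + r *\<^sub>R b)) has_derivative (\<lambda>q. f' (x + r *\<^sub>R b) (q *\<^sub>R b))) (at r)" .
    moreover have "(\<lambda>q. f' (x + r *\<^sub>R b) (q *\<^sub>R b)) = (*) (f' (x + r *\<^sub>R b) b)"
      by (auto simp: fun_eq_iff linear_scale[OF has_derivative_linear[OF f]])
    ultimately show ?thesis by (simp add: has_field_derivative_def)
  qed
  have lim: "(\<lambda>i. s i x) \<longlonglongrightarrow> f' x b" for x
  proof -
    have "((\<lambda>h. (f (x + h *\<^sub>R b) - f x) / h) \<longlongrightarrow> f' x b) (at 0)"
      using d[of x 0] by (simp add: DERIV_def)
    moreover have "filterlim (\<lambda>i. 1 / real (Suc i)) (at 0) sequentially"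
      unfolding filterlim_at using LIMSEQ_inverse_real_of_nat by (auto simp: inverse_eq_divide)
    ultimately show ?thesis unfolding s_def by (rule filterlim_compose)
  qed
  have M0: "0 \<le> M" using M[of 0] by linarith
  \<comment> \<open>The steps are at most 1 and |b| is at most 1, so all difference quotients vanish
    outside the ball of radius R + 1; inside it the mean value theorem bounds them by
    \<open>M\<close>. A fixed multiple of an indicator therefore dominates.\<close>
  have bd: "norm (s i x) \<le> M * indicator (cball 0 (R + 1)) x" for i x
  proof (cases "norm x \<le> R + 1")
    case True
    define e where "e = 1 / real (Suc i)"
    have e: "e > 0" by (simp add: e_def)
    have "\<exists>z. 0 < z \<and> z < e \<and> f (x + e *\<^sub>R b) - f (x + 0 *\<^sub>R b) = (e - 0) * f' (x + z *\<^sub>R b) b"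
      using e by (intro MVT2 d)
    then obtain z where "f (x + e *\<^sub>R b) - f x = e * f' (x + z *\<^sub>R b) b" by auto
    moreover have "s i x = (f (x + e *\<^sub>R b) - f x) / e" by (simp only: s_def e_def)
    ultimately have "s i x = f' (x + z *\<^sub>R b) b" using e by simp
    then show ?thesis using M True by (simp add: indicator_def)
  next
    case False
    have "norm ((1 / real (Suc i)) *\<^sub>R b) \<le> 1 * 1"
      unfolding norm_scaleR using b by (intro mult_mono) auto
    then have "norm (x + (1 / real (Suc i)) *\<^sub>R b) > R"
      using False norm_diff_ineq[of x "(1 / real (Suc i)) *\<^sub>R b"] by linarith
    then show ?thesis using False supp M0 by (simp add: s_def)
  qed
  have fm: "(\<lambda>x. f' x b) \<in> borel_measurable borel"
    by (rule borel_measurable_LIMSEQ_real[OF lim]) simp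
  have wi: "integrable lborel (\<lambda>x::'a. M * indicator (cball 0 (R + 1)) x :: real)"
    by (intro integrable_mult_right integrable_real_indicator) (use emeasure_bounded_finite[OF bounded_cball, of "0::'a" "R + 1"] in auto)
  show "integrable lborel (\<lambda>x. f' x b)"
    by (rule integrable_dominated_convergence[OF _ _ wi AE_I2[OF lim] AE_I2[OF bd]]) (use fm in auto)
  have "(\<lambda>i. LINT x|lborel. s i x) \<longlonglongrightarrow> (LINT x|lborel. f' x b)"
    by (rule integral_dominated_convergence[OF _ _ wi AE_I2[OF lim] AE_I2[OF bd]]) (use fm in auto)
  then show "(LINT x|lborel. f' x b) = 0"
    unfolding s0 by (simp add: LIMSEQ_const_iff)
qed

lemma integral_divergence_zero:
  fixes V :: "'a::euclidean_space \<Rightarrow> 'a"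
  assumes V: "\<And>x. (V has_derivative V' x) (at x)" and M: "\<And>x b. b \<in> Basis \<Longrightarrow> norm (V' x b) \<le> M"
    and supp: "\<And>x. norm x > R \<Longrightarrow> V x = 0"
  shows "integrable lborel (\<lambda>x. \<Sum>b\<in>Basis. V' x b \<bullet> b)" and "(LINT x|lborel. (\<Sum>b\<in>Basis. V' x b \<bullet> b)) = 0"
proof -
  have *: "integrable lborel (\<lambda>x. V' x b \<bullet> b) \<and> (LINT x|lborel. V' x b \<bullet> b) = 0" if b: "b \<in> Basis" for b
  proof -
    have 1: "((\<lambda>x. V x \<bullet> b) has_derivative (\<lambda>v. V' x v \<bullet> b)) (at x)" for x
      by (rule has_derivative_inner_left[OF V])
    have 2: "\<bar>V' x b \<bullet> b\<bar> \<le> M" for x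
      using Cauchy_Schwarz_ineq2[of "V' x b" b] M[OF b, of x] b by simp
    show ?thesis
      using integral_partial_derivative_zero[of "\<lambda>x. V x \<bullet> b" "\<lambda>x v. V' x v \<bullet> b" b M R, OF 1 _ 2] b supp by auto
  qed
  then show "integrable lborel (\<lambda>x. \<Sum>b\<in>Basis. V' x b \<bullet> b)" by auto
  show "(LINT x|lborel. (\<Sum>b\<in>Basis. V' x b \<bullet> b)) = 0"
    using * by (subst Bochner_Integration.integral_sum) auto
qed

text \<open>The divergence of \<phi> grad \<mu> - \<mu> grad \<phi> + \<phi> q integrates to zero.
  The mixed products of the two gradients cancel, as in Green's second identity, and the last
  summand moves the divergence off \<open>q\<close>.\<close>

lemma integral_by_parts_compact:
  fixes \<phi> \<mu> :: "'a::euclidean_space \<Rightarrow> real" and q :: "'a \<Rightarrow> 'a"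
  assumes \<phi>: "\<And>x. (\<phi> has_derivative (\<lambda>v. g\<phi> x \<bullet> v)) (at x)" "\<And>x. (g\<phi> has_derivative h\<phi> x) (at x)"
    and \<mu>: "\<And>x. (\<mu> has_derivative (\<lambda>v. g x \<bullet> v)) (at x)" "\<And>x. (g has_derivative h x) (at x)"
    and q: "\<And>x. (q has_derivative q' x) (at x)"
    and supp: "\<And>x. norm x > R \<Longrightarrow> \<phi> x = 0" "\<And>x. norm x > R \<Longrightarrow> g\<phi> x = 0" "\<And>x b. norm x > R \<Longrightarrow> h\<phi> x b = 0"
    and bd: "\<And>x b. norm x \<le> R \<Longrightarrow> b \<in> Basis \<Longrightarrow> \<bar>\<phi> x\<bar> \<le> K \<and> norm (g\<phi> x) \<le> K \<and> norm (h\<phi> x b) \<le> K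
       \<and> \<bar>\<mu> x\<bar> \<le> K \<and> norm (g x) \<le> K \<and> norm (h x b) \<le> K \<and> norm (q x) \<le> K \<and> norm (q' x b) \<le> K"
  shows "integrable lborel (\<lambda>x. ((\<Sum>b\<in>Basis. h x b \<bullet> b) + (\<Sum>b\<in>Basis. q' x b \<bullet> b)) * \<phi> x
         - (\<mu> x * (\<Sum>b\<in>Basis. h\<phi> x b \<bullet> b) - q x \<bullet> g\<phi> x))"
    and "(LINT x|lborel. ((\<Sum>b\<in>Basis. h x b \<bullet> b) + (\<Sum>b\<in>Basis. q' x b \<bullet> b)) * \<phi> x
         - (\<mu> x * (\<Sum>b\<in>Basis. h\<phi> x b \<bullet> b) - q x \<bullet> g\<phi> x)) = 0"
proof -
  define V where "V x = \<phi> x *\<^sub>R g x - \<mu> x *\<^sub>R g\<phi> x + \<phi> x *\<^sub>R q x" for x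
  define V' where "V' x v = (\<phi> x *\<^sub>R h x v + (g\<phi> x \<bullet> v) *\<^sub>R g x) - (\<mu> x *\<^sub>R h\<phi> x v + (g x \<bullet> v) *\<^sub>R g\<phi> x)
     + (\<phi> x *\<^sub>R q' x v + (g\<phi> x \<bullet> v) *\<^sub>R q x)" for x v
  have VV: "(V has_derivative V' x) (at x)" for x
    unfolding V_def[abs_def] V'_def[abs_def]
    by (intro has_derivative_add has_derivative_diff has_derivative_scaleR \<phi> \<mu> q)
  have K0: "0 \<le> K" if "norm (x::'a) \<le> R" for x
  proof -
    have "norm (g\<phi> x) \<le> K" using bd[OF that SOME_Basis] by blast
    then show ?thesis using norm_ge_zero[of "g\<phi> x"] by linarith
  qed
  have M: "norm (V' x b) \<le> 6 * (K * K)" if b: "b \<in> Basis" for x b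
  proof (cases "norm x \<le> R")
    case True
    note B = bd[OF True b]
    have i: "\<bar>z \<bullet> b\<bar> \<le> K" if "norm z \<le> K" for z
      using Cauchy_Schwarz_ineq2[of z b] b that by simp
    have n: "norm (c *\<^sub>R z) \<le> K * K" if "\<bar>c\<bar> \<le> K" "norm z \<le> K" for c and z :: 'a
      unfolding norm_scaleR using that K0[OF True] by (intro mult_mono) auto
    have t: "norm ((a1 + a2) - (a3 + a4) + (a5 + a6)) \<le> norm a1 + norm a2 + norm a3 + norm a4 + norm a5 + norm a6"
      for a1 a2 a3 a4 a5 a6 :: 'a
      by (intro order_trans[OF norm_triangle_ineq] order_trans[OF add_mono[OF norm_triangle_ineq4 norm_triangle_ineq]])
         (smt (verit) norm_triangle_ineq)
    have "norm (V' x b) \<le> K * K + K * K + K * K + K * K + K * K + K * K"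
      unfolding V'_def by (rule order_trans[OF t], intro add_mono n i) (use B in auto)
    then show ?thesis by simp
  next
    case False
    then have "V' x b = 0" using supp by (simp add: V'_def)
    then show ?thesis by simp
  qed
  have supV: "V x = 0" if "norm x > R" for x using supp that by (simp add: V_def)
  have e: "(\<Sum>b\<in>Basis. V' x b \<bullet> b) = ((\<Sum>b\<in>Basis. h x b \<bullet> b) + (\<Sum>b\<in>Basis. q' x b \<bullet> b)) * \<phi> x
         - (\<mu> x * (\<Sum>b\<in>Basis. h\<phi> x b \<bullet> b) - q x \<bullet> g\<phi> x)" for x
  proof -
    have s: "(\<Sum>b\<in>Basis. (z \<bullet> b) * (y \<bullet> b)) = z \<bullet> y" for z y :: 'a by (rule euclidean_inner[symmetric])
    have "(\<Sum>b\<in>Basis. V' x b \<bullet> b) = \<phi> x * (\<Sum>b\<in>Basis. h x b \<bullet> b) + (\<Sum>b\<in>Basis. (g\<phi> x \<bullet> b) * (g x \<bullet> b))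
      - (\<mu> x * (\<Sum>b\<in>Basis. h\<phi> x b \<bullet> b) + (\<Sum>b\<in>Basis. (g x \<bullet> b) * (g\<phi> x \<bullet> b)))
      + (\<phi> x * (\<Sum>b\<in>Basis. q' x b \<bullet> b) + (\<Sum>b\<in>Basis. (g\<phi> x \<bullet> b) * (q x \<bullet> b)))"
      unfolding V'_def by (simp add: inner_add_left inner_diff_left sum.distrib sum_subtractf sum_distrib_left mult.commute)
    moreover have "g\<phi> x \<bullet> g x = g x \<bullet> g\<phi> x" "g\<phi> x \<bullet> q x = q x \<bullet> g\<phi> x" by (simp_all only: inner_commute)
    ultimately show ?thesis unfolding s by (simp add: algebra_simps)
  qed
  show "integrable lborel (\<lambda>x. ((\<Sum>b\<in>Basis. h x b \<bullet> b) + (\<Sum>b\<in>Basis. q' x b \<bullet> b)) * \<phi> x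
         - (\<mu> x * (\<Sum>b\<in>Basis. h\<phi> x b \<bullet> b) - q x \<bullet> g\<phi> x))"
    using integral_divergence_zero(1)[OF VV M supV] unfolding e .
  show "(LINT x|lborel. ((\<Sum>b\<in>Basis. h x b \<bullet> b) + (\<Sum>b\<in>Basis. q' x b \<bullet> b)) * \<phi> x
         - (\<mu> x * (\<Sum>b\<in>Basis. h\<phi> x b \<bullet> b) - q x \<bullet> g\<phi> x)) = 0"
    using integral_divergence_zero(2)[OF VV M supV] unfolding e .
qed

section \<open>Duhamel's formula for the Fokker-Planck equation\<close>

text \<open>Bounds uniform in z and in \<tau> away from 0, used to dominate kernels before the
  singular time. The growing factor |z| is absorbed by the exponential through u exp(-u) <=
  1.\<close>

lemma heat_grad_bound:
  fixes z :: "'a::euclidean_space" and \<tau> :: real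
  assumes a: "0 < \<tau>0" "\<tau>0 \<le> \<tau>" "\<tau> \<le> \<tau>1"
  shows "norm (heat_grad \<tau> z) \<le> (1 + 4 * \<tau>1) / (2 * \<tau>0) * (1 / sqrt (4 * pi * \<tau>0) ^ DIM('a))"
    and "heat \<tau> z \<le> 1 / sqrt (4 * pi * \<tau>0) ^ DIM('a)"
proof -
  have \<tau>: "\<tau> > 0" using a by simp
  define S where "S = sqrt (4 * pi * \<tau>) ^ DIM('a)"
  have S: "S > 0" using \<tau> by (simp add: S_def)
  have S': "sqrt (4 * pi * \<tau>0) ^ DIM('a) \<le> S"
    unfolding S_def using a by (intro power_mono) auto
  then have S0: "1 / S \<le> 1 / sqrt (4 * pi * \<tau>0) ^ DIM('a)"
    using a S by (intro divide_left_mono) auto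
  show "heat \<tau> z \<le> 1 / sqrt (4 * pi * \<tau>0) ^ DIM('a)"
    using heat_le[OF \<tau>, of z] S0 by (simp add: S_def)
  define u where "u = (z \<bullet> z) / (4 * \<tau>)"
  have u0: "u \<ge> 0" using \<tau> by (simp add: u_def)
  have "u \<le> exp u" using exp_ge_add_one_self[of u] by linarith
  then have ue: "u * exp (- u) \<le> 1" by (simp add: exp_minus field_simps)
  have e1: "exp (- u) \<le> 1" using u0 by simp
  have "2 * 1 * norm z \<le> 1\<^sup>2 + (norm z)\<^sup>2" by (rule sum_squares_bound)
  then have "2 * norm z \<le> 1 + z \<bullet> z" by (simp add: power2_norm_eq_inner)
  then have "norm z \<le> 1 + z \<bullet> z" using norm_ge_zero[of z] by linarith
  then have "norm z \<le> 1 + 4 * \<tau> * u" using \<tau> by (simp add: u_def)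
  then have "norm z * exp (- u) \<le> (1 + 4 * \<tau> * u) * exp (- u)" by (intro mult_right_mono) auto
  also have "\<dots> = exp (- u) + 4 * \<tau> * (u * exp (- u))" by (simp add: algebra_simps)
  also have "\<dots> \<le> 1 + 4 * \<tau> * 1" using \<tau> ue e1 by (intro add_mono mult_left_mono) auto
  finally have 1: "norm z * exp (- u) \<le> 1 + 4 * \<tau>" by simp
  have "norm (heat_grad \<tau> z) = (norm z * exp (- u)) / (2 * \<tau>) * (1 / S)"
    unfolding norm_heat_grad[OF \<tau>] heat_def S_def u_def by simp
  also have "\<dots> \<le> (1 + 4 * \<tau>1) / (2 * \<tau>0) * (1 / sqrt (4 * pi * \<tau>0) ^ DIM('a))"
    using 1 S S' S0 a \<tau> by (intro mult_mono frac_le) auto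
  finally show "norm (heat_grad \<tau> z) \<le> (1 + 4 * \<tau>1) / (2 * \<tau>0) * (1 / sqrt (4 * pi * \<tau>0) ^ DIM('a))" .
qed

lemma continuous_on_heat:
  fixes f :: "'b::topological_space \<Rightarrow> real" and z :: "'b \<Rightarrow> 'a::euclidean_space"
  assumes "continuous_on A f" "continuous_on A z" "\<And>x. x \<in> A \<Longrightarrow> f x > 0"
  shows "continuous_on A (\<lambda>x. heat (f x) (z x))"
    and "continuous_on A (\<lambda>x. heat_grad (f x) (z x))"
proof -
  have 1: "continuous_on A (\<lambda>x. heat (f x) (z x))"
    unfolding heat_def using assms(3)
    by (intro continuous_intros assms(1,2)) (auto dest: order_less_imp_not_eq2)
  then show "continuous_on A (\<lambda>x. heat (f x) (z x))" .
  show "continuous_on A (\<lambda>x. heat_grad (f x) (z x))"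
    unfolding heat_grad_def using assms(3)
    by (intro continuous_intros 1 assms(1,2)) (auto dest: order_less_imp_not_eq2)
qed

text \<open>An interface that forgets the Hamiltonian. \<mu> is a difference of densities without a
  sign, \<sigma> stands for their sum and supplies the integrable majorant of mass at most 2, and
  \<open>q\<close> is the difference of the fluxes, with \<mu>_t equal to the Laplacian of \<mu>
  plus div \<open>q\<close>. Besides its differentiability in space, \<open>q\<close> has
  derivatives that are bounded on balls, as the divergence theorem requires.\<close>

locale fp_difference =
  fixes \<mu> mt \<sigma> :: "'a::euclidean_space \<Rightarrow> real \<Rightarrow> real" and g q :: "'a \<Rightarrow> real \<Rightarrow> 'a"
    and h q' :: "'a \<Rightarrow> real \<Rightarrow> 'a \<Rightarrow> 'a" and B :: real
  assumes cont_\<mu>: "continuous_on (UNIV \<times> {0<..}) (\<lambda>(x, t). \<mu> x t)"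
    and cont_g: "continuous_on (UNIV \<times> {0<..}) (\<lambda>(x, t). g x t)"
    and cont_h: "\<And>v. continuous_on (UNIV \<times> {0<..}) (\<lambda>(x, t). h x t v)"
    and cont_mt: "continuous_on (UNIV \<times> {0<..}) (\<lambda>(x, t). mt x t)"
    and cont_q: "continuous_on (UNIV \<times> {0<..}) (\<lambda>(x, t). q x t)"
    and cont_\<sigma>: "continuous_on (UNIV \<times> {0<..}) (\<lambda>(x, t). \<sigma> x t)"
    and \<mu>_deriv: "\<And>x t. t > 0 \<Longrightarrow> ((\<lambda>y. \<mu> y t) has_derivative (\<lambda>v. g x t \<bullet> v)) (at x)"
    and g_deriv: "\<And>x t. t > 0 \<Longrightarrow> ((\<lambda>y. g y t) has_derivative h x t) (at x)"
    and \<mu>_time: "\<And>x t. t > 0 \<Longrightarrow> ((\<lambda>s. \<mu> x s) has_real_derivative mt x t) (at t)"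
    and q_deriv: "\<And>x t. t > 0 \<Longrightarrow> ((\<lambda>y. q y t) has_derivative q' x t) (at x)"
    and q'_bdd: "\<And>R t. t > 0 \<Longrightarrow> \<exists>K. \<forall>x b. norm x \<le> R \<longrightarrow> b \<in> Basis \<longrightarrow> norm (q' x t b) \<le> K"
    and eqn: "\<And>x t. t > 0 \<Longrightarrow> mt x t = (\<Sum>b\<in>Basis. h x t b \<bullet> b) + (\<Sum>b\<in>Basis. q' x t b \<bullet> b)"
    and \<mu>_le: "\<And>x t. t > 0 \<Longrightarrow> \<bar>\<mu> x t\<bar> \<le> \<sigma> x t"
    and q_le: "\<And>x t. t > 0 \<Longrightarrow> norm (q x t) \<le> B * \<sigma> x t" and B: "B \<ge> 0"
    and mass: "\<And>t. t > 0 \<Longrightarrow> (\<integral>\<^sup>+x. ennreal (\<sigma> x t) \<partial>lborel) \<le> 2"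
begin

lemma \<sigma>_nonneg: "t > 0 \<Longrightarrow> \<sigma> x t \<ge> 0"
  using \<mu>_le[of t x] by linarith

lemma continuous_on_slice:
  assumes c: "continuous_on (UNIV \<times> {0<..}) (\<lambda>(x, t). f x t)" and t: "t > 0"
  shows "continuous_on A (\<lambda>x. f x t)"
proof -
  have "continuous_on A ((\<lambda>(x, t). f x t) \<circ> (\<lambda>x. (x, t)))"
    by (intro continuous_on_compose continuous_on_subset[OF c] continuous_intros) (use t in auto)
  then show ?thesis by (simp add: comp_def)
qed

lemma continuous_on_strip:
  assumes c: "continuous_on (UNIV \<times> {0<..}) (\<lambda>(x, t). f x t)" and A: "\<And>z. z \<in> A \<Longrightarrow> snd z > 0"
  shows "continuous_on A (\<lambda>z. f (fst z) (snd z))"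
  using continuous_on_subset[OF c, of A] A by (force simp: case_prod_unfold)

lemma borel_measurable_strip:
  fixes f :: "'a \<Rightarrow> real \<Rightarrow> 'b::real_normed_vector"
  assumes c: "continuous_on (UNIV \<times> {0<..}) (\<lambda>(x, t). f x t)" and I: "I \<in> sets borel" "I \<subseteq> {0<..}"
  shows "(\<lambda>z. indicator I (snd z) *\<^sub>R f (fst z) (snd z)) \<in> borel_measurable borel"
proof -
  have "UNIV \<times> I \<in> sets (borel :: ('a \<times> real) measure)" using I by (simp add: borel_prod[symmetric])
  moreover have "continuous_on (UNIV \<times> I) (\<lambda>z. f (fst z) (snd z))"
    by (rule continuous_on_strip[OF c]) (use I in auto)
  ultimately have "(\<lambda>z. indicator (UNIV \<times> I) z *\<^sub>R f (fst z) (snd z)) \<in> borel_measurable borel"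
    by (rule borel_measurable_continuous_on_indicator)
  moreover have "indicator (UNIV \<times> I) z = (indicator I (snd z) :: real)" for z :: "'a \<times> real"
    by (cases z) (auto simp: indicator_def)
  ultimately show ?thesis by simp
qed

lemma slice_measurable: "t > 0 \<Longrightarrow> (\<lambda>x. \<mu> x t) \<in> borel_measurable borel"
    "t > 0 \<Longrightarrow> (\<lambda>x. \<sigma> x t) \<in> borel_measurable borel"
  by (auto intro!: borel_measurable_continuous_onI continuous_on_slice cont_\<mu> cont_\<sigma>)

lemma \<sigma>_integrable: "t > 0 \<Longrightarrow> integrable lborel (\<lambda>x. \<sigma> x t)"
proof (rule integrableI_nonneg)
  assume t: "t > 0"
  show "(\<integral>\<^sup>+x. ennreal (\<sigma> x t) \<partial>lborel) < \<infinity>" using mass[OF t] by (rule le_less_trans) simp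
qed (auto simp: slice_measurable \<sigma>_nonneg)

lemma \<sigma>_strip_integrable:
  assumes s: "0 < s1" "s1 \<le> s2"
  shows "integrable lborel (\<lambda>z. indicator {s1..s2} (snd z) * \<sigma> (fst z) (snd z))"
proof -
  have m: "(\<lambda>z. indicator {s1..s2} (snd z) * \<sigma> (fst z) (snd z)) \<in> borel_measurable borel"
    using borel_measurable_strip[OF cont_\<sigma>, of "{s1..s2}"] s by (simp add: subset_iff)
  have "(\<integral>\<^sup>+z. ennreal (indicator {s1..s2} (snd z) * \<sigma> (fst z) (snd z)) \<partial>(lborel :: ('a \<times> real) measure))
    = (\<integral>\<^sup>+t. \<integral>\<^sup>+x. ennreal (indicator {s1..s2} t * \<sigma> x t) \<partial>lborel \<partial>lborel)"
    using m by (subst lborel_prod[symmetric], subst lborel_pair.nn_integral_snd[symmetric]) (auto simp: borel_prod[symmetric])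
  also have "\<dots> \<le> (\<integral>\<^sup>+t. 2 * indicator {s1..s2} t \<partial>lborel)"
  proof (rule nn_integral_mono)
    fix t :: real
    show "(\<integral>\<^sup>+x. ennreal (indicator {s1..s2} t * \<sigma> x t) \<partial>lborel) \<le> 2 * indicator {s1..s2} t"
      using mass[of t] s by (auto simp: indicator_def)
  qed
  also have "\<dots> < \<infinity>" using s by (simp add: nn_integral_cmult_indicator ennreal_mult_less_top)
  finally show ?thesis
    using m by (intro integrableI_nonneg AE_I2) (use s in \<open>auto simp: indicator_def \<sigma>_nonneg\<close>)
qed

text \<open>The cut-off error terms all carry a derivative of the bump function.\<close>

lemma truncated_duhamel:
  fixes x0 :: 'a and s1 s2 T R :: real
  assumes s: "0 < s1" "s1 \<le> s2" "s2 < T" and R: "R > 0"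
  defines "E \<equiv> \<lambda>y s. \<mu> y s * (2 * (bump_grad R y \<bullet> heat_grad (T - s) (y - x0))
        + heat (T - s) (y - x0) * (\<Sum>b\<in>Basis. bump_hess R y b \<bullet> b))
      - q y s \<bullet> (heat (T - s) (y - x0) *\<^sub>R bump_grad R y + bump R y *\<^sub>R heat_grad (T - s) (y - x0))"
  shows "integrable lborel (\<lambda>z. indicator {s1..s2} (snd z) * E (fst z) (snd z))"
    and "(LINT y|lborel. \<mu> y s2 * (bump R y * heat (T - s2) (y - x0)))
       - (LINT y|lborel. \<mu> y s1 * (bump R y * heat (T - s1) (y - x0)))
     = (LINT z|lborel. indicator {s1..s2} (snd z) * E (fst z) (snd z))"
proof -
  define \<Gamma> where "\<Gamma> y s = heat (T - s) (y - x0)" for y s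
  define \<Gamma>g where "\<Gamma>g y s = heat_grad (T - s) (y - x0)" for y s
  \<comment> \<open>Next to its spatial derivatives, \<Gamma> has time derivative -\<Gamma>l, where
    \<Gamma>l is also its Laplacian: it solves the backward heat equation. The terms with \<Gamma>l
    therefore cancel and only derivatives of the cut-off survive in \<open>E\<close>.\<close>
  define \<Gamma>h where "\<Gamma>h y s v = (- (heat (T - s) (y - x0) / (2 * (T - s)))) *\<^sub>R v
     - ((heat_grad (T - s) (y - x0) \<bullet> v) / (2 * (T - s))) *\<^sub>R (y - x0)" for y s v
  define \<Gamma>l where "\<Gamma>l y s = heat (T - s) (y - x0) * (((y - x0) \<bullet> (y - x0)) / (4 * (T - s)\<^sup>2) - DIM('a) / (2 * (T - s)))" for y s
  define \<phi> where "\<phi> y s = bump R y * \<Gamma> y s" for y s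
  define \<phi>g where "\<phi>g y s = \<Gamma> y s *\<^sub>R bump_grad R y + bump R y *\<^sub>R \<Gamma>g y s" for y s
  define \<phi>h where "\<phi>h y s v = (\<Gamma> y s *\<^sub>R bump_hess R y v + (\<Gamma>g y s \<bullet> v) *\<^sub>R bump_grad R y)
     + (bump R y *\<^sub>R \<Gamma>h y s v + (bump_grad R y \<bullet> v) *\<^sub>R \<Gamma>g y s)" for y s v
  \<comment> \<open>\<open>D\<close> is the time derivative of \<mu> \<phi>. Integrating it first in
    time gives the boundary terms at \<open>s2\<close> and \<open>s1\<close>; integrating first in
    space, integration by parts replaces it by \<open>E\<close>. Fubini identifies the two.\<close>
  define D where "D y s = mt y s * \<phi> y s - \<mu> y s * (bump R y * \<Gamma>l y s)" for y s
  have E: "E y s = \<mu> y s * (2 * (bump_grad R y \<bullet> \<Gamma>g y s) + \<Gamma> y s * (\<Sum>b\<in>Basis. bump_hess R y b \<bullet> b)) - q y s \<bullet> \<phi>g y s" for y s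
    unfolding E_def \<Gamma>_def \<Gamma>g_def \<phi>g_def ..
  have \<Gamma>d: "((\<lambda>y. \<Gamma> y s) has_derivative (\<lambda>v. \<Gamma>g y s \<bullet> v)) (at y)" if "s < T" for y s
  proof -
    have "((\<lambda>y. y - x0) has_derivative (\<lambda>v. v)) (at y)" by (auto intro!: derivative_eq_intros)
    from has_derivative_compose[OF this heat_has_derivative[of "T - s"]] that show ?thesis by (simp add: \<Gamma>_def \<Gamma>g_def)
  qed
  have \<Gamma>gd: "((\<lambda>y. \<Gamma>g y s) has_derivative \<Gamma>h y s) (at y)" if "s < T" for y s
  proof -
    have "((\<lambda>y. y - x0) has_derivative (\<lambda>v. v)) (at y)" by (auto intro!: derivative_eq_intros)
    from has_derivative_compose[OF this heat_grad_has_derivative[of "T - s"]] that show ?thesis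
      by (simp add: \<Gamma>h_def[abs_def] \<Gamma>g_def)
  qed
  have \<Gamma>t: "((\<lambda>s. \<Gamma> y s) has_real_derivative - \<Gamma>l y s) (at s)" if "s < T" for y s
  proof -
    have "((\<lambda>s. T - s) has_real_derivative -1) (at s)" by (auto intro!: derivative_eq_intros)
    from DERIV_chain2[where f = "\<lambda>\<tau>. heat \<tau> (y - x0)" and g = "\<lambda>s. T - s", OF heat_has_time_derivative this] that
    show ?thesis by (simp add: \<Gamma>_def \<Gamma>l_def)
  qed
  have \<Gamma>lap: "(\<Sum>b\<in>Basis. \<Gamma>h y s b \<bullet> b) = \<Gamma>l y s" if "s < T" for y s
    unfolding \<Gamma>h_def \<Gamma>l_def using that by (intro heat_laplacian) simp
  have \<phi>d: "((\<lambda>y. \<phi> y s) has_derivative (\<lambda>v. \<phi>g y s \<bullet> v)) (at y)" if "s < T" for y s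
    unfolding \<phi>_def \<phi>g_def
    by (rule has_derivative_eq_rhs[OF has_derivative_mult[OF bump_derivative[OF R] \<Gamma>d[OF that]]])
       (auto simp: fun_eq_iff inner_add_left)
  have \<phi>gd: "((\<lambda>y. \<phi>g y s) has_derivative \<phi>h y s) (at y)" if "s < T" for y s
    unfolding \<phi>g_def \<phi>h_def[abs_def]
    by (intro has_derivative_add has_derivative_scaleR bump_grad_derivative[OF R] \<Gamma>gd[OF that] \<Gamma>d[OF that] bump_derivative[OF R])
  have \<phi>lap: "(\<Sum>b\<in>Basis. \<phi>h y s b \<bullet> b) = \<Gamma> y s * (\<Sum>b\<in>Basis. bump_hess R y b \<bullet> b)
      + 2 * (bump_grad R y \<bullet> \<Gamma>g y s) + bump R y * \<Gamma>l y s" if "s < T" for y s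
  proof -
    have i: "(\<Sum>b\<in>Basis. (a \<bullet> b) * (c \<bullet> b)) = a \<bullet> c" for a c :: 'a by (rule euclidean_inner[symmetric])
    have "(\<Sum>b\<in>Basis. \<phi>h y s b \<bullet> b) = (\<Gamma> y s * (\<Sum>b\<in>Basis. bump_hess R y b \<bullet> b) + (\<Sum>b\<in>Basis. (\<Gamma>g y s \<bullet> b) * (bump_grad R y \<bullet> b)))
      + (bump R y * (\<Sum>b\<in>Basis. \<Gamma>h y s b \<bullet> b) + (\<Sum>b\<in>Basis. (bump_grad R y \<bullet> b) * (\<Gamma>g y s \<bullet> b)))"
      by (simp only: \<phi>h_def inner_add_left sum.distrib inner_scaleR_left sum_distrib_left)
    moreover have "\<Gamma>g y s \<bullet> bump_grad R y = bump_grad R y \<bullet> \<Gamma>g y s" by (rule inner_commute)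
    ultimately show ?thesis unfolding i \<Gamma>lap[OF that] by simp
  qed
  have bz: "bump_base R y = 0" if "norm y > R" for y :: 'a using that bump_base_eq_0[OF R, of y] by simp
  have supp: "\<phi> y s = 0" "\<phi>g y s = 0" "\<phi>h y s v = 0" if "norm y > R" for y s v
    using bz[OF that] by (simp_all add: \<phi>_def \<phi>g_def \<phi>h_def bump_def bump_grad_def bump_hess_def)
  have D0: "D y s = 0" and E0: "E y s = 0" if "norm y > R" for y s
    using supp[OF that] bz[OF that] by (simp_all add: D_def E bump_def bump_grad_def bump_hess_def)
  have space: "integrable lborel (\<lambda>y. D y s - E y s)" "(LINT y|lborel. D y s - E y s) = 0" if s: "0 < s" "s < T" for s
  proof -
    have DE: "D y s - E y s = ((\<Sum>b\<in>Basis. h y s b \<bullet> b) + (\<Sum>b\<in>Basis. q' y s b \<bullet> b)) * \<phi> y s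
         - (\<mu> y s * (\<Sum>b\<in>Basis. \<phi>h y s b \<bullet> b) - q y s \<bullet> \<phi>g y s)" for y
      unfolding D_def E \<phi>lap[OF s(2)] eqn[OF s(1)] by (simp add: algebra_simps)
    have cb: "\<exists>K. \<forall>y. norm y \<le> R \<longrightarrow> norm (f y) \<le> K" if fc: "continuous_on (cball 0 R) f" for f :: "'a \<Rightarrow> 'b::real_normed_vector"
    proof -
      obtain K where "\<forall>x\<in>f ` cball 0 R. norm x \<le> K"
        using compact_imp_bounded[OF compact_continuous_image[OF fc compact_cball]] by (auto simp: bounded_iff)
      then show ?thesis by (intro exI[of _ K]) auto
    qed
    have cbB: "\<exists>K. \<forall>y b. norm y \<le> R \<longrightarrow> b \<in> Basis \<longrightarrow> norm (f y b) \<le> K"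
      if "\<And>b. continuous_on (cball 0 R) (\<lambda>y. f y b)" for f :: "'a \<Rightarrow> 'a \<Rightarrow> 'a"
    proof -
      have "\<forall>b. \<exists>K. \<forall>y. norm y \<le> R \<longrightarrow> norm (f y b) \<le> K" using cb[OF that] by blast
      then obtain K where K: "\<And>b y. norm y \<le> R \<Longrightarrow> norm (f y b) \<le> K b" by metis
      show ?thesis
      proof (intro exI[of _ "\<Sum>b\<in>Basis. \<bar>K b\<bar>"] allI impI)
        fix y b :: 'a assume "norm y \<le> R" "b \<in> Basis"
        then have "norm (f y b) \<le> \<bar>K b\<bar>" using K[of y b] by linarith
        also have "\<dots> \<le> (\<Sum>b\<in>Basis. \<bar>K b\<bar>)" using \<open>b \<in> Basis\<close> by (intro member_le_sum) auto
        finally show "norm (f y b) \<le> (\<Sum>b\<in>Basis. \<bar>K b\<bar>)" .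
      qed
    qed
    have c\<Gamma>: "continuous_on A (\<lambda>y. \<Gamma> y s)" "continuous_on A (\<lambda>y. \<Gamma>g y s)" "continuous_on A (\<lambda>y. \<Gamma>h y s v)" for A v
      unfolding \<Gamma>_def \<Gamma>g_def \<Gamma>h_def using s by (auto intro!: continuous_intros continuous_on_heat)
    have c\<phi>: "continuous_on A (\<lambda>y. \<phi> y s)" "continuous_on A (\<lambda>y. \<phi>g y s)" "continuous_on A (\<lambda>y. \<phi>h y s v)" for A v
      unfolding \<phi>_def \<phi>g_def \<phi>h_def by (intro continuous_intros bump_continuous c\<Gamma>)+
    obtain K1 where K1: "\<forall>y. norm y \<le> R \<longrightarrow> norm (\<phi> y s) \<le> K1"
      using cb[OF c\<phi>(1)] by (rule exE)
    obtain K2 where K2: "\<forall>y. norm y \<le> R \<longrightarrow> norm (\<phi>g y s) \<le> K2"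
      using cb[OF c\<phi>(2)] by (rule exE)
    obtain K3 where K3: "\<forall>y b. norm y \<le> R \<longrightarrow> b \<in> Basis \<longrightarrow> norm (\<phi>h y s b) \<le> K3"
      using cbB[of "\<lambda>y. \<phi>h y s", OF c\<phi>(3)] by (rule exE)
    obtain K4 where K4: "\<forall>y. norm y \<le> R \<longrightarrow> norm (\<mu> y s) \<le> K4"
      using cb[of "\<lambda>y. \<mu> y s", OF continuous_on_slice[OF cont_\<mu> s(1)]] by (rule exE)
    obtain K5 where K5: "\<forall>y. norm y \<le> R \<longrightarrow> norm (g y s) \<le> K5"
      using cb[of "\<lambda>y. g y s", OF continuous_on_slice[OF cont_g s(1)]] by (rule exE)
    obtain K6 where K6: "\<forall>y b. norm y \<le> R \<longrightarrow> b \<in> Basis \<longrightarrow> norm (h y s b) \<le> K6"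
      using cbB[of "\<lambda>y. h y s", OF continuous_on_slice[OF cont_h s(1)]] by (rule exE)
    obtain K7 where K7: "\<forall>y. norm y \<le> R \<longrightarrow> norm (q y s) \<le> K7"
      using cb[of "\<lambda>y. q y s", OF continuous_on_slice[OF cont_q s(1)]] by (rule exE)
    obtain K8 where K8: "\<forall>y b. norm y \<le> R \<longrightarrow> b \<in> Basis \<longrightarrow> norm (q' y s b) \<le> K8"
      using q'_bdd[OF s(1), of R] by (rule exE)
    define K where "K = Max {K1, K2, K3, K4, K5, K6, K7, K8}"
    have "K1 \<le> K" "K2 \<le> K" "K3 \<le> K" "K4 \<le> K" "K5 \<le> K" "K6 \<le> K" "K7 \<le> K" "K8 \<le> K"
      unfolding K_def by (rule Max_ge; simp)+
    note K = order_trans[OF K1[rule_format] this(1)] order_trans[OF K2[rule_format] this(2)] order_trans[OF K3[rule_format] this(3)] order_trans[OF K4[rule_format] this(4)]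
       order_trans[OF K5[rule_format] this(5)] order_trans[OF K6[rule_format] this(6)] order_trans[OF K7[rule_format] this(7)] order_trans[OF K8[rule_format] this(8)]
    have bd: "\<bar>\<phi> y s\<bar> \<le> K \<and> norm (\<phi>g y s) \<le> K \<and> norm (\<phi>h y s b) \<le> K \<and> \<bar>\<mu> y s\<bar> \<le> K \<and> norm (g y s) \<le> K
        \<and> norm (h y s b) \<le> K \<and> norm (q y s) \<le> K \<and> norm (q' y s b) \<le> K" if "norm y \<le> R" "b \<in> Basis" for y b
      using K that by simp
    note ibp = integral_by_parts_compact[of "\<lambda>y. \<phi> y s" "\<lambda>y. \<phi>g y s" "\<lambda>y. \<phi>h y s" "\<lambda>y. \<mu> y s" "\<lambda>y. g y s" "\<lambda>y. h y s"
       "\<lambda>y. q y s" "\<lambda>y. q' y s", OF \<phi>d[OF s(2)] \<phi>gd[OF s(2)] \<mu>_deriv[OF s(1)] g_deriv[OF s(1)] q_deriv[OF s(1)] supp bd]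
    show "integrable lborel (\<lambda>y. D y s - E y s)" unfolding DE by (rule ibp(1))
    show "(LINT y|lborel. D y s - E y s) = 0" unfolding DE by (rule ibp(2))
  qed
  define A where "A = cball (0::'a) R \<times> {s1..s2}"
  have Apos: "snd z > 0" "snd z < T" if "z \<in> A" for z using that s by (auto simp: A_def)
  have cA: "continuous_on A (\<lambda>z. \<Gamma> (fst z) (snd z))" "continuous_on A (\<lambda>z. \<Gamma>g (fst z) (snd z))" "continuous_on A (\<lambda>z. \<Gamma>l (fst z) (snd z))"
    unfolding \<Gamma>_def \<Gamma>g_def \<Gamma>l_def
    by (intro continuous_intros continuous_on_heat; use Apos in force)+
  have cB: "continuous_on A (\<lambda>z. bump R (fst z))" "continuous_on A (\<lambda>z. bump_grad R (fst z))" "continuous_on A (\<lambda>z. bump_hess R (fst z) v)" for v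
    unfolding bump_def bump_grad_def bump_hess_def bump_base_def divide_inverse by (intro continuous_intros)+
  have Ac: "compact A" unfolding A_def by (intro compact_Times compact_cball compact_Icc)
  have indA: "indicator A z *\<^sub>R f (fst z) (snd z) = indicator {s1..s2} (snd z) * f (fst z) (snd z)"
    if "\<And>y s. norm y > R \<Longrightarrow> f y s = 0" for f :: "'a \<Rightarrow> real \<Rightarrow> real" and z
    using that[of "fst z" "snd z"] by (cases z) (auto simp: A_def indicator_def)
  have cD: "continuous_on A (\<lambda>z. D (fst z) (snd z))"
    unfolding D_def \<phi>_def by (intro continuous_intros cA cB continuous_on_strip cont_mt cont_\<mu> Apos)
  have cE: "continuous_on A (\<lambda>z. E (fst z) (snd z))"
    unfolding E \<phi>g_def by (intro continuous_intros cA cB continuous_on_strip cont_q cont_\<mu> Apos)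
  have Di: "integrable lborel (\<lambda>z. indicator {s1..s2} (snd z) * D (fst z) (snd z))"
    using borel_integrable_compact[OF Ac cD] by (simp only: indA[of D, OF D0])
  show Ei: "integrable lborel (\<lambda>z. indicator {s1..s2} (snd z) * E (fst z) (snd z))"
    using borel_integrable_compact[OF Ac cE] by (simp only: indA[of E, OF E0])
  have ftc: "(LINT s|lborel. indicator {s1..s2} s * D y s) = \<mu> y s2 * \<phi> y s2 - \<mu> y s1 * \<phi> y s1" for y
  proof -
    have "(LINT s|lborel. indicator {s1..s2} s *\<^sub>R D y s) = \<mu> y s2 * \<phi> y s2 - \<mu> y s1 * \<phi> y s1"
    proof (rule integral_FTC_atLeastAtMost[OF s(2)])
      fix t assume t: "s1 \<le> t" "t \<le> s2"
      then have t': "0 < t" "t < T" using s by auto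
      have "((\<lambda>s. \<mu> y s * \<phi> y s) has_real_derivative D y t) (at t)"
        unfolding \<phi>_def D_def
        by (rule DERIV_cong[OF DERIV_mult[OF \<mu>_time[OF t'(1)] DERIV_cmult[OF \<Gamma>t[OF t'(2)]]]]) (simp add: algebra_simps)
      then show "((\<lambda>s. \<mu> y s * \<phi> y s) has_vector_derivative D y t) (at t within {s1..s2})"
        by (simp add: has_real_derivative_iff_has_vector_derivative has_vector_derivative_at_within)
    next
      show "continuous_on {s1..s2} (D y)"
      proof (cases "norm y \<le> R")
        case True
        have "continuous_on {s1..s2} ((\<lambda>z. D (fst z) (snd z)) \<circ> (\<lambda>s. (y, s)))"
          by (intro continuous_on_compose continuous_on_subset[OF cD] continuous_intros) (use True in \<open>auto simp: A_def\<close>)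
        then show ?thesis by (simp add: comp_def)
      next
        case False
        then have "D y = (\<lambda>_. 0)" using D0 by auto
        then show ?thesis by simp
      qed
    qed
    then show ?thesis by simp
  qed
  have "(LINT z|lborel. indicator {s1..s2} (snd z) * D (fst z) (snd z))
     = (LINT y|lborel. LINT s|lborel. indicator {s1..s2} s * D y s)"
    using lborel_pair.integral_fst'[of "\<lambda>z. indicator {s1..s2} (snd z) * D (fst z) (snd z)"] Di by (simp add: lborel_prod)
  also have "\<dots> = (LINT y|lborel. \<mu> y s2 * \<phi> y s2 - \<mu> y s1 * \<phi> y s1)" unfolding ftc ..
  also have "\<dots> = (LINT y|lborel. \<mu> y s2 * \<phi> y s2) - (LINT y|lborel. \<mu> y s1 * \<phi> y s1)"
  proof (rule Bochner_Integration.integral_diff)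
    have "integrable lborel (\<lambda>y. \<mu> y t * \<phi> y t)" if t: "0 < t" "t < T" for t
    proof -
      have "continuous_on (cball 0 R) (\<lambda>y. \<mu> y t * \<phi> y t)"
        unfolding \<phi>_def \<Gamma>_def using t
        by (intro continuous_intros continuous_on_slice[OF cont_\<mu>] bump_continuous continuous_on_heat) auto
      from borel_integrable_compact[OF compact_cball this]
      have "integrable lborel (\<lambda>y. indicator (cball 0 R) y *\<^sub>R (\<mu> y t * \<phi> y t))" .
      moreover have "(\<lambda>y. indicator (cball 0 R) y *\<^sub>R (\<mu> y t * \<phi> y t)) = (\<lambda>y. \<mu> y t * \<phi> y t)"
        using supp(1) by (auto simp: fun_eq_iff indicator_def)
      ultimately show ?thesis by simp
    qed
    then show "integrable lborel (\<lambda>y. \<mu> y s2 * \<phi> y s2)" "integrable lborel (\<lambda>y. \<mu> y s1 * \<phi> y s1)"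
      using s by auto
  qed
  finally have 1: "(LINT z|lborel. indicator {s1..s2} (snd z) * D (fst z) (snd z))
    = (LINT y|lborel. \<mu> y s2 * \<phi> y s2) - (LINT y|lborel. \<mu> y s1 * \<phi> y s1)" .
  have "(LINT z|lborel. indicator {s1..s2} (snd z) * D (fst z) (snd z)) - (LINT z|lborel. indicator {s1..s2} (snd z) * E (fst z) (snd z))
     = (LINT z|lborel. indicator {s1..s2} (snd z) * (D (fst z) (snd z) - E (fst z) (snd z)))"
    using Di Ei by (simp add: right_diff_distrib)
  also have "\<dots> = (LINT t|lborel. LINT y|lborel. indicator {s1..s2} t * (D y t - E y t))"
  proof -
    have "integrable (lborel \<Otimes>\<^sub>M lborel) (case_prod (\<lambda>y t. indicator {s1..s2} t * (D y t - E y t)))"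
      using Di Ei by (simp add: lborel_prod right_diff_distrib case_prod_unfold)
    from lborel_pair.integral_snd[OF this] show ?thesis by (simp add: lborel_prod case_prod_unfold)
  qed
  also have "\<dots> = (LINT t|(lborel::real measure). 0)"
    using s by (intro Bochner_Integration.integral_cong) (auto simp: indicator_def space)
  finally have 2: "(LINT z|lborel. indicator {s1..s2} (snd z) * D (fst z) (snd z))
      = (LINT z|lborel. indicator {s1..s2} (snd z) * E (fst z) (snd z))" by simp
  show "(LINT y|lborel. \<mu> y s2 * (bump R y * heat (T - s2) (y - x0)))
       - (LINT y|lborel. \<mu> y s1 * (bump R y * heat (T - s1) (y - x0)))
     = (LINT z|lborel. indicator {s1..s2} (snd z) * E (fst z) (snd z))"
    using 1 2 unfolding \<phi>_def \<Gamma>_def by simp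
qed

end

section \<open>Removing the cut-off and reaching the terminal time\<close>

lemma lborel_shift:
  fixes f :: "'a::euclidean_space \<Rightarrow> 'b::{banach, second_countable_topology}"
  assumes [measurable]: "f \<in> borel_measurable borel"
  shows "integrable lborel (\<lambda>x. f (x - c)) \<longleftrightarrow> integrable lborel f"
    and "(LINT x|lborel. f (x - c)) = (LINT x|lborel. f x)"
proof -
  have e: "(\<lambda>x. f (x - c)) = (\<lambda>x. f (- c + x))" by (simp add: add.commute)
  have "integrable (distr lborel borel ((+) (- c))) f \<longleftrightarrow> integrable lborel (\<lambda>x. f (- c + x))"
    by (rule integrable_distr_eq) auto
  then show "integrable lborel (\<lambda>x. f (x - c)) \<longleftrightarrow> integrable lborel f"
    unfolding e by (simp only: lborel_distr_plus)
  have "(LINT x|distr lborel borel ((+) (- c)). f x) = (LINT x|lborel. f (- c + x))"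
    by (rule integral_distr) auto
  then show "(LINT x|lborel. f (x - c)) = (LINT x|lborel. f x)"
    unfolding e by (simp only: lborel_distr_plus)
qed

lemma nn_integral_lborel_shift:
  fixes f :: "'a::euclidean_space \<Rightarrow> ennreal"
  assumes [measurable]: "f \<in> borel_measurable borel"
  shows "(\<integral>\<^sup>+x. f (x - c) \<partial>lborel) = (\<integral>\<^sup>+x. f x \<partial>lborel)"
proof -
  have "(\<integral>\<^sup>+x. f x \<partial>distr lborel borel ((+) (- c))) = (\<integral>\<^sup>+x. f (- c + x) \<partial>lborel)"
    by (rule nn_integral_distr) auto
  then show ?thesis by (simp only: lborel_distr_plus) (simp add: add.commute)
qed

lemma integral_heat_second_moment:
  fixes \<tau> :: real
  assumes "\<tau> > 0"
  shows "integrable lborel (\<lambda>z::'a::euclidean_space. (z \<bullet> z) * heat \<tau> z)"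
    and "(LINT z|(lborel::'a measure). (z \<bullet> z) * heat \<tau> z) = 2 * DIM('a) * \<tau>"
proof -
  show i: "integrable lborel (\<lambda>z::'a. (z \<bullet> z) * heat \<tau> z)"
    using assms by (intro integrableI_nonneg AE_I2) (auto simp: nn_integral_heat_second_moment[OF assms])
  have "ennreal (LINT z|(lborel::'a measure). (z \<bullet> z) * heat \<tau> z) = ennreal (2 * DIM('a) * \<tau>)"
    using assms by (subst nn_integral_eq_integral[OF i, symmetric]) (auto simp: nn_integral_heat_second_moment[OF assms])
  then show "(LINT z|(lborel::'a measure). (z \<bullet> z) * heat \<tau> z) = 2 * DIM('a) * \<tau>"
    using assms by (subst (asm) ennreal_inj) (auto intro!: integral_nonneg_AE)
qed

text \<open>In the variable x = r^2 / (4 \<tau>) the expression is controlled by a multiple of x^n /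
  exp x. Once 4 pi \<tau> is below 1 its square root may be replaced by the smaller number itself,
  which makes the powers match.\<close>

lemma gaussian_tail_tendsto_0:
  fixes r :: real
  assumes r: "r > 0"
  shows "((\<lambda>\<tau>. exp (- (r\<^sup>2) / (4 * \<tau>)) / sqrt (4 * pi * \<tau>) ^ n) \<longlongrightarrow> 0) (at_right 0)"
proof (rule tendsto_sandwich[where f = "\<lambda>_. 0" and
      h = "\<lambda>\<tau>. (1 / (pi * r\<^sup>2)) ^ n * ((r\<^sup>2 / (4 * \<tau>)) ^ n / exp (r\<^sup>2 / (4 * \<tau>)))"])
  have lim: "filterlim (\<lambda>\<tau>::real. r\<^sup>2 / (4 * \<tau>)) at_top (at_right 0)"
  proof -
    have "filterlim (\<lambda>\<tau>::real. (r\<^sup>2 / 4) * inverse \<tau>) at_top (at_right 0)"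
      by (rule filterlim_tendsto_pos_mult_at_top[OF tendsto_const _ filterlim_inverse_at_top_right]) (use r in simp)
    moreover have "r\<^sup>2 / (4 * \<tau>) = (r\<^sup>2 / 4) * inverse \<tau>" for \<tau> by (simp add: inverse_eq_divide)
    ultimately show ?thesis by simp
  qed
  from filterlim_compose[OF tendsto_power_div_exp_0[of n] lim]
  have "((\<lambda>\<tau>. (1 / (pi * r\<^sup>2)) ^ n * ((r\<^sup>2 / (4 * \<tau>)) ^ n / exp (r\<^sup>2 / (4 * \<tau>)))) \<longlongrightarrow> (1 / (pi * r\<^sup>2)) ^ n * 0) (at_right 0)"
    by (intro tendsto_mult tendsto_const)
  then show "((\<lambda>\<tau>. (1 / (pi * r\<^sup>2)) ^ n * ((r\<^sup>2 / (4 * \<tau>)) ^ n / exp (r\<^sup>2 / (4 * \<tau>)))) \<longlongrightarrow> 0) (at_right 0)"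
    by simp
  show "eventually (\<lambda>\<tau>. 0 \<le> exp (- (r\<^sup>2) / (4 * \<tau>)) / sqrt (4 * pi * \<tau>) ^ n) (at_right 0)"
    using eventually_at_right_less[of 0] by eventually_elim auto
  have "eventually (\<lambda>\<tau>::real. 0 < \<tau> \<and> \<tau> < 1 / (4 * pi)) (at_right 0)"
    by (intro eventually_conj eventually_at_right_less) (auto simp: eventually_at_right_field intro!: exI[of _ "1 / (4 * pi)"])
  then show "eventually (\<lambda>\<tau>. exp (- (r\<^sup>2) / (4 * \<tau>)) / sqrt (4 * pi * \<tau>) ^ n
     \<le> (1 / (pi * r\<^sup>2)) ^ n * ((r\<^sup>2 / (4 * \<tau>)) ^ n / exp (r\<^sup>2 / (4 * \<tau>)))) (at_right 0)"
  proof eventually_elim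
    case (elim \<tau>)
    define a where "a = 4 * pi * \<tau>"
    have a: "0 < a" "a < 1" using elim by (auto simp: a_def field_simps)
    have "a\<^sup>2 \<le> a" using a by (simp add: power2_eq_square mult_left_le)
    then have "a \<le> sqrt a" using a by (simp add: real_le_rsqrt)
    then have "1 / sqrt a ^ n \<le> 1 / a ^ n"
      using a by (intro divide_left_mono power_mono mult_pos_pos) auto
    moreover have "(1 / (pi * r\<^sup>2)) ^ n * (r\<^sup>2 / (4 * \<tau>)) ^ n = 1 / a ^ n"
    proof -
      have "(1 / (pi * r\<^sup>2)) * (r\<^sup>2 / (4 * \<tau>)) = 1 / a" using r elim by (simp add: a_def)
      then have "((1 / (pi * r\<^sup>2)) * (r\<^sup>2 / (4 * \<tau>))) ^ n = 1 / a ^ n" by (simp only: power_one_over)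
      then show ?thesis by (simp only: power_mult_distrib)
    qed
    ultimately have "exp (- (r\<^sup>2 / (4 * \<tau>))) * (1 / sqrt a ^ n)
       \<le> exp (- (r\<^sup>2 / (4 * \<tau>))) * ((1 / (pi * r\<^sup>2)) ^ n * (r\<^sup>2 / (4 * \<tau>)) ^ n)"
      by (intro mult_left_mono) auto
    moreover have "exp (- (r\<^sup>2) / (4 * \<tau>)) / sqrt (4 * pi * \<tau>) ^ n = exp (- (r\<^sup>2 / (4 * \<tau>))) * (1 / sqrt a ^ n)"
      by (simp add: a_def)
    moreover have "(1 / (pi * r\<^sup>2)) ^ n * ((r\<^sup>2 / (4 * \<tau>)) ^ n / exp (r\<^sup>2 / (4 * \<tau>)))
      = exp (- (r\<^sup>2 / (4 * \<tau>))) * ((1 / (pi * r\<^sup>2)) ^ n * (r\<^sup>2 / (4 * \<tau>)) ^ n)"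
      unfolding exp_minus divide_inverse by (simp only: mult_ac)
    ultimately show ?case by (simp only:)
  qed
qed auto

context fp_difference begin

lemma slice_heat_integrable:
  assumes t: "0 < t" "t < T"
  shows "integrable lborel (\<lambda>y. \<mu> y t * heat (T - t) (y - x0))"
proof (rule Bochner_Integration.integrable_bound)
  show "integrable lborel (\<lambda>y. (1 / sqrt (4 * pi * (T - t)) ^ DIM('a)) * \<sigma> y t)"
    using \<sigma>_integrable[OF t(1)] by (rule integrable_mult_right)
  show "(\<lambda>y. \<mu> y t * heat (T - t) (y - x0)) \<in> borel_measurable lborel"
    using slice_measurable(1)[OF t(1)] unfolding heat_def by measurable
  show "AE y in lborel. norm (\<mu> y t * heat (T - t) (y - x0))
      \<le> norm ((1 / sqrt (4 * pi * (T - t)) ^ DIM('a)) * \<sigma> y t)"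
  proof (rule AE_I2)
    fix y
    have "\<bar>\<mu> y t\<bar> * heat (T - t) (y - x0) \<le> \<sigma> y t * (1 / sqrt (4 * pi * (T - t)) ^ DIM('a))"
      using \<mu>_le[OF t(1), of y] heat_le[of "T - t" "y - x0"] t by (intro mult_mono) auto
    then show "norm (\<mu> y t * heat (T - t) (y - x0)) \<le> norm ((1 / sqrt (4 * pi * (T - t)) ^ DIM('a)) * \<sigma> y t)"
      using t \<sigma>_nonneg[OF t(1), of y] by (simp add: abs_mult mult.commute)
  qed
qed

text \<open>The cut-off radius tends to infinity in the truncated formula. Because \<open>s2\<close>
  < T keeps the kernel away from its singularity, a single multiple of \<sigma> on the strip
  dominates all error terms.\<close>

lemma duhamel_interior:
  assumes s: "0 < s1" "s1 \<le> s2" "s2 < T"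
  shows "(LINT y|lborel. \<mu> y s2 * heat (T - s2) (y - x0)) - (LINT y|lborel. \<mu> y s1 * heat (T - s1) (y - x0))
     = - (LINT z|lborel. indicator {s1..s2} (snd z) * (q (fst z) (snd z) \<bullet> heat_grad (T - snd z) (fst z - x0)))"
proof -
  define E where "E i y s = \<mu> y s * (2 * (bump_grad (real (Suc i)) y \<bullet> heat_grad (T - s) (y - x0))
        + heat (T - s) (y - x0) * (\<Sum>b\<in>Basis. bump_hess (real (Suc i)) y b \<bullet> b))
      - q y s \<bullet> (heat (T - s) (y - x0) *\<^sub>R bump_grad (real (Suc i)) y + bump (real (Suc i)) y *\<^sub>R heat_grad (T - s) (y - x0))" for i y s
  define L where "L i t = (LINT y|lborel. \<mu> y t * (bump (real (Suc i)) y * heat (T - t) (y - x0)))" for i t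
  have td: "integrable lborel (\<lambda>z. indicator {s1..s2} (snd z) * E i (fst z) (snd z))"
     "L i s2 - L i s1 = (LINT z|lborel. indicator {s1..s2} (snd z) * E i (fst z) (snd z))" for i
    using truncated_duhamel[OF s, of "real (Suc i)" x0] unfolding E_def L_def by auto
  have b1: "(\<lambda>i. bump (real (Suc i)) y) \<longlonglongrightarrow> 1" for y :: 'a
    by (rule filterlim_compose[OF bump_tendsto filterlim_compose[OF filterlim_real_sequentially filterlim_Suc]])
  have inv0: "(\<lambda>i. c / real (Suc i)) \<longlonglongrightarrow> 0" for c :: real
    using tendsto_mult[OF tendsto_const[of c] LIMSEQ_inverse_real_of_nat] by (simp add: divide_inverse)
  have b2: "(\<lambda>i. bump_grad (real (Suc i)) y) \<longlonglongrightarrow> 0" for y :: 'a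
    by (rule Lim_null_comparison[OF _ inv0[of 6]]) (auto intro!: always_eventually norm_bump_grad_le)
  have hs: "\<bar>\<Sum>b\<in>Basis. bump_hess (real (Suc i)) y b \<bullet> b\<bar> \<le> DIM('a) * 30 / real (Suc i)" for i and y :: 'a
  proof -
    have "\<bar>bump_hess (real (Suc i)) y b \<bullet> b\<bar> \<le> 30 / real (Suc i)" if "b \<in> Basis" for b
    proof -
      have "\<bar>bump_hess (real (Suc i)) y b \<bullet> b\<bar> \<le> norm (bump_hess (real (Suc i)) y b)"
        using Cauchy_Schwarz_ineq2[of "bump_hess (real (Suc i)) y b" b] that by simp
      also have "\<dots> \<le> 30 / (real (Suc i))\<^sup>2" using that by (intro norm_bump_hess_le) auto
      also have "\<dots> \<le> 30 / real (Suc i)" by (intro divide_left_mono) (auto simp: power2_eq_square)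
      finally show ?thesis .
    qed
    then have "\<bar>\<Sum>b\<in>Basis. bump_hess (real (Suc i)) y b \<bullet> b\<bar> \<le> (\<Sum>b\<in>(Basis::'a set). 30 / real (Suc i))"
      by (intro order_trans[OF sum_abs] sum_mono)
    then show ?thesis by simp
  qed
  have b3: "(\<lambda>i. \<Sum>b\<in>Basis. bump_hess (real (Suc i)) y b \<bullet> b) \<longlonglongrightarrow> 0" for y :: 'a
    by (rule Lim_null_comparison[OF _ inv0[of "DIM('a) * 30"]]) (use hs in \<open>auto intro!: always_eventually\<close>)
  have lims: "(\<lambda>i. E i y t) \<longlonglongrightarrow> \<mu> y t * (2 * (0 \<bullet> heat_grad (T - t) (y - x0)) + heat (T - t) (y - x0) * 0)
      - q y t \<bullet> (heat (T - t) (y - x0) *\<^sub>R 0 + 1 *\<^sub>R heat_grad (T - t) (y - x0))" for y t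
    unfolding E_def by (intro tendsto_intros b1 b2 b3)
  define \<Gamma>0 where "\<Gamma>0 = 1 / sqrt (4 * pi * (T - s2)) ^ DIM('a)"
  define g0 where "g0 = (1 + 4 * (T - s1)) / (2 * (T - s2)) * \<Gamma>0"
  have \<Gamma>0: "\<Gamma>0 \<ge> 0" using s by (simp add: \<Gamma>0_def)
  have g00: "g0 \<ge> 0" using s \<Gamma>0 by (simp add: g0_def)
  have hb: "heat (T - t) z \<le> \<Gamma>0" "norm (heat_grad (T - t) z) \<le> g0" if "s1 \<le> t" "t \<le> s2" for t and z :: 'a
    using heat_grad_bound[of "T - s2" "T - t" "T - s1" z] that s by (auto simp: \<Gamma>0_def g0_def)
  \<comment> \<open>The radii are at least 1, so 6 bounds the gradient of the cut-off and 30 per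
    dimension its Laplacian; \<Gamma>0 and \<open>g0\<close> bound the kernel and its gradient on
    the time interval.\<close>
  define K where "K = (2 * (6 * g0) + \<Gamma>0 * (DIM('a) * 30)) + B * (\<Gamma>0 * 6 + 1 * g0)"
  have Ebd: "\<bar>E i y t\<bar> \<le> K * \<sigma> y t" if t: "s1 \<le> t" "t \<le> s2" for i y t
  proof -
    have t0: "t > 0" "T - t > 0" using t s by auto
    define R where "R = real (Suc i)"
    have R: "R \<ge> 1" "R > 0" by (auto simp: R_def)
    have "6 / R \<le> 6" using R by (simp add: field_simps)
    then have bg: "norm (bump_grad R y) \<le> 6" using norm_bump_grad_le[OF R(2), of y] by linarith
    have "DIM('a) * 30 / R \<le> DIM('a) * 30" using R by (simp add: field_simps)
    then have bh: "\<bar>\<Sum>b\<in>Basis. bump_hess R y b \<bullet> b\<bar> \<le> DIM('a) * 30" using hs[of i y] by (simp add: R_def)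
    have 1: "\<bar>bump_grad R y \<bullet> heat_grad (T - t) (y - x0)\<bar> \<le> 6 * g0"
      using bg hb(2)[OF t, of "y - x0"] g00
      by (intro order_trans[OF Cauchy_Schwarz_ineq2] mult_mono) auto
    have 2: "\<bar>heat (T - t) (y - x0) * (\<Sum>b\<in>Basis. bump_hess R y b \<bullet> b)\<bar> \<le> \<Gamma>0 * (DIM('a) * 30)"
      unfolding abs_mult using bh hb(1)[OF t, of "y - x0"] \<Gamma>0 heat_nonneg[OF t0(2), of "y - x0"] by (intro mult_mono) auto
    have "\<bar>2 * (bump_grad R y \<bullet> heat_grad (T - t) (y - x0)) + heat (T - t) (y - x0) * (\<Sum>b\<in>Basis. bump_hess R y b \<bullet> b)\<bar>
       \<le> 2 * (6 * g0) + \<Gamma>0 * (DIM('a) * 30)" using 1 2 by linarith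
    then have 3: "\<bar>\<mu> y t * (2 * (bump_grad R y \<bullet> heat_grad (T - t) (y - x0)) + heat (T - t) (y - x0) * (\<Sum>b\<in>Basis. bump_hess R y b \<bullet> b))\<bar>
       \<le> \<sigma> y t * (2 * (6 * g0) + \<Gamma>0 * (DIM('a) * 30))"
      unfolding abs_mult using \<mu>_le[OF t0(1), of y] by (intro mult_mono) auto
    have 4: "norm (heat (T - t) (y - x0) *\<^sub>R bump_grad R y + bump R y *\<^sub>R heat_grad (T - t) (y - x0)) \<le> \<Gamma>0 * 6 + 1 * g0"
    proof (rule order_trans[OF norm_triangle_ineq], rule add_mono)
      show "norm (heat (T - t) (y - x0) *\<^sub>R bump_grad R y) \<le> \<Gamma>0 * 6"
        unfolding norm_scaleR using bg hb(1)[OF t, of "y - x0"] \<Gamma>0 heat_nonneg[OF t0(2), of "y - x0"] by (intro mult_mono) auto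
      show "norm (bump R y *\<^sub>R heat_grad (T - t) (y - x0)) \<le> 1 * g0"
        unfolding norm_scaleR using bump_bounds[of R y] hb(2)[OF t, of "y - x0"] by (intro mult_mono) auto
    qed
    have "\<bar>q y t \<bullet> (heat (T - t) (y - x0) *\<^sub>R bump_grad R y + bump R y *\<^sub>R heat_grad (T - t) (y - x0))\<bar>
       \<le> (B * \<sigma> y t) * (\<Gamma>0 * 6 + 1 * g0)"
      using q_le[OF t0(1), of y] 4 B \<sigma>_nonneg[OF t0(1), of y]
      by (intro order_trans[OF Cauchy_Schwarz_ineq2] mult_mono) auto
    with 3 have "\<bar>E i y t\<bar> \<le> \<sigma> y t * (2 * (6 * g0) + \<Gamma>0 * (DIM('a) * 30)) + (B * \<sigma> y t) * (\<Gamma>0 * 6 + 1 * g0)"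
      unfolding E_def R_def[symmetric] by linarith
    then show ?thesis unfolding K_def by (simp add: algebra_simps)
  qed
  have dom: "integrable lborel (\<lambda>z. K * (indicator {s1..s2} (snd z) * \<sigma> (fst z) (snd z)))"
    by (intro integrable_mult_right \<sigma>_strip_integrable s)
  have "(\<lambda>i. LINT z|lborel. indicator {s1..s2} (snd z) * E i (fst z) (snd z))
    \<longlonglongrightarrow> (LINT z|lborel. indicator {s1..s2} (snd z) * - (q (fst z) (snd z) \<bullet> heat_grad (T - snd z) (fst z - x0)))"
  proof (rule integral_dominated_convergence[OF _ _ dom])
    show m: "(\<lambda>z. indicator {s1..s2} (snd z) * E i (fst z) (snd z)) \<in> borel_measurable lborel" for i
      using td(1) by (rule borel_measurable_integrable)
    have l: "(\<lambda>i. indicator {s1..s2} (snd z) * E i (fst z) (snd z))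
       \<longlonglongrightarrow> indicator {s1..s2} (snd z) * - (q (fst z) (snd z) \<bullet> heat_grad (T - snd z) (fst z - x0))" for z
      by (intro tendsto_mult tendsto_const) (use lims[of "fst z" "snd z"] in simp)
    then show "AE z in lborel. (\<lambda>i. indicator {s1..s2} (snd z) * E i (fst z) (snd z))
       \<longlonglongrightarrow> indicator {s1..s2} (snd z) * - (q (fst z) (snd z) \<bullet> heat_grad (T - snd z) (fst z - x0))"
      by (intro AE_I2)
    show "(\<lambda>z. indicator {s1..s2} (snd z) * - (q (fst z) (snd z) \<bullet> heat_grad (T - snd z) (fst z - x0))) \<in> borel_measurable lborel"
      by (rule borel_measurable_LIMSEQ_real[OF l m])
    show "AE z in lborel. norm (indicator {s1..s2} (snd z) * E i (fst z) (snd z)) \<le> K * (indicator {s1..s2} (snd z) * \<sigma> (fst z) (snd z))" for i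
      using Ebd by (intro AE_I2) (auto simp: indicator_def)
  qed
  moreover have "(\<lambda>i. L i t) \<longlonglongrightarrow> (LINT y|lborel. \<mu> y t * heat (T - t) (y - x0))" if t: "0 < t" "t < T" for t
    unfolding L_def
  proof (rule integral_dominated_convergence[where w = "\<lambda>y. norm (\<mu> y t * heat (T - t) (y - x0))"])
    show m: "(\<lambda>y. \<mu> y t * heat (T - t) (y - x0)) \<in> borel_measurable lborel"
      using slice_heat_integrable[OF t] by (rule borel_measurable_integrable)
    show "(\<lambda>y. \<mu> y t * (bump (real (Suc i)) y * heat (T - t) (y - x0))) \<in> borel_measurable lborel" for i
    proof -
      have e: "(\<lambda>y. \<mu> y t * (bump (real (Suc i)) y * heat (T - t) (y - x0))) = (\<lambda>y. bump (real (Suc i)) y * (\<mu> y t * heat (T - t) (y - x0)))"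
        by (simp add: fun_eq_iff)
      have "(\<lambda>y. bump (real (Suc i)) y) \<in> borel_measurable (lborel :: 'a measure)"
        using borel_measurable_continuous_onI[OF bump_continuous(1)] by simp
      then show ?thesis unfolding e by (rule borel_measurable_times[OF _ m])
    qed
    show "integrable lborel (\<lambda>y. norm (\<mu> y t * heat (T - t) (y - x0)))"
      using slice_heat_integrable[OF t] by (rule integrable_norm)
    show "AE y in lborel. (\<lambda>i. \<mu> y t * (bump (real (Suc i)) y * heat (T - t) (y - x0))) \<longlonglongrightarrow> \<mu> y t * heat (T - t) (y - x0)"
    proof (rule AE_I2)
      fix y
      have "(\<lambda>i. \<mu> y t * (bump (real (Suc i)) y * heat (T - t) (y - x0))) \<longlonglongrightarrow> \<mu> y t * (1 * heat (T - t) (y - x0))"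
        by (intro tendsto_intros b1)
      then show "(\<lambda>i. \<mu> y t * (bump (real (Suc i)) y * heat (T - t) (y - x0))) \<longlonglongrightarrow> \<mu> y t * heat (T - t) (y - x0)"
        by simp
    qed
    show "AE y in lborel. norm (\<mu> y t * (bump (real (Suc i)) y * heat (T - t) (y - x0))) \<le> norm (\<mu> y t * heat (T - t) (y - x0))" for i
    proof (rule AE_I2)
      fix y
      have "bump (real (Suc i)) y * (\<bar>\<mu> y t\<bar> * \<bar>heat (T - t) (y - x0)\<bar>) \<le> 1 * (\<bar>\<mu> y t\<bar> * \<bar>heat (T - t) (y - x0)\<bar>)"
        using bump_bounds(2)[of "real (Suc i)" y] by (intro mult_right_mono) auto
      then show "norm (\<mu> y t * (bump (real (Suc i)) y * heat (T - t) (y - x0))) \<le> norm (\<mu> y t * heat (T - t) (y - x0))"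
        using bump_bounds(1)[of "real (Suc i)" y] by (simp add: abs_mult mult_ac)
    qed
  qed
  from tendsto_diff[OF this[of s2] this[of s1]] s
  have "(\<lambda>i. L i s2 - L i s1) \<longlonglongrightarrow> (LINT y|lborel. \<mu> y s2 * heat (T - s2) (y - x0)) - (LINT y|lborel. \<mu> y s1 * heat (T - s1) (y - x0))"
    by auto
  ultimately have "(LINT y|lborel. \<mu> y s2 * heat (T - s2) (y - x0)) - (LINT y|lborel. \<mu> y s1 * heat (T - s1) (y - x0))
    = (LINT z|lborel. indicator {s1..s2} (snd z) * - (q (fst z) (snd z) \<bullet> heat_grad (T - snd z) (fst z - x0)))"
    unfolding td(2) by (rule LIMSEQ_unique[rotated])
  then show ?thesis by simp
qed

text \<open>The kernel is an approximate identity, but the function it acts on moves with s and is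
  controlled only in L1. Near \<open>x0\<close> joint continuity is used. Far away the kernel itself
  is uniformly small against the mass of \<sigma>, and the tail of the constant \<mu> x0 T is
  estimated by the second moment of the kernel.\<close>

lemma heat_convolution_tendsto:
  assumes T: "T > 0"
  shows "((\<lambda>s. LINT y|lborel. \<mu> y s * heat (T - s) (y - x0)) \<longlongrightarrow> \<mu> x0 T) (at_left T)"
proof (rule tendstoI)
  fix \<epsilon> :: real assume \<epsilon>: "\<epsilon> > 0"
  define m0 where "m0 = \<mu> x0 T"
  have "isCont (\<lambda>(x, t). \<mu> x t) (x0, T)"
    using cont_\<mu> by (rule continuous_on_interior) (use T in \<open>auto simp: interior_Times interior_open\<close>)
  then have "eventually (\<lambda>z. dist ((\<lambda>(x, t). \<mu> x t) z) m0 < \<epsilon> / 2) (at (x0, T))"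
    unfolding isCont_def m0_def using \<epsilon> by (intro tendstoD) auto
  then obtain r where r: "r > 0" "\<And>z. z \<noteq> (x0, T) \<Longrightarrow> dist z (x0, T) < r \<Longrightarrow> dist ((\<lambda>(x, t). \<mu> x t) z) m0 < \<epsilon> / 2"
    unfolding eventually_at by auto
  define \<rho> where "\<rho> = r / 2"
  have \<rho>: "\<rho> > 0" using r by (simp add: \<rho>_def)
  have near: "\<bar>\<mu> y s - m0\<bar> \<le> \<epsilon> / 2" if "norm (y - x0) < \<rho>" "T - \<rho> < s" "s < T" for y s
  proof -
    have "dist (y, s) (x0, T) \<le> dist y x0 + dist s T" by (simp add: dist_Pair_Pair sqrt_sum_squares_le_sum)
    also have "\<dots> < r" using that by (simp add: dist_norm \<rho>_def)
    finally show ?thesis using r(2)[of "(y, s)"] that by (simp add: dist_real_def)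
  qed
  \<comment> \<open>The value of the kernel at distance \<rho>, hence its maximum outside the ball
    of that radius around \<open>x0\<close>.\<close>
  define H where "H \<tau> = exp (- (\<rho>\<^sup>2) / (4 * \<tau>)) / sqrt (4 * pi * \<tau>) ^ DIM('a)" for \<tau>
  have bound: "\<bar>(LINT y|lborel. \<mu> y s * heat (T - s) (y - x0)) - m0\<bar>
     \<le> \<epsilon> / 2 + 2 * H (T - s) + \<bar>m0\<bar> / \<rho>\<^sup>2 * (2 * DIM('a) * (T - s))"
    if s: "0 < s" "T - \<rho> < s" "s < T" for s
  proof -
    define \<tau> where "\<tau> = T - s"
    have \<tau>: "\<tau> > 0" using s by (simp add: \<tau>_def)
    have hm: "(\<lambda>z::'a. heat \<tau> z) \<in> borel_measurable borel" by measurable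
    have hm2: "(\<lambda>z::'a. (z \<bullet> z) * heat \<tau> z) \<in> borel_measurable borel" by measurable
    have i1: "integrable lborel (\<lambda>y. heat \<tau> (y - x0))" "(LINT y|lborel. heat \<tau> (y - x0)) = 1"
      using lborel_shift[OF hm, of x0] integrable_heat[OF \<tau>, where 'a = 'a] integral_heat[OF \<tau>, where 'a = 'a] by auto
    have i2: "integrable lborel (\<lambda>y. ((y - x0) \<bullet> (y - x0)) * heat \<tau> (y - x0))"
       "(LINT y|lborel. ((y - x0) \<bullet> (y - x0)) * heat \<tau> (y - x0)) = 2 * DIM('a) * \<tau>"
      using lborel_shift[OF hm2, of x0] integral_heat_second_moment[OF \<tau>, where 'a = 'a] by auto
    have i3: "integrable lborel (\<lambda>y. \<mu> y s * heat \<tau> (y - x0))"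
      unfolding \<tau>_def using s by (intro slice_heat_integrable) auto
    have i4: "integrable lborel (\<lambda>y. \<sigma> y s)" "(LINT y|lborel. \<sigma> y s) \<le> 2"
    proof -
      show "integrable lborel (\<lambda>y. \<sigma> y s)" by (rule \<sigma>_integrable[OF s(1)])
      then have "ennreal (LINT y|lborel. \<sigma> y s) \<le> 2"
        using mass[OF s(1)] \<sigma>_nonneg[OF s(1)] by (subst nn_integral_eq_integral[symmetric]) auto
      then show "(LINT y|lborel. \<sigma> y s) \<le> 2"
        by (metis ennreal_le_iff ennreal_numeral zero_le_numeral)
    qed
    have H0: "H \<tau> \<ge> 0" using \<tau> by (simp add: H_def)
    have pw: "\<bar>\<mu> y s - m0\<bar> * heat \<tau> (y - x0) \<le> \<epsilon> / 2 * heat \<tau> (y - x0) + H \<tau> * \<sigma> y s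
       + \<bar>m0\<bar> / \<rho>\<^sup>2 * (((y - x0) \<bullet> (y - x0)) * heat \<tau> (y - x0))" for y
    proof (cases "norm (y - x0) < \<rho>")
      case True
      then have "\<bar>\<mu> y s - m0\<bar> * heat \<tau> (y - x0) \<le> \<epsilon> / 2 * heat \<tau> (y - x0)"
        using near[of y s] s \<tau> by (intro mult_right_mono) auto
      moreover have "0 \<le> H \<tau> * \<sigma> y s" using H0 \<sigma>_nonneg[OF s(1)] by simp
      moreover have "0 \<le> \<bar>m0\<bar> / \<rho>\<^sup>2 * (((y - x0) \<bullet> (y - x0)) * heat \<tau> (y - x0))" using \<tau> by simp
      ultimately show ?thesis by linarith
    next
      case False
      have n2: "\<rho>\<^sup>2 \<le> (y - x0) \<bullet> (y - x0)"
        using False \<rho> power_mono[of \<rho> "norm (y - x0)" 2] by (simp add: power2_norm_eq_inner)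
      have "heat \<tau> (y - x0) \<le> H \<tau>"
        unfolding heat_def H_def using n2 \<tau> by (intro divide_right_mono) (auto simp: divide_right_mono)
      then have 1: "\<bar>\<mu> y s\<bar> * heat \<tau> (y - x0) \<le> \<sigma> y s * H \<tau>"
        using \<mu>_le[OF s(1), of y] \<tau> \<sigma>_nonneg[OF s(1), of y] by (intro mult_mono) auto
      have "1 \<le> ((y - x0) \<bullet> (y - x0)) / \<rho>\<^sup>2" using n2 \<rho> by simp
      then have "(\<bar>m0\<bar> * heat \<tau> (y - x0)) * 1 \<le> (\<bar>m0\<bar> * heat \<tau> (y - x0)) * (((y - x0) \<bullet> (y - x0)) / \<rho>\<^sup>2)"
        using \<tau> by (intro mult_left_mono) auto
      then have 2: "\<bar>m0\<bar> * heat \<tau> (y - x0) \<le> \<bar>m0\<bar> / \<rho>\<^sup>2 * (((y - x0) \<bullet> (y - x0)) * heat \<tau> (y - x0))"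
        by (simp add: mult_ac)
      have "\<bar>\<mu> y s - m0\<bar> * heat \<tau> (y - x0) \<le> (\<bar>\<mu> y s\<bar> + \<bar>m0\<bar>) * heat \<tau> (y - x0)"
        using \<tau> by (intro mult_right_mono) auto
      moreover have "0 \<le> \<epsilon> / 2 * heat \<tau> (y - x0)" using \<epsilon> \<tau> by simp
      ultimately show ?thesis using 1 2 by (simp add: algebra_simps)
    qed
    have "(LINT y|lborel. \<mu> y s * heat \<tau> (y - x0)) - m0 = (LINT y|lborel. \<mu> y s * heat \<tau> (y - x0)) - (LINT y|lborel. m0 * heat \<tau> (y - x0))"
      using i1 by simp
    also have "\<dots> = (LINT y|lborel. (\<mu> y s - m0) * heat \<tau> (y - x0))"
      unfolding left_diff_distrib by (rule Bochner_Integration.integral_diff[symmetric]) (use i1 i3 in auto)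
    finally have "\<bar>(LINT y|lborel. \<mu> y s * heat \<tau> (y - x0)) - m0\<bar> \<le> (LINT y|lborel. \<bar>(\<mu> y s - m0) * heat \<tau> (y - x0)\<bar>)"
      by (simp only: integral_abs_bound)
    also have "\<dots> \<le> (LINT y|lborel. \<epsilon> / 2 * heat \<tau> (y - x0) + H \<tau> * \<sigma> y s
       + \<bar>m0\<bar> / \<rho>\<^sup>2 * (((y - x0) \<bullet> (y - x0)) * heat \<tau> (y - x0)))"
    proof (rule integral_mono')
      show "integrable lborel (\<lambda>y. \<epsilon> / 2 * heat \<tau> (y - x0) + H \<tau> * \<sigma> y s
       + \<bar>m0\<bar> / \<rho>\<^sup>2 * (((y - x0) \<bullet> (y - x0)) * heat \<tau> (y - x0)))"
        by (intro Bochner_Integration.integrable_add integrable_mult_right i1 i2 i4)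
      fix y
      show le: "\<bar>(\<mu> y s - m0) * heat \<tau> (y - x0)\<bar> \<le> \<epsilon> / 2 * heat \<tau> (y - x0) + H \<tau> * \<sigma> y s
       + \<bar>m0\<bar> / \<rho>\<^sup>2 * (((y - x0) \<bullet> (y - x0)) * heat \<tau> (y - x0))"
        using pw[of y] \<tau> by (simp add: abs_mult)
      show "0 \<le> \<epsilon> / 2 * heat \<tau> (y - x0) + H \<tau> * \<sigma> y s
       + \<bar>m0\<bar> / \<rho>\<^sup>2 * (((y - x0) \<bullet> (y - x0)) * heat \<tau> (y - x0))"
        by (rule order_trans[OF abs_ge_zero le])
    qed
    also have "\<dots> = \<epsilon> / 2 * (LINT y|lborel. heat \<tau> (y - x0)) + H \<tau> * (LINT y|lborel. \<sigma> y s)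
       + \<bar>m0\<bar> / \<rho>\<^sup>2 * (LINT y|lborel. ((y - x0) \<bullet> (y - x0)) * heat \<tau> (y - x0))"
      using i1(1) i2(1) i4(1)
      by (subst Bochner_Integration.integral_add, simp, simp)+ (simp only: integral_mult_right_zero)
    also have "\<dots> \<le> \<epsilon> / 2 + 2 * H \<tau> + \<bar>m0\<bar> / \<rho>\<^sup>2 * (2 * DIM('a) * \<tau>)"
      using mult_left_mono[OF i4(2) H0] unfolding i1(2) i2(2) by simp
    finally show ?thesis by (simp add: \<tau>_def)
  qed
  have lim: "((\<lambda>s. 2 * H (T - s) + \<bar>m0\<bar> / \<rho>\<^sup>2 * (2 * DIM('a) * (T - s))) \<longlongrightarrow> 2 * 0 + \<bar>m0\<bar> / \<rho>\<^sup>2 * (real (2 * DIM('a)) * 0)) (at_left T)"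
  proof -
    have f: "filterlim (\<lambda>s. T - s) (at_right 0) (at_left T)"
      unfolding filterlim_at
      by (auto intro!: tendsto_eq_intros simp: eventually_at_filter)
    have f0: "((\<lambda>s. T - s) \<longlongrightarrow> 0) (at_left T)" by (auto intro!: tendsto_eq_intros)
    have "((\<lambda>s. H (T - s)) \<longlongrightarrow> 0) (at_left T)"
      using filterlim_compose[OF gaussian_tail_tendsto_0[OF \<rho>, of "DIM('a)"] f] by (simp add: H_def)
    then show ?thesis by (intro tendsto_intros f0)
  qed
  have "eventually (\<lambda>s. 2 * H (T - s) + \<bar>m0\<bar> / \<rho>\<^sup>2 * (2 * DIM('a) * (T - s)) < \<epsilon> / 2) (at_left T)"
    using order_tendstoD(2)[OF lim, of "\<epsilon> / 2"] \<epsilon> by simp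
  moreover have "eventually (\<lambda>s. s \<in> {max 0 (T - \<rho>)<..<T}) (at_left T)"
    using T \<rho> by (intro eventually_at_left_real) auto
  ultimately show "eventually (\<lambda>s. dist (LINT y|lborel. \<mu> y s * heat (T - s) (y - x0)) (\<mu> x0 T) < \<epsilon>) (at_left T)"
  proof eventually_elim
    case (elim s)
    then show ?case using bound[of s] by (auto simp: dist_real_def m0_def)
  qed
qed

end

section \<open>Time integrals against the exponential weight\<close>

lemma heat_grad_measurable_compose [measurable (raw)]:
  assumes [measurable]: "f \<in> borel_measurable M" "g \<in> borel_measurable M"
  shows "(\<lambda>x. heat_grad (f x) (g x :: 'a::euclidean_space)) \<in> borel_measurable M"
  unfolding heat_grad_def heat_def by measurable

text \<open>The integrand is dominated by the derivative of \<open>4 \<surd>r / (1 + k \<surd>r)\<close>, where \<open>r = T - s\<close> and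
  \<open>k = \<surd>\<kappa>\<close>.\<close>

lemma singular_time_integral:
  fixes \<kappa> T :: real
  assumes \<kappa>: "\<kappa> > 0" and T: "T > 0"
  shows "(\<integral>\<^sup>+s. ennreal (indicator {0<..<T} s * (exp (\<kappa> * s) / sqrt (T - s))) \<partial>lborel) \<le> ennreal (4 / sqrt \<kappa> * exp (\<kappa> * T))"
proof -
  define k where "k = sqrt \<kappa>"
  have k: "k > 0" "\<kappa> = k * k" using \<kappa> by (simp_all add: k_def)
  define F where "F s = - (4 * sqrt (T - s) / (1 + k * sqrt (T - s)))" for s
  define f where "f s = 2 / (sqrt (T - s) * (1 + k * sqrt (T - s))\<^sup>2)" for s
  have pos: "1 + k * sqrt (T - s) > 0" if "s \<le> T" for s
    using k that by (simp add: add_pos_nonneg)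
  have dF: "(F has_real_derivative f s) (at s)" if s: "s < T" for s
  proof -
    define w where "w = sqrt (T - s)"
    have w: "w > 0" using s by (simp add: w_def)
    have d: "((\<lambda>s. sqrt (T - s)) has_real_derivative - (1 / (2 * w))) (at s)"
      using s by (auto intro!: derivative_eq_intros simp: w_def inverse_eq_divide)
    have p: "1 + k * w > 0" using k w by (simp add: add_pos_pos)
    have "(F has_real_derivative - ((4 * - (1 / (2 * w)) * (1 + k * w) - 4 * w * (k * - (1 / (2 * w)))) / ((1 + k * w) * (1 + k * w)))) (at s)"
      unfolding F_def[abs_def]
      using DERIV_minus[OF DERIV_divide[OF DERIV_cmult[OF d, of 4] DERIV_add[OF DERIV_const[of 1] DERIV_cmult[OF d, of k]]]] p
      by (simp add: w_def)
    moreover have "- ((4 * - (1 / (2 * w)) * (1 + k * w) - 4 * w * (k * - (1 / (2 * w)))) / ((1 + k * w) * (1 + k * w))) = f s"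
    proof -
      have "4 * - (1 / (2 * w)) * (1 + k * w) - 4 * w * (k * - (1 / (2 * w))) = - (2 / w)"
        using w by (simp add: field_simps)
      then show ?thesis using w p by (simp add: f_def w_def[symmetric] power2_eq_square)
    qed
    ultimately show ?thesis by simp
  qed
  \<comment> \<open>The integrand is singular at T. The fundamental theorem for nonnegative
    derivatives provides integrability and value together from the one-sided limits of
    \<open>F\<close>.\<close>
  have ftc: "set_integrable lborel (einterval (ereal 0) (ereal T)) f"
      "(LBINT x=ereal 0..ereal T. f x) = 0 - F 0"
  proof -
    have c1: "isCont f s" if "s < T" for s
      unfolding f_def using that pos[of s] by (intro continuous_intros) auto
    have l0: "((F \<circ> real_of_ereal) \<longlongrightarrow> F 0) (at_right (ereal 0))"
      using dF[of 0] T DERIV_isCont[of F "f 0" 0] unfolding ereal_tendsto_simps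
      by (auto simp: isCont_def intro: filterlim_mono at_within_le_at tendsto_mono)
    have lT: "((F \<circ> real_of_ereal) \<longlongrightarrow> 0) (at_left (ereal T))"
    proof -
      have "((\<lambda>s. - (4 * sqrt (T - s) / (1 + k * sqrt (T - s)))) \<longlongrightarrow> - (4 * sqrt (T - T) / (1 + k * sqrt (T - T)))) (at_left T)"
        using k by (intro tendsto_intros) auto
      then show ?thesis unfolding ereal_tendsto_simps by (simp add: F_def[abs_def])
    qed
    have nn: "AE x in lborel. ereal 0 < ereal x \<longrightarrow> ereal x < ereal T \<longrightarrow> 0 \<le> f x"
      using pos by (intro AE_I2) (auto simp: f_def)
    show "set_integrable lborel (einterval (ereal 0) (ereal T)) f"
      by (rule interval_integral_FTC_nonneg(1)[OF _ dF c1 nn l0 lT]) (use T in auto)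
    show "(LBINT x=ereal 0..ereal T. f x) = 0 - F 0"
      by (rule interval_integral_FTC_nonneg(2)[OF _ dF c1 nn l0 lT]) (use T in auto)
  qed
  have e: "einterval (ereal 0) (ereal T) = {0<..<T}" by (auto simp: einterval_def)
  have fi: "integrable lborel (\<lambda>s. indicator {0<..<T} s * f s)"
    using ftc(1) unfolding e set_integrable_def by simp
  have fI: "(LINT s|lborel. indicator {0<..<T} s * f s) = - F 0"
    using ftc(2) T unfolding interval_lebesgue_integral_def set_lebesgue_integral_def e by simp
  have F0: "- F 0 \<le> 4 / k"
    using k T pos[of 0] by (simp add: F_def field_simps)
  have le: "exp (\<kappa> * s) / sqrt (T - s) \<le> exp (\<kappa> * T) * f s" if s: "s < T" for s
  proof -
    define w where "w = sqrt (T - s)"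
    have w: "w > 0" "w * w = T - s" using s by (simp_all add: w_def)
    define y where "y = k * w"
    have y: "y > 0" using k w by (simp add: y_def)
    \<comment> \<open>With y = k sqrt(T - s) the weight relative to its value at T is exp(-y^2).
      Replacing this Gaussian by 2 / (1 + y)^2 is what makes an elementary antiderivative
      available.\<close>
    have "(1 + y)\<^sup>2 \<le> 2 * (1 + y\<^sup>2)"
      using sum_squares_bound[of 1 y] by (simp add: power2_sum)
    also have "\<dots> \<le> 2 * exp (y\<^sup>2)" using exp_ge_add_one_self[of "y\<^sup>2"] by (intro mult_left_mono) auto
    finally have "exp (- (y\<^sup>2)) * (1 + y)\<^sup>2 \<le> exp (- (y\<^sup>2)) * (2 * exp (y\<^sup>2))" by (intro mult_left_mono) auto
    also have "\<dots> = 2" by (simp add: exp_minus)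
    finally have 1: "exp (- (y\<^sup>2)) \<le> 2 / (1 + y)\<^sup>2" using y by (simp add: pos_le_divide_eq)
    have "y\<^sup>2 = \<kappa> * (T - s)" unfolding y_def k(2) w(2)[symmetric] by (simp add: power2_eq_square)
    then have "exp (\<kappa> * s) = exp (\<kappa> * T) * exp (- (y\<^sup>2))" by (simp add: exp_add[symmetric] algebra_simps)
    also have "\<dots> \<le> exp (\<kappa> * T) * (2 / (1 + y)\<^sup>2)" using 1 by (intro mult_left_mono) auto
    finally have "exp (\<kappa> * s) / w \<le> exp (\<kappa> * T) * (2 / (1 + y)\<^sup>2) / w" using w by (intro divide_right_mono) auto
    also have "\<dots> = exp (\<kappa> * T) * f s" unfolding f_def w_def[symmetric] y_def[symmetric] by (simp add: mult.commute)
    finally show ?thesis by (simp add: w_def)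
  qed
  have f0: "0 \<le> f s" if "s < T" for s using pos[of s] that by (simp add: f_def)
  have "(\<integral>\<^sup>+s. ennreal (indicator {0<..<T} s * (exp (\<kappa> * s) / sqrt (T - s))) \<partial>lborel)
     \<le> (\<integral>\<^sup>+s. ennreal (exp (\<kappa> * T) * (indicator {0<..<T} s * f s)) \<partial>lborel)"
    using le by (intro nn_integral_mono ennreal_leI) (auto simp: indicator_def)
  also have "\<dots> = ennreal (LINT s|lborel. exp (\<kappa> * T) * (indicator {0<..<T} s * f s))"
    using fi f0 by (intro nn_integral_eq_integral integrable_mult_right AE_I2) (auto simp: indicator_def)
  also have "\<dots> = ennreal (exp (\<kappa> * T) * - F 0)" by (simp add: fI)
  also have "\<dots> \<le> ennreal (4 / sqrt \<kappa> * exp (\<kappa> * T))"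
    using mult_left_mono[OF F0, of "exp (\<kappa> * T)"] by (intro ennreal_leI) (simp add: k_def mult.commute)
  finally show ?thesis .
qed

lemma exponential_time_integral:
  fixes \<kappa> T :: real
  assumes \<kappa>: "\<kappa> > 0" and T: "T > 0"
  shows "(\<integral>\<^sup>+s. ennreal (indicator {0<..<T} s * exp (\<kappa> * s)) \<partial>lborel) \<le> ennreal (exp (\<kappa> * T) / \<kappa>)"
proof -
  have "(\<integral>\<^sup>+s. ennreal (indicator {0<..<T} s * exp (\<kappa> * s)) \<partial>lborel)
     \<le> (\<integral>\<^sup>+s. ennreal (exp (\<kappa> * s)) * indicator {0..T} s \<partial>lborel)"
    by (intro nn_integral_mono) (auto simp: indicator_def)
  also have "\<dots> = ennreal (exp (\<kappa> * T) / \<kappa> - exp (\<kappa> * 0) / \<kappa>)"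
    using \<kappa> T by (intro nn_integral_FTC_Icc[where F = "\<lambda>s. exp (\<kappa> * s) / \<kappa>"]) (auto intro!: derivative_eq_intros)
  also have "\<dots> \<le> ennreal (exp (\<kappa> * T) / \<kappa>)" using \<kappa> by (intro ennreal_leI) auto
  finally show ?thesis .
qed

text \<open>The initial condition is tested with functions that may change with s, because the
  kernel in Duhamel's formula does. Bounded functions with a uniform Lipschitz constant form a class
  for which continuity in \<open>d1\<close> delivers it.\<close>

locale fp_zero_initial = fp_difference \<mu> mt \<sigma> g q h q' B
  for \<mu> mt \<sigma> :: "'a::euclidean_space \<Rightarrow> real \<Rightarrow> real" and g q :: "'a \<Rightarrow> real \<Rightarrow> 'a"
    and h q' :: "'a \<Rightarrow> real \<Rightarrow> 'a \<Rightarrow> 'a" and B :: real +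
  assumes init: "\<And>\<phi> K. (\<And>s x. \<bar>\<phi> s x\<bar> \<le> K) \<Longrightarrow> (\<And>s x y. \<bar>\<phi> s x - \<phi> s y\<bar> \<le> K * norm (x - y)) \<Longrightarrow>
      ((\<lambda>s. LINT y|lborel. \<mu> y s * \<phi> s y) \<longlongrightarrow> 0) (at_right 0)"
begin

lemma heat_convolution_initial:
  assumes T: "T > 0"
  shows "((\<lambda>s. LINT y|lborel. \<mu> y s * heat (T - s) (y - x0)) \<longlongrightarrow> 0) (at_right 0)"
proof -
  \<comment> \<open>The bounds in \<open>init\<close> must hold for every s, so the kernel is kept
    only for times before T / 2, where it is uniformly regular, and replaced by 0 elsewhere. The
    limit at 0 does not see the change.\<close>
  define \<phi> where "\<phi> s y = (if 0 < s \<and> s < T / 2 then heat (T - s) (y - x0) else 0)" for s y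
  define K1 where "K1 = 1 / sqrt (4 * pi * (T / 2)) ^ DIM('a)"
  define K2 where "K2 = (1 + 4 * T) / (2 * (T / 2)) * (1 / sqrt (4 * pi * (T / 2)) ^ DIM('a))"
  have K0: "K1 \<ge> 0" "K2 \<ge> 0" using T by (simp_all add: K1_def K2_def)
  have hb: "heat (T - s) z \<le> K1" "norm (heat_grad (T - s) z) \<le> K2" if "0 < s \<and> s < T / 2" for s and z :: 'a
    using heat_grad_bound[of "T / 2" "T - s" T z] that T by (auto simp: K1_def K2_def)
  have "((\<lambda>s. LINT y|lborel. \<mu> y s * \<phi> s y) \<longlongrightarrow> 0) (at_right 0)"
  proof (rule init)
    fix s and x y :: 'a
    show "\<bar>\<phi> s x\<bar> \<le> K1 + K2"
      using hb[of s "x - x0"] K0 heat_nonneg[of "T - s" "x - x0"] by (auto simp: \<phi>_def)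
    show "\<bar>\<phi> s x - \<phi> s y\<bar> \<le> (K1 + K2) * norm (x - y)"
    proof (cases "0 < s \<and> s < T / 2")
      case True
      then have "T - s > 0" using T by auto
      from lipschitz_of_gradient_bound[OF heat_has_derivative[OF this] hb(2)[OF True], of "x - x0" "y - x0"]
      have "\<bar>\<phi> s x - \<phi> s y\<bar> \<le> K2 * norm (x - y)" using True by (simp add: \<phi>_def)
      also have "\<dots> \<le> (K1 + K2) * norm (x - y)" using K0 by (intro mult_right_mono) auto
      finally show ?thesis .
    next
      case False
      then have "\<phi> s x - \<phi> s y = 0" by (auto simp: \<phi>_def)
      then show ?thesis using K0 by simp
    qed
  qed
  moreover have "eventually (\<lambda>s. (LINT y|lborel. \<mu> y s * \<phi> s y) = (LINT y|lborel. \<mu> y s * heat (T - s) (y - x0))) (at_right 0)"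
  proof -
    have "eventually (\<lambda>s. s \<in> {0<..<T / 2}) (at_right 0)" using T by (intro eventually_at_right_real) auto
    then show ?thesis by eventually_elim (simp add: \<phi>_def)
  qed
  ultimately show ?thesis by (rule Lim_transform_eventually)
qed

text \<open>\<open>duhamel_interior\<close> on time intervals that exhaust (0, T): the boundary
  terms tend to \<mu> x0 T and to 0. Integrability up to the singular time is a hypothesis on the
  point \<open>x0\<close>; Fubini's theorem provides it almost everywhere in
  \<open>AE_duhamel\<close>.\<close>

lemma duhamel:
  assumes T: "T > 0"
    and J: "integrable lborel (\<lambda>z. indicator {0<..<T} (snd z) * (q (fst z) (snd z) \<bullet> heat_grad (T - snd z) (x0 - fst z)))"
  shows "\<mu> x0 T = (LINT z|lborel. indicator {0<..<T} (snd z) * (q (fst z) (snd z) \<bullet> heat_grad (T - snd z) (x0 - fst z)))"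
proof -
  define j where "j z = q (fst z) (snd z) \<bullet> heat_grad (T - snd z) (x0 - fst z)" for z :: "'a \<times> real"
  \<comment> \<open>The kernel gradient is odd, so reversing its argument absorbs the minus sign of
    \<open>duhamel_interior\<close>.\<close>
  have jm: "- (q (fst z) (snd z) \<bullet> heat_grad (T - snd z) (fst z - x0)) = j z" for z
    using heat_grad_minus[of "T - snd z" "x0 - fst z"] by (simp add: j_def)
  define I where "I s = (LINT y|lborel. \<mu> y s * heat (T - s) (y - x0))" for s
  \<comment> \<open>The shift by 3 makes T / (n + 3) at most T / 2, so that \<open>s1 n\<close>
    never exceeds \<open>s2 n\<close>.\<close>
  define s1 where "s1 n = T / real (n + 3)" for n
  define s2 where "s2 n = T - T / real (n + 3)" for n
  have s: "0 < s1 n" "s1 n \<le> s2 n" "s2 n < T" for n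
  proof -
    show "0 < s1 n" "s2 n < T" using T by (simp_all add: s1_def s2_def)
    have "T / real (n + 3) \<le> T / 2" using T by (intro divide_left_mono) auto
    then show "s1 n \<le> s2 n" unfolding s1_def s2_def by linarith
  qed
  have z: "(\<lambda>n. T / real (n + 3)) \<longlonglongrightarrow> 0"
    by (rule LIMSEQ_ignore_initial_segment[OF lim_const_over_n, of T 3])
  have f1: "filterlim s1 (at_right 0) sequentially"
    unfolding filterlim_at s1_def using z T by (auto intro!: always_eventually)
  have f2: "filterlim s2 (at_left T) sequentially"
    unfolding filterlim_at s2_def using tendsto_diff[OF tendsto_const[of T] z] T by (auto intro!: always_eventually)
  have "(\<lambda>n. I (s2 n) - I (s1 n)) \<longlonglongrightarrow> \<mu> x0 T - 0"
    unfolding I_def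
    by (intro tendsto_diff filterlim_compose[OF heat_convolution_tendsto[OF T] f2] filterlim_compose[OF heat_convolution_initial[OF T] f1])
  moreover have "I (s2 n) - I (s1 n) = (LINT z|lborel. indicator {s1 n..s2 n} (snd z) * j z)" for n
  proof -
    have "I (s2 n) - I (s1 n) = - (LINT z|lborel. indicator {s1 n..s2 n} (snd z) * (q (fst z) (snd z) \<bullet> heat_grad (T - snd z) (fst z - x0)))"
      unfolding I_def by (rule duhamel_interior[OF s])
    also have "\<dots> = (LINT z|lborel. indicator {s1 n..s2 n} (snd z) * - (q (fst z) (snd z) \<bullet> heat_grad (T - snd z) (fst z - x0)))"
      by simp
    finally show ?thesis unfolding jm .
  qed
  moreover have "(\<lambda>n. LINT z|lborel. indicator {s1 n..s2 n} (snd z) * j z) \<longlonglongrightarrow> (LINT z|lborel. indicator {0<..<T} (snd z) * j z)"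
  proof (rule integral_dominated_convergence[where w = "\<lambda>z. norm (indicator {0<..<T} (snd z) * j z)"])
    show jM: "(\<lambda>z. indicator {0<..<T} (snd z) * j z) \<in> borel_measurable lborel"
      using J unfolding j_def by (rule borel_measurable_integrable)
    have im: "(\<lambda>z::'a \<times> real. indicator {a..b} (snd z) :: real) \<in> borel_measurable lborel" for a b
      by (simp add: borel_prod[symmetric])
    show "(\<lambda>z. indicator {s1 n..s2 n} (snd z) * j z) \<in> borel_measurable lborel" for n
    proof -
      have "(\<lambda>z. indicator {s1 n..s2 n} (snd z) * j z) = (\<lambda>z. indicator {s1 n..s2 n} (snd z) * (indicator {0<..<T} (snd z) * j z))"
        using s[of n] by (auto simp: fun_eq_iff indicator_def)
      then show ?thesis using borel_measurable_times[OF im jM] by simp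
    qed
    show "integrable lborel (\<lambda>z. norm (indicator {0<..<T} (snd z) * j z))"
      using J unfolding j_def by (rule integrable_norm)
    show "AE z in lborel. (\<lambda>n. indicator {s1 n..s2 n} (snd z) * j z) \<longlonglongrightarrow> indicator {0<..<T} (snd z) * j z"
    proof (intro AE_I2 tendsto_mult tendsto_const)
      fix z :: "'a \<times> real"
      show "(\<lambda>n. indicator {s1 n..s2 n} (snd z) :: real) \<longlonglongrightarrow> indicator {0<..<T} (snd z)"
      proof (cases "0 < snd z \<and> snd z < T")
        case True
        have "eventually (\<lambda>n. s1 n < snd z) sequentially"
          using order_tendstoD(2)[OF z, of "snd z"] True by (simp add: s1_def)
        moreover have "eventually (\<lambda>n. snd z < s2 n) sequentially"
          using order_tendstoD(2)[OF z, of "T - snd z"] True by (simp add: s2_def algebra_simps)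
        ultimately have "eventually (\<lambda>n. indicator {0<..<T} (snd z) = (indicator {s1 n..s2 n} (snd z) :: real)) sequentially"
          by eventually_elim (use True in auto)
        then show ?thesis by (rule Lim_transform_eventually[OF tendsto_const])
      next
        case False
        then have "snd z \<notin> {s1 n..s2 n}" for n using s[of n] by auto
        then have "(\<lambda>n. indicator {s1 n..s2 n} (snd z) :: real) = (\<lambda>_. 0)" by (simp add: fun_eq_iff)
        moreover have "indicator {0<..<T} (snd z) = (0::real)" using False by simp
        ultimately show ?thesis by simp
      qed
    qed
    show "AE z in lborel. norm (indicator {s1 n..s2 n} (snd z) * j z) \<le> norm (indicator {0<..<T} (snd z) * j z)" for n
      using s[of n] by (intro AE_I2) (auto simp: indicator_def)
  qed
  ultimately have "\<mu> x0 T - 0 = (LINT z|lborel. indicator {0<..<T} (snd z) * j z)"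
    using LIMSEQ_unique by fastforce
  then show ?thesis by (simp add: j_def)
qed

end

text \<open>A fixed terminal time, and a bound \<open>Q\<close> for the flux in the exponentially
  weighted norm. The rate \<kappa> is going to be \<open>k\<^sup>2\<close>.\<close>

locale fp_flux = fp_zero_initial \<mu> mt \<sigma> g q h q' B
  for \<mu> mt \<sigma> :: "'a::euclidean_space \<Rightarrow> real \<Rightarrow> real" and g q :: "'a \<Rightarrow> real \<Rightarrow> 'a"
    and h q' :: "'a \<Rightarrow> real \<Rightarrow> 'a \<Rightarrow> 'a" and B :: real +
  fixes T \<kappa> Q :: real
  assumes T: "T > 0" and \<kappa>: "\<kappa> > 0" and Q: "Q \<ge> 0"
    and flux: "\<And>s. 0 < s \<Longrightarrow> s < T \<Longrightarrow> (\<integral>\<^sup>+y. ennreal (norm (q y s)) \<partial>lborel) \<le> ennreal (Q * exp (\<kappa> * s))"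
begin

text \<open>The signed density that the source point u = (y, s) deposits at x at time T. For fixed u
  it is odd about y, so each source point moves mass without creating any.\<close>

definition G :: "'a \<times> real \<Rightarrow> 'a \<Rightarrow> real" where
  "G u x = indicator {0<..<T} (snd u) * (q (fst u) (snd u) \<bullet> heat_grad (T - snd u) (x - fst u))"

lemma q_measurable [measurable]:
  "(\<lambda>u. indicator {0<..<T} (snd u) *\<^sub>R q (fst u) (snd u)) \<in> borel_measurable (borel \<Otimes>\<^sub>M borel)"
  using borel_measurable_strip[OF cont_q, of "{0<..<T}"] by (simp add: borel_prod greaterThanLessThan_def)

lemma norm_q_measurable [measurable]:
  "(\<lambda>u. indicator {0<..<T} (snd u) * norm (q (fst u) (snd u))) \<in> borel_measurable (borel \<Otimes>\<^sub>M borel)"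
proof -
  have "(\<lambda>u. norm (indicator {0<..<T} (snd u) *\<^sub>R q (fst u) (snd u))) \<in> borel_measurable (borel \<Otimes>\<^sub>M borel)"
    by measurable
  then show ?thesis by simp
qed

lemma G_measurable [measurable]:
  "(\<lambda>z. G (fst z) (snd z)) \<in> borel_measurable ((borel \<Otimes>\<^sub>M borel) \<Otimes>\<^sub>M borel)"
proof -
  have "(\<lambda>z. (\<lambda>u. indicator {0<..<T} (snd u) *\<^sub>R q (fst u) (snd u)) (fst z) \<bullet> heat_grad (T - snd (fst z)) (snd z - fst (fst z)))
     \<in> borel_measurable ((borel \<Otimes>\<^sub>M borel) \<Otimes>\<^sub>M borel)"
    by measurable
  then show ?thesis by (simp add: G_def)
qed

text \<open>Separates space and time in integrals of the flux. It serves the total mass and the cost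
  of the transport with c = 1, and the first moment with c equal to the norm.\<close>

lemma flux_time_integral:
  fixes c :: "'a \<Rightarrow> real" and k W :: "real \<Rightarrow> real"
  assumes [measurable]: "c \<in> borel_measurable borel" "k \<in> borel_measurable borel"
    and c: "\<And>y. c y \<ge> 0" and k: "\<And>s. s < T \<Longrightarrow> k s \<ge> 0" and W0: "\<And>s. W s \<ge> 0"
    and W: "\<And>s. 0 < s \<Longrightarrow> s < T \<Longrightarrow> (\<integral>\<^sup>+y. ennreal (c y * norm (q y s)) \<partial>lborel) \<le> ennreal (W s)"
  shows "(\<integral>\<^sup>+u. ennreal (indicator {0<..<T} (snd u) * norm (q (fst u) (snd u)) * (c (fst u) * k (snd u))) \<partial>lborel)
     \<le> (\<integral>\<^sup>+s. ennreal (indicator {0<..<T} s * (W s * k s)) \<partial>lborel)"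
proof -
  have m: "(\<lambda>u. ennreal (indicator {0<..<T} (snd u) * norm (q (fst u) (snd u)) * (c (fst u) * k (snd u))))
     \<in> borel_measurable (borel \<Otimes>\<^sub>M borel)" by measurable
  have "(\<integral>\<^sup>+u. ennreal (indicator {0<..<T} (snd u) * norm (q (fst u) (snd u)) * (c (fst u) * k (snd u))) \<partial>lborel)
    = (\<integral>\<^sup>+s. \<integral>\<^sup>+y. ennreal (indicator {0<..<T} s * norm (q y s) * (c y * k s)) \<partial>lborel \<partial>lborel)"
    using m by (subst lborel_prod[symmetric], subst lborel_pair.nn_integral_snd[symmetric]) auto
  also have "\<dots> \<le> (\<integral>\<^sup>+s. ennreal (indicator {0<..<T} s * (W s * k s)) \<partial>lborel)"
  proof (rule nn_integral_mono)
    fix s :: real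
    show "(\<integral>\<^sup>+y. ennreal (indicator {0<..<T} s * norm (q y s) * (c y * k s)) \<partial>lborel) \<le> ennreal (indicator {0<..<T} s * (W s * k s))"
    proof (cases "0 < s \<and> s < T")
      case True
      have qm: "(\<lambda>y. norm (q y s)) \<in> borel_measurable borel"
        using True by (intro borel_measurable_continuous_onI continuous_on_norm continuous_on_slice[OF cont_q]) auto
      have "(\<integral>\<^sup>+y. ennreal (indicator {0<..<T} s * norm (q y s) * (c y * k s)) \<partial>lborel)
         = (\<integral>\<^sup>+y. ennreal (k s) * ennreal (c y * norm (q y s)) \<partial>lborel)"
        using True k[of s] c by (intro nn_integral_cong) (simp add: ennreal_mult[symmetric] mult_ac)
      also have "\<dots> = ennreal (k s) * (\<integral>\<^sup>+y. ennreal (c y * norm (q y s)) \<partial>lborel)"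
        using measurable_compose[OF borel_measurable_times[OF assms(1) qm] measurable_ennreal]
        by (intro nn_integral_cmult) simp
      also have "\<dots> \<le> ennreal (k s) * ennreal (W s)" using W True by (intro mult_left_mono) auto
      also have "\<dots> = ennreal (indicator {0<..<T} s * (W s * k s))"
        using True k[of s] W0[of s] by (simp add: ennreal_mult[symmetric] mult.commute)
      finally show ?thesis .
    next
      case False
      then have "indicator {0<..<T} s = (0::real)" by simp
      then show ?thesis by simp
    qed
  qed
  finally show ?thesis .
qed

lemma abs_G_le: "\<bar>G u x\<bar> \<le> indicator {0<..<T} (snd u) * norm (q (fst u) (snd u)) * norm (heat_grad (T - snd u) (x - fst u))"
  using Cauchy_Schwarz_ineq2[of "q (fst u) (snd u)" "heat_grad (T - snd u) (x - fst u)"]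
  by (auto simp: G_def indicator_def)

text \<open>The two L1 norms of the kernel gradient, without and with the displacement as weight.
  Only the first is singular as s tends to T.\<close>

lemma slice_G:
  "(\<integral>\<^sup>+x. ennreal \<bar>G u x\<bar> \<partial>lborel)
     \<le> ennreal (indicator {0<..<T} (snd u) * norm (q (fst u) (snd u)) * ((1 + 2 * DIM('a)) / 4 / sqrt (T - snd u)))"
  "(\<integral>\<^sup>+x. ennreal (norm (x - fst u) * \<bar>G u x\<bar>) \<partial>lborel)
     \<le> ennreal (indicator {0<..<T} (snd u) * norm (q (fst u) (snd u)) * DIM('a))"
proof -
  define a where "a = indicator {0<..<T} (snd u) * norm (q (fst u) (snd u))"
  have a: "a \<ge> 0" by (simp add: a_def)
  have a0: "a = 0" if "\<not> (0 < snd u \<and> snd u < T)" using that by (simp add: a_def)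
  have m1: "(\<lambda>z::'a. ennreal (norm (heat_grad (T - snd u) z))) \<in> borel_measurable borel" by measurable
  have m2: "(\<lambda>z::'a. ennreal (norm z * norm (heat_grad (T - snd u) z))) \<in> borel_measurable borel" by measurable
  have "(\<integral>\<^sup>+x. ennreal \<bar>G u x\<bar> \<partial>lborel) \<le> (\<integral>\<^sup>+x. ennreal a * ennreal (norm (heat_grad (T - snd u) (x - fst u))) \<partial>lborel)"
    using abs_G_le[of u] a by (intro nn_integral_mono) (auto simp: a_def ennreal_mult[symmetric] intro!: ennreal_leI)
  also have "\<dots> = ennreal a * (\<integral>\<^sup>+z. ennreal (norm (heat_grad (T - snd u) z)) \<partial>(lborel :: 'a measure))"
    using nn_integral_lborel_shift[OF m1, of "fst u"] by (subst nn_integral_cmult) auto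
  also have "\<dots> \<le> ennreal (a * ((1 + 2 * DIM('a)) / 4 / sqrt (T - snd u)))"
  proof (cases "0 < snd u \<and> snd u < T")
    case True
    then have "ennreal a * (\<integral>\<^sup>+z. ennreal (norm (heat_grad (T - snd u) z)) \<partial>(lborel :: 'a measure))
       \<le> ennreal a * ennreal ((1 + 2 * DIM('a)) / 4 / sqrt (T - snd u))"
      by (intro mult_left_mono nn_integral_norm_heat_grad) auto
    also have "\<dots> = ennreal (a * ((1 + 2 * DIM('a)) / 4 / sqrt (T - snd u)))"
      using a True by (intro ennreal_mult[symmetric]) auto
    finally show ?thesis .
  qed (simp add: a0)
  finally show "(\<integral>\<^sup>+x. ennreal \<bar>G u x\<bar> \<partial>lborel)
     \<le> ennreal (indicator {0<..<T} (snd u) * norm (q (fst u) (snd u)) * ((1 + 2 * DIM('a)) / 4 / sqrt (T - snd u)))"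
    by (simp only: a_def)
  have "norm (x - fst u) * \<bar>G u x\<bar> \<le> a * (norm (x - fst u) * norm (heat_grad (T - snd u) (x - fst u)))" for x
    using mult_left_mono[OF abs_G_le[of u x], of "norm (x - fst u)"] by (simp add: a_def mult_ac)
  then have "(\<integral>\<^sup>+x. ennreal (norm (x - fst u) * \<bar>G u x\<bar>) \<partial>lborel)
    \<le> (\<integral>\<^sup>+x. ennreal a * ennreal (norm (x - fst u) * norm (heat_grad (T - snd u) (x - fst u))) \<partial>lborel)"
    using a by (intro nn_integral_mono) (auto simp: ennreal_mult[symmetric] intro!: ennreal_leI)
  also have "\<dots> = ennreal a * (\<integral>\<^sup>+z. ennreal (norm z * norm (heat_grad (T - snd u) z)) \<partial>(lborel :: 'a measure))"
    using nn_integral_lborel_shift[OF m2, of "fst u"] by (subst nn_integral_cmult) auto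
  also have "\<dots> \<le> ennreal (a * DIM('a))"
  proof (cases "0 < snd u \<and> snd u < T")
    case True
    then have "(\<integral>\<^sup>+z. ennreal (norm z * norm (heat_grad (T - snd u) z)) \<partial>(lborel :: 'a measure)) = ennreal DIM('a)"
      by (intro nn_integral_norm_times_heat_grad) simp
    then show ?thesis using a by (simp only: ennreal_mult[OF a of_nat_0_le_iff] order_refl)
  qed (simp add: a0)
  finally show "(\<integral>\<^sup>+x. ennreal (norm (x - fst u) * \<bar>G u x\<bar>) \<partial>lborel)
     \<le> ennreal (indicator {0<..<T} (snd u) * norm (q (fst u) (snd u)) * DIM('a))"
    by (simp only: a_def)
qed

text \<open>The quarter from the kernel norm cancels against the factor 4 of
  \<open>singular_time_integral\<close>. The result bounds the total variation and also justifies
  every use of Fubini's theorem for \<open>G\<close>.\<close>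

lemma G_total: "(\<integral>\<^sup>+u. \<integral>\<^sup>+x. ennreal \<bar>G u x\<bar> \<partial>lborel \<partial>lborel) \<le> ennreal ((1 + 2 * DIM('a)) / sqrt \<kappa> * Q * exp (\<kappa> * T))"
proof -
  define C where "C = (1 + 2 * real DIM('a)) / 4"
  have C: "C \<ge> 0" by (simp add: C_def)
  have "(\<integral>\<^sup>+u. \<integral>\<^sup>+x. ennreal \<bar>G u x\<bar> \<partial>lborel \<partial>lborel)
    \<le> (\<integral>\<^sup>+u. ennreal (indicator {0<..<T} (snd u) * norm (q (fst u) (snd u)) * (1 * (C / sqrt (T - snd u)))) \<partial>lborel)"
    using slice_G(1) by (intro nn_integral_mono) (simp add: C_def)
  also have "\<dots> \<le> (\<integral>\<^sup>+s. ennreal (indicator {0<..<T} s * (Q * exp (\<kappa> * s) * (C / sqrt (T - s)))) \<partial>lborel)"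
    by (rule flux_time_integral) (use flux C Q in auto)
  also have "\<dots> = (\<integral>\<^sup>+s. ennreal (C * Q) * ennreal (indicator {0<..<T} s * (exp (\<kappa> * s) / sqrt (T - s))) \<partial>lborel)"
    using C Q by (intro nn_integral_cong) (auto simp: ennreal_mult[symmetric] indicator_def mult_ac)
  also have "\<dots> = ennreal (C * Q) * (\<integral>\<^sup>+s. ennreal (indicator {0<..<T} s * (exp (\<kappa> * s) / sqrt (T - s))) \<partial>lborel)"
    by (intro nn_integral_cmult) measurable
  also have "\<dots> \<le> ennreal (C * Q) * ennreal (4 / sqrt \<kappa> * exp (\<kappa> * T))"
    by (intro mult_left_mono singular_time_integral \<kappa> T) auto
  also have "\<dots> = ennreal ((1 + 2 * DIM('a)) / sqrt \<kappa> * Q * exp (\<kappa> * T))"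
    using C Q \<kappa> by (simp add: ennreal_mult[symmetric] C_def mult_ac)
  finally show ?thesis .
qed

lemma G_integrable: "integrable (lborel \<Otimes>\<^sub>M lborel) (\<lambda>z. G (fst z) (snd z))"
proof (rule integrableI_bounded)
  show m: "(\<lambda>z. G (fst z) (snd z)) \<in> borel_measurable (lborel \<Otimes>\<^sub>M lborel)"
    using G_measurable by (simp add: borel_prod lborel_prod)
  have "(\<integral>\<^sup>+z. ennreal (norm (G (fst z) (snd z))) \<partial>(lborel \<Otimes>\<^sub>M lborel)) = (\<integral>\<^sup>+u. \<integral>\<^sup>+x. ennreal \<bar>G u x\<bar> \<partial>lborel \<partial>lborel)"
    using m by (subst lborel.nn_integral_fst[symmetric]) auto
  also have "\<dots> < \<infinity>" by (rule le_less_trans[OF G_total]) simp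
  finally show "(\<integral>\<^sup>+z. ennreal (norm (G (fst z) (snd z))) \<partial>(lborel \<Otimes>\<^sub>M lborel)) < \<infinity>" .
qed

lemma AE_duhamel: "AE x in lborel. integrable lborel (\<lambda>u. G u x) \<and> \<mu> x T = (LINT u|lborel. G u x)"
proof -
  have "AE x in lborel. integrable lborel (\<lambda>u. G u x)"
    by (rule lborel_pair.AE_integrable_snd) (use G_integrable in \<open>simp add: case_prod_unfold\<close>)
  then show ?thesis
  proof eventually_elim
    case (elim x)
    then show ?case using duhamel[OF T, of x] unfolding G_def by simp
  qed
qed

lemma total_variation_bound:
  "(\<integral>\<^sup>+x. ennreal \<bar>\<mu> x T\<bar> \<partial>lborel) \<le> ennreal ((1 + 2 * DIM('a)) / sqrt \<kappa> * Q * exp (\<kappa> * T))"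
proof -
  have m: "(\<lambda>z. ennreal \<bar>G (fst z) (snd z)\<bar>) \<in> borel_measurable (lborel \<Otimes>\<^sub>M lborel)"
    using G_measurable by (simp add: borel_prod lborel_prod)
  have "(\<integral>\<^sup>+x. ennreal \<bar>\<mu> x T\<bar> \<partial>lborel) \<le> (\<integral>\<^sup>+x. \<integral>\<^sup>+u. ennreal \<bar>G u x\<bar> \<partial>lborel \<partial>lborel)"
  proof (rule nn_integral_mono_AE)
    show "AE x in lborel. ennreal \<bar>\<mu> x T\<bar> \<le> (\<integral>\<^sup>+u. ennreal \<bar>G u x\<bar> \<partial>lborel)"
      using AE_duhamel
    proof eventually_elim
      case (elim x)
      then show ?case using integral_norm_bound_ennreal[of lborel "\<lambda>u. G u x"] by simp
    qed
  qed
  also have "\<dots> = (\<integral>\<^sup>+u. \<integral>\<^sup>+x. ennreal \<bar>G u x\<bar> \<partial>lborel \<partial>lborel)"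
    using lborel_pair.Fubini'[of "\<lambda>u x. ennreal \<bar>G u x\<bar>"] m by (simp add: case_prod_unfold)
  also note G_total
  finally show ?thesis .
qed

end

lemma lborel_distr_reflect: "distr lborel borel (\<lambda>x. c - x) = (lborel :: 'a::euclidean_space measure)"
  using lborel_affine[of "-1" c] by (simp add: density_1)

context fp_flux begin

text \<open>The kernel is odd, so the positive part of \<open>G u\<close>, reflected at the base point of \<open>u\<close>, is its
  negative part. Moving the former onto the latter costs \<open>2 |x - y|\<close> per unit of mass.\<close>

lemma d1_bound:
  assumes m1: "m1 \<in> P1" and m2: "m2 \<in> P1"
    and net: "\<And>A. A \<in> sets borel \<Longrightarrow> measure m1 A - measure m2 A = (LINT x|lborel. indicator A x * \<mu> x T)"
    and moment: "\<And>s. 0 < s \<Longrightarrow> s < T \<Longrightarrow> (\<integral>\<^sup>+y. ennreal (norm y * norm (q y s)) \<partial>lborel) \<le> ennreal M" and M: "M \<ge> 0"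
  shows "d1 m1 m2 \<le> 2 * DIM('a) * Q * exp (\<kappa> * T) / \<kappa>"
proof -
  define P where "P = (lborel :: ('a \<times> real) measure) \<Otimes>\<^sub>M (lborel :: 'a measure)"
  have sP[measurable_cong]: "sets P = sets ((borel \<Otimes>\<^sub>M borel) \<Otimes>\<^sub>M borel)"
  proof -
    have "sets P = sets ((borel :: ('a \<times> real) measure) \<Otimes>\<^sub>M (borel :: 'a measure))"
      unfolding P_def by (intro sets_pair_measure_cong) auto
    then show ?thesis by (simp only: borel_prod)
  qed
  have spP: "space P = UNIV" by (simp add: P_def space_pair_measure)
  define w where "w z = max 0 (G (fst z) (snd z))" for z
  have w0: "0 \<le> w z" for z by (simp add: w_def)
  have wle: "w z \<le> \<bar>G (fst z) (snd z)\<bar>" for z by (simp add: w_def)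
  have GP[measurable]: "(\<lambda>z. G (fst z) (snd z)) \<in> borel_measurable P"
    using G_measurable by (simp cong: measurable_cong_sets[OF sP refl])
  have wm[measurable]: "w \<in> borel_measurable P" unfolding w_def by measurable
  define \<pi> where "\<pi> z = (snd z, 2 *\<^sub>R fst (fst z) - snd z)" for z :: "('a \<times> real) \<times> 'a"
  have \<pi>m[measurable]: "\<pi> \<in> measurable P (borel \<Otimes>\<^sub>M borel)" unfolding \<pi>_def by measurable
  have \<pi>m': "\<pi> \<in> measurable P borel" using \<pi>m by (simp add: borel_prod)
  define \<gamma> where "\<gamma> = distr (density P (\<lambda>z. ennreal (w z))) borel \<pi>"
  have s\<gamma>: "sets \<gamma> = sets borel" by (simp add: \<gamma>_def)
  have nn\<gamma>: "(\<integral>\<^sup>+z. f z \<partial>\<gamma>) = (\<integral>\<^sup>+z. ennreal (w z) * f (\<pi> z) \<partial>P)" if [measurable]: "f \<in> borel_measurable (borel \<Otimes>\<^sub>M borel)" for f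
  proof -
    have "f \<in> borel_measurable borel" using that by (simp add: borel_prod)
    then have "(\<integral>\<^sup>+z. f z \<partial>\<gamma>) = (\<integral>\<^sup>+z. f (\<pi> z) \<partial>density P (\<lambda>z. ennreal (w z)))"
      unfolding \<gamma>_def using \<pi>m' by (subst nn_integral_distr) auto
    also have "\<dots> = (\<integral>\<^sup>+z. ennreal (w z) * f (\<pi> z) \<partial>P)"
      by (rule nn_integral_density) measurable
    finally show ?thesis .
  qed
  have Gi: "integrable P (\<lambda>z. G (fst z) (snd z))" unfolding P_def by (rule G_integrable)
  have nnP: "(\<integral>\<^sup>+z. f z \<partial>P) = (\<integral>\<^sup>+u. \<integral>\<^sup>+x. f (u, x) \<partial>lborel \<partial>lborel)" if "f \<in> borel_measurable P" for f
    using that unfolding P_def by (rule lborel.nn_integral_fst[symmetric])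
  have fin: "finite_measure \<gamma>"
  proof (rule finite_measureI)
    have "emeasure \<gamma> (space \<gamma>) = (\<integral>\<^sup>+z. 1 \<partial>\<gamma>)" by simp
    also have "\<dots> = (\<integral>\<^sup>+z. ennreal (w z) * 1 \<partial>P)" by (rule nn\<gamma>) auto
    also have "\<dots> \<le> (\<integral>\<^sup>+z. ennreal (norm (G (fst z) (snd z))) \<partial>P)"
      using wle by (intro nn_integral_mono) (auto intro: ennreal_leI)
    also have "\<dots> < \<infinity>" using Gi by (simp add: integrable_iff_bounded)
    finally show "emeasure \<gamma> (space \<gamma>) \<noteq> \<infinity>" by simp
  qed
  interpret finite_measure \<gamma> by fact
  have meas: "ennreal (measure \<gamma> X) = (\<integral>\<^sup>+z. ennreal (w z) * indicator X (\<pi> z) \<partial>P)" if X: "X \<in> sets (borel \<Otimes>\<^sub>M borel)" for X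
  proof -
    have "X \<in> sets \<gamma>" using X unfolding s\<gamma> by (simp only: borel_prod)
    then have "ennreal (measure \<gamma> X) = (\<integral>\<^sup>+z. indicator X z \<partial>\<gamma>)"
      by (subst nn_integral_indicator) (simp_all add: emeasure_eq_measure)
    also have "\<dots> = (\<integral>\<^sup>+z. ennreal (w z) * indicator X (\<pi> z) \<partial>P)"
      by (rule nn\<gamma>) (rule borel_measurable_indicator[OF X])
    finally show ?thesis .
  qed
  have net\<gamma>: "measure m1 A - measure m2 A = measure \<gamma> (fst -` A) - measure \<gamma> (snd -` A)" if A[measurable]: "A \<in> sets borel" for A
  proof -
    have fA: "fst -` A \<in> sets (borel \<Otimes>\<^sub>M (borel :: 'a measure))" "snd -` A \<in> sets ((borel :: 'a measure) \<Otimes>\<^sub>M borel)"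
      using measurable_sets[OF measurable_fst[of borel borel] A] measurable_sets[OF measurable_snd[of borel borel] A]
      by (simp_all add: space_pair_measure)
    define p where "p z = max 0 (G (fst z) (snd z)) * indicator A (snd z)" for z
    define n where "n z = max 0 (- G (fst z) (snd z)) * indicator A (snd z)" for z
    have pn0: "0 \<le> p z" "0 \<le> n z" for z by (simp_all add: p_def n_def)
    have pm[measurable]: "p \<in> borel_measurable P" "n \<in> borel_measurable P" unfolding p_def n_def by measurable
    have pi: "integrable P p" "integrable P n"
      by (rule Bochner_Integration.integrable_bound[OF Gi], use pm in simp, intro AE_I2, auto simp: p_def n_def indicator_def)+
    have "ennreal (measure \<gamma> (fst -` A)) = (\<integral>\<^sup>+z. ennreal (p z) \<partial>P)"
      unfolding meas[OF fA(1)] by (intro nn_integral_cong) (auto simp: p_def w_def \<pi>_def indicator_def)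
    also have "\<dots> = ennreal (LINT z|P. p z)"
      by (rule nn_integral_eq_integral[OF pi(1)]) (simp add: p_def)
    finally have M1: "measure \<gamma> (fst -` A) = (LINT z|P. p z)"
      by (subst (asm) ennreal_inj) (auto intro!: integral_nonneg_AE simp: pn0)
    have "ennreal (measure \<gamma> (snd -` A)) = (\<integral>\<^sup>+z. ennreal (max 0 (G (fst z) (snd z)) * indicator A (2 *\<^sub>R fst (fst z) - snd z)) \<partial>P)"
      unfolding meas[OF fA(2)] by (intro nn_integral_cong) (auto simp: w_def \<pi>_def indicator_def)
    also have "\<dots> = (\<integral>\<^sup>+u. \<integral>\<^sup>+x. ennreal (max 0 (G u x) * indicator A (2 *\<^sub>R fst u - x)) \<partial>lborel \<partial>lborel)"
      by (subst nnP) auto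
    also have "\<dots> = (\<integral>\<^sup>+u. \<integral>\<^sup>+x. ennreal (n (u, x)) \<partial>lborel \<partial>lborel)"
    proof (rule nn_integral_cong)
      fix u :: "'a \<times> real"
      have [measurable]: "(\<lambda>x. G u x) \<in> borel_measurable borel" unfolding G_def by measurable
      have G: "G u (2 *\<^sub>R fst u - x) = - G u x" for x
      proof -
        have "2 *\<^sub>R fst u - x - fst u = - (x - fst u)" by (simp add: scaleR_2)
        then show ?thesis by (simp only: G_def heat_grad_minus) simp
      qed
      have "(\<integral>\<^sup>+x. ennreal (max 0 (G u x) * indicator A (2 *\<^sub>R fst u - x)) \<partial>lborel)
        = (\<integral>\<^sup>+x. ennreal (max 0 (G u x) * indicator A (2 *\<^sub>R fst u - x)) \<partial>distr lborel borel (\<lambda>x. 2 *\<^sub>R fst u - x))"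
        by (simp only: lborel_distr_reflect)
      also have "\<dots> = (\<integral>\<^sup>+x. ennreal (n (u, x)) \<partial>lborel)"
        by (subst nn_integral_distr) (auto simp: G n_def)
      finally show "(\<integral>\<^sup>+x. ennreal (max 0 (G u x) * indicator A (2 *\<^sub>R fst u - x)) \<partial>lborel) = (\<integral>\<^sup>+x. ennreal (n (u, x)) \<partial>lborel)" .
    qed
    also have "\<dots> = (\<integral>\<^sup>+z. ennreal (n z) \<partial>P)" by (subst nnP) auto
    also have "\<dots> = ennreal (LINT z|P. n z)"
      by (rule nn_integral_eq_integral[OF pi(2)]) (simp add: n_def)
    finally have M2: "measure \<gamma> (snd -` A) = (LINT z|P. n z)"
      by (subst (asm) ennreal_inj) (auto intro!: integral_nonneg_AE simp: pn0)
    have "integrable P (\<lambda>z. G (fst z) (snd z) * indicator A (snd z))"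
      by (rule Bochner_Integration.integrable_bound[OF Gi]) (auto simp: indicator_def)
    then have GA: "integrable (lborel \<Otimes>\<^sub>M lborel) (case_prod (\<lambda>u x. G u x * indicator A x))"
      by (simp add: P_def case_prod_unfold)
    have "measure \<gamma> (fst -` A) - measure \<gamma> (snd -` A) = (LINT z|P. p z - n z)"
      unfolding M1 M2 using pi by simp
    also have "\<dots> = (LINT z|P. G (fst z) (snd z) * indicator A (snd z))"
      by (intro Bochner_Integration.integral_cong) (auto simp: p_def n_def max_def indicator_def)
    also have "\<dots> = (LINT x|lborel. LINT u|lborel. G u x * indicator A x)"
      using lborel_pair.integral_snd[OF GA] by (simp add: P_def case_prod_unfold)
    also have "\<dots> = (LINT x|lborel. indicator A x * \<mu> x T)"
    proof (rule Bochner_Integration.integral_cong_AE)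
      show "AE x in lborel. (LINT u|lborel. G u x * indicator A x) = indicator A x * \<mu> x T"
        using AE_duhamel by eventually_elim simp
      show "(\<lambda>x. indicator A x * \<mu> x T) \<in> borel_measurable lborel"
        using borel_measurable_times[OF borel_measurable_indicator[OF A] slice_measurable(1)[OF T]] by simp
      show "(\<lambda>x. LINT u|lborel. G u x * indicator A x) \<in> borel_measurable lborel"
        using lborel_pair.integrable_snd[OF GA] by (rule borel_measurable_integrable)
    qed
    also have "\<dots> = measure m1 A - measure m2 A" using net[OF A] by simp
    finally show ?thesis by simp
  qed
  have displacement: "(\<integral>\<^sup>+z. ennreal (norm (snd z - fst (fst z)) * \<bar>G (fst z) (snd z)\<bar>) \<partial>P) \<le> ennreal (DIM('a) * Q * (exp (\<kappa> * T) / \<kappa>))"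
  proof -
    have "(\<integral>\<^sup>+z. ennreal (norm (snd z - fst (fst z)) * \<bar>G (fst z) (snd z)\<bar>) \<partial>P)
       = (\<integral>\<^sup>+u. \<integral>\<^sup>+x. ennreal (norm (x - fst u) * \<bar>G u x\<bar>) \<partial>lborel \<partial>lborel)"
      by (subst nnP) auto
    also have "\<dots> \<le> (\<integral>\<^sup>+u. ennreal (indicator {0<..<T} (snd u) * norm (q (fst u) (snd u)) * (1 * real DIM('a))) \<partial>lborel)"
      using slice_G(2) by (intro nn_integral_mono) simp
    also have "\<dots> \<le> (\<integral>\<^sup>+s. ennreal (indicator {0<..<T} s * (Q * exp (\<kappa> * s) * real DIM('a))) \<partial>lborel)"
      by (rule flux_time_integral) (use flux Q in auto)
    also have "\<dots> = (\<integral>\<^sup>+s. ennreal (DIM('a) * Q) * ennreal (indicator {0<..<T} s * exp (\<kappa> * s)) \<partial>lborel)"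
      using Q by (intro nn_integral_cong) (auto simp: ennreal_mult[symmetric] indicator_def mult_ac)
    also have "\<dots> = ennreal (DIM('a) * Q) * (\<integral>\<^sup>+s. ennreal (indicator {0<..<T} s * exp (\<kappa> * s)) \<partial>lborel)"
      by (intro nn_integral_cmult) measurable
    also have "\<dots> \<le> ennreal (DIM('a) * Q) * ennreal (exp (\<kappa> * T) / \<kappa>)"
      by (intro mult_left_mono exponential_time_integral \<kappa> T) auto
    also have "\<dots> = ennreal (DIM('a) * Q * (exp (\<kappa> * T) / \<kappa>))"
      using Q \<kappa> by (intro ennreal_mult[symmetric]) auto
    finally show ?thesis .
  qed
  \<comment> \<open>\<open>N\<close> dominates the norms of both endpoints, x and its reflection 2 y
    - x. Its integral is finite by the moment hypothesis for the position y and by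
    \<open>displacement\<close> for the rest; the value of \<open>M\<close> does not enter the final
    estimate.\<close>
  define N where "N z = norm (fst (fst z)) + norm (snd z - fst (fst z))" for z :: "('a \<times> real) \<times> 'a"
  have Nfin: "(\<integral>\<^sup>+z. ennreal (w z) * ennreal (N z) \<partial>P) < \<infinity>"
  proof -
    define C where "C = (1 + 2 * real DIM('a)) / 4"
    have C: "C \<ge> 0" by (simp add: C_def)
    have "(\<integral>\<^sup>+z. ennreal (w z) * ennreal (N z) \<partial>P)
       \<le> (\<integral>\<^sup>+z. ennreal (norm (fst (fst z)) * \<bar>G (fst z) (snd z)\<bar>) + ennreal (norm (snd z - fst (fst z)) * \<bar>G (fst z) (snd z)\<bar>) \<partial>P)"
    proof (rule nn_integral_mono)
      fix z
      have "w z * N z \<le> \<bar>G (fst z) (snd z)\<bar> * N z" using wle by (intro mult_right_mono) (auto simp: N_def)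
      then show "ennreal (w z) * ennreal (N z) \<le> ennreal (norm (fst (fst z)) * \<bar>G (fst z) (snd z)\<bar>) + ennreal (norm (snd z - fst (fst z)) * \<bar>G (fst z) (snd z)\<bar>)"
        using w0 by (simp add: ennreal_mult[symmetric] ennreal_plus[symmetric] N_def algebra_simps ennreal_leI del: ennreal_plus)
    qed
    also have "\<dots> = (\<integral>\<^sup>+z. ennreal (norm (fst (fst z)) * \<bar>G (fst z) (snd z)\<bar>) \<partial>P) + (\<integral>\<^sup>+z. ennreal (norm (snd z - fst (fst z)) * \<bar>G (fst z) (snd z)\<bar>) \<partial>P)"
      by (rule nn_integral_add) measurable
    also have "\<dots> < \<infinity>"
    proof -
      have "(\<integral>\<^sup>+z. ennreal (norm (fst (fst z)) * \<bar>G (fst z) (snd z)\<bar>) \<partial>P) = (\<integral>\<^sup>+u. \<integral>\<^sup>+x. ennreal (norm (fst u) * \<bar>G u x\<bar>) \<partial>lborel \<partial>lborel)"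
        by (subst nnP) auto
      also have "\<dots> \<le> (\<integral>\<^sup>+u. ennreal (indicator {0<..<T} (snd u) * norm (q (fst u) (snd u)) * (norm (fst u) * (C / sqrt (T - snd u)))) \<partial>lborel)"
      proof (rule nn_integral_mono)
        fix u :: "'a \<times> real"
        have [measurable]: "(\<lambda>x. G u x) \<in> borel_measurable borel" unfolding G_def by measurable
        have "(\<integral>\<^sup>+x. ennreal (norm (fst u) * \<bar>G u x\<bar>) \<partial>lborel) = ennreal (norm (fst u)) * (\<integral>\<^sup>+x. ennreal \<bar>G u x\<bar> \<partial>lborel)"
          by (subst nn_integral_cmult[symmetric]) (auto simp: ennreal_mult)
        also have "\<dots> \<le> ennreal (norm (fst u)) * ennreal (indicator {0<..<T} (snd u) * norm (q (fst u) (snd u)) * (C / sqrt (T - snd u)))"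
          using slice_G(1)[of u] unfolding C_def by (intro mult_left_mono) auto
        also have "\<dots> = ennreal (indicator {0<..<T} (snd u) * norm (q (fst u) (snd u)) * (norm (fst u) * (C / sqrt (T - snd u))))"
          using C by (subst ennreal_mult[symmetric]) (auto simp: indicator_def mult_ac)
        finally show "(\<integral>\<^sup>+x. ennreal (norm (fst u) * \<bar>G u x\<bar>) \<partial>lborel)
          \<le> ennreal (indicator {0<..<T} (snd u) * norm (q (fst u) (snd u)) * (norm (fst u) * (C / sqrt (T - snd u))))" .
      qed
      also have "\<dots> \<le> (\<integral>\<^sup>+s. ennreal (indicator {0<..<T} s * (M * (C / sqrt (T - s)))) \<partial>lborel)"
        by (rule flux_time_integral) (use moment C M in auto)
      also have "\<dots> \<le> (\<integral>\<^sup>+s. ennreal (C * M) * ennreal (indicator {0<..<T} s * (exp (\<kappa> * s) / sqrt (T - s))) \<partial>lborel)"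
      proof (rule nn_integral_mono)
        fix s :: real
        show "ennreal (indicator {0<..<T} s * (M * (C / sqrt (T - s)))) \<le> ennreal (C * M) * ennreal (indicator {0<..<T} s * (exp (\<kappa> * s) / sqrt (T - s)))"
        proof (cases "0 < s \<and> s < T")
          case True
          have "(C * M / sqrt (T - s)) * 1 \<le> (C * M / sqrt (T - s)) * exp (\<kappa> * s)"
            using True \<kappa> C M by (intro mult_left_mono) auto
          then show ?thesis using True C M by (simp add: ennreal_mult[symmetric] ennreal_leI mult_ac)
        qed auto
      qed
      also have "\<dots> = ennreal (C * M) * (\<integral>\<^sup>+s. ennreal (indicator {0<..<T} s * (exp (\<kappa> * s) / sqrt (T - s))) \<partial>lborel)"
        by (intro nn_integral_cmult) measurable
      also have "\<dots> \<le> ennreal (C * M) * ennreal (4 / sqrt \<kappa> * exp (\<kappa> * T))"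
        by (intro mult_left_mono singular_time_integral \<kappa> T) auto
      also have "\<dots> < \<infinity>" by (simp add: ennreal_mult_less_top)
      finally have 1: "(\<integral>\<^sup>+z. ennreal (norm (fst (fst z)) * \<bar>G (fst z) (snd z)\<bar>) \<partial>P) < \<infinity>" .
      from displacement have "(\<integral>\<^sup>+z. ennreal (norm (snd z - fst (fst z)) * \<bar>G (fst z) (snd z)\<bar>) \<partial>P) < \<infinity>"
        by (rule le_less_trans) simp
      with 1 show ?thesis by (simp add: ennreal_add_less_top)
    qed
    finally show ?thesis .
  qed
  have inf: "(\<integral>\<^sup>+z. ennreal (f z) \<partial>\<gamma>) < \<infinity>" if [measurable]: "f \<in> borel_measurable (borel \<Otimes>\<^sub>M borel)" and f: "\<And>z. f (\<pi> z) \<le> N z" for f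
  proof -
    have "(\<integral>\<^sup>+z. ennreal (f z) \<partial>\<gamma>) = (\<integral>\<^sup>+z. ennreal (w z) * ennreal (f (\<pi> z)) \<partial>P)" by (rule nn\<gamma>) measurable
    also have "\<dots> \<le> (\<integral>\<^sup>+z. ennreal (w z) * ennreal (N z) \<partial>P)"
      using f by (intro nn_integral_mono mult_left_mono ennreal_leI) auto
    also note Nfin
    finally show ?thesis .
  qed
  have i1: "integrable \<gamma> (\<lambda>z. norm (fst z))"
  proof (rule integrableI_nonneg)
    show "(\<integral>\<^sup>+z. ennreal (norm (fst z)) \<partial>\<gamma>) < \<infinity>"
    proof (rule inf)
      fix z show "norm (fst (\<pi> z)) \<le> N z"
        using norm_triangle_ineq[of "fst (fst z)" "snd z - fst (fst z)"] by (simp add: \<pi>_def N_def)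
    qed measurable
  qed (auto simp: s\<gamma> borel_prod[symmetric] cong: measurable_cong_sets)
  have i2: "integrable \<gamma> (\<lambda>z. norm (snd z))"
  proof (rule integrableI_nonneg)
    show "(\<integral>\<^sup>+z. ennreal (norm (snd z)) \<partial>\<gamma>) < \<infinity>"
    proof (rule inf)
      fix z show "norm (snd (\<pi> z)) \<le> N z"
      proof -
        have "snd (\<pi> z) = fst (fst z) - (snd z - fst (fst z))" by (simp add: \<pi>_def scaleR_2)
        then show ?thesis using norm_triangle_ineq4[of "fst (fst z)" "snd z - fst (fst z)"] by (simp only: N_def)
      qed
    qed measurable
  qed (auto simp: s\<gamma> borel_prod[symmetric] cong: measurable_cong_sets)
  have "d1 m1 m2 \<le> (LINT z|\<gamma>. dist (fst z) (snd z))"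
    by (rule d1_le_plan[OF m1 m2 fin s\<gamma> net\<gamma> i1 i2])
  also have "\<dots> = enn2real (\<integral>\<^sup>+z. ennreal (dist (fst z) (snd z)) \<partial>\<gamma>)"
    by (rule integral_eq_nn_integral) (auto simp: s\<gamma> borel_prod[symmetric] cong: measurable_cong_sets)
  also have "\<dots> \<le> 2 * DIM('a) * Q * exp (\<kappa> * T) / \<kappa>"
  proof (rule enn2real_leI)
    show "0 \<le> 2 * DIM('a) * Q * exp (\<kappa> * T) / \<kappa>" using Q \<kappa> by simp
    have "(\<integral>\<^sup>+z. ennreal (dist (fst z) (snd z)) \<partial>\<gamma>) = (\<integral>\<^sup>+z. ennreal (w z) * ennreal (dist (fst (\<pi> z)) (snd (\<pi> z))) \<partial>P)"
      by (rule nn\<gamma>) measurable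
    also have "\<dots> \<le> (\<integral>\<^sup>+z. 2 * ennreal (norm (snd z - fst (fst z)) * \<bar>G (fst z) (snd z)\<bar>) \<partial>P)"
    proof (rule nn_integral_mono)
      fix z
      have "dist (fst (\<pi> z)) (snd (\<pi> z)) = norm (2 *\<^sub>R (snd z - fst (fst z)))"
        by (simp add: \<pi>_def dist_norm scaleR_2 algebra_simps)
      then have "w z * dist (fst (\<pi> z)) (snd (\<pi> z)) \<le> 2 * (norm (snd z - fst (fst z)) * \<bar>G (fst z) (snd z)\<bar>)"
        using mult_right_mono[OF wle[of z], of "2 * norm (snd z - fst (fst z))"] by (simp add: mult_ac)
      then have "ennreal (w z * dist (fst (\<pi> z)) (snd (\<pi> z))) \<le> ennreal (2 * (norm (snd z - fst (fst z)) * \<bar>G (fst z) (snd z)\<bar>))"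
        by (rule ennreal_leI)
      then show "ennreal (w z) * ennreal (dist (fst (\<pi> z)) (snd (\<pi> z))) \<le> 2 * ennreal (norm (snd z - fst (fst z)) * \<bar>G (fst z) (snd z)\<bar>)"
        using w0[of z] by (simp add: ennreal_mult)
    qed
    also have "\<dots> = 2 * (\<integral>\<^sup>+z. ennreal (norm (snd z - fst (fst z)) * \<bar>G (fst z) (snd z)\<bar>) \<partial>P)"
      by (rule nn_integral_cmult) measurable
    also have "\<dots> \<le> 2 * ennreal (DIM('a) * Q * (exp (\<kappa> * T) / \<kappa>))"
      by (intro mult_left_mono displacement) auto
    also have "\<dots> = ennreal (2 * DIM('a) * Q * exp (\<kappa> * T) / \<kappa>)"
      using Q \<kappa> by (subst ennreal_numeral[symmetric], subst ennreal_mult[symmetric]) (auto simp: mult_ac)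
    finally show "(\<integral>\<^sup>+z. ennreal (dist (fst z) (snd z)) \<partial>\<gamma>) \<le> ennreal (2 * DIM('a) * Q * exp (\<kappa> * T) / \<kappa>)" .
  qed
  finally show ?thesis .
qed

end

section \<open>Solutions of the mean field game system\<close>

text \<open>Dividing the first order expansion along \<open>v\<close> by the step length lets the
  remainder vanish, so Lipschitz continuity at the single point \<open>x\<close> suffices.\<close>

lemma norm_derivative_le_of_lipschitz:
  fixes f :: "'a::real_normed_vector \<Rightarrow> 'b::real_normed_vector"
  assumes f: "(f has_derivative f') (at x)" and K: "\<And>y. norm (f y - f x) \<le> K * norm (y - x)"
  shows "norm (f' v) \<le> K * norm v"
proof -
  have "((\<lambda>s. x + s *\<^sub>R v) has_derivative (\<lambda>s. s *\<^sub>R v)) (at 0)" by (auto intro!: derivative_eq_intros)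
  moreover have "(f has_derivative f') (at (x + 0 *\<^sub>R v))" using f by simp
  ultimately have "((\<lambda>s. f (x + s *\<^sub>R v)) has_derivative (\<lambda>s. f' (s *\<^sub>R v))) (at 0)"
    by (rule has_derivative_compose)
  then have "((\<lambda>s. f (x + s *\<^sub>R v)) has_derivative (\<lambda>s. s *\<^sub>R f' v)) (at 0)"
    by (simp add: linear_scale[OF has_derivative_linear[OF f]])
  then have lim: "((\<lambda>s. norm (f (x + s *\<^sub>R v) - f x - s *\<^sub>R f' v) / norm s) \<longlongrightarrow> 0) (at 0)"
    by (simp add: has_derivative_at)
  have "norm (f' v) - K * norm v \<le> 0"
  proof (rule tendsto_lowerbound[OF lim])
    show "eventually (\<lambda>s. norm (f' v) - K * norm v \<le> norm (f (x + s *\<^sub>R v) - f x - s *\<^sub>R f' v) / norm s) (at 0)"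
    proof (unfold eventually_at_filter, rule always_eventually, intro allI impI)
      fix s :: real assume s: "s \<noteq> 0"
      have "\<bar>s\<bar> * norm (f' v) \<le> norm (f (x + s *\<^sub>R v) - f x) + norm (f (x + s *\<^sub>R v) - f x - s *\<^sub>R f' v)"
        using norm_triangle_ineq4[of "f (x + s *\<^sub>R v) - f x" "f (x + s *\<^sub>R v) - f x - s *\<^sub>R f' v"] by simp
      also have "norm (f (x + s *\<^sub>R v) - f x) \<le> K * (\<bar>s\<bar> * norm v)" using K[of "x + s *\<^sub>R v"] by simp
      finally have "(norm (f' v) - K * norm v) * \<bar>s\<bar> \<le> norm (f (x + s *\<^sub>R v) - f x - s *\<^sub>R f' v)"
        by (simp add: algebra_simps)
      then show "norm (f' v) - K * norm v \<le> norm (f (x + s *\<^sub>R v) - f x - s *\<^sub>R f' v) / norm s"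
        using s by (simp add: pos_le_divide_eq)
    qed
  qed simp
  then show ?thesis by simp
qed

text \<open>Nonemptiness of the set of couplings is what allows a lower bound to pass to the infimum
  in \<open>d1\<close>.\<close>

lemma couplings_nonempty:
  fixes \<mu> \<nu> :: "'a::euclidean_space measure"
  assumes \<mu>: "\<mu> \<in> P1" and \<nu>: "\<nu> \<in> P1"
  shows "\<mu> \<Otimes>\<^sub>M \<nu> \<in> couplings \<mu> \<nu>"
proof -
  interpret \<mu>: prob_space \<mu> using P1_D[OF \<mu>] by auto
  interpret \<nu>: prob_space \<nu> using P1_D[OF \<nu>] by auto
  interpret pair_prob_space \<mu> \<nu> ..
  note s\<mu> = P1_D(2)[OF \<mu>] and s\<nu> = P1_D(2)[OF \<nu>]
  have s: "sets (\<mu> \<Otimes>\<^sub>M \<nu>) = sets (borel \<Otimes>\<^sub>M borel)" by (rule sets_pair_measure_cong[OF s\<mu> s\<nu>])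
  have "distr (\<mu> \<Otimes>\<^sub>M \<nu>) borel fst = \<mu>"
  proof (rule measure_eqI)
    fix A assume "A \<in> sets (distr (\<mu> \<Otimes>\<^sub>M \<nu>) borel fst)"
    then have A: "A \<in> sets borel" by simp
    have "fst -` A \<inter> space (\<mu> \<Otimes>\<^sub>M \<nu>) = A \<times> UNIV" by (auto simp: space_pair_measure P1_D(3)[OF \<mu>] P1_D(3)[OF \<nu>])
    then have "emeasure (distr (\<mu> \<Otimes>\<^sub>M \<nu>) borel fst) A = emeasure (\<mu> \<Otimes>\<^sub>M \<nu>) (A \<times> UNIV)"
      using A by (subst emeasure_distr) (simp_all cong: measurable_cong_sets[OF s refl])
    also have "\<dots> = emeasure \<mu> A * emeasure \<nu> UNIV"
      using A s\<mu> s\<nu> by (intro \<nu>.emeasure_pair_measure_Times) auto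
    finally show "emeasure (distr (\<mu> \<Otimes>\<^sub>M \<nu>) borel fst) A = emeasure \<mu> A"
      using \<nu>.emeasure_space_1 by (simp add: P1_D(3)[OF \<nu>])
  qed (simp add: s\<mu>)
  moreover have "distr (\<mu> \<Otimes>\<^sub>M \<nu>) borel snd = \<nu>"
  proof (rule measure_eqI)
    fix A assume "A \<in> sets (distr (\<mu> \<Otimes>\<^sub>M \<nu>) borel snd)"
    then have A: "A \<in> sets borel" by simp
    have "snd -` A \<inter> space (\<mu> \<Otimes>\<^sub>M \<nu>) = UNIV \<times> A" by (auto simp: space_pair_measure P1_D(3)[OF \<mu>] P1_D(3)[OF \<nu>])
    then have "emeasure (distr (\<mu> \<Otimes>\<^sub>M \<nu>) borel snd) A = emeasure (\<mu> \<Otimes>\<^sub>M \<nu>) (UNIV \<times> A)"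
      using A by (subst emeasure_distr) (simp_all cong: measurable_cong_sets[OF s refl])
    also have "\<dots> = emeasure \<mu> UNIV * emeasure \<nu> A"
      using A s\<mu> s\<nu> by (intro \<nu>.emeasure_pair_measure_Times) auto
    finally show "emeasure (distr (\<mu> \<Otimes>\<^sub>M \<nu>) borel snd) A = emeasure \<nu> A"
      using \<mu>.emeasure_space_1 by (simp add: P1_D(3)[OF \<mu>])
  qed (simp add: s\<nu>)
  moreover have "prob_space (\<mu> \<Otimes>\<^sub>M \<nu>)" by (rule P.prob_space_axioms)
  moreover have "sets (\<mu> \<Otimes>\<^sub>M \<nu>) = sets borel" using s by (simp only: borel_prod)
  ultimately show ?thesis unfolding couplings_def by blast
qed

text \<open>The easy half of Kantorovich duality: the difference of the integrals is the integral of
  f x - f y over any coupling. This is how continuity in \<open>d1\<close> is converted into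
  statements about moments and initial values.\<close>

lemma lipschitz_integral_diff_le_d1:
  fixes \<mu> \<nu> :: "'a::euclidean_space measure" and f :: "'a \<Rightarrow> real"
  assumes \<mu>: "\<mu> \<in> P1" and \<nu>: "\<nu> \<in> P1" and K: "K > 0"
    and lip: "\<And>x y. \<bar>f x - f y\<bar> \<le> K * norm (x - y)"
  shows "integrable \<mu> f" "\<bar>(LINT x|\<mu>. f x) - (LINT x|\<nu>. f x)\<bar> \<le> K * d1 \<mu> \<nu>"
proof -
  have "continuous_on UNIV f"
  proof (rule continuous_onI)
    fix x :: 'a and e :: real assume "e > 0"
    then show "\<exists>d>0. \<forall>x'\<in>UNIV. dist x' x < d \<longrightarrow> dist (f x') (f x) \<le> e"
      using K by (intro exI[of _ "e / K"]) (auto simp: dist_norm field_simps intro!: order_trans[OF lip])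
  qed
  then have fm[measurable]: "f \<in> borel_measurable borel" by (rule borel_measurable_continuous_onI)
  have int: "integrable \<theta> f" if \<theta>: "\<theta> \<in> P1" for \<theta>
  proof (rule Bochner_Integration.integrable_bound)
    interpret prob_space \<theta> using P1_D[OF \<theta>] by auto
    show "integrable \<theta> (\<lambda>x. K * norm x + \<bar>f 0\<bar>)" using P1_D(4)[OF \<theta>] by auto
    show "f \<in> borel_measurable \<theta>" using fm by (simp cong: measurable_cong_sets[OF P1_D(2)[OF \<theta>] refl])
    show "AE x in \<theta>. norm (f x) \<le> norm (K * norm x + \<bar>f 0\<bar>)"
    proof (rule AE_I2)
      fix x have "\<bar>f x\<bar> \<le> K * norm x + \<bar>f 0\<bar>" using lip[of x 0] by auto
      then show "norm (f x) \<le> norm (K * norm x + \<bar>f 0\<bar>)" by simp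
    qed
  qed
  show "integrable \<mu> f" by (rule int[OF \<mu>])
  have "\<bar>(LINT x|\<mu>. f x) - (LINT x|\<nu>. f x)\<bar> / K \<le> (LINT z|\<pi>. dist (fst z) (snd z))" if \<pi>: "\<pi> \<in> couplings \<mu> \<nu>" for \<pi>
  proof -
    from \<pi> have p: "prob_space \<pi>" and s: "sets \<pi> = sets borel" and d1: "distr \<pi> borel fst = \<mu>" and d2: "distr \<pi> borel snd = \<nu>"
      by (auto simp: couplings_def)
    have s': "sets \<pi> = sets (borel \<Otimes>\<^sub>M borel)" unfolding s by (simp only: borel_prod)
    have m1: "fst \<in> measurable \<pi> borel" and m2: "snd \<in> measurable \<pi> borel"
      by (simp_all cong: measurable_cong_sets[OF s' refl])
    have i1: "integrable \<pi> (\<lambda>z. h (fst z))" "(LINT z|\<pi>. h (fst z)) = (LINT x|\<mu>. h x)"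
      if "integrable \<mu> h" "h \<in> borel_measurable borel" for h :: "'a \<Rightarrow> real"
      using that integrable_distr_eq[OF m1, of h] integral_distr[OF m1, of h] unfolding d1 by auto
    have i2: "integrable \<pi> (\<lambda>z. h (snd z))" "(LINT z|\<pi>. h (snd z)) = (LINT x|\<nu>. h x)"
      if "integrable \<nu> h" "h \<in> borel_measurable borel" for h :: "'a \<Rightarrow> real"
      using that integrable_distr_eq[OF m2, of h] integral_distr[OF m2, of h] unfolding d2 by auto
    have di: "integrable \<pi> (\<lambda>z. dist (fst z) (snd z))"
    proof (rule Bochner_Integration.integrable_bound)
      show "integrable \<pi> (\<lambda>z. norm (fst z) + norm (snd z))"
        using i1(1)[OF P1_D(4)[OF \<mu>]] i2(1)[OF P1_D(4)[OF \<nu>]] by auto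
      show "(\<lambda>z. dist (fst z) (snd z)) \<in> borel_measurable \<pi>"
        using m1 m2 by measurable
      show "AE z in \<pi>. norm (dist (fst z) (snd z)) \<le> norm (norm (fst z) + norm (snd z))"
        by (intro AE_I2) (simp add: dist_norm norm_triangle_ineq4)
    qed
    have "(LINT x|\<mu>. f x) - (LINT x|\<nu>. f x) = (LINT z|\<pi>. f (fst z) - f (snd z))"
      using i1[OF int[OF \<mu>] fm] i2[OF int[OF \<nu>] fm] by simp
    then have "\<bar>(LINT x|\<mu>. f x) - (LINT x|\<nu>. f x)\<bar> \<le> (LINT z|\<pi>. \<bar>f (fst z) - f (snd z)\<bar>)"
      by (simp only: integral_abs_bound)
    also have "\<dots> \<le> (LINT z|\<pi>. K * dist (fst z) (snd z))"
      by (rule integral_mono') (use di lip K in \<open>auto simp: dist_norm\<close>)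
    also have "\<dots> = K * (LINT z|\<pi>. dist (fst z) (snd z))" by simp
    finally show ?thesis using K by (simp add: field_simps)
  qed
  then have "\<bar>(LINT x|\<mu>. f x) - (LINT x|\<nu>. f x)\<bar> / K \<le> d1 \<mu> \<nu>"
    unfolding d1_def using couplings_nonempty[OF \<mu> \<nu>] by (intro cINF_greatest) auto
  then show "\<bar>(LINT x|\<mu>. f x) - (LINT x|\<nu>. f x)\<bar> \<le> K * d1 \<mu> \<nu>" using K by (simp add: field_simps)
qed

lemma d1_nonneg:
  fixes \<mu> \<nu> :: "'a::euclidean_space measure"
  assumes "\<mu> \<in> P1" "\<nu> \<in> P1"
  shows "0 \<le> d1 \<mu> \<nu>"
  using lipschitz_integral_diff_le_d1(2)[OF assms, of 1 "\<lambda>_. 0"] by simp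

locale mfg_single =
  fixes \<alpha> C L lam :: real and F :: "real^'n \<Rightarrow> (real^'n) measure \<Rightarrow> real" and H :: "real^'n \<Rightarrow> real^'n \<Rightarrow> real"
    and m0 :: "(real^'n) measure" and u :: "real^'n \<Rightarrow> real \<Rightarrow> real" and m :: "real \<Rightarrow> (real^'n) measure"
  assumes C: "C \<ge> 1" and L: "L > 0" and ham: "hamiltonian_assms \<alpha> C H" and cost: "coupling_cost_assms \<alpha> C L F"
    and lam: "lam \<ge> 2 * C" and sol: "mfg_classical_solution F H m0 lam u m" and bounds: "uniqueness_bounds u"
begin

text \<open>\<open>R\<close> is the bound for \<open>lam\<close> |Du| from
  \<open>hjb_gradient_bound\<close>. On momenta of norm at most \<open>R\<close>,
  \<open>drift_bound\<close> serves both as a bound for D_pH and as a Lipschitz constant of H in p.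
  Neither number involves \<open>lam\<close>; otherwise the threshold for \<open>lam\<close> would
  be circular.\<close>

definition R :: real where "R = 2 * (L + C)"
definition drift_bound :: real where "drift_bound = C * (2 + (1 + R)\<^sup>2)"
definition b :: "real^'n \<Rightarrow> real \<Rightarrow> real^'n" where "b x t = grad_p H (lam *\<^sub>R grad (\<lambda>y. u y t) x) x"
definition b' :: "real^'n \<Rightarrow> real \<Rightarrow> real^'n \<Rightarrow> real^'n" where "b' x t = frechet_derivative (\<lambda>y. b y t) (at x)"

lemma hjb: "hjb_solution F H lam u m" and fp: "fp_solution H m0 lam u m"
  using sol by (simp_all add: mfg_classical_solution_def)

lemma lam_pos: "lam > 0" using lam C by simp

lemma m_P1: "t \<ge> 0 \<Longrightarrow> m t \<in> P1"
  using fp by (simp add: fp_solution_def)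

lemma u_C21: "class_C21_on {0..} u" using hjb by (simp add: hjb_solution_def)

lemma u_gradient_bound: "t > 0 \<Longrightarrow> lam * norm (grad (\<lambda>y. u y t) x) \<le> R"
  unfolding R_def using hjb_gradient_bound[OF ham C cost L hjb bounds m_P1 lam] by simp

lemma drift_bound_nonneg: "drift_bound \<ge> 0" using C by (simp add: drift_bound_def)

lemma norm_drift_le: assumes t: "t > 0" shows "norm (b x t) \<le> drift_bound"
proof -
  have "norm (lam *\<^sub>R grad (\<lambda>y. u y t) x) \<le> R" using u_gradient_bound[OF t] lam_pos by simp
  then have "C * (2 + (1 + norm (lam *\<^sub>R grad (\<lambda>y. u y t) x))\<^sup>2) \<le> drift_bound"
    unfolding drift_bound_def using C by (intro mult_left_mono add_left_mono power_mono) auto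
  then show ?thesis using norm_grad_p_le[OF ham C, of "lam *\<^sub>R grad (\<lambda>y. u y t) x" x] unfolding b_def by linarith
qed

lemma grad_u_lipschitz:
  assumes t: "t > 0"
  shows "norm (grad (\<lambda>y. u y t) x - grad (\<lambda>y. u y t) y) \<le> norm (x - y)"
proof -
  have "onorm (hess (\<lambda>y. u y t) x) \<le> 1" for x
    using bounds t by (simp add: uniqueness_bounds_def)
  then have "norm (grad (\<lambda>y. u y t) x - grad (\<lambda>y. u y t) y) \<le> 1 * norm (x - y)"
    by (intro differentiable_bound[of UNIV _ "\<lambda>x. hess (\<lambda>y. u y t) x"] class_C21_onD(2)[OF u_C21, THEN has_derivative_at_withinI])
       (use t in auto)
  then show ?thesis by simp
qed

text \<open>The bound 1 on the Hessian of u enters here, through \<open>grad_u_lipschitz\<close>.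
  The constant grows with \<open>lam\<close>, which is acceptable: it serves to bound the derivative
  of the flux on balls before integrating by parts.\<close>

lemma b_lipschitz:
  assumes t: "t > 0"
  shows "norm (b x t - b y t) \<le> (C * lam + C * (1 + R)) * norm (x - y)"
proof -
  define p where "p x = lam *\<^sub>R grad (\<lambda>y. u y t) x" for x
  have pR: "norm (p x) \<le> R" for x using u_gradient_bound[OF t] lam_pos by (simp add: p_def)
  have "norm (p x - p y) \<le> lam * norm (x - y)"
    using grad_u_lipschitz[OF t, of x y] lam_pos by (simp add: p_def scaleR_diff_right[symmetric])
  then have "norm (grad_p H (p x) x - grad_p H (p y) x) \<le> C * (lam * norm (x - y))"
    using C by (intro order_trans[OF grad_p_lipschitz_p[OF ham C]] mult_left_mono) auto
  moreover have "norm (grad_p H (p y) x - grad_p H (p y) y) \<le> C * (1 + R) * norm (x - y)"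
    using C pR[of y] by (intro order_trans[OF grad_p_lipschitz_x[OF ham C]] mult_right_mono mult_left_mono) auto
  moreover have e: "b x t - b y t = (grad_p H (p x) x - grad_p H (p y) x) + (grad_p H (p y) x - grad_p H (p y) y)"
    by (simp add: b_def p_def)
  ultimately have "norm (b x t - b y t) \<le> C * (lam * norm (x - y)) + C * (1 + R) * norm (x - y)"
    unfolding e by (intro order_trans[OF norm_triangle_ineq] add_mono)
  then show ?thesis by (simp add: algebra_simps)
qed

lemma b_derivative:
  assumes t: "t > 0"
  shows "((\<lambda>y. b y t) has_derivative b' x t) (at x)"
proof -
  have "((\<lambda>y. (lam *\<^sub>R grad (\<lambda>y. u y t) y, y)) has_derivative (\<lambda>v. (lam *\<^sub>R hess (\<lambda>y. u y t) x v, v))) (at x)"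
    using class_C21_onD(2)[OF u_C21, of t x] t by (auto intro!: derivative_eq_intros)
  moreover obtain D where "((\<lambda>z. grad_p H (fst z) (snd z)) has_derivative D) (at (lam *\<^sub>R grad (\<lambda>y. u y t) x, x))"
    using grad_p_differentiable[OF ham C] unfolding differentiable_def by blast
  ultimately have "((\<lambda>y. grad_p H (fst (lam *\<^sub>R grad (\<lambda>y. u y t) y, y)) (snd (lam *\<^sub>R grad (\<lambda>y. u y t) y, y)))
      has_derivative (\<lambda>v. D (lam *\<^sub>R hess (\<lambda>y. u y t) x v, v))) (at x)"
    by (rule has_derivative_compose)
  then have "(\<lambda>y. b y t) differentiable (at x)"
    by (auto simp: differentiable_def b_def)
  then show ?thesis by (simp add: b'_def frechet_derivative_works)
qed

lemma norm_b'_le: "t > 0 \<Longrightarrow> norm (b' x t v) \<le> (C * lam + C * (1 + R)) * norm v"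
  by (rule norm_derivative_le_of_lipschitz[OF b_derivative b_lipschitz])

lemma b_continuous: "continuous_on (UNIV \<times> {0<..}) (\<lambda>(x, t). b x t)"
proof -
  have "continuous_on (UNIV \<times> {0..}) (\<lambda>(x, t). grad (\<lambda>y. u y t) x)"
    using u_C21 by (simp add: class_C21_on_def)
  then have 1: "continuous_on (UNIV \<times> {0<..}) (\<lambda>z. grad (\<lambda>y. u y (snd z)) (fst z))"
    unfolding case_prod_unfold by (rule continuous_on_subset) auto
  have 2: "continuous_on UNIV (\<lambda>z. grad_p H (fst z) (snd z))"
    using grad_p_differentiable[OF ham C] by (intro differentiable_imp_continuous_on differentiable_at_imp_differentiable_on) auto
  have "continuous_on (UNIV \<times> {0<..}) (\<lambda>z. grad_p H (fst (lam *\<^sub>R grad (\<lambda>y. u y (snd z)) (fst z), fst z)) (snd (lam *\<^sub>R grad (\<lambda>y. u y (snd z)) (fst z), fst z)))"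
    by (rule continuous_on_compose2[OF 2, of _ "\<lambda>z. (lam *\<^sub>R grad (\<lambda>y. u y (snd z)) (fst z), fst z)"])
       (auto intro!: continuous_intros 1)
  then show ?thesis by (simp add: b_def case_prod_unfold)
qed

text \<open>The solution concept asserts only that a density exists; a choice is fixed once and for
  all.\<close>

definition \<rho> :: "real^'n \<Rightarrow> real \<Rightarrow> real" where
  "\<rho> = (SOME \<rho>. class_C21_on {0<..} \<rho> \<and>
        (\<forall>t>0. (\<forall>x. 0 \<le> \<rho> x t) \<and> m t = density lborel (\<lambda>x. ennreal (\<rho> x t))) \<and>
        (\<forall>x. \<forall>t>0. time_deriv \<rho> x t - laplacian (\<lambda>y. \<rho> y t) x
             - divergence (\<lambda>y. \<rho> y t *\<^sub>R grad_p H (lam *\<^sub>R grad (\<lambda>z. u z t) y) y) x = 0))"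

lemma \<rho>_props:
  "class_C21_on {0<..} \<rho> \<and>
        (\<forall>t>0. (\<forall>x. 0 \<le> \<rho> x t) \<and> m t = density lborel (\<lambda>x. ennreal (\<rho> x t))) \<and>
        (\<forall>x. \<forall>t>0. time_deriv \<rho> x t - laplacian (\<lambda>y. \<rho> y t) x
             - divergence (\<lambda>y. \<rho> y t *\<^sub>R grad_p H (lam *\<^sub>R grad (\<lambda>z. u z t) y) y) x = 0)"
proof -
  have "\<exists>\<rho>. class_C21_on {0<..} \<rho> \<and>
        (\<forall>t>0. (\<forall>x. 0 \<le> \<rho> x t) \<and> m t = density lborel (\<lambda>x. ennreal (\<rho> x t))) \<and>
        (\<forall>x. \<forall>t>0. time_deriv \<rho> x t - laplacian (\<lambda>y. \<rho> y t) x
             - divergence (\<lambda>y. \<rho> y t *\<^sub>R grad_p H (lam *\<^sub>R grad (\<lambda>z. u z t) y) y) x = 0)"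
    using fp unfolding fp_solution_def by (elim conjE)
  then show ?thesis unfolding \<rho>_def by (rule someI_ex)
qed

lemma \<rho>_C21: "class_C21_on {0<..} \<rho>" using \<rho>_props by (rule conjunct1)
lemma \<rho>_nonneg: "t > 0 \<Longrightarrow> 0 \<le> \<rho> x t"
  and m_density: "t > 0 \<Longrightarrow> m t = density lborel (\<lambda>x. ennreal (\<rho> x t))"
  using \<rho>_props[THEN conjunct2, THEN conjunct1] by blast+

lemma \<rho>_derivs:
  assumes t: "t > 0"
  shows "((\<lambda>y. \<rho> y t) has_derivative (\<lambda>v. grad (\<lambda>y. \<rho> y t) x \<bullet> v)) (at x)"
    "((\<lambda>y. grad (\<lambda>z. \<rho> z t) y) has_derivative hess (\<lambda>y. \<rho> y t) x) (at x)"
    "((\<lambda>s. \<rho> x s) has_real_derivative time_deriv \<rho> x t) (at t)"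
  using class_C21_onD[OF \<rho>_C21] t by auto

lemma \<rho>_cont:
  "continuous_on (UNIV \<times> {0<..}) (\<lambda>(x, t). \<rho> x t)"
  "continuous_on (UNIV \<times> {0<..}) (\<lambda>(x, t). grad (\<lambda>y. \<rho> y t) x)"
  "continuous_on (UNIV \<times> {0<..}) (\<lambda>(x, t). hess (\<lambda>y. \<rho> y t) x v)"
  "continuous_on (UNIV \<times> {0<..}) (\<lambda>(x, t). time_deriv \<rho> x t)"
  using \<rho>_C21 by (simp_all add: class_C21_on_def)

definition flux' :: "real^'n \<Rightarrow> real \<Rightarrow> real^'n \<Rightarrow> real^'n" where
  "flux' x t v = \<rho> x t *\<^sub>R b' x t v + (grad (\<lambda>y. \<rho> y t) x \<bullet> v) *\<^sub>R b x t"

lemma flux_derivative: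
  assumes t: "t > 0"
  shows "((\<lambda>y. \<rho> y t *\<^sub>R b y t) has_derivative flux' x t) (at x)"
  unfolding flux'_def[abs_def] by (rule has_derivative_scaleR[OF \<rho>_derivs(1)[OF t] b_derivative[OF t]])

lemma \<rho>_equation:
  assumes t: "t > 0"
  shows "time_deriv \<rho> x t = (\<Sum>c\<in>Basis. hess (\<lambda>y. \<rho> y t) x c \<bullet> c) + (\<Sum>c\<in>Basis. flux' x t c \<bullet> c)"
proof -
  have "time_deriv \<rho> x t - laplacian (\<lambda>y. \<rho> y t) x - divergence (\<lambda>y. \<rho> y t *\<^sub>R b y t) x = 0"
    using \<rho>_props[THEN conjunct2, THEN conjunct2] t unfolding b_def by blast
  moreover have "divergence (\<lambda>y. \<rho> y t *\<^sub>R b y t) x = (\<Sum>c\<in>Basis. flux' x t c \<bullet> c)"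
    unfolding divergence_def using frechet_derivative_at[OF flux_derivative[OF t, of x]] by simp
  ultimately show ?thesis by (simp add: laplacian_eq)
qed

lemma \<rho>_slice_continuous: "t > 0 \<Longrightarrow> continuous_on UNIV (\<lambda>y. \<rho> y t)"
  using \<rho>_derivs(1) by (intro has_derivative_continuous_on) (auto intro: has_derivative_at_withinI)

lemma \<rho>_measurable: "t > 0 \<Longrightarrow> (\<lambda>y. \<rho> y t) \<in> borel_measurable borel"
  by (rule borel_measurable_continuous_onI[OF \<rho>_slice_continuous])

lemma flux'_bounded:
  assumes t: "t > 0"
  shows "\<exists>K. \<forall>x c. norm x \<le> r \<longrightarrow> c \<in> Basis \<longrightarrow> norm (flux' x t c) \<le> K"
proof -
  have c1: "continuous_on (cball 0 r) (\<lambda>y. \<rho> y t)"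
    using \<rho>_slice_continuous[OF t] by (rule continuous_on_subset) auto
  have "continuous_on UNIV (\<lambda>y. grad (\<lambda>y. \<rho> y t) y)"
    using \<rho>_derivs(2)[OF t] by (intro has_derivative_continuous_on) (auto intro: has_derivative_at_withinI)
  then have c2: "continuous_on (cball 0 r) (\<lambda>y. grad (\<lambda>y. \<rho> y t) y)" by (rule continuous_on_subset) auto
  obtain K1 where K1: "\<forall>z\<in>(\<lambda>y. \<rho> y t) ` cball 0 r. norm z \<le> K1"
    using compact_imp_bounded[OF compact_continuous_image[OF c1 compact_cball]] by (auto simp: bounded_iff)
  obtain K2 where K2: "\<forall>z\<in>(\<lambda>y. grad (\<lambda>y. \<rho> y t) y) ` cball 0 r. norm z \<le> K2"
    using compact_imp_bounded[OF compact_continuous_image[OF c2 compact_cball]] by (auto simp: bounded_iff)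
  show ?thesis
  proof (intro exI allI impI)
    fix x c :: "real^'n" assume x: "norm x \<le> r" and c: "c \<in> Basis"
    have 1: "\<bar>\<rho> x t\<bar> \<le> K1" "norm (grad (\<lambda>y. \<rho> y t) x) \<le> K2" using K1 K2 x by auto
    have 2: "norm (b' x t c) \<le> C * lam + C * (1 + R)" using norm_b'_le[OF t, of x c] c by simp
    have 3: "\<bar>grad (\<lambda>y. \<rho> y t) x \<bullet> c\<bar> \<le> K2"
      using Cauchy_Schwarz_ineq2[of "grad (\<lambda>y. \<rho> y t) x" c] c 1 by simp
    have 4: "K1 \<ge> 0" "K2 \<ge> 0" using 1 norm_ge_zero[of "grad (\<lambda>y. \<rho> y t) x"] by linarith+
    have "norm (flux' x t c) \<le> norm (\<rho> x t *\<^sub>R b' x t c) + norm ((grad (\<lambda>y. \<rho> y t) x \<bullet> c) *\<^sub>R b x t)"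
      unfolding flux'_def by (rule norm_triangle_ineq)
    also have "\<dots> \<le> K1 * (C * lam + C * (1 + R)) + K2 * drift_bound"
      unfolding norm_scaleR using 1 2 3 4 norm_drift_le[OF t, of x] by (intro add_mono mult_mono) auto
    finally show "norm (flux' x t c) \<le> K1 * (C * lam + C * (1 + R)) + K2 * drift_bound" .
  qed
qed

lemma \<rho>_mass: assumes t: "t > 0" shows "(\<integral>\<^sup>+x. ennreal (\<rho> x t) \<partial>lborel) = 1"
proof -
  interpret prob_space "m t" using P1_D[OF m_P1] t by auto
  have "(\<integral>\<^sup>+x. ennreal (\<rho> x t) \<partial>lborel) = emeasure (m t) UNIV"
    unfolding m_density[OF t] using \<rho>_measurable[OF t] by (subst emeasure_density) auto
  then show ?thesis using emeasure_space_1 P1_D(3)[OF m_P1, of t] t by simp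
qed

lemma integral_m:
  assumes t: "t > 0" and f: "f \<in> borel_measurable borel"
  shows "(LINT x|m t. f x) = (LINT x|lborel. \<rho> x t * f x)"
  unfolding m_density[OF t] using f \<rho>_measurable[OF t] \<rho>_nonneg[OF t] by (subst integral_density) auto

text \<open>The norm is 1-Lipschitz, so the first moment is a continuous function of time with
  respect to \<open>d1\<close> and is bounded on the compact interval [0, T].\<close>

lemma moment_bounded: "\<exists>M\<ge>0. \<forall>s. 0 < s \<longrightarrow> s < T \<longrightarrow> (\<integral>\<^sup>+y. ennreal (norm y * \<rho> y s) \<partial>lborel) \<le> ennreal M"
proof -
  define \<nu> where "\<nu> s = (LINT x|m s. norm x)" for s
  have lip: "\<bar>norm x - norm y\<bar> \<le> 1 * norm (x - y)" for x y :: "real^'n" by (simp add: norm_triangle_ineq3)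
  have cont: "continuous_on {0..T} \<nu>"
    unfolding continuous_on_def
  proof
    fix t assume t: "t \<in> {0..T}"
    have "((\<lambda>s. d1 (m s) (m t)) \<longlongrightarrow> 0) (at t within {0..})"
      using fp t by (simp add: fp_solution_def)
    then have l: "((\<lambda>s. d1 (m s) (m t)) \<longlongrightarrow> 0) (at t within {0..T})"
      by (rule tendsto_within_subset) auto
    have "((\<lambda>s. \<nu> s - \<nu> t) \<longlongrightarrow> 0) (at t within {0..T})"
    proof (rule Lim_null_comparison[OF _ l])
      show "eventually (\<lambda>s. norm (\<nu> s - \<nu> t) \<le> d1 (m s) (m t)) (at t within {0..T})"
        unfolding eventually_at_filter
      proof (rule always_eventually, intro allI impI)
        fix s assume "s \<noteq> t" "s \<in> {0..T}"
        then show "norm (\<nu> s - \<nu> t) \<le> d1 (m s) (m t)"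
          using lipschitz_integral_diff_le_d1(2)[OF m_P1[of s] m_P1[of t] _ lip] t by (simp add: \<nu>_def)
      qed
    qed
    then show "(\<nu> \<longlongrightarrow> \<nu> t) (at t within {0..T})" by (simp add: LIM_zero_iff)
  qed
  obtain M where M: "\<forall>z\<in>\<nu> ` {0..T}. norm z \<le> M"
    using compact_imp_bounded[OF compact_continuous_image[OF cont compact_Icc]] by (auto simp: bounded_iff)
  show ?thesis
  proof (intro exI[of _ "\<bar>M\<bar>"] conjI allI impI)
    fix s assume s: "0 < s" "s < T"
    have "(\<integral>\<^sup>+y. ennreal (norm y * \<rho> y s) \<partial>lborel) = (\<integral>\<^sup>+y. ennreal (norm y) \<partial>(m s))"
      unfolding m_density[OF s(1)] using \<rho>_measurable[OF s(1)] \<rho>_nonneg[OF s(1)]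
      by (subst nn_integral_density) (auto intro!: nn_integral_cong simp: ennreal_mult[symmetric] mult.commute)
    also have "\<dots> = ennreal (\<nu> s)"
      unfolding \<nu>_def using P1_D(4)[OF m_P1, of s] s by (intro nn_integral_eq_integral) auto
    also have "\<dots> \<le> ennreal \<bar>M\<bar>"
    proof (rule ennreal_leI)
      have "norm (\<nu> s) \<le> M" using M s by auto
      then show "\<nu> s \<le> \<bar>M\<bar>" by simp
    qed
    finally show "(\<integral>\<^sup>+y. ennreal (norm y * \<rho> y s) \<partial>lborel) \<le> ennreal \<bar>M\<bar>" .
  qed auto
qed

text \<open>The Lipschitz constant is uniform in s, so the distance of m s to the initial measure
  controls the difference even though the test function moves. No limit of the test functions is
  required.\<close>

lemma initial_continuity:
  assumes K: "K > 0" and lip: "\<And>s x y. \<bar>\<phi> s x - \<phi> s y\<bar> \<le> K * norm (x - y)"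
  shows "((\<lambda>s. (LINT x|m s. \<phi> s x) - (LINT x|m0. \<phi> s x)) \<longlongrightarrow> 0) (at_right 0)"
proof -
  have m0: "m 0 = m0" using fp by (simp add: fp_solution_def)
  have "((\<lambda>s. d1 (m s) (m 0)) \<longlongrightarrow> 0) (at 0 within {0..})"
    using fp[unfolded fp_solution_def, THEN conjunct2, THEN conjunct1, rule_format, of 0] by simp
  then have "((\<lambda>s. d1 (m s) (m 0)) \<longlongrightarrow> 0) (at_right 0)"
    by (rule tendsto_within_subset) auto
  then have "((\<lambda>s. K * d1 (m s) (m 0)) \<longlongrightarrow> K * 0) (at_right 0)"
    by (intro tendsto_mult tendsto_const)
  then have l: "((\<lambda>s. K * d1 (m s) (m 0)) \<longlongrightarrow> 0) (at_right 0)" by simp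
  show ?thesis
  proof (rule Lim_null_comparison[OF _ l])
    show "eventually (\<lambda>s. norm ((LINT x|m s. \<phi> s x) - (LINT x|m0. \<phi> s x)) \<le> K * d1 (m s) (m 0)) (at_right 0)"
      using eventually_at_right_less[of 0]
    proof eventually_elim
      case (elim s)
      then show ?case
        using lipschitz_integral_diff_le_d1(2)[OF m_P1[of s] m_P1[of 0] K lip, of s] by (simp add: m0)
    qed
  qed
qed

end

section \<open>Two solutions with the same initial datum\<close>

locale mfg_pair =
  s1: mfg_single \<alpha> C L lam F H m0 u1 m1 + s2: mfg_single \<alpha> C L lam F H m0 u2 m2
  for \<alpha> C L lam :: real and F :: "real^'n \<Rightarrow> (real^'n) measure \<Rightarrow> real" and H :: "real^'n \<Rightarrow> real^'n \<Rightarrow> real"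
    and m0 :: "(real^'n) measure" and u1 u2 :: "real^'n \<Rightarrow> real \<Rightarrow> real" and m1 m2 :: "real \<Rightarrow> (real^'n) measure"
begin

abbreviation \<mu> :: "real^'n \<Rightarrow> real \<Rightarrow> real" where "\<mu> x t \<equiv> s1.\<rho> x t - s2.\<rho> x t"
abbreviation \<sigma> :: "real^'n \<Rightarrow> real \<Rightarrow> real" where "\<sigma> x t \<equiv> s1.\<rho> x t + s2.\<rho> x t"
abbreviation q :: "real^'n \<Rightarrow> real \<Rightarrow> real^'n" where "q x t \<equiv> s1.\<rho> x t *\<^sub>R s1.b x t - s2.\<rho> x t *\<^sub>R s2.b x t"

lemma continuous_on_case_prod_diff:
  fixes f g :: "real^'n \<Rightarrow> real \<Rightarrow> 'b::real_normed_vector"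
  assumes "continuous_on A (\<lambda>(x, t). f x t)" "continuous_on A (\<lambda>(x, t). g x t)"
  shows "continuous_on A (\<lambda>(x, t). f x t - g x t)"
  using assms unfolding case_prod_unfold by (intro continuous_intros)

lemma norm_q_le:
  assumes t: "t > 0"
  shows "norm (q x t) \<le> s1.drift_bound * \<sigma> x t"
proof -
  have "norm (q x t) \<le> s1.\<rho> x t * norm (s1.b x t) + s2.\<rho> x t * norm (s2.b x t)"
    using norm_triangle_ineq4[of "s1.\<rho> x t *\<^sub>R s1.b x t" "s2.\<rho> x t *\<^sub>R s2.b x t"] s1.\<rho>_nonneg[OF t, of x] s2.\<rho>_nonneg[OF t, of x]
    by simp
  also have "\<dots> \<le> s1.\<rho> x t * s1.drift_bound + s2.\<rho> x t * s1.drift_bound"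
    using s1.norm_drift_le[OF t] s2.norm_drift_le[OF t] s1.\<rho>_nonneg[OF t] s2.\<rho>_nonneg[OF t]
    by (intro add_mono mult_left_mono) auto
  finally show ?thesis by (simp add: algebra_simps)
qed

lemma integral_\<mu>:
  assumes t: "t > 0" and f: "f \<in> borel_measurable borel" and i: "integrable (m1 t) f" "integrable (m2 t) f"
  shows "(LINT x|lborel. \<mu> x t * f x) = (LINT x|m1 t. f x) - (LINT x|m2 t. f x)"
proof -
  have "integrable lborel (\<lambda>x. s1.\<rho> x t * f x)"
    using i(1) f s1.\<rho>_measurable[OF t] s1.\<rho>_nonneg[OF t] unfolding s1.m_density[OF t]
    by (subst (asm) integrable_density) auto
  moreover have "integrable lborel (\<lambda>x. s2.\<rho> x t * f x)"
    using i(2) f s2.\<rho>_measurable[OF t] s2.\<rho>_nonneg[OF t] unfolding s2.m_density[OF t]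
    by (subst (asm) integrable_density) auto
  ultimately show ?thesis
    unfolding s1.integral_m[OF t f] s2.integral_m[OF t f] left_diff_distrib by (rule Bochner_Integration.integral_diff)
qed

sublocale fp_zero_initial \<mu> "\<lambda>x t. time_deriv s1.\<rho> x t - time_deriv s2.\<rho> x t" \<sigma>
    "\<lambda>x t. grad (\<lambda>y. s1.\<rho> y t) x - grad (\<lambda>y. s2.\<rho> y t) x" q
    "\<lambda>x t v. hess (\<lambda>y. s1.\<rho> y t) x v - hess (\<lambda>y. s2.\<rho> y t) x v"
    "\<lambda>x t v. s1.flux' x t v - s2.flux' x t v" s1.drift_bound
proof
  show "continuous_on (UNIV \<times> {0<..}) (\<lambda>(x, t). \<mu> x t)"
    by (intro continuous_on_case_prod_diff s1.\<rho>_cont s2.\<rho>_cont)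
  show "continuous_on (UNIV \<times> {0<..}) (\<lambda>(x, t). grad (\<lambda>y. s1.\<rho> y t) x - grad (\<lambda>y. s2.\<rho> y t) x)"
    by (intro continuous_on_case_prod_diff s1.\<rho>_cont s2.\<rho>_cont)
  show "continuous_on (UNIV \<times> {0<..}) (\<lambda>(x, t). hess (\<lambda>y. s1.\<rho> y t) x v - hess (\<lambda>y. s2.\<rho> y t) x v)" for v
    by (intro continuous_on_case_prod_diff s1.\<rho>_cont s2.\<rho>_cont)
  show "continuous_on (UNIV \<times> {0<..}) (\<lambda>(x, t). time_deriv s1.\<rho> x t - time_deriv s2.\<rho> x t)"
    by (intro continuous_on_case_prod_diff s1.\<rho>_cont s2.\<rho>_cont)
  show "continuous_on (UNIV \<times> {0<..}) (\<lambda>(x, t). q x t)"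
    using s1.\<rho>_cont(1) s2.\<rho>_cont(1) s1.b_continuous s2.b_continuous unfolding case_prod_unfold by (intro continuous_intros)
  show "continuous_on (UNIV \<times> {0<..}) (\<lambda>(x, t). \<sigma> x t)"
    using s1.\<rho>_cont(1) s2.\<rho>_cont(1) unfolding case_prod_unfold by (intro continuous_intros)
  show "s1.drift_bound \<ge> 0" by (rule s1.drift_bound_nonneg)
next
  fix x :: "real^'n" and t :: real assume t: "t > 0"
  show "((\<lambda>y. \<mu> y t) has_derivative (\<lambda>v. (grad (\<lambda>y. s1.\<rho> y t) x - grad (\<lambda>y. s2.\<rho> y t) x) \<bullet> v)) (at x)"
    unfolding inner_diff_left by (intro has_derivative_diff s1.\<rho>_derivs(1) s2.\<rho>_derivs(1) t)
  show "((\<lambda>y. grad (\<lambda>y. s1.\<rho> y t) y - grad (\<lambda>y. s2.\<rho> y t) y) has_derivative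
      (\<lambda>v. hess (\<lambda>y. s1.\<rho> y t) x v - hess (\<lambda>y. s2.\<rho> y t) x v)) (at x)"
    by (intro has_derivative_diff s1.\<rho>_derivs(2) s2.\<rho>_derivs(2) t)
  show "((\<lambda>s. \<mu> x s) has_real_derivative time_deriv s1.\<rho> x t - time_deriv s2.\<rho> x t) (at t)"
    by (intro DERIV_diff s1.\<rho>_derivs(3) s2.\<rho>_derivs(3) t)
  show "((\<lambda>y. q y t) has_derivative (\<lambda>v. s1.flux' x t v - s2.flux' x t v)) (at x)"
    by (intro has_derivative_diff s1.flux_derivative s2.flux_derivative t)
  show "time_deriv s1.\<rho> x t - time_deriv s2.\<rho> x t
     = (\<Sum>b\<in>Basis. (hess (\<lambda>y. s1.\<rho> y t) x b - hess (\<lambda>y. s2.\<rho> y t) x b) \<bullet> b) + (\<Sum>b\<in>Basis. (s1.flux' x t b - s2.flux' x t b) \<bullet> b)"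
    unfolding s1.\<rho>_equation[OF t] s2.\<rho>_equation[OF t] by (simp add: inner_diff_left sum_subtractf)
  show "\<bar>\<mu> x t\<bar> \<le> \<sigma> x t" using s1.\<rho>_nonneg[OF t, of x] s2.\<rho>_nonneg[OF t, of x] by simp
  show "norm (q x t) \<le> s1.drift_bound * \<sigma> x t" by (rule norm_q_le[OF t])
next
  fix t :: real assume t: "t > 0"
  show "(\<integral>\<^sup>+x. ennreal (\<sigma> x t) \<partial>lborel) \<le> 2"
  proof -
    have "(\<integral>\<^sup>+x. ennreal (\<sigma> x t) \<partial>lborel) = (\<integral>\<^sup>+x. ennreal (s1.\<rho> x t) + ennreal (s2.\<rho> x t) \<partial>lborel)"
      using s1.\<rho>_nonneg[OF t] s2.\<rho>_nonneg[OF t] by simp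
    also have "\<dots> = (\<integral>\<^sup>+x. ennreal (s1.\<rho> x t) \<partial>lborel) + (\<integral>\<^sup>+x. ennreal (s2.\<rho> x t) \<partial>lborel)"
      using s1.\<rho>_measurable[OF t] s2.\<rho>_measurable[OF t] by (intro nn_integral_add) auto
    also have "\<dots> = 2" using s1.\<rho>_mass[OF t] s2.\<rho>_mass[OF t] by (simp add: one_add_one)
    finally show ?thesis by simp
  qed
  fix r :: real
  obtain K1 where K1: "\<forall>x c. norm x \<le> r \<longrightarrow> c \<in> Basis \<longrightarrow> norm (s1.flux' x t c) \<le> K1" using s1.flux'_bounded[OF t] by (rule exE)
  obtain K2 where K2: "\<forall>x c. norm x \<le> r \<longrightarrow> c \<in> Basis \<longrightarrow> norm (s2.flux' x t c) \<le> K2" using s2.flux'_bounded[OF t] by (rule exE)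
  show "\<exists>K. \<forall>x b. norm x \<le> r \<longrightarrow> b \<in> Basis \<longrightarrow> norm (s1.flux' x t b - s2.flux' x t b) \<le> K"
  proof (intro exI allI impI)
    fix x b :: "real^'n" assume "norm x \<le> r" "b \<in> Basis"
    then show "norm (s1.flux' x t b - s2.flux' x t b) \<le> K1 + K2"
      using K1 K2 by (intro order_trans[OF norm_triangle_ineq4] add_mono) auto
  qed
next
  fix \<phi> :: "real \<Rightarrow> real^'n \<Rightarrow> real" and K :: real
  assume bd: "\<And>s x. \<bar>\<phi> s x\<bar> \<le> K" and lip: "\<And>s x y. \<bar>\<phi> s x - \<phi> s y\<bar> \<le> K * norm (x - y)"
  have K0: "K \<ge> 0" using bd[of 0 0] by linarith
  have lip': "\<bar>\<phi> s x - \<phi> s y\<bar> \<le> (K + 1) * norm (x - y)" for s x y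
    using lip[of s x y] K0 by (intro order_trans[OF lip] mult_right_mono) auto
  have K1: "K + 1 > 0" using K0 by simp
  \<comment> \<open>The integrals against the common initial measure need not converge as s tends to
    0, but they cancel between the two solutions.\<close>
  have "((\<lambda>s. ((LINT x|m1 s. \<phi> s x) - (LINT x|m0. \<phi> s x)) - ((LINT x|m2 s. \<phi> s x) - (LINT x|m0. \<phi> s x))) \<longlongrightarrow> 0 - 0) (at_right 0)"
    by (intro tendsto_diff s1.initial_continuity[OF K1 lip'] s2.initial_continuity[OF K1 lip'])
  then have l: "((\<lambda>s. (LINT x|m1 s. \<phi> s x) - (LINT x|m2 s. \<phi> s x)) \<longlongrightarrow> 0) (at_right 0)" by simp
  show "((\<lambda>s. LINT y|lborel. \<mu> y s * \<phi> s y) \<longlongrightarrow> 0) (at_right 0)"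
  proof (rule Lim_transform_eventually[OF l])
    show "eventually (\<lambda>s. (LINT x|m1 s. \<phi> s x) - (LINT x|m2 s. \<phi> s x) = (LINT y|lborel. \<mu> y s * \<phi> s y)) (at_right 0)"
      using eventually_at_right_less[of 0]
    proof eventually_elim
      case (elim s)
      have i: "integrable (m1 s) (\<phi> s)" "integrable (m2 s) (\<phi> s)"
        using lipschitz_integral_diff_le_d1(1)[OF s1.m_P1[of s] s2.m_P1[of s] K1 lip']
          lipschitz_integral_diff_le_d1(1)[OF s2.m_P1[of s] s1.m_P1[of s] K1 lip'] elim by auto
      then have "\<phi> s \<in> borel_measurable borel"
        using borel_measurable_integrable[OF i(1)] P1_D(2)[OF s1.m_P1[of s]] elim by (simp cong: measurable_cong_sets)
      then show ?case using integral_\<mu>[OF elim _ i] by simp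
    qed
  qed
qed

text \<open>The L1 norm of the signed density, twice the total variation distance of the two
  probability measures; hence the universal bound 2.\<close>

definition tv :: "real \<Rightarrow> real" where "tv t = (LINT x|lborel. \<bar>\<mu> x t\<bar>)"

lemma tv_props:
  assumes t: "t > 0"
  shows "(\<integral>\<^sup>+x. ennreal \<bar>\<mu> x t\<bar> \<partial>lborel) = ennreal (tv t)" "0 \<le> tv t" "tv t \<le> 2"
proof -
  have i: "integrable lborel (\<lambda>x. \<bar>\<mu> x t\<bar>)"
    by (rule Bochner_Integration.integrable_bound[OF \<sigma>_integrable[OF t]])
       (use \<mu>_le[OF t] slice_measurable(1)[OF t] \<sigma>_nonneg[OF t] in auto)
  show e: "(\<integral>\<^sup>+x. ennreal \<bar>\<mu> x t\<bar> \<partial>lborel) = ennreal (tv t)"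
    unfolding tv_def using i by (intro nn_integral_eq_integral) auto
  show "0 \<le> tv t" unfolding tv_def by (intro integral_nonneg_AE) auto
  have "(\<integral>\<^sup>+x. ennreal \<bar>\<mu> x t\<bar> \<partial>lborel) \<le> (\<integral>\<^sup>+x. ennreal (\<sigma> x t) \<partial>lborel)"
    using \<mu>_le[OF t] by (intro nn_integral_mono ennreal_leI)
  also have "\<dots> \<le> 2" by (rule mass[OF t])
  finally have "ennreal (tv t) \<le> ennreal 2" unfolding e by simp
  then show "tv t \<le> 2" by (subst (asm) ennreal_le_iff) auto
qed

lemma flux_integral_le:
  assumes t: "t > 0" and A: "\<And>x. norm (grad (\<lambda>y. u1 y t) x - grad (\<lambda>y. u2 y t) x) \<le> A"
  shows "(\<integral>\<^sup>+x. ennreal (norm (q x t)) \<partial>lborel) \<le> ennreal (s1.drift_bound * tv t + C * lam * A)"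
proof -
  have A0: "A \<ge> 0" using A[of 0] norm_ge_zero order_trans by blast
  have c0: "0 \<le> C * lam * A" using s1.C s1.lam_pos A0 by simp
  have "norm (q x t) \<le> s1.drift_bound * \<bar>\<mu> x t\<bar> + C * lam * A * s2.\<rho> x t" for x
  proof -
    have "norm (s1.b x t - s2.b x t) \<le> C * norm (lam *\<^sub>R grad (\<lambda>y. u1 y t) x - lam *\<^sub>R grad (\<lambda>y. u2 y t) x)"
      unfolding s1.b_def s2.b_def by (rule grad_p_lipschitz_p[OF s1.ham s1.C])
    also have "\<dots> = C * (lam * norm (grad (\<lambda>y. u1 y t) x - grad (\<lambda>y. u2 y t) x))"
      using s1.lam_pos by (simp add: scaleR_diff_right[symmetric])
    also have "\<dots> \<le> C * (lam * A)" using s1.C s1.lam_pos A by (intro mult_left_mono) auto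
    finally have 1: "norm (s1.b x t - s2.b x t) \<le> C * (lam * A)" .
    \<comment> \<open>An asymmetric splitting: the bounded drift goes with the signed density, the
      difference of the drifts with the second density, whose mass is 1. Integration thus costs no
      dimensional factor.\<close>
    have "q x t = \<mu> x t *\<^sub>R s1.b x t + s2.\<rho> x t *\<^sub>R (s1.b x t - s2.b x t)" by (simp add: algebra_simps)
    then have "norm (q x t) \<le> \<bar>\<mu> x t\<bar> * norm (s1.b x t) + s2.\<rho> x t * norm (s1.b x t - s2.b x t)"
      using norm_triangle_ineq[of "\<mu> x t *\<^sub>R s1.b x t" "s2.\<rho> x t *\<^sub>R (s1.b x t - s2.b x t)"] s2.\<rho>_nonneg[OF t, of x] by simp
    also have "\<dots> \<le> \<bar>\<mu> x t\<bar> * s1.drift_bound + s2.\<rho> x t * (C * (lam * A))"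
      using 1 s1.norm_drift_le[OF t, of x] s2.\<rho>_nonneg[OF t, of x] by (intro add_mono mult_left_mono) auto
    finally show ?thesis by (simp add: mult_ac)
  qed
  then have "(\<integral>\<^sup>+x. ennreal (norm (q x t)) \<partial>lborel)
    \<le> (\<integral>\<^sup>+x. ennreal s1.drift_bound * ennreal \<bar>\<mu> x t\<bar> + ennreal (C * lam * A) * ennreal (s2.\<rho> x t) \<partial>lborel)"
    using s1.drift_bound_nonneg c0 s2.\<rho>_nonneg[OF t]
    by (intro nn_integral_mono) (simp add: ennreal_mult[symmetric] ennreal_plus[symmetric] ennreal_leI del: ennreal_plus)
  also have "\<dots> = ennreal s1.drift_bound * ennreal (tv t) + ennreal (C * lam * A) * 1"
    using slice_measurable(1)[OF t] s2.\<rho>_measurable[OF t]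
    by (subst nn_integral_add, simp, simp) (simp add: nn_integral_cmult tv_props(1)[OF t] s2.\<rho>_mass[OF t])
  also have "\<dots> = ennreal (s1.drift_bound * tv t + C * lam * A)"
    using s1.drift_bound_nonneg c0 tv_props(2)[OF t] by (simp add: ennreal_mult[symmetric] ennreal_plus[symmetric] del: ennreal_plus)
  finally show ?thesis .
qed

lemma moment_q: "\<exists>M\<ge>0. \<forall>s. 0 < s \<longrightarrow> s < T \<longrightarrow> (\<integral>\<^sup>+y. ennreal (norm y * norm (q y s)) \<partial>lborel) \<le> ennreal M"
proof -
  obtain M1 where M1: "M1 \<ge> 0" "\<forall>s. 0 < s \<longrightarrow> s < T \<longrightarrow> (\<integral>\<^sup>+y. ennreal (norm y * s1.\<rho> y s) \<partial>lborel) \<le> ennreal M1"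
    using s1.moment_bounded by auto
  obtain M2 where M2: "M2 \<ge> 0" "\<forall>s. 0 < s \<longrightarrow> s < T \<longrightarrow> (\<integral>\<^sup>+y. ennreal (norm y * s2.\<rho> y s) \<partial>lborel) \<le> ennreal M2"
    using s2.moment_bounded by auto
  show ?thesis
  proof (intro exI[of _ "s1.drift_bound * (M1 + M2)"] conjI allI impI)
    show "0 \<le> s1.drift_bound * (M1 + M2)" using M1 M2 s1.drift_bound_nonneg by simp
    fix s assume s: "0 < s" "s < T"
    note nn = s1.\<rho>_nonneg[OF s(1)] s2.\<rho>_nonneg[OF s(1)]
    have pw: "norm y * norm (q y s) \<le> s1.drift_bound * (norm y * s1.\<rho> y s + norm y * s2.\<rho> y s)" for y
      using mult_left_mono[OF norm_q_le[OF s(1), of y] norm_ge_zero[of y]] by (simp add: algebra_simps)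
    have "(\<integral>\<^sup>+y. ennreal (norm y * norm (q y s)) \<partial>lborel)
      \<le> (\<integral>\<^sup>+y. ennreal s1.drift_bound * (ennreal (norm y * s1.\<rho> y s) + ennreal (norm y * s2.\<rho> y s)) \<partial>lborel)"
    proof (rule nn_integral_mono)
      fix y
      have "ennreal (norm y * norm (q y s)) \<le> ennreal (s1.drift_bound * (norm y * s1.\<rho> y s + norm y * s2.\<rho> y s))"
        by (rule ennreal_leI[OF pw])
      also have "\<dots> = ennreal s1.drift_bound * (ennreal (norm y * s1.\<rho> y s) + ennreal (norm y * s2.\<rho> y s))"
        using nn[of y] s1.drift_bound_nonneg by (subst ennreal_mult) (auto simp: ennreal_plus)
      finally show "ennreal (norm y * norm (q y s)) \<le> ennreal s1.drift_bound * (ennreal (norm y * s1.\<rho> y s) + ennreal (norm y * s2.\<rho> y s))" .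
    qed
    also have "\<dots> = ennreal s1.drift_bound * ((\<integral>\<^sup>+y. ennreal (norm y * s1.\<rho> y s) \<partial>lborel) + (\<integral>\<^sup>+y. ennreal (norm y * s2.\<rho> y s) \<partial>lborel))"
    proof -
      have m: "(\<lambda>y. ennreal (norm y * s1.\<rho> y s)) \<in> borel_measurable lborel" "(\<lambda>y. ennreal (norm y * s2.\<rho> y s)) \<in> borel_measurable lborel"
        using s1.\<rho>_measurable[OF s(1)] s2.\<rho>_measurable[OF s(1)] by auto
      show ?thesis unfolding nn_integral_add[OF m, symmetric] by (rule nn_integral_cmult) (use m in auto)
    qed
    also have "\<dots> \<le> ennreal s1.drift_bound * (ennreal M1 + ennreal M2)"
      using M1 M2 s by (intro mult_left_mono add_mono) auto
    also have "\<dots> = ennreal (s1.drift_bound * (M1 + M2))"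
      using M1 M2 s1.drift_bound_nonneg by (simp add: ennreal_mult)
    finally show "(\<integral>\<^sup>+y. ennreal (norm y * norm (q y s)) \<partial>lborel) \<le> ennreal (s1.drift_bound * (M1 + M2))" .
  qed
qed

text \<open>The forward half of the loop. Weighted bounds \<open>S\<close> on the total variation
  and \<open>A\<close> on the gradient difference determine the weighted flux bound
  \<open>Q\<close>, which the heat kernel estimates turn into bounds for total variation and
  distance with factors 1/k and 1/k^2.\<close>

lemma stability:
  assumes k: "k > 0" and S: "S \<ge> 0" "\<And>s. s > 0 \<Longrightarrow> tv s \<le> S * exp (k\<^sup>2 * s)"
    and A: "A \<ge> 0" "\<And>s x. s > 0 \<Longrightarrow> norm (grad (\<lambda>y. u1 y s) x - grad (\<lambda>y. u2 y s) x) \<le> A * exp (k\<^sup>2 * s)"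
    and T: "T > 0"
  shows "tv T \<le> (1 + 2 * CARD('n)) / k * (s1.drift_bound * S + C * lam * A) * exp (k\<^sup>2 * T)"
    and "d1 (m1 T) (m2 T) \<le> 2 * CARD('n) * (s1.drift_bound * S + C * lam * A) * exp (k\<^sup>2 * T) / k\<^sup>2"
proof -
  define Q where "Q = s1.drift_bound * S + C * lam * A"
  have c0: "0 \<le> C * lam" using s1.C s1.lam_pos by simp
  have Q0: "Q \<ge> 0" using s1.drift_bound_nonneg S A c0 by (simp add: Q_def)
  interpret fp_flux \<mu> "\<lambda>x t. time_deriv s1.\<rho> x t - time_deriv s2.\<rho> x t" \<sigma>
    "\<lambda>x t. grad (\<lambda>y. s1.\<rho> y t) x - grad (\<lambda>y. s2.\<rho> y t) x" q
    "\<lambda>x t v. hess (\<lambda>y. s1.\<rho> y t) x v - hess (\<lambda>y. s2.\<rho> y t) x v"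
    "\<lambda>x t v. s1.flux' x t v - s2.flux' x t v" s1.drift_bound T "k\<^sup>2" Q
  proof
    show "T > 0" "k\<^sup>2 > 0" "Q \<ge> 0" using T k Q0 by auto
    fix s assume s: "0 < s" "s < T"
    have "(\<integral>\<^sup>+y. ennreal (norm (q y s)) \<partial>lborel) \<le> ennreal (s1.drift_bound * tv s + C * lam * (A * exp (k\<^sup>2 * s)))"
      by (rule flux_integral_le[OF s(1) A(2)[OF s(1)]])
    also have "\<dots> \<le> ennreal (Q * exp (k\<^sup>2 * s))"
    proof (rule ennreal_leI)
      have "s1.drift_bound * tv s \<le> s1.drift_bound * (S * exp (k\<^sup>2 * s))" using S(2)[OF s(1)] s1.drift_bound_nonneg by (rule mult_left_mono)
      then show "s1.drift_bound * tv s + C * lam * (A * exp (k\<^sup>2 * s)) \<le> Q * exp (k\<^sup>2 * s)"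
        by (simp add: Q_def algebra_simps)
    qed
    finally show "(\<integral>\<^sup>+y. ennreal (norm (q y s)) \<partial>lborel) \<le> ennreal (Q * exp (k\<^sup>2 * s))" .
  qed
  have "ennreal (tv T) \<le> ennreal ((1 + 2 * CARD('n)) / k * Q * exp (k\<^sup>2 * T))"
    using total_variation_bound tv_props(1)[OF T] k by simp
  then show "tv T \<le> (1 + 2 * CARD('n)) / k * (s1.drift_bound * S + C * lam * A) * exp (k\<^sup>2 * T)"
    using k Q0 unfolding Q_def by (subst (asm) ennreal_le_iff) auto
  obtain M where M: "M \<ge> 0" "\<forall>s. 0 < s \<longrightarrow> s < T \<longrightarrow> (\<integral>\<^sup>+y. ennreal (norm y * norm (q y s)) \<partial>lborel) \<le> ennreal M"
    using moment_q by auto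
  have net: "measure (m1 T) X - measure (m2 T) X = (LINT x|lborel. indicator X x * \<mu> x T)" if X: "X \<in> sets borel" for X
  proof -
    interpret p1: prob_space "m1 T" using P1_D[OF s1.m_P1] T by auto
    interpret p2: prob_space "m2 T" using P1_D[OF s2.m_P1] T by auto
    have s: "sets (m1 T) = sets borel" "sets (m2 T) = sets borel" "space (m1 T) = UNIV" "space (m2 T) = UNIV"
      using P1_D[OF s1.m_P1[of T]] P1_D[OF s2.m_P1[of T]] T by auto
    have "(LINT x|lborel. \<mu> x T * indicator X x) = (LINT x|m1 T. indicator X x) - (LINT x|m2 T. indicator X x)"
      using X by (intro integral_\<mu>[OF T] integrable_real_indicator) (auto simp: s p1.emeasure_eq_measure p2.emeasure_eq_measure)
    then show ?thesis using X by (simp add: s mult.commute)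
  qed
  have "d1 (m1 T) (m2 T) \<le> 2 * DIM(real^'n) * Q * exp (k\<^sup>2 * T) / k\<^sup>2"
    by (rule d1_bound[OF s1.m_P1 s2.m_P1 net]) (use M T in auto)
  then show "d1 (m1 T) (m2 T) \<le> 2 * CARD('n) * (s1.drift_bound * S + C * lam * A) * exp (k\<^sup>2 * T) / k\<^sup>2"
    by (simp add: Q_def)
qed

end

section \<open>Closing the loop\<close>

context mfg_pair begin

text \<open>The backward estimate bounds gradients by distances and \<open>stability\<close> bounds
  distances by gradients. The three thresholds for k serve, in order, the gradient estimate, the
  absorption of the total variation, and the final contraction.\<close>

lemma coincidence_of_measures_and_gradients:
  assumes k: "k > 0" and lk: "lam = 2 * k\<^sup>2" and k1: "k \<ge> s1.drift_bound" and k2: "k \<ge> 2 * (1 + 2 * CARD('n)) * s1.drift_bound"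
    and k3: "k \<ge> 32 * CARD('n) * C * L" and t: "t > 0"
  shows "m1 t = m2 t" and "grad (\<lambda>y. u1 y t) x = grad (\<lambda>y. u2 y t) x"
proof -
  define n where "n = real CARD('n)"
  have n: "n \<ge> 1" using zero_less_card_finite[where 'a = 'n] by (simp add: n_def Suc_le_eq)
  define E where "E t = exp (k\<^sup>2 * t)" for t
  have E0: "E t > 0" for t by (simp add: E_def)
  have E1: "E t \<ge> 1" if "t > 0" for t using that by (simp add: E_def)
  have R0: "s1.R > 0" using s1.L s1.C by (simp add: s1.R_def)
  have C0: "C \<ge> 1" "L > 0" "lam > 0" "s1.drift_bound \<ge> 0" using s1.C s1.L s1.lam_pos s1.drift_bound_nonneg by auto
  define d where "d t = d1 (m1 t) (m2 t)" for t
  have d0: "d t \<ge> 0" if "t > 0" for t using d1_nonneg[OF s1.m_P1 s2.m_P1] that by (simp add: d_def)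
  \<comment> \<open>A contraction says nothing about an infinite supremum. \<open>stability\<close>
    is therefore applied first with the trivial data: total variation at most 2 and gradient
    difference at most 2 R / \<open>lam\<close>.\<close>
  define D0 where "D0 = 2 * n * (s1.drift_bound * 2 + C * lam * (2 * s1.R / lam)) / k\<^sup>2"
  have dD0: "d t \<le> D0 * E t" if t: "t > 0" for t
  proof -
    have "d t \<le> 2 * CARD('n) * (s1.drift_bound * 2 + C * lam * (2 * s1.R / lam)) * exp (k\<^sup>2 * t) / k\<^sup>2"
      unfolding d_def
    proof (rule stability(2)[OF k _ _ _ _ t])
      show "(0::real) \<le> 2" "0 \<le> 2 * s1.R / lam" using R0 C0 by auto
      fix s :: real assume s: "s > 0"
      have "2 * 1 \<le> 2 * E s" using E1[OF s] by (intro mult_left_mono) auto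
      then show "tv s \<le> 2 * exp (k\<^sup>2 * s)" using tv_props(3)[OF s] unfolding E_def by linarith
      fix x
      have "norm (grad (\<lambda>y. u1 y s) x) \<le> s1.R / lam" "norm (grad (\<lambda>y. u2 y s) x) \<le> s1.R / lam"
        using s1.u_gradient_bound[OF s, of x] s2.u_gradient_bound[OF s, of x] C0 by (auto simp: field_simps)
      then have "norm (grad (\<lambda>y. u1 y s) x - grad (\<lambda>y. u2 y s) x) \<le> 2 * s1.R / lam"
        using norm_triangle_ineq4[of "grad (\<lambda>y. u1 y s) x" "grad (\<lambda>y. u2 y s) x"] by simp
      also have "\<dots> = 2 * s1.R / lam * 1" by simp
      also have "\<dots> \<le> 2 * s1.R / lam * exp (k\<^sup>2 * s)"
        using E1[OF s] R0 C0 unfolding E_def by (intro mult_left_mono) auto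
      finally show "norm (grad (\<lambda>y. u1 y s) x - grad (\<lambda>y. u2 y s) x) \<le> 2 * s1.R / lam * exp (k\<^sup>2 * s)" .
    qed
    then show ?thesis by (simp add: D0_def n_def E_def)
  qed
  define V where "V = (\<lambda>t. d t / E t) ` {0<..}"
  define D where "D = Sup V"
  have Vb: "bdd_above V"
    unfolding V_def using dD0 E0 by (intro bdd_aboveI[of _ D0]) (auto simp: pos_divide_le_eq)
  have dD: "d t \<le> D * E t" if "t > 0" for t
  proof -
    have "d t / E t \<le> D" unfolding D_def using that by (intro cSup_upper[OF _ Vb]) (auto simp: V_def)
    then show ?thesis using E0[of t] by (simp add: pos_divide_le_eq)
  qed
  have "0 \<le> D * E 1" using dD[of 1] d0[of 1] by simp
  then have D_nonneg: "D \<ge> 0" using E0[of 1] by (simp add: zero_le_mult_iff)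
  \<comment> \<open>The backward half of the loop: the weighted distance \<open>D\<close> determines
    the weighted gradient difference.\<close>
  define A where "A = 2 * L * D / k"
  have A0: "A \<ge> 0" using C0 D_nonneg k by (simp add: A_def)
  have gA: "norm (grad (\<lambda>y. u1 y s) x - grad (\<lambda>y. u2 y s) x) \<le> A * exp (k\<^sup>2 * s)" if s: "s > 0" for s x
    unfolding A_def
    by (rule hjb_difference_gradient_bound[OF s1.ham s1.C s1.cost s1.L s1.hjb s2.hjb _ _ s1.u_gradient_bound s2.u_gradient_bound lk _ _ D_nonneg R0 s])
       (use k1 dD s1.m_P1 s2.m_P1 in \<open>auto simp: s1.drift_bound_def d_def E_def\<close>)
  define W where "W = (\<lambda>t. tv t / E t) ` {0<..}"
  define S where "S = Sup W"
  have Wb: "bdd_above W"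
    unfolding W_def
  proof (rule bdd_aboveI[of _ 2])
    fix z assume "z \<in> (\<lambda>t. tv t / E t) ` {0<..}"
    then obtain t where t: "t > 0" "z = tv t / E t" by auto
    have "2 * 1 \<le> 2 * E t" using E1[OF t(1)] by (intro mult_left_mono) auto
    then have "tv t \<le> 2 * E t" using tv_props(3)[OF t(1)] by linarith
    then show "z \<le> 2" using t E0[of t] by (simp add: pos_divide_le_eq)
  qed
  have tS: "tv t \<le> S * E t" if "t > 0" for t
  proof -
    have "tv t / E t \<le> S" unfolding S_def using that by (intro cSup_upper[OF _ Wb]) (auto simp: W_def)
    then show ?thesis using E0[of t] by (simp add: pos_divide_le_eq)
  qed
  have "0 \<le> S * E 1" using tS[of 1] tv_props(2)[of 1] by simp
  then have S_nonneg: "S \<ge> 0" using E0[of 1] by (simp add: zero_le_mult_iff)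
  define Q where "Q = s1.drift_bound * S + C * lam * A"
  have st: "tv t \<le> (1 + 2 * n) / k * Q * E t" "d t \<le> 2 * n * Q / k\<^sup>2 * E t" if "t > 0" for t
    using stability[OF k S_nonneg tS[unfolded E_def] A0 gA that] by (simp_all add: Q_def n_def E_def d_def)
  have SQ: "S \<le> (1 + 2 * n) / k * Q"
    unfolding S_def
  proof (rule cSup_least)
    show "W \<noteq> {}" by (auto simp: W_def intro: exI[of _ 1])
    fix z assume "z \<in> W"
    then obtain t where "t > 0" "z = tv t / E t" by (auto simp: W_def)
    then show "z \<le> (1 + 2 * n) / k * Q" using st(1)[of t] E0[of t] by (simp add: pos_divide_le_eq)
  qed
  have DQ: "D \<le> 2 * n * Q / k\<^sup>2"
    unfolding D_def
  proof (rule cSup_least)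
    show "V \<noteq> {}" by (auto simp: V_def intro: exI[of _ 1])
    fix z assume "z \<in> V"
    then obtain t where "t > 0" "z = d t / E t" by (auto simp: V_def)
    then show "z \<le> 2 * n * Q / k\<^sup>2" using st(2)[of t] E0[of t] by (simp add: pos_divide_le_eq)
  qed
  have Q0: "Q \<ge> 0" using C0 S_nonneg A0 by (simp add: Q_def)
  \<comment> \<open>The total variation feeds back into the flux that generates it. The second
    threshold for k makes this part at most half of \<open>Q\<close>, so \<open>Q\<close> is
    controlled by the gradient difference alone.\<close>
  have "s1.drift_bound * S \<le> s1.drift_bound * ((1 + 2 * n) / k * Q)" using SQ C0 by (intro mult_left_mono) auto
  also have "\<dots> = (2 * (1 + 2 * n) * s1.drift_bound) * (Q / (2 * k))" using k by (simp add: field_simps)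
  also have "\<dots> \<le> k * (Q / (2 * k))" using k2 Q0 k by (intro mult_right_mono) (auto simp: n_def)
  also have "\<dots> = Q / 2" using k by simp
  finally have "s1.drift_bound * S \<le> Q / 2" .
  moreover have "x \<le> (x + y) / 2 \<Longrightarrow> x + y \<le> 2 * y" for x y :: real by (simp add: field_simps)
  ultimately have "Q \<le> 2 * (C * lam * A)" unfolding Q_def by blast
  \<comment> \<open>Inserting \<open>lam\<close> = 2 k^2 and \<open>A\<close> = 2 L D / k gives D <=
    16 n C L D / k. The threshold with 32 makes this at most D / 2, and a finite nonnegative D must
    vanish.\<close>
  then have "2 * n * Q / k\<^sup>2 \<le> 2 * n * (2 * (C * lam * A)) / k\<^sup>2"
    using n by (intro divide_right_mono mult_left_mono) auto
  also have "\<dots> = (32 * n * C * L) * (D / (2 * k))" using k by (simp add: A_def lk power2_eq_square)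
  also have "\<dots> \<le> k * (D / (2 * k))" using k3 D_nonneg k by (intro mult_right_mono) (auto simp: n_def)
  also have "\<dots> = D / 2" using k by simp
  finally have "D = 0" using DQ D_nonneg by simp
  then have A: "A = 0" by (simp add: A_def)
  then have "Q = 0" using \<open>Q \<le> 2 * (C * lam * A)\<close> Q0 by simp
  then have tv0: "tv t = 0" using st(1)[OF t] tv_props(2)[OF t] by simp
  show "grad (\<lambda>y. u1 y t) x = grad (\<lambda>y. u2 y t) x" using gA[OF t, of x] A by simp
  have "(\<integral>\<^sup>+x. ennreal \<bar>\<mu> x t\<bar> \<partial>lborel) = 0" using tv_props(1)[OF t] tv0 by simp
  then have "AE x in lborel. ennreal \<bar>\<mu> x t\<bar> = 0"
    using slice_measurable(1)[OF t] by (subst (asm) nn_integral_0_iff_AE) auto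
  then have "AE x in lborel. ennreal (s1.\<rho> x t) = ennreal (s2.\<rho> x t)"
    by eventually_elim simp
  then show "m1 t = m2 t"
    unfolding s1.m_density[OF t] s2.m_density[OF t]
    using s1.\<rho>_measurable[OF t] s2.\<rho>_measurable[OF t] by (intro density_cong) auto
qed

text \<open>For fixed x the lower bound and the linear growth bound confine each solution for all
  times. The constant depends on x, which suffices because the argument that follows is an ordinary
  differential equation in t at that point.\<close>

lemma value_difference_bounded:
  "\<exists>K. \<forall>t>0. \<bar>u1 x t - u2 x t\<bar> \<le> K"
proof -
  have one: "\<exists>K. \<forall>t>0. \<bar>u x t\<bar> \<le> K" if "uniqueness_bounds u" for u :: "real^'n \<Rightarrow> real \<Rightarrow> real"
  proof -
    note b = that[unfolded uniqueness_bounds_def]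
    obtain a where a: "\<And>z. z \<in> (\<lambda>(x, t). u x t) ` (UNIV \<times> {0..}) \<Longrightarrow> a \<le> z"
      using b[THEN conjunct1] unfolding bdd_below_def by blast
    obtain c where c: "\<And>z. z \<in> (\<lambda>(x, t). u x t / (1 + norm x)) ` (UNIV \<times> {0..}) \<Longrightarrow> z \<le> c"
      using b[THEN conjunct2, THEN conjunct1] unfolding bdd_above_def by blast
    have p: "1 + norm x > 0" by (simp add: add_pos_nonneg)
    have "\<bar>u x t\<bar> \<le> \<bar>a\<bar> + \<bar>c * (1 + norm x)\<bar>" if "t > 0" for t
    proof -
      have "a \<le> u x t" using that by (intro a) (auto intro: image_eqI[of _ _ "(x, t)"])
      moreover have "u x t / (1 + norm x) \<le> c" using that by (intro c) (auto intro: image_eqI[of _ _ "(x, t)"])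
      then have "u x t \<le> c * (1 + norm x)" using p by (simp add: pos_divide_le_eq)
      ultimately show ?thesis by linarith
    qed
    then show ?thesis by blast
  qed
  obtain K1 where K1: "\<forall>t>0. \<bar>u1 x t\<bar> \<le> K1" using one[OF s1.bounds] by (rule exE)
  obtain K2 where K2: "\<forall>t>0. \<bar>u2 x t\<bar> \<le> K2" using one[OF s2.bounds] by (rule exE)
  show ?thesis
  proof (intro exI allI impI)
    fix t :: real assume t: "t > 0"
    have "\<bar>u1 x t\<bar> \<le> K1" "\<bar>u2 x t\<bar> \<le> K2" using K1 K2 t by auto
    then show "\<bar>u1 x t - u2 x t\<bar> \<le> K1 + K2" by linarith
  qed
qed

text \<open>Once the measures and the gradients agree, \<open>u1 - u2\<close> solves \<open>v' = lam v\<close> in time, and only the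
  zero solution is bounded.\<close>

lemma coincidence_of_values:
  assumes m: "\<And>t. t > 0 \<Longrightarrow> m1 t = m2 t"
    and g: "\<And>t x. t > 0 \<Longrightarrow> grad (\<lambda>y. u1 y t) x = grad (\<lambda>y. u2 y t) x"
    and t: "t \<ge> 0"
  shows "u1 x t = u2 x t"
proof -
  define w where "w s = exp (- (lam * s)) * (u1 x s - u2 x s)" for s
  have dw: "(w has_real_derivative 0) (at s)" if s: "s > 0" for s
  proof -
    have d1: "((\<lambda>s. u1 x s) has_real_derivative time_deriv u1 x s) (at s)" and d2: "((\<lambda>s. u2 x s) has_real_derivative time_deriv u2 x s) (at s)"
      using class_C21_onD(3)[OF s1.u_C21] class_C21_onD(3)[OF s2.u_C21] s by auto
    have "grad (\<lambda>y. u1 y s) = grad (\<lambda>y. u2 y s)" using g[OF s] by auto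
    then have "hess (\<lambda>y. u1 y s) x = hess (\<lambda>y. u2 y s) x" by (simp add: hess_def)
    then have e: "time_deriv u1 x s - time_deriv u2 x s = lam * (u1 x s - u2 x s)"
      using hjb_equation[OF s1.hjb s, of x] hjb_equation[OF s2.hjb s, of x] g[OF s, of x] m[OF s]
      by (simp add: algebra_simps)
    have "((\<lambda>s. exp (- (lam * s))) has_real_derivative - lam * exp (- (lam * s))) (at s)"
      by (auto intro!: derivative_eq_intros)
    from DERIV_mult[OF this DERIV_diff[OF d1 d2]]
    have "(w has_real_derivative - lam * exp (- (lam * s)) * (u1 x s - u2 x s) + (time_deriv u1 x s - time_deriv u2 x s) * exp (- (lam * s))) (at s)"
      unfolding w_def[abs_def] .
    then show ?thesis unfolding e by (simp add: algebra_simps)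
  qed
  obtain K where K: "\<forall>t>0. \<bar>u1 x t - u2 x t\<bar> \<le> K" using value_difference_bounded by (rule exE)
  have w0: "w s = 0" if s: "s > 0" for s
  proof -
    have c: "w r = w s" if r: "r > s" for r
    proof (rule DERIV_isconst_end[OF r])
      show "continuous_on {s..r} w"
        by (intro continuous_at_imp_continuous_on ballI DERIV_isCont[OF dw]) (use s in auto)
    qed (use dw s in auto)
    have "((\<lambda>r. K * exp (- (lam * r))) \<longlongrightarrow> K * 0) at_top"
    proof (intro tendsto_mult tendsto_const)
      have "filterlim (\<lambda>r. lam * r) at_top at_top"
        using s1.lam_pos by (intro filterlim_tendsto_pos_mult_at_top[OF tendsto_const] filterlim_ident)
      then show "((\<lambda>r. exp (- (lam * r))) \<longlongrightarrow> 0) at_top"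
        using filterlim_compose[OF exp_at_bot] by (auto simp: filterlim_uminus_at_top)
    qed
    moreover have "eventually (\<lambda>r. \<bar>w s\<bar> \<le> K * exp (- (lam * r))) at_top"
      using eventually_gt_at_top[of s]
    proof eventually_elim
      case (elim r)
      have "\<bar>w s\<bar> = \<bar>w r\<bar>" using c[OF elim] by simp
      also have "\<dots> = exp (- (lam * r)) * \<bar>u1 x r - u2 x r\<bar>" by (simp add: w_def abs_mult)
      also have "\<dots> \<le> exp (- (lam * r)) * K" using K elim s by (intro mult_left_mono) auto
      finally show ?case by (simp add: mult.commute)
    qed
    ultimately have "\<bar>w s\<bar> \<le> K * 0" by (rule tendsto_lowerbound) simp
    then show ?thesis by simp
  qed
  have pos: "u1 x s = u2 x s" if "s > 0" for s using w0[OF that] by (simp add: w_def)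
  \<comment> \<open>The equation is available for t > 0 only; the initial time follows by continuity
    from the right.\<close>
  show ?thesis
  proof (cases "t = 0")
    case True
    have c: "((\<lambda>s. u x s) \<longlongrightarrow> u x 0) (at_right 0)" if "class_C21_on {0..} u" for u :: "real^'n \<Rightarrow> real \<Rightarrow> real"
    proof -
      have "(\<lambda>s. u x s) differentiable (at 0 within {0..})" using that by (simp add: class_C21_on_def)
      then have "continuous (at 0 within {0..}) (\<lambda>s. u x s)" by (rule differentiable_imp_continuous_within)
      then have "((\<lambda>s. u x s) \<longlongrightarrow> u x 0) (at 0 within {0..})" by (simp add: continuous_within)
      then show ?thesis by (rule tendsto_within_subset) auto
    qed
    have "((\<lambda>s. u1 x s - u2 x s) \<longlongrightarrow> u1 x 0 - u2 x 0) (at_right 0)"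
      by (intro tendsto_diff c s1.u_C21 s2.u_C21)
    moreover have "((\<lambda>s. u1 x s - u2 x s) \<longlongrightarrow> 0) (at_right 0)"
    proof (rule tendsto_eventually)
      show "eventually (\<lambda>s. u1 x s - u2 x s = 0) (at_right 0)"
        using eventually_at_right_less[of 0] by eventually_elim (simp add: pos)
    qed
    ultimately have "u1 x 0 - u2 x 0 = 0" by (intro tendsto_unique[of "at_right (0::real)"]) auto
    then show ?thesis using True by simp
  qed (use pos t in auto)
qed

end

theorem theorem3p5:
  fixes C\<^sub>o L :: real
  assumes "C\<^sub>o \<ge> 1" and "L > 0"
  shows "\<exists>\<eta>' lam\<^sub>0 :: real. lam\<^sub>0 \<ge> 1 \<and>
    (\<forall>(\<alpha>::real) (F :: real^'n \<Rightarrow> (real^'n) measure \<Rightarrow> real) (H :: real^'n \<Rightarrow> real^'n \<Rightarrow> real)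
        (m\<^sub>0 :: (real^'n) measure) (lam::real) u\<^sub>1 u\<^sub>2 m\<^sub>1 m\<^sub>2.
       0 < \<alpha> \<and> \<alpha> < 1 \<and>
       m\<^sub>0 \<in> P1 \<and> coupling_cost_assms \<alpha> C\<^sub>o L F \<and> hamiltonian_assms \<alpha> C\<^sub>o H \<and>
       lam \<ge> max lam\<^sub>0 \<eta>' \<and>
       mfg_classical_solution F H m\<^sub>0 lam u\<^sub>1 m\<^sub>1 \<and> uniqueness_bounds u\<^sub>1 \<and>
       mfg_classical_solution F H m\<^sub>0 lam u\<^sub>2 m\<^sub>2 \<and> uniqueness_bounds u\<^sub>2
       \<longrightarrow> (\<forall>x. \<forall>t\<ge>0. u\<^sub>1 x t = u\<^sub>2 x t) \<and> (\<forall>t\<ge>0. m\<^sub>1 t = m\<^sub>2 t))"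
proof -
  \<comment> \<open>\<open>B\<close> is the value of \<open>drift_bound\<close> for R = 2 (L + C).
    Adding the three thresholds in \<open>k0\<close> lets one inequality imply them all, and the
    summand 1 keeps k positive. In \<open>lam0\<close> the term 2 C serves the gradient bound, and 2
    k0^2 ensures that k = sqrt(lam / 2) is at least \<open>k0\<close>.\<close>
  define B where "B = C\<^sub>o * (2 + (1 + 2 * (L + C\<^sub>o))\<^sup>2)"
  define k0 where "k0 = 1 + B + 2 * (1 + 2 * CARD('n)) * B + 32 * CARD('n) * C\<^sub>o * L"
  define lam0 where "lam0 = 1 + 2 * C\<^sub>o + 2 * k0\<^sup>2"
  have B_nonneg: "B \<ge> 0" using assms by (simp add: B_def)
  have terms: "0 \<le> 2 * (1 + 2 * CARD('n)) * B" "0 \<le> 32 * CARD('n) * C\<^sub>o * L"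
    using B_nonneg assms by auto
  have lam0: "lam0 \<ge> 1" using assms zero_le_power2[of k0] unfolding lam0_def by linarith
  show ?thesis
  proof (rule exI[of _ 0], rule exI[of _ lam0], rule conjI[OF lam0], intro allI impI, elim conjE)
    fix \<alpha> lam :: real and F :: "real^'n \<Rightarrow> (real^'n) measure \<Rightarrow> real" and H :: "real^'n \<Rightarrow> real^'n \<Rightarrow> real"
      and m\<^sub>0 :: "(real^'n) measure" and u\<^sub>1 u\<^sub>2 m\<^sub>1 m\<^sub>2
    assume F: "coupling_cost_assms \<alpha> C\<^sub>o L F" and H: "hamiltonian_assms \<alpha> C\<^sub>o H" and lam: "max lam0 0 \<le> lam"
      and sol1: "mfg_classical_solution F H m\<^sub>0 lam u\<^sub>1 m\<^sub>1" and b1: "uniqueness_bounds u\<^sub>1"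
      and sol2: "mfg_classical_solution F H m\<^sub>0 lam u\<^sub>2 m\<^sub>2" and b2: "uniqueness_bounds u\<^sub>2"
    have lam2: "lam \<ge> 2 * C\<^sub>o" "lam \<ge> 2 * k0\<^sup>2"
      using lam assms zero_le_power2[of k0] unfolding lam0_def by linarith+
    interpret mfg_pair \<alpha> C\<^sub>o L lam F H m\<^sub>0 u\<^sub>1 u\<^sub>2 m\<^sub>1 m\<^sub>2
      by unfold_locales (use assms F H lam2 sol1 b1 sol2 b2 in auto)
    define k where "k = sqrt (lam / 2)"
    have "k0 \<le> k" unfolding k_def using lam2 by (intro real_le_rsqrt) simp
    moreover have "1 + x + y + z \<le> k \<Longrightarrow> 0 \<le> x \<Longrightarrow> 0 \<le> y \<Longrightarrow> 0 \<le> z \<Longrightarrow> k > 0 \<and> k \<ge> x \<and> k \<ge> y \<and> k \<ge> z" for x y z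
      by auto
    ultimately have k: "k > 0" "k \<ge> B" "k \<ge> 2 * (1 + 2 * CARD('n)) * B" "k \<ge> 32 * CARD('n) * C\<^sub>o * L"
      using B_nonneg terms unfolding k0_def by blast+
    have lk: "lam = 2 * k\<^sup>2" using lam2 assms by (simp add: k_def)
    have drift_bound: "s1.drift_bound = B" by (simp add: s1.drift_bound_def s1.R_def B_def)
    note co = coincidence_of_measures_and_gradients[OF k(1) lk k(2-4)[folded drift_bound]]
    have "m\<^sub>1 t = m\<^sub>2 t" if "t \<ge> 0" for t
    proof (cases "t = 0")
      case True
      then show ?thesis using s1.fp s2.fp by (simp add: fp_solution_def)
    qed (use co(1)[of t] that in auto)
    moreover have "u\<^sub>1 x t = u\<^sub>2 x t" if "t \<ge> 0" for x t
      by (rule coincidence_of_values[OF co that])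
    ultimately show "(\<forall>x. \<forall>t\<ge>0. u\<^sub>1 x t = u\<^sub>2 x t) \<and> (\<forall>t\<ge>0. m\<^sub>1 t = m\<^sub>2 t)" by blast
  qed
qed

end
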